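(* Given a binary sequence of length $n$, Jacobson's rank structure and Clark's select structure for it (succinct structures supporting rank and select queries in $O(1)$ work) can be constructed in parallel using $O(n)$ work and $O(\log n)$ depth.
   Context: Model: work-depth model with concurrent reads and writes permitted, with unit-cost operations on machine words of $\Theta(\log n)$ bits. The work is the total number of operations and the depth is the number of parallel time steps. $\log$ is base 2; non-integral quantities below are rounded to integers. For a binary sequence $S$ (indexed from $0$), $\mathrm{rank}_c(S,i)$ is the number of times $c$ appears in positions $0$ to $i$ of $S$, and $\mathrm{select}_c(S,i)$ is the position of the $i$'th occurrence of $c$ in $S$. A structure is succinct if its size in bits is sub-linear in $n$. Jacobson's rank structure: stores the rank of every $\log^2 n$'th bit in a first-level directory, and, within each of the resulting ranges, the rank (relative to the range) of every $\log n$'th bit in a second-level directory, whose entries take $O(\log\log n)$ bits each and are packed into words. It also stores a look-up table giving the ranks for all bit-strings of length up to $\frac{\log n}{2}$, so that queries inside a range of size $\log n$ take at most two look-ups. Clark's select structure (described for $1$ bits): stores the position of every $(\log n\log\log n)$'th $1$ bit in a first-level directory. For each range between consecutive such positions, of length $r$: if $r\ge \log^2 n(\log\log n)^2$, the $\log n\log\log n$ answers in the range are stored directly; otherwise the position of every $(\log r\log\log n)$'th $1$ bit in the range is stored in a second-level directory. For each sub-range between consecutive second-level positions, of length $r'$: if $r'\ge \log r'\log r(\log\log n)^2$, all answers in the sub-range are stored directly; otherwise select queries are answered with a look-up table for all bit-strings of length less than $r'$. Entries are packed into words. *)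

theory Defs
  imports Complex_Main "HOL-Library.Landau_Symbols" "HOL-Library.Log_Nat"
begin

section \<open>The machine\<close>

text \<open>
  A synchronous PRAM in work-depth form: one thread of control whose instructions are unit-cost
  operations on words of \<open>w\<close> bits, together with parallel steps in which any number of processors
  execute the same guarded store.  In a parallel step all processors read the memory as it was
  before the step; several of them may read one cell, and several may write one cell provided that
  they write the same word there (otherwise the step has no successor state).  This is the weakest
  of the usual conventions for concurrent writes: a run is also a run of the machines in which an
  arbitrary or the lowest-numbered writer succeeds.
\<close>

type_synonym memory = "nat \<Rightarrow> nat"
type_synonym regs = "nat \<Rightarrow> nat"

datatype binop =
  Add | Sub | Mul | Div | Mod | BitAnd | BitOr | BitXor | ShiftL | ShiftR | Equal | Less

datatype expr = Const nat | Reg nat | Load expr | Op binop expr expr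

datatype com =
    Skip
  | Assign nat expr
  | Store expr expr
  | Seq com com
  | Cond expr com com
  | While expr com
  | Par nat expr expr expr expr
      \<comment> \<open>\<open>Par x k g a v\<close>: for all \<open>x < k\<close> in parallel, if \<open>g \<noteq> 0\<close> then \<open>mem[a] := v\<close>\<close>

fun apply_op :: "nat \<Rightarrow> binop \<Rightarrow> nat \<Rightarrow> nat \<Rightarrow> nat" where
  "apply_op w Add x y = take_bit w (x + y)"
| "apply_op w Sub x y = take_bit w (x + 2 ^ w - y)"
| "apply_op w Mul x y = take_bit w (x * y)"
| "apply_op w Div x y = x div y"
| "apply_op w Mod x y = x mod y"
| "apply_op w BitAnd x y = and x y"
| "apply_op w BitOr x y = or x y"
| "apply_op w BitXor x y = xor x y"
| "apply_op w ShiftL x y = take_bit w (push_bit y x)"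
| "apply_op w ShiftR x y = drop_bit y x"
| "apply_op w Equal x y = of_bool (x = y)"
| "apply_op w Less x y = of_bool (x < y)"

fun eval :: "nat \<Rightarrow> memory \<Rightarrow> regs \<Rightarrow> expr \<Rightarrow> nat" where
  "eval w m r (Const k) = take_bit w k"
| "eval w m r (Reg x) = r x"
| "eval w m r (Load e) = m (eval w m r e)"
| "eval w m r (Op f e1 e2) = apply_op w f (eval w m r e1) (eval w m r e2)"

fun ops :: "expr \<Rightarrow> nat" where
  "ops (Const k) = 1"
| "ops (Reg x) = 1"
| "ops (Load e) = ops e + 1"
| "ops (Op f e1 e2) = ops e1 + ops e2 + 1"

definition writes ::
  "nat \<Rightarrow> memory \<Rightarrow> regs \<Rightarrow> nat \<Rightarrow> expr \<Rightarrow> expr \<Rightarrow> expr \<Rightarrow> expr \<Rightarrow> (nat \<times> nat) set" where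
  "writes w m r x k g a v =
     {(eval w m (r(x := i)) a, eval w m (r(x := i)) v) | i.
        i < eval w m r k \<and> eval w m (r(x := i)) g \<noteq> 0}"

definition write_all :: "memory \<Rightarrow> (nat \<times> nat) set \<Rightarrow> memory" where
  "write_all m A = (\<lambda>p. if p \<in> Domain A then (THE u. (p, u) \<in> A) else m p)"

text \<open>
  \<open>exec w c (m, r) W D (m', r')\<close>: with word length \<open>w\<close>, the program \<open>c\<close> started with memory \<open>m\<close> and
  registers \<open>r\<close> halts with \<open>m'\<close> and \<open>r'\<close> after \<open>W\<close> operations and \<open>D\<close> time steps.  The processors
  of a parallel step evaluate their expressions one operation at a time.
\<close>

inductive exec ::
  "nat \<Rightarrow> com \<Rightarrow> memory \<times> regs \<Rightarrow> nat \<Rightarrow> nat \<Rightarrow> memory \<times> regs \<Rightarrow> bool" for w where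
  Skip: "exec w Skip (m, r) 1 1 (m, r)"
| Assign: "exec w (Assign x e) (m, r) (ops e + 1) (ops e + 1) (m, r(x := eval w m r e))"
| Store: "exec w (Store a e) (m, r) (ops a + ops e + 1) (ops a + ops e + 1)
            (m(eval w m r a := eval w m r e), r)"
| Seq: "exec w c1 s W1 D1 s' \<Longrightarrow> exec w c2 s' W2 D2 s'' \<Longrightarrow>
          exec w (Seq c1 c2) s (W1 + W2) (D1 + D2) s''"
| CondTrue: "eval w m r e \<noteq> 0 \<Longrightarrow> exec w c1 (m, r) W D s' \<Longrightarrow>
          exec w (Cond e c1 c2) (m, r) (ops e + 1 + W) (ops e + 1 + D) s'"
| CondFalse: "eval w m r e = 0 \<Longrightarrow> exec w c2 (m, r) W D s' \<Longrightarrow>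
          exec w (Cond e c1 c2) (m, r) (ops e + 1 + W) (ops e + 1 + D) s'"
| WhileFalse: "eval w m r e = 0 \<Longrightarrow> exec w (While e c) (m, r) (ops e + 1) (ops e + 1) (m, r)"
| WhileTrue: "eval w m r e \<noteq> 0 \<Longrightarrow> exec w c (m, r) W1 D1 s' \<Longrightarrow>
          exec w (While e c) s' W2 D2 s'' \<Longrightarrow>
          exec w (While e c) (m, r) (ops e + 1 + W1 + W2) (ops e + 1 + D1 + D2) s''"
| Par: "single_valued (writes w m r x k g a v) \<Longrightarrow>
          exec w (Par x k g a v) (m, r)
            (ops k + 1 + eval w m r k * (ops g + ops a + ops v + 1))
            (ops k + 1 + (ops g + ops a + ops v + 1))
            (write_all m (writes w m r x k g a v), r)"

lemma exec_deterministic: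
  "exec w c s W D s' \<Longrightarrow> exec w c s W2 D2 s2 \<Longrightarrow> W2 = W \<and> D2 = D \<and> s2 = s'"
proof (induction arbitrary: W2 D2 s2 rule: exec.induct)
  case (Skip m r)
  then show ?case by (cases rule: exec.cases) auto
next
  case (Assign x e m r)
  then show ?case by (cases rule: exec.cases) auto
next
  case (Store a e m r)
  then show ?case by (cases rule: exec.cases) auto
next
  case (Seq c1 s W1 D1 s' c2 W2' D2' s'')
  from Seq.prems obtain U1 E1 t U2 E2
    where "exec w c1 s U1 E1 t" "exec w c2 t U2 E2 s2" "W2 = U1 + U2" "D2 = E1 + E2"
    by (cases rule: exec.cases) auto
  with Seq.IH show ?case by metis
next
  case (CondTrue m r e c1 W D s' c2)
  from CondTrue.prems CondTrue.hyps(1) obtain U E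
    where "exec w c1 (m, r) U E s2" "W2 = ops e + 1 + U" "D2 = ops e + 1 + E"
    by (cases rule: exec.cases) auto
  with CondTrue.IH show ?case by metis
next
  case (CondFalse m r e c2 W D s' c1)
  from CondFalse.prems CondFalse.hyps(1) obtain U E
    where "exec w c2 (m, r) U E s2" "W2 = ops e + 1 + U" "D2 = ops e + 1 + E"
    by (cases rule: exec.cases) auto
  with CondFalse.IH show ?case by metis
next
  case (WhileFalse m r e c)
  from WhileFalse.prems WhileFalse.hyps show ?case by (cases rule: exec.cases) auto
next
  case (WhileTrue m r e c W1 D1 s' W2' D2' s'')
  from WhileTrue.prems WhileTrue.hyps(1) obtain U1 E1 t U2 E2
    where "exec w c (m, r) U1 E1 t" "exec w (While e c) t U2 E2 s2"
      "W2 = ops e + 1 + U1 + U2" "D2 = ops e + 1 + E1 + E2"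
    by (cases rule: exec.cases) auto
  with WhileTrue.IH show ?case by metis
next
  case (Par m r x k g a v)
  from Par.prems show ?case by (cases rule: exec.cases) auto
qed

definition valid_mem :: "nat \<Rightarrow> memory \<Rightarrow> bool" where
  "valid_mem w m \<longleftrightarrow> (\<forall>p. m p < 2 ^ w)"

definition init_regs :: "nat list \<Rightarrow> regs" where
  "init_regs xs = (\<lambda>x. if x < length xs then xs ! x else 0)"


section \<open>Packed data\<close>

text \<open>The memory is also viewed as one long bit string, \<open>w\<close> bits per word, low-order bit first.\<close>

definition mem_bit :: "nat \<Rightarrow> memory \<Rightarrow> nat \<Rightarrow> bool" where
  "mem_bit w m p = bit (m (p div w)) (p mod w)"

definition holds_seq :: "nat \<Rightarrow> memory \<Rightarrow> bool list \<Rightarrow> bool" where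
  "holds_seq w m S \<longleftrightarrow> (\<forall>i < length S. mem_bit w m i = S ! i)"

definition field :: "nat \<Rightarrow> memory \<Rightarrow> nat \<Rightarrow> nat \<Rightarrow> nat" where
  "field w m p b = horner_sum of_bool 2 (map (mem_bit w m) [p ..< p + b])"

text \<open>
  The words \<open>base, \<dots>, base + len - 1\<close> contain the list \<open>xs\<close>, packed with \<open>b\<close> bits per entry.
  Where in this block the list begins is left to the implementation, and so are the pointers to it.
\<close>

definition stores :: "nat \<Rightarrow> memory \<Rightarrow> nat \<Rightarrow> nat \<Rightarrow> nat \<Rightarrow> nat list \<Rightarrow> bool" where
  "stores w m base len b xs \<longleftrightarrow>
     (\<exists>p. base * w \<le> p \<and> p + length xs * b \<le> (base + len) * w \<and>
          (\<forall>i < length xs. field w m (p + i * b) b = xs ! i))"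


section \<open>Rank and select\<close>

text \<open>Positions are counted from 0, occurrences from 1.\<close>

definition rank :: "bool \<Rightarrow> bool list \<Rightarrow> nat \<Rightarrow> nat" where
  "rank c S i = card {j. j \<le> i \<and> j < length S \<and> S ! j = c}"

definition select :: "bool \<Rightarrow> bool list \<Rightarrow> nat \<Rightarrow> nat" where
  "select c S i = filter (\<lambda>p. S ! p = c) [0 ..< length S] ! (i - 1)"

text \<open>Logarithms are rounded up, and to at least 1 so that no block length degenerates to 0.\<close>

definition lg :: "nat \<Rightarrow> nat" where
  "lg x = max 1 (nat \<lceil>log 2 (real x)\<rceil>)"

definition bitstring :: "nat \<Rightarrow> nat \<Rightarrow> bool list" where
  "bitstring l x = map (bit x) [0 ..< l]"


section \<open>Jacobson's rank structure\<close>

definition rank_dir1 :: "bool list \<Rightarrow> nat list" where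
  "rank_dir1 S = (let n = length S; L = lg n in
     map (\<lambda>i. rank True S ((i + 1) * L\<^sup>2 - 1)) [0 ..< n div L\<^sup>2])"

text \<open>A full range of \<open>L\<^sup>2\<close> bits contributes exactly \<open>L\<close> consecutive second-level entries.\<close>

definition rank_dir2 :: "bool list \<Rightarrow> nat list" where
  "rank_dir2 S = (let n = length S; L = lg n in
     map (\<lambda>t. rank True (take (L\<^sup>2) (drop (t div L * L\<^sup>2) S)) ((t mod L + 1) * L - 1))
       [0 ..< n div L])"

definition rank_table :: "nat \<Rightarrow> nat list" where
  "rank_table l = concat (map (\<lambda>x. map (rank True (bitstring l x)) [0 ..< l]) [0 ..< 2 ^ l])"

text \<open>
  \<open>floorlog 2 v\<close> is the number of bits of \<open>v\<close>; in particular the second-level entries have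
  \<open>O(log log n)\<close> bits.
\<close>

definition jacobson :: "nat \<Rightarrow> memory \<Rightarrow> nat \<Rightarrow> nat \<Rightarrow> bool list \<Rightarrow> bool" where
  "jacobson w m base len S \<longleftrightarrow>
     (let n = length S; L = lg n; h = (L + 1) div 2 in
        stores w m base len (floorlog 2 n) (rank_dir1 S) \<and>
        stores w m base len (floorlog 2 (L\<^sup>2)) (rank_dir2 S) \<and>
        (\<forall>l \<le> h. stores w m base len (floorlog 2 h) (rank_table l)))"


section \<open>Clark's select structure\<close>

text \<open>
  The positions of each \<open>K\<close>'th occurrence of \<open>c\<close> cut \<open>S\<close> into pieces.  Piece \<open>k\<close> begins after
  occurrence \<open>k K\<close> (at position 0 if \<open>k = 0\<close>) and ends with occurrence \<open>(k + 1) K\<close>, or at the end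
  of \<open>S\<close> if there are not that many.
\<close>

definition cut :: "bool \<Rightarrow> bool list \<Rightarrow> nat \<Rightarrow> nat" where
  "cut c S i =
     (if i = 0 then 0 else if i \<le> count_list S c then select c S i + 1 else length S)"

definition piece :: "bool \<Rightarrow> nat \<Rightarrow> bool list \<Rightarrow> nat \<Rightarrow> bool list" where
  "piece c K S k = drop (cut c S (k * K)) (take (cut c S ((k + 1) * K)) S)"

definition select_dir :: "bool \<Rightarrow> nat \<Rightarrow> bool list \<Rightarrow> nat list" where
  "select_dir c K S = map (\<lambda>i. select c S ((i + 1) * K)) [0 ..< count_list S c div K]"

definition select_answers :: "bool \<Rightarrow> bool list \<Rightarrow> nat list" where
  "select_answers c S = map (\<lambda>i. select c S (i + 1)) [0 ..< count_list S c]"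

text \<open>The row of a bit string with fewer than \<open>l\<close> occurrences of \<open>c\<close> is padded with zeros.\<close>

definition select_table :: "bool \<Rightarrow> nat \<Rightarrow> nat list" where
  "select_table c l = concat (map (\<lambda>x. let T = bitstring l x in
     map (\<lambda>i. if i < count_list T c then select c T (i + 1) else 0) [0 ..< l]) [0 ..< 2 ^ l])"

text \<open>
  The second level is expressed by positions relative to the range, the direct answers for a
  sub-range by positions relative to the sub-range.  All sub-ranges may share one look-up table.
\<close>

definition clark_subrange ::
  "nat \<Rightarrow> memory \<Rightarrow> nat \<Rightarrow> nat \<Rightarrow> bool \<Rightarrow> nat \<Rightarrow> nat \<Rightarrow> bool list \<Rightarrow> bool" where
  "clark_subrange w m base len c LL r T \<longleftrightarrow>
     (let r' = length T in
        if r' \<ge> lg r' * lg r * LL\<^sup>2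
        then stores w m base len (floorlog 2 r') (select_answers c T)
        else \<forall>l \<le> r'. stores w m base len (floorlog 2 l) (select_table c l))"

definition clark :: "nat \<Rightarrow> memory \<Rightarrow> nat \<Rightarrow> nat \<Rightarrow> bool \<Rightarrow> bool list \<Rightarrow> bool" where
  "clark w m base len c S \<longleftrightarrow>
     (let n = length S; L = lg n; LL = lg L; K = L * LL in
        stores w m base len (floorlog 2 n) (select_dir c K S) \<and>
        (\<forall>k. k * K < count_list S c \<longrightarrow>
          (let R = piece c K S k; r = length R; K2 = lg r * LL in
             if r \<ge> L\<^sup>2 * LL\<^sup>2
             then stores w m base len (floorlog 2 n)
                    (map (\<lambda>a. cut c S (k * K) + a) (select_answers c R))
             else stores w m base len (floorlog 2 r) (select_dir c K2 R) \<and>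
                  (\<forall>j. j * K2 < count_list R c \<longrightarrow>
                     clark_subrange w m base len c LL r (piece c K2 R j)))))"


section \<open>Queries\<close>

text \<open>
  A query program gets the word length, the address of the structure, the bit \<open>c\<close> and the index
  \<open>i\<close>, finds \<open>f c i\<close> in at most \<open>Q\<close> operations and leaves the memory unchanged.
\<close>

definition answers ::
  "nat \<Rightarrow> com \<Rightarrow> memory \<Rightarrow> nat \<Rightarrow> nat \<Rightarrow> (bool \<Rightarrow> nat \<Rightarrow> nat) \<Rightarrow> bool \<Rightarrow> nat \<Rightarrow> bool" where
  "answers w q m base Q f c i \<longleftrightarrow>
     (\<exists>W D r. exec w q (m, init_regs [w, base, of_bool c, i]) W D (m, r) \<and> W \<le> Q \<and> r 0 = f c i)"

end

theory Submission
  imports Defs "HOL-Real_Asymp.Real_Asymp"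
begin

text \<open>
  Everything that the two structures store is a simple function of two arrays: the prefix counts of
  the \<open>1\<close> bits and, for each \<open>c\<close>, the cuts, where cut \<open>j\<close> is the end of the shortest prefix with
  \<open>j\<close> occurrences of \<open>c\<close>.  The prefix counts take \<open>L = lg n\<close> sequential steps in all blocks of length
  \<open>L\<close> at once and then pointer doubling on the \<open>n / L\<close> block sums, so \<open>O(n)\<close> work and \<open>O(L)\<close> depth; the
  cuts are one scatter of the prefix counts.  Each bit of a packed structure then depends on \<open>O(1)\<close>
  entries of these arrays and gets its own processor, and a word is assembled in \<open>w\<close> rounds.

  The parts whose size depends on the input need no allocation: the part for a range that starts at
  position \<open>s\<close> of \<open>S\<close> is placed at an offset proportional to \<open>s\<close>, since a long range pays for its
  answers with its length, and the owner of an offset is found by a prefix count.  A sub-range that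
  is not long has length less than \<open>16 (lg L)\<^sup>4\<close>, so tables for all shorter bit-strings have size
  \<open>o(n)\<close>.  Every value is a polynomial of bounded degree in \<open>n\<close>, and
  words of \<open>c\<^sub>0 lg n\<close> bits rule out overflow.
\<close>

section \<open>Expressions without overflow\<close>

text \<open>Two features of the machine shape the proof: arithmetic is modulo \<open>2 ^ w\<close>,
  and there is neither a logarithm nor allocation. So everything is prescribed in advance: each
  register (\<open>pv\<close>) and each array entry (\<open>FA\<close>) has a closed form over the
  unbounded naturals, and a step only has to reproduce its closed form from earlier ones.
  Expressions live in a language whose semantics has no overflow. If all stored values have
  \<open>u\<close> bits, a syntactic degree bounds every value by \<open>2 ^ (u * deg e)\<close>,
  and \<open>max_deg * u \<le> w\<close> transfers it to the machine once and for all.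

  The constant \<open>max_deg * word_factor\<close> is large because the numbers
  \<open>2 ^ H\<close> of the select table must fit into a word: \<open>H\<close> is polynomial in
  log log \<open>n\<close>, but a bound valid for every \<open>n\<close> is only
  \<open>1024 * lg n\<close>.

  Queries need \<open>lg r\<close> and the bit length of \<open>r\<close> for lengths
  \<open>r\<close> known only at run time. The block therefore contains tables of both functions for
  arguments below \<open>M\<close>, which is polylogarithmic; longer ranges store their answers and
  need no such look-up.

  One array of bit counts and one array of select answers serve the tables of all lengths, by
  masking, and those of both bits, by complement.\<close>

datatype aexp = Num nat | Var nat | Wrd aexp | Arr nat aexp | Bin binop aexp aexp
  | Pow2 aexp | Fld aexp aexp

abbreviation add_e (infixl "+!" 65) where "a +! b \<equiv> Bin Add a b"
abbreviation sub_e (infixl "-!" 65) where "a -! b \<equiv> Bin Sub a b"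
abbreviation mul_e (infixl "*!" 70) where "a *! b \<equiv> Bin Mul a b"
abbreviation div_e (infixl "div!" 70) where "a div! b \<equiv> Bin Div a b"
abbreviation mod_e (infixl "mod!" 70) where "a mod! b \<equiv> Bin Mod a b"
abbreviation less_e (infix "<!" 50) where "a <! b \<equiv> Bin Less a b"
abbreviation eq_e (infix "=!" 50) where "a =! b \<equiv> Bin Equal a b"

text \<open>Truncated subtraction yields the minimum without a branch.\<close>

definition min_e :: "aexp \<Rightarrow> aexp \<Rightarrow> aexp" where
  "min_e a b = a -! (a -! b)"

definition bit_e :: "aexp \<Rightarrow> aexp \<Rightarrow> aexp" where
  "bit_e a b = Bin ShiftR a b mod! Num 2"

text \<open>Operators that have no counterpart here get the dummy value 0 and are excluded by
  \<open>op_ok\<close>.\<close>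

fun ideal_op :: "binop \<Rightarrow> nat \<Rightarrow> nat \<Rightarrow> nat" where
  "ideal_op Add x y = x + y"
| "ideal_op Sub x y = x - y"
| "ideal_op Mul x y = x * y"
| "ideal_op Div x y = x div y"
| "ideal_op Mod x y = x mod y"
| "ideal_op ShiftR x y = x div 2 ^ y"
| "ideal_op Equal x y = of_bool (x = y)"
| "ideal_op Less x y = of_bool (x < y)"
| "ideal_op _ x y = 0"

abbreviation tbase :: nat where "tbase \<equiv> 44"

text \<open>
  \<open>Sub\<close> is compiled so that it truncates at 0.  Array \<open>a\<close> is spread with stride 64 over the memory
  from the address in register \<open>tbase\<close> on, so that distinct arrays never overlap.  \<open>Fld p b\<close> reads
  the \<open>b\<close> bits from bit position \<open>p\<close> on, which may lie in two words; register 0 holds the word length.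
\<close>

definition arr_addr :: "nat \<Rightarrow> expr \<Rightarrow> expr" where
  "arr_addr a e = Op Add (Reg tbase) (Op Add (Op Mul (Const 64) e) (Const a))"

fun compile :: "aexp \<Rightarrow> expr" where
  "compile (Num k) = Const k"
| "compile (Var x) = Reg x"
| "compile (Wrd e) = Load (compile e)"
| "compile (Arr a e) = Load (arr_addr a (compile e))"
| "compile (Bin f a b) =
    (if f = Sub
     then Op Mul (Op Less (compile b) (compile a)) (Op Sub (compile a) (compile b))
     else Op f (compile a) (compile b))"
| "compile (Pow2 e) = Op ShiftL (Const 1) (compile e)"
| "compile (Fld p b) =
     Op Mod
       (Op BitOr
         (Op ShiftR (Load (Op Div (compile p) (Reg 0))) (Op Mod (compile p) (Reg 0)))
         (Op ShiftL (Load (Op Add (Op Div (compile p) (Reg 0)) (Const 1)))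
            (Op Sub (Reg 0) (Op Mod (compile p) (Reg 0)))))
       (Op ShiftL (Const 1) (compile b))"

text \<open>Every source of values comes with a predicate that says which of its cells may be read.
  It is used to record what has been computed so far, so \<open>good\<close> also checks that
  nothing is read before it is written.\<close>

record env =
  regv :: "nat \<Rightarrow> nat"
  regok :: "nat \<Rightarrow> bool"
  arrv :: "nat \<Rightarrow> nat \<Rightarrow> nat"
  arrok :: "nat \<Rightarrow> nat \<Rightarrow> bool"
  wrdv :: "nat \<Rightarrow> nat"
  wrdok :: "nat \<Rightarrow> bool"
  fldv :: "nat \<Rightarrow> nat \<Rightarrow> nat"
  fldok :: "nat \<Rightarrow> nat \<Rightarrow> bool"

fun aeval :: "env \<Rightarrow> aexp \<Rightarrow> nat" where
  "aeval E (Num k) = k"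
| "aeval E (Var x) = regv E x"
| "aeval E (Wrd e) = wrdv E (aeval E e)"
| "aeval E (Arr a e) = arrv E a (aeval E e)"
| "aeval E (Bin f a b) = ideal_op f (aeval E a) (aeval E b)"
| "aeval E (Pow2 e) = 2 ^ aeval E e"
| "aeval E (Fld p b) = fldv E (aeval E p) (aeval E b)"

fun op_ok :: "binop \<Rightarrow> bool" where
  "op_ok BitAnd = False"
| "op_ok BitOr = False"
| "op_ok BitXor = False"
| "op_ok ShiftL = False"
| "op_ok _ = True"

fun good :: "nat \<Rightarrow> env \<Rightarrow> aexp \<Rightarrow> bool" where
  "good u E (Num k) = (k < 2 ^ u)"
| "good u E (Var x) = regok E x"
| "good u E (Wrd e) = (good u E e \<and> wrdok E (aeval E e))"
| "good u E (Arr a e) = (good u E e \<and> arrok E a (aeval E e))"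
| "good u E (Bin f a b) = (op_ok f \<and> good u E a \<and> good u E b)"
| "good u E (Pow2 e) = (good u E e \<and> aeval E e < u)"
| "good u E (Fld p b) = (good u E p \<and> good u E b \<and> aeval E b < u \<and> fldok E (aeval E p) (aeval E b))"

text \<open>Measures size in units of \<open>u\<close> bits: leaves count 1 and each operator adds,
  which covers products and, with one extra unit, carries. The extra 3 of \<open>Arr\<close> and 2
  of \<open>Fld\<close> are headroom for the address arithmetic generated by
  \<open>compile\<close>.\<close>

fun deg :: "aexp \<Rightarrow> nat" where
  "deg (Num k) = 1"
| "deg (Var x) = 1"
| "deg (Wrd e) = deg e"
| "deg (Arr a e) = deg e + 3"
| "deg (Bin f a b) = deg a + deg b + 1"
| "deg (Pow2 e) = deg e"
| "deg (Fld p b) = deg p + deg b + 2"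

text \<open>For a field, only the word in which it starts has to be below \<open>2 ^ w\<close>:
  excess bits there would be shifted down into the result, whereas those of the following word are
  cut off by \<open>ShiftL\<close>.\<close>

definition models :: "nat \<Rightarrow> nat \<Rightarrow> env \<Rightarrow> memory \<Rightarrow> regs \<Rightarrow> bool" where
  "models w u E m r \<longleftrightarrow>
     8 \<le> u \<and>
     (\<forall>x. regok E x \<longrightarrow> r x = regv E x \<and> regv E x < 2 ^ u) \<and>
     (\<forall>a i. arrok E a i \<longrightarrow> m (r tbase + (64 * i + a)) = arrv E a i \<and> arrv E a i < 2 ^ u \<and>
        a < 64 \<and> r tbase < 2 ^ u) \<and>
     (\<forall>p. wrdok E p \<longrightarrow> m p = wrdv E p \<and> wrdv E p < 2 ^ u) \<and>
     (\<forall>p b. fldok E p b \<longrightarrow> fldv E p b = field w m p b \<and> m (p div w) < 2 ^ w \<and> r 0 = w)"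

section \<open>Compiled expressions compute the ideal values\<close>

lemma deg_pos: "1 \<le> deg e"
  by (induction e) auto

lemma ideal_op_less:
  assumes x: "x < 2 ^ p" and y: "y < 2 ^ q"
  shows "ideal_op f x y < 2 ^ (p + q + 1)"
proof -
  have X: "x < 2 ^ (p + q)" using x by (meson le_add1 less_le_trans one_le_numeral power_increasing)
  have Y: "y < 2 ^ (p + q)" using y by (meson le_add2 less_le_trans one_le_numeral power_increasing)
  have X': "x < 2 ^ (p + q + 1)" using X by simp
  have D: "x div k < 2 ^ (p + q + 1)" for k
    by (rule le_less_trans[OF div_le_dividend X'])
  have M: "x mod k < 2 ^ (p + q + 1)" for k
    by (rule le_less_trans[OF mod_less_eq_dividend X'])
  have MU: "x * y < 2 ^ (p + q + 1)"
  proof -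
    have "x * y \<le> 2 ^ p * 2 ^ q" using x y by (intro mult_mono) auto
    also have "\<dots> < 2 ^ (p + q + 1)" by (simp add: power_add)
    finally show ?thesis .
  qed
  have S: "x - y < 2 ^ (p + q + 1)" using X by simp
  have O: "(1::nat) < 2 ^ (p + q + 1)"
    by (rule one_less_power) auto
  show ?thesis
    using X Y D M MU O S by (cases f) (auto simp: of_bool_def)
qed

lemma field_less: "field w m p b < 2 ^ b"
  unfolding field_def using horner_sum_of_bool_2_less[of "map (mem_bit w m) [p..<p + b]"] by simp

lemma bit_field: "bit (field w m p b) j \<longleftrightarrow> j < b \<and> mem_bit w m (p + j)"
  unfolding field_def by (auto simp: bit_horner_sum_bit_iff)

text \<open>Since \<open>b < w\<close>, a field meets at most two words. When it starts at a word
  boundary the second word is shifted by the full \<open>w\<close>, so truncation leaves nothing of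
  it; otherwise each bit below \<open>b\<close> comes from exactly one of the two words.\<close>

lemma field_read:
  assumes b: "b < w" and q: "m (p div w) < 2 ^ w"
  shows "or (drop_bit (p mod w) (m (p div w)))
            (take_bit w (push_bit (w - p mod w) (m (p div w + 1)))) mod 2 ^ b = field w m p b"
    (is "?l mod _ = _")
proof -
  have w: "0 < w" using b by simp
  have o: "p mod w < w" using w by simp
  obtain k where k: "p mod w = k" "k < w" using o by blast
  have "bit (take_bit b ?l) j = bit (field w m p b) j" for j
  proof (cases "j < b")
    case True
    show ?thesis
    proof (cases "p mod w + j < w")
      case lt: True
      have eq: "p + j = (p mod w + j) + p div w * w"
        using div_mult_mod_eq[of p w] by (simp add: algebra_simps)
      have d: "(p + j) div w = p div w"
      proof (rule div_nat_eqI)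
        show "w * (p div w) \<le> p + j" using mult.commute[of w "p div w"] eq by linarith
        show "p + j < w * Suc (p div w)" using mult.commute[of w "p div w"] eq lt
          unfolding mult_Suc_right by linarith
      qed
      moreover have "(p + j) mod w = p mod w + j"
        using eq div_mult_mod_eq[of "p + j" w, unfolded d] by linarith
      ultimately show ?thesis using True lt b k(2) unfolding k(1)
        by (auto simp: bit_field mem_bit_def bit_take_bit_iff bit_or_iff bit_drop_bit_eq bit_push_bit_iff)
    next
      case ge: False
      have eq: "p + j = (p mod w + j - w) + w * Suc (p div w)"
        using ge div_mult_mod_eq[of p w] mult.commute[of w "p div w"] unfolding mult_Suc_right by linarith
      have lt: "p mod w + j - w < w" using o True b by linarith
      have d: "(p + j) div w = p div w + 1"
      proof (rule div_nat_eqI)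
        show "w * (p div w + 1) \<le> p + j" using eq by simp
        show "p + j < w * Suc (p div w + 1)" using eq lt
          unfolding mult_Suc_right Suc_eq_plus1[symmetric] by linarith
      qed
      moreover have "(p + j) mod w = p mod w + j - w"
        using eq div_mult_mod_eq[of "p + j" w, unfolded d] mult.commute[of w "p div w + 1"]
        unfolding Suc_eq_plus1 by linarith
      moreover have "\<not> bit (m (p div w)) (p mod w + j)"
        using q ge by (metis bit_take_bit_iff take_bit_nat_eq_self)
      ultimately show ?thesis using True ge b k(2) unfolding k(1)
        by (auto simp: bit_field mem_bit_def bit_take_bit_iff bit_or_iff bit_drop_bit_eq bit_push_bit_iff
            Suc_diff_le add.commute)
    qed
  next
    case False then show ?thesis by (simp add: bit_field bit_take_bit_iff bit_or_iff)
  qed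
  then have "take_bit b ?l = field w m p b" by (rule bit_eqI)
  then show ?thesis by (simp add: take_bit_eq_mod)
qed

text \<open>Value and bound are proved together, because the bound for the subexpressions is what
  rules out a wrap-around in the operation above them.\<close>

lemma compile_correct:
  assumes M: "models w u E m r"
  shows "good u E e \<Longrightarrow> u * deg e \<le> w \<Longrightarrow>
    eval w m r (compile e) = aeval E e \<and> aeval E e < 2 ^ (u * deg e)"
proof (induction e)
  case (Num k)
  then have "k < 2 ^ w"
    by (metis deg.simps(1) good.simps(1) le_trans less_le_trans mult.right_neutral one_le_numeral power_increasing)
  with Num show ?case by (simp add: take_bit_nat_eq_self)
next
  case (Var x)
  then have "r x = regv E x \<and> regv E x < 2 ^ u" using M unfolding models_def good.simps by blast
  then show ?case by simp
next
  case (Wrd e)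
  have "1 \<le> deg e" by (rule deg_pos)
  then have "(2::nat) ^ u \<le> 2 ^ (u * deg e)" by (intro power_increasing) auto
  moreover have "eval w m r (compile e) = aeval E e" "wrdok E (aeval E e)"
    using Wrd by auto
  moreover have "m (aeval E e) = wrdv E (aeval E e)" "wrdv E (aeval E e) < 2 ^ u"
    using M \<open>wrdok E (aeval E e)\<close> unfolding models_def by blast+
  ultimately show ?case by (metis compile.simps(3) eval.simps(3) aeval.simps(3) deg.simps(3) less_le_trans)
next
  case (Arr a e)
  have "1 \<le> deg e" by (rule deg_pos)
  then have P: "(2::nat) ^ u \<le> 2 ^ (u * (deg e + 3))" by (intro power_increasing) auto
  have le: "u * deg e \<le> w" using Arr.prems(2) by (simp add: algebra_simps)
  from Arr have I: "eval w m r (compile e) = aeval E e" "aeval E e < 2 ^ (u * deg e)"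
    using le by auto
  have A: "m (r tbase + (64 * aeval E e + a)) = arrv E a (aeval E e)"
    "arrv E a (aeval E e) < 2 ^ u" "a < 64" "r tbase < 2 ^ u"
    using M Arr.prems(1) unfolding models_def good.simps by blast+
  have u8: "8 \<le> u" using M unfolding models_def by blast
  have "(64::nat) \<le> 2 ^ 6" by simp
  also have "\<dots> \<le> 2 ^ u" using u8 by (intro power_increasing) auto
  finally have u64: "64 \<le> (2::nat) ^ u" .
  define q :: nat where "q = 2 ^ (u * deg e)"
  have q1: "2 ^ u \<le> q" unfolding q_def using \<open>1 \<le> deg e\<close> by (intro power_increasing) auto
  have s1: "r tbase + (64 * aeval E e + a) < q + (64 * q + 64)"
    using A(3,4) I(2)[folded q_def] q1 by linarith
  also have "\<dots> \<le> 66 * q" using q1 u64 by simp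
  also have "\<dots> \<le> 2 ^ 8 * q" by simp
  also have "\<dots> \<le> 2 ^ u * q" using u8 by (intro mult_right_mono power_increasing) auto
  also have "\<dots> = 2 ^ (u * deg e + u)" by (simp add: q_def power_add)
  also have "\<dots> \<le> 2 ^ w" using Arr.prems(2) by (intro power_increasing) (auto simp: algebra_simps)
  finally have fin: "r tbase + (64 * aeval E e + a) < 2 ^ w" .
  have a64: "64 < (2::nat) ^ w"
  proof -
    have "(64::nat) < 2 ^ 8" by simp
    also have "\<dots> \<le> 2 ^ w" using u8 Arr.prems(2) by (intro power_increasing) (auto simp: algebra_simps)
    finally show ?thesis .
  qed
  have a64': "a < 2 ^ w" using a64 A(3) by linarith
  have "64 * aeval E e + a < 2 ^ w" "64 * aeval E e < 2 ^ w" using fin by linarith+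
  then have "eval w m r (compile (Arr a e)) = arrv E a (aeval E e)"
    using A(1) fin a64 a64' I(1) by (simp add: arr_addr_def take_bit_nat_eq_self)
  moreover have "arrv E a (aeval E e) < 2 ^ (u * (deg e + 3))"
    using A(2) P by (rule less_le_trans)
  ultimately show ?case by simp
next
  case (Bin f a b)
  have da: "u * deg a \<le> w" and db: "u * deg b \<le> w"
    using Bin.prems(2) by (auto simp: algebra_simps)
  let ?x = "aeval E a" and ?y = "aeval E b"
  from Bin.IH Bin.prems(1) da db
  have x: "eval w m r (compile a) = ?x" "?x < 2 ^ (u * deg a)"
    and y: "eval w m r (compile b) = ?y" "?y < 2 ^ (u * deg b)" by auto
  have u8: "8 \<le> u" using M unfolding models_def by blast
  have "ideal_op f ?x ?y < 2 ^ (u * deg a + u * deg b + 1)"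
    by (rule ideal_op_less[OF x(2) y(2)])
  also have "\<dots> \<le> 2 ^ (u * deg (Bin f a b))"
    using u8 by (intro power_increasing) (auto simp: algebra_simps)
  finally have fin: "ideal_op f ?x ?y < 2 ^ (u * deg (Bin f a b))" .
  then have fw: "ideal_op f ?x ?y < 2 ^ w"
    using Bin.prems(2) by (meson less_le_trans one_le_numeral power_increasing)
  have xw: "?x < 2 ^ w" using x(2) da by (meson less_le_trans one_le_numeral power_increasing)
  have yw: "?y < 2 ^ w" using y(2) db by (meson less_le_trans one_le_numeral power_increasing)
  have "eval w m r (compile (Bin f a b)) = ideal_op f ?x ?y"
  proof (cases "f = Sub")
    case True
    have "take_bit w (?x + 2 ^ w - ?y) = ?x - ?y" if "?y < ?x"
    proof -
      have "?x + 2 ^ w - ?y = (?x - ?y) + 2 ^ w" using that by linarith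
      moreover have "?x - ?y < 2 ^ w" using xw by (rule le_less_trans[OF diff_le_self])
      ultimately show ?thesis by (simp only: take_bit_eq_mod mod_add_self2 mod_less)
    qed
    then show ?thesis using True xw x(1) y(1)
      by (cases "?y < ?x") (simp_all add: take_bit_nat_eq_self le_less_trans[OF diff_le_self])
  next
    case False
    then show ?thesis using Bin.prems(1) fw
      by (cases f) (simp_all add: take_bit_nat_eq_self drop_bit_eq_div x(1) y(1))
  qed
  with fin show ?case by simp
next
  case (Pow2 e)
  have u8: "8 \<le> u" using M unfolding models_def by blast
  have d: "1 \<le> deg e" by (rule deg_pos)
  from Pow2 have I: "eval w m r (compile e) = aeval E e" "aeval E e < u" by auto
  have "(2::nat) ^ aeval E e < 2 ^ u" using I(2) by simp
  also have "\<dots> \<le> 2 ^ (u * deg e)" using d by (intro power_increasing) auto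
  finally have l: "(2::nat) ^ aeval E e < 2 ^ (u * deg e)" .
  also have "\<dots> \<le> 2 ^ w" using Pow2.prems(2) by (intro power_increasing) auto
  finally have "(2::nat) ^ aeval E e < 2 ^ w" .
  moreover have "0 < w" using Pow2.prems(2) u8 d by (cases w) auto
  ultimately show ?case using I l by (simp add: push_bit_eq_mult take_bit_nat_eq_self)
next
  case (Fld p b)
  have u8: "8 \<le> u" using M unfolding models_def by blast
  have dp: "u * deg p \<le> w" and db: "u * deg b \<le> w" and d2: "u * deg p + 2 * u \<le> w"
    using Fld.prems(2) by (auto simp: algebra_simps)
  let ?p = "aeval E p" and ?b = "aeval E b"
  from Fld.IH Fld.prems(1) dp db
  have p: "eval w m r (compile p) = ?p" "?p < 2 ^ (u * deg p)"
    and b: "eval w m r (compile b) = ?b" "?b < u" by auto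
  have F: "fldv E ?p ?b = field w m ?p ?b" "m (?p div w) < 2 ^ w" "r 0 = w"
    using M Fld.prems(1) unfolding models_def good.simps by blast+
  have bw: "?b < w" and w2: "2 * u \<le> w" using b(2) d2 by auto
  have "?p div w + 1 \<le> 2 ^ (u * deg p)" using p(2) div_le_dividend[of ?p w] by linarith
  also have "\<dots> < 2 ^ w" using d2 u8 by (intro power_strict_increasing) auto
  finally have s: "?p div w + 1 < 2 ^ w" .
  have wb: "w < 2 ^ w" by (rule less_exp)
  have o: "take_bit w (w + 2 ^ w - ?p mod w) = w - ?p mod w"
  proof -
    have "?p mod w < w" using bw by simp
    then have "w + 2 ^ w - ?p mod w = (w - ?p mod w) + 2 ^ w" by linarith
    moreover have "w - ?p mod w < 2 ^ w" using wb by (rule le_less_trans[OF diff_le_self])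
    ultimately show ?thesis by (simp only: take_bit_eq_mod mod_add_self2 mod_less)
  qed
  have "(2::nat) ^ ?b < 2 ^ w" using bw by simp
  then have t: "take_bit w (push_bit ?b 1) = (2::nat) ^ ?b" "take_bit w (?p div w + 1) = ?p div w + 1"
    "take_bit w (1::nat) = 1"
    using s bw by (simp_all add: push_bit_eq_mult take_bit_nat_eq_self del: add_Suc_right)
  have e: "eval w m r (compile (Fld p b)) = field w m ?p ?b"
    by (simp only: compile.simps eval.simps apply_op.simps p(1) b(1) F(3) t o field_read[of ?b w m ?p, OF bw F(2)])
  have "field w m ?p ?b < 2 ^ u"
    using field_less[of w m ?p ?b] b(2) by (meson less_imp_le_nat less_le_trans one_le_numeral power_increasing)
  also have "\<dots> \<le> 2 ^ (u * deg (Fld p b))" by (intro power_increasing) auto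
  finally show ?case using e F(1) by (simp only: aeval.simps)
qed

lemma aeval_min_e [simp]: "aeval E (min_e a b) = min (aeval E a) (aeval E b)"
  by (auto simp: min_e_def)

lemma good_min_e [simp]: "good u E (min_e a b) \<longleftrightarrow> good u E a \<and> good u E b"
  by (auto simp: min_e_def)

lemma deg_min_e [simp]: "deg (min_e a b) = 2 * deg a + deg b + 2"
  by (simp add: min_e_def)

lemma ops_min_e [simp]:
  "ops (compile (min_e a b)) = 6 * ops (compile a) + 4 * ops (compile b) + 9"
  by (simp add: min_e_def)

lemma aeval_bit_e [simp]: "aeval E (bit_e a b) = of_bool (bit (aeval E a) (aeval E b))"
  by (simp add: bit_e_def bit_iff_odd mod_2_eq_odd)

lemma good_bit_e [simp]: "good u E (bit_e a b) \<longleftrightarrow> 2 < (2::nat) ^ u \<and> good u E a \<and> good u E b"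
  by (auto simp: bit_e_def)

lemma deg_bit_e [simp]: "deg (bit_e a b) = deg a + deg b + 3"
  by (simp add: bit_e_def)

lemma ops_bit_e [simp]: "ops (compile (bit_e a b)) = ops (compile a) + ops (compile b) + 3"
  by (simp add: bit_e_def)

lemma modelsI:
  assumes "8 \<le> u" "\<And>x. regok E x \<Longrightarrow> r x = regv E x \<and> regv E x < 2 ^ u"
    "\<And>a i. arrok E a i \<Longrightarrow> m (r tbase + (64 * i + a)) = arrv E a i \<and> arrv E a i < 2 ^ u \<and>
        a < 64 \<and> r tbase < 2 ^ u"
    "\<And>p. wrdok E p \<Longrightarrow> m p = wrdv E p \<and> wrdv E p < 2 ^ u"
    "\<And>p b. fldok E p b \<Longrightarrow> fldv E p b = field w m p b \<and> m (p div w) < 2 ^ w \<and> r 0 = w"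
  shows "models w u E m r"
  using assms unfolding models_def by blast

section \<open>Running programs\<close>

text \<open>Upper bounds in place of the exact counts of \<open>exec\<close>, so that costs can be
  rounded after every step.\<close>

definition runs :: "nat \<Rightarrow> com \<Rightarrow> memory \<times> regs \<Rightarrow> nat \<Rightarrow> nat \<Rightarrow> memory \<times> regs \<Rightarrow> bool" where
  "runs w c s W D s' \<longleftrightarrow> (\<exists>W' D'. exec w c s W' D' s' \<and> W' \<le> W \<and> D' \<le> D)"

lemma runs_mono: "runs w c s W D s' \<Longrightarrow> W \<le> W2 \<Longrightarrow> D \<le> D2 \<Longrightarrow> runs w c s W2 D2 s'"
  unfolding runs_def by (meson le_trans)

lemma runs_Seq:
  "runs w c1 s W1 D1 s' \<Longrightarrow> runs w c2 s' W2 D2 s'' \<Longrightarrow> runs w (Seq c1 c2) s (W1 + W2) (D1 + D2) s''"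
  unfolding runs_def by (meson exec.Seq add_mono)

lemma runs_Skip: "runs w Skip s 1 1 s"
  unfolding runs_def by (metis exec.Skip le_refl surj_pair)

lemma runs_Assign:
  "eval w m r e = v \<Longrightarrow> runs w (Assign x e) (m, r) (ops e + 1) (ops e + 1) (m, r(x := v))"
  unfolding runs_def using exec.Assign by blast

lemma exec_Assign: "eval w m r e = v \<Longrightarrow> ops e + 1 = k \<Longrightarrow> exec w (Assign x e) (m, r) k k (m, r(x := v))"
  using exec.Assign by blast

lemma runs_Assign_0: "runs w (Assign t (Const 0)) (m, r) 2 2 (m, r(t := 0))"
  by (rule runs_mono[OF runs_Assign[of w m r "Const 0" 0]]) auto

lemma runs_Store:
  "eval w m r a = p \<Longrightarrow> eval w m r e = v \<Longrightarrow>
   runs w (Store a e) (m, r) (ops a + ops e + 1) (ops a + ops e + 1) (m(p := v), r)"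
  unfolding runs_def using exec.Store by blast

lemma runs_Cond:
  assumes "runs w (if eval w m r e \<noteq> 0 then c1 else c2) (m, r) W D s'"
  shows "runs w (Cond e c1 c2) (m, r) (ops e + 1 + W) (ops e + 1 + D) s'"
  using assms unfolding runs_def
  by (cases "eval w m r e = 0") (force intro: exec.CondFalse exec.CondTrue)+

fun seqs :: "com list \<Rightarrow> com" where
  "seqs [] = Skip"
| "seqs (c # cs) = Seq c (seqs cs)"

text \<open>The invariant and the costs are indexed by an absolute counter starting at
  \<open>k\<close>, so that the index can be the number of the register or array being
  computed.\<close>

lemma runs_seqs:
  assumes "P k s"
    and "\<And>j s. j < length cs \<Longrightarrow> P (k + j) s \<Longrightarrow>
           \<exists>s'. runs w (cs ! j) s (Wf (k + j)) (Df (k + j)) s' \<and> P (Suc (k + j)) s'"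
  shows "\<exists>s'. runs w (seqs cs) s (1 + (\<Sum>j = k..<k + length cs. Wf j))
               (1 + (\<Sum>j = k..<k + length cs. Df j)) s' \<and> P (k + length cs) s'"
  using assms
proof (induction cs arbitrary: k s)
  case Nil
  then show ?case using runs_Skip by fastforce
next
  case (Cons c cs)
  from Cons.prems(2)[of 0 s] Cons.prems(1) obtain s1
    where s1: "runs w c s (Wf k) (Df k) s1" "P (Suc k) s1" by auto
  have "\<exists>s'. runs w (seqs cs) s1 (1 + (\<Sum>j = Suc k..<Suc k + length cs. Wf j))
               (1 + (\<Sum>j = Suc k..<Suc k + length cs. Df j)) s' \<and> P (Suc k + length cs) s'"
  proof (rule Cons.IH[OF s1(2)])
    fix j s assume "j < length cs" "P (Suc k + j) s"
    then show "\<exists>s'. runs w (cs ! j) s (Wf (Suc k + j)) (Df (Suc k + j)) s' \<and> P (Suc (Suc k + j)) s'"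
      using Cons.prems(2)[of "Suc j" s] by auto
  qed
  then obtain s' where s': "runs w (seqs cs) s1 (1 + (\<Sum>j = Suc k..<Suc k + length cs. Wf j))
               (1 + (\<Sum>j = Suc k..<Suc k + length cs. Df j)) s'" "P (Suc k + length cs) s'" by blast
  have S: "(\<Sum>j = k..<k + length (c # cs). f j) = f k + (\<Sum>j = Suc k..<Suc k + length cs. f j)"
    for f :: "nat \<Rightarrow> nat"
    by (subst sum.atLeast_Suc_lessThan) auto
  have "runs w (seqs (c # cs)) s (1 + (\<Sum>j = k..<k + length (c # cs). Wf j))
      (1 + (\<Sum>j = k..<k + length (c # cs). Df j)) s'"
    unfolding S seqs.simps using runs_Seq[OF s1(1) s'(1)] by (rule runs_mono) auto
  then show ?case using s'(2) by (intro exI[of _ s']) simp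
qed

text \<open>Active processors have distinct target cells, which makes the set of writes a function
  and determines the new memory completely: a target gets its value, any other cell is
  unchanged.\<close>

lemma runs_Par:
  assumes N: "eval w m r k = N"
    and g: "\<And>i. i < N \<Longrightarrow> (eval w m (r(x := i)) g \<noteq> 0) = gd i"
    and a: "\<And>i. i < N \<Longrightarrow> gd i \<Longrightarrow> eval w m (r(x := i)) a = ad i"
    and v: "\<And>i. i < N \<Longrightarrow> gd i \<Longrightarrow> eval w m (r(x := i)) v = va i"
    and inj: "inj_on ad {i. i < N \<and> gd i}"
  shows "\<exists>m'. runs w (Par x k g a v) (m, r) (ops k + 1 + N * (ops g + ops a + ops v + 1))
            (ops k + ops g + ops a + ops v + 2) (m', r) \<and>
          (\<forall>i < N. gd i \<longrightarrow> m' (ad i) = va i) \<and>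
          (\<forall>p. (\<forall>i < N. gd i \<longrightarrow> ad i \<noteq> p) \<longrightarrow> m' p = m p)"
proof -
  have W: "writes w m r x k g a v = (\<lambda>i. (ad i, va i)) ` {i. i < N \<and> gd i}"
  proof (intro equalityI subsetI)
    fix z assume "z \<in> writes w m r x k g a v"
    then obtain i where i: "z = (eval w m (r(x := i)) a, eval w m (r(x := i)) v)" "i < N"
      "eval w m (r(x := i)) g \<noteq> 0"
      unfolding writes_def N by blast
    then show "z \<in> (\<lambda>i. (ad i, va i)) ` {i. i < N \<and> gd i}" using g[of i] a[of i] v[of i] by simp
  next
    fix z assume "z \<in> (\<lambda>i. (ad i, va i)) ` {i. i < N \<and> gd i}"
    then obtain i where i: "z = (ad i, va i)" "i < N" "gd i" by blast
    then show "z \<in> writes w m r x k g a v"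
      unfolding writes_def N using g[of i] a[of i] v[of i] by (intro CollectI exI[of _ i]) simp
  qed
  have SV: "single_valued (writes w m r x k g a v)"
    unfolding W single_valued_def using inj by (auto dest: inj_onD)
  let ?m = "write_all m (writes w m r x k g a v)"
  have "exec w (Par x k g a v) (m, r) (ops k + 1 + N * (ops g + ops a + ops v + 1))
          (ops k + 1 + (ops g + ops a + ops v + 1)) (?m, r)"
    using exec.Par[OF SV] unfolding N .
  then have "runs w (Par x k g a v) (m, r) (ops k + 1 + N * (ops g + ops a + ops v + 1))
      (ops k + ops g + ops a + ops v + 2) (?m, r)"
    unfolding runs_def by force
  moreover have "?m (ad i) = va i" if i: "i < N" "gd i" for i
  proof -
    have "(ad i, va i) \<in> writes w m r x k g a v" unfolding W using i by blast
    moreover from this have "(THE y. (ad i, y) \<in> writes w m r x k g a v) = va i"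
      using SV by (intro the_equality) (auto simp: single_valued_def)
    ultimately show ?thesis unfolding write_all_def by (auto simp: Domain_iff)
  qed
  moreover have "?m p = m p" if "\<forall>i < N. gd i \<longrightarrow> ad i \<noteq> p" for p
    using that unfolding write_all_def W by (auto simp: Domain_iff)
  ultimately show ?thesis by blast
qed

definition for_loop :: "nat \<Rightarrow> expr \<Rightarrow> com \<Rightarrow> com" where
  "for_loop t b c = Seq (Assign t (Const 0))
     (While (Op Less (Reg t) b) (Seq c (Assign t (Op Add (Reg t) (Const 1)))))"

text \<open>The bound is evaluated anew before each round, hence the assumption that the invariant
  keeps its value at \<open>N\<close>. The counter does not wrap because
  \<open>N < 2 ^ w\<close>.\<close>

lemma runs_for_loop:
  assumes N: "N < 2 ^ w"
    and b: "\<And>j m. j \<le> N \<Longrightarrow> Inv j m \<Longrightarrow> eval w m (r(t := j)) b = N"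
    and I0: "Inv 0 m"
    and body: "\<And>j m. j < N \<Longrightarrow> Inv j m \<Longrightarrow>
      \<exists>m'. runs w c (m, r(t := j)) Wb Db (m', r(t := j)) \<and> Inv (Suc j) m'"
  shows "\<exists>m'. runs w (for_loop t b c) (m, r) ((N + 1) * (Wb + ops b + 10)) ((N + 1) * (Db + ops b + 10))
           (m', r(t := N)) \<and> Inv N m'"
proof -
  let ?L = "While (Op Less (Reg t) b) (Seq c (Assign t (Op Add (Reg t) (Const 1))))"
  have loop: "\<exists>m'. runs w ?L (m, r(t := j)) (k * (Wb + ops b + 10) + ops b + 3)
      (k * (Db + ops b + 10) + ops b + 3) (m', r(t := N)) \<and> Inv N m'"
    if "j + k = N" "Inv j m" for j k m
    using that
  proof (induction k arbitrary: j m)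
    case 0
    then have "eval w m (r(t := j)) (Op Less (Reg t) b) = 0" using b[of j m] by simp
    from exec.WhileFalse[OF this, of "Seq c (Assign t (Op Add (Reg t) (Const 1)))"] show ?case
      using 0 unfolding runs_def by force
  next
    case (Suc k)
    then have j: "j < N" by simp
    then have tr: "eval w m (r(t := j)) (Op Less (Reg t) b) \<noteq> 0" using b[of j m] Suc.prems by simp
    obtain m1 where m1: "runs w c (m, r(t := j)) Wb Db (m1, r(t := j))" "Inv (Suc j) m1"
      using body[OF j Suc.prems(2)] by blast
    have e1: "take_bit w (Suc 0) = Suc 0" using N j by (intro take_bit_nat_eq_self) linarith
    have "take_bit w (Suc j) = Suc j" using N j by (intro take_bit_nat_eq_self) linarith
    then have "eval w m1 (r(t := j)) (Op Add (Reg t) (Const 1)) = Suc j"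
      using e1 by simp
    from runs_Assign[OF this, of t]
    have "runs w (Assign t (Op Add (Reg t) (Const 1))) (m1, r(t := j)) 4 4 (m1, r(t := Suc j))"
      unfolding fun_upd_upd by (rule runs_mono) auto
    from runs_Seq[OF m1(1) this] obtain W1 D1 where
      bd: "exec w (Seq c (Assign t (Op Add (Reg t) (Const 1)))) (m, r(t := j)) W1 D1 (m1, r(t := Suc j))"
        "W1 \<le> Wb + 4" "D1 \<le> Db + 4"
      unfolding runs_def by blast
    from Suc.IH[of "Suc j" m1] Suc.prems m1(2) obtain m2 W2 D2 where
      m2: "exec w ?L (m1, r(t := Suc j)) W2 D2 (m2, r(t := N))" "Inv N m2"
        "W2 \<le> k * (Wb + ops b + 10) + ops b + 3" "D2 \<le> k * (Db + ops b + 10) + ops b + 3"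
      unfolding runs_def by auto
    have "exec w ?L (m, r(t := j)) (ops (Op Less (Reg t) b) + 1 + W1 + W2)
        (ops (Op Less (Reg t) b) + 1 + D1 + D2) (m2, r(t := N))"
      by (rule exec.WhileTrue[OF tr bd(1) m2(1)])
    moreover have "ops (Op Less (Reg t) b) + 1 + W1 + W2 \<le> Suc k * (Wb + ops b + 10) + ops b + 3"
      "ops (Op Less (Reg t) b) + 1 + D1 + D2 \<le> Suc k * (Db + ops b + 10) + ops b + 3"
      using bd m2 by auto
    ultimately show ?case using m2(2) unfolding runs_def by blast
  qed
  obtain m' where m': "runs w ?L (m, r(t := 0)) (N * (Wb + ops b + 10) + ops b + 3)
      (N * (Db + ops b + 10) + ops b + 3) (m', r(t := N))" "Inv N m'"
    using loop[of 0 N m] I0 by auto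
  from runs_Seq[OF runs_Assign_0 m'(1)] have "runs w (for_loop t b c) (m, r) ((N + 1) * (Wb + ops b + 10))
      ((N + 1) * (Db + ops b + 10)) (m', r(t := N))"
    unfolding for_loop_def by (rule runs_mono) auto
  then show ?thesis using m'(2) by blast
qed

section \<open>Steps of the construction\<close>

text \<open>The processor index, the round counter and a scratch register lie beyond the 45
  registers whose values end up in the header of the block.\<close>

abbreviation ireg :: nat where "ireg \<equiv> 64"
abbreviation treg :: nat where "treg \<equiv> 65"
abbreviation lreg :: nat where "lreg \<equiv> 66"

definition flog_prog :: "nat \<Rightarrow> aexp \<Rightarrow> com" where
  "flog_prog x e = Seq (Assign lreg (compile e)) (Seq (Assign x (Const 0))
     (While (Reg lreg) (Seq (Assign lreg (Op ShiftR (Reg lreg) (Const 1)))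
        (Assign x (Op Add (Reg x) (Const 1))))))"

lemma floorlog_le: "floorlog 2 v \<le> v"
proof (cases "v = 0")
  case False
  then show ?thesis using floorlog_leI[of v 2 v] less_exp[of v] by simp
qed (simp add: floorlog_def)

text \<open>Each halving removes one bit and costs 10 operations: 2 for the loop test and 4 for each
  of the two assignments. The total is linear in the resulting bit length, hence logarithmic in the
  argument.\<close>

lemma runs_flog_prog:
  assumes v: "eval w m r (compile e) = v" "v < 2 ^ w" and x: "x \<noteq> lreg" and w: "0 < w"
  shows "runs w (flog_prog x e) (m, r) (ops (compile e) + 10 * floorlog 2 v + 5)
     (ops (compile e) + 10 * floorlog 2 v + 5) (m, r(lreg := 0, x := floorlog 2 v))"
proof -
  let ?L = "While (Reg lreg) (Seq (Assign lreg (Op ShiftR (Reg lreg) (Const 1)))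
        (Assign x (Op Add (Reg x) (Const 1))))"
  have t1: "take_bit w (Suc 0) = Suc 0"
    using w one_less_power[of "2::nat" w] by (intro take_bit_nat_eq_self) simp
  have loop: "exec w ?L (m, r(lreg := y, x := c)) (10 * floorlog 2 y + 2) (10 * floorlog 2 y + 2)
          (m, r(lreg := 0, x := c + floorlog 2 y))"
    if "c + floorlog 2 y < 2 ^ w" for c y
    using that
  proof (induction y arbitrary: c rule: less_induct)
    case (less y)
    show ?case
    proof (cases "y = 0")
      case True
      have "exec w ?L (m, r(lreg := y, x := c)) (ops (Reg lreg) + 1) (ops (Reg lreg) + 1)
          (m, r(lreg := y, x := c))"
        by (rule exec.WhileFalse) (use x True in simp)
      moreover have "floorlog 2 (0::nat) = 0" by (simp add: floorlog_def)
      ultimately show ?thesis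
        unfolding True by (simp only: ops.simps mult_0_right add_0_right add_0_left one_add_one)
    next
      case False
      have fl: "floorlog 2 y = Suc (floorlog 2 (y div 2))"
        using compute_floorlog[of 2 y] False by simp
      let ?s1 = "(r(lreg := y, x := c))(lreg := y div 2)"
      have a1: "exec w (Assign lreg (Op ShiftR (Reg lreg) (Const 1))) (m, r(lreg := y, x := c)) 4 4 (m, ?s1)"
        by (rule exec_Assign) (use x t1 in \<open>simp_all add: drop_bit_eq_div\<close>)
      have "take_bit w (Suc c) = Suc c" using less.prems fl by (intro take_bit_nat_eq_self) simp
      then have a2: "exec w (Assign x (Op Add (Reg x) (Const 1))) (m, ?s1) 4 4 (m, ?s1(x := Suc c))"
        by (intro exec_Assign) (use x t1 in simp_all)
      have eq: "?s1(x := Suc c) = r(lreg := y div 2, x := Suc c)" using x by auto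
      have rec: "exec w ?L (m, r(lreg := y div 2, x := Suc c)) (10 * floorlog 2 (y div 2) + 2)
          (10 * floorlog 2 (y div 2) + 2) (m, r(lreg := 0, x := Suc c + floorlog 2 (y div 2)))"
        by (rule less.IH) (use less.prems False fl in simp_all)
      have "exec w ?L (m, r(lreg := y, x := c)) (ops (Reg lreg) + 1 + (4 + 4) + (10 * floorlog 2 (y div 2) + 2))
          (ops (Reg lreg) + 1 + (4 + 4) + (10 * floorlog 2 (y div 2) + 2))
          (m, r(lreg := 0, x := Suc c + floorlog 2 (y div 2)))"
        by (rule exec.WhileTrue[OF _ exec.Seq[OF a1 a2[unfolded eq]] rec]) (use x False in simp)
      moreover have "10 * floorlog 2 y + 2 = ops (Reg lreg) + 1 + (4 + 4) + (10 * floorlog 2 (y div 2) + 2)"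
        "c + floorlog 2 y = Suc c + floorlog 2 (y div 2)" by (simp_all add: fl)
      ultimately show ?thesis by (simp only:)
    qed
  qed
  have "exec w ?L (m, r(lreg := v, x := 0)) (10 * floorlog 2 v + 2)
      (10 * floorlog 2 v + 2) (m, r(lreg := 0, x := 0 + floorlog 2 v))"
    by (rule loop) (use v(2) floorlog_le[of v] in linarith)
  then have lp: "runs w ?L (m, r(lreg := v, x := 0)) (10 * floorlog 2 v + 2)
      (10 * floorlog 2 v + 2) (m, r(lreg := 0, x := floorlog 2 v))"
    unfolding runs_def add_0_left by blast
  from runs_Seq[OF runs_Assign[OF v(1)] runs_Seq[OF runs_Assign_0 lp]] show ?thesis
    unfolding flog_prog_def by (rule runs_mono) auto
qed

datatype rstep = Val aexp | Flog aexp

fun rexp :: "rstep \<Rightarrow> aexp" where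
  "rexp (Val e) = e"
| "rexp (Flog e) = e"

fun reg_prog :: "nat \<Rightarrow> rstep \<Rightarrow> com" where
  "reg_prog x (Val e) = Assign x (compile e)"
| "reg_prog x (Flog e) = flog_prog x e"

fun rval :: "env \<Rightarrow> rstep \<Rightarrow> nat" where
  "rval E (Val e) = aeval E e"
| "rval E (Flog e) = floorlog 2 (aeval E e)"

fun rcost :: "rstep \<Rightarrow> nat \<Rightarrow> nat" where
  "rcost (Val e) v = 0"
| "rcost (Flog e) v = 10 * v"

text \<open>
  An array is filled by one parallel store and a loop of guarded parallel stores; most arrays need
  only one of the two.
\<close>

record astep =
  ini_n :: aexp
  ini_ix :: aexp
  ini_v :: aexp
  rounds :: aexp
  upd_n :: aexp
  upd_g :: aexp
  upd_ix :: aexp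
  upd_v :: aexp

definition arr_prog :: "nat \<Rightarrow> astep \<Rightarrow> com" where
  "arr_prog a s = Seq (Assign treg (Const 0)) (Seq
     (Par ireg (compile (ini_n s)) (Const 1) (arr_addr a (compile (ini_ix s))) (compile (ini_v s)))
     (for_loop treg (compile (rounds s))
       (Par ireg (compile (upd_n s)) (compile (upd_g s)) (arr_addr a (compile (upd_ix s)))
          (compile (upd_v s)))))"

text \<open>Generous limits for degree and length of the expressions that occur; every expression is
  checked against them by evaluation.\<close>

definition max_deg :: nat where "max_deg = 4096"
definition max_ops :: nat where "max_ops = 100000"

text \<open>The slack of 16 leaves room for turning the value of the expression into an array
  address.\<close>

definition small :: "aexp \<Rightarrow> bool" where
  "small e \<longleftrightarrow> deg e + 16 \<le> max_deg \<and> ops (compile e) \<le> max_ops"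

abbreviation nregs :: nat where "nregs \<equiv> 45"
abbreviation narrs :: nat where "narrs \<equiv> 30"

text \<open>\<open>pv\<close>, \<open>NA\<close> and \<open>FA\<close> are the intended final
  register values, array lengths and array contents. The assumption \<open>nT\<close> keeps the work
  arrays above the first \<open>n\<close> words, and the \<open>n\<close> bits of the input lie
  within these words.\<close>

locale builder =
  fixes w u n :: nat and pv :: "nat \<Rightarrow> nat" and NA :: "nat \<Rightarrow> nat" and FA :: "nat \<Rightarrow> nat \<Rightarrow> nat"
    and m0 :: memory
  assumes pv0: "pv 0 = w" and pv1: "pv 1 = n" and u8: "8 \<le> u" and uw: "max_deg * u \<le> w"
    and pvu: "\<And>x. x < nregs \<Longrightarrow> pv x < 2 ^ u"
    and FAu: "\<And>a i. a < narrs \<Longrightarrow> i < NA a \<Longrightarrow> FA a i < 2 ^ u"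
    and low: "\<And>p. p < n \<Longrightarrow> m0 p < 2 ^ w"
    and nT: "n \<le> pv tbase"
begin

definition st :: "nat \<Rightarrow> nat \<Rightarrow> memory \<times> regs \<Rightarrow> bool" where
  "st X Y s \<longleftrightarrow> (\<forall>x < X. snd s x = pv x) \<and>
     (\<forall>a < Y. \<forall>i < NA a. fst s (pv tbase + (64 * i + a)) = FA a i) \<and>
     (\<forall>p < n. fst s p = m0 p)"

definition renv :: "nat \<Rightarrow> env" where
  "renv X = \<lparr>regv = pv, regok = (\<lambda>x. x < X), arrv = (\<lambda>_ _. 0), arrok = (\<lambda>_ _. False),
     wrdv = (\<lambda>_. 0), wrdok = (\<lambda>_. False), fldv = (\<lambda>_ _. 0), fldok = (\<lambda>_ _. False)\<rparr>"

text \<open>What a processor may read while array \<open>a\<close> is built: all registers, the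
  finished arrays, single bits of the input, and the cells \<open>F\<close> of \<open>a\<close>
  itself with their current values \<open>G\<close>. The last item is what lets a loop update an
  array in place.\<close>

definition aenv :: "nat \<Rightarrow> (nat \<Rightarrow> bool) \<Rightarrow> (nat \<Rightarrow> nat) \<Rightarrow> nat \<Rightarrow> nat \<Rightarrow> env" where
  "aenv a F G i t =
     \<lparr>regv = (\<lambda>x. if x = ireg then i else if x = treg then t else pv x),
      regok = (\<lambda>x. x < nregs \<or> x = ireg \<or> x = treg),
      arrv = (\<lambda>b j. if b = a then G j else FA b j),
      arrok = (\<lambda>b j. if b = a then F j else b < a \<and> j < NA b),
      wrdv = (\<lambda>_. 0), wrdok = (\<lambda>_. False),
      fldv = field w m0, fldok = (\<lambda>p b. p < n \<and> b = 1)\<rparr>"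

section \<open>One register step and one array step\<close>

lemma w_pos: "0 < w"
  using u8 uw by (cases w) (auto simp: max_deg_def)

lemma u_le_w: "u \<le> w"
  using uw by (simp add: max_deg_def)

lemma small_w: 
  assumes "small e"
  shows "u * deg e \<le> w"
proof -
  have "u * deg e \<le> u * max_deg" using assms unfolding small_def by (intro mult_le_mono2) simp
  also have "\<dots> \<le> w" using uw by (simp only: mult.commute)
  finally show ?thesis .
qed

lemma models_renv:
  assumes "st X Y (m, r)" "X \<le> nregs"
  shows "models w u (renv X) m r"
proof (rule modelsI[OF u8])
  fix x assume "regok (renv X) x"
  then show "r x = regv (renv X) x \<and> regv (renv X) x < 2 ^ u"
    using assms pvu[of x] by (simp add: renv_def st_def)
qed (simp_all add: renv_def)

lemma field1: "(\<And>q. q < n \<Longrightarrow> m q = m0 q) \<Longrightarrow> p < n \<Longrightarrow> field w m p 1 = field w m0 p 1"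
  using le_less_trans[OF div_le_dividend[of p w]] by (simp add: field_def mem_bit_def)

lemma models_aenv:
  assumes st: "st nregs a (m, r)" and a: "a \<le> narrs"
    and F: "\<And>j. F j \<Longrightarrow> m (pv tbase + (64 * j + a)) = G j \<and> G j < 2 ^ u"
    and i: "i < 2 ^ u" and t: "t < 2 ^ u"
  shows "models w u (aenv a F G i t) m (r(treg := t, ireg := i))"
proof -
  have R: "r x = pv x" if "x < nregs" for x using st that by (auto simp: st_def)
  have A: "m (pv tbase + (64 * i + b)) = FA b i" if "b < a" "i < NA b" for b i
    using st that by (auto simp: st_def)
  have M: "m p = m0 p" if "p < n" for p using st that by (auto simp: st_def)
  have L: "m (p div w) < 2 ^ w" if "p < n" for p
    using M[of "p div w"] low[of "p div w"] that div_le_dividend[of p w] by auto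
  have "r 0 = w" using R[of 0] pv0 by simp
  show ?thesis
  proof (rule modelsI[OF u8])
    fix x assume "regok (aenv a F G i t) x"
    then show "(r(treg := t, ireg := i)) x = regv (aenv a F G i t) x \<and> regv (aenv a F G i t) x < 2 ^ u"
      using R[of x] pvu[of x] i t by (auto simp: aenv_def)
  next
    fix b j assume "arrok (aenv a F G i t) b j"
    then have "if b = a then F j else b < a \<and> j < NA b" by (simp add: aenv_def)
    then show "m ((r(treg := t, ireg := i)) tbase + (64 * j + b)) = arrv (aenv a F G i t) b j \<and>
        arrv (aenv a F G i t) b j < 2 ^ u \<and> b < 64 \<and> (r(treg := t, ireg := i)) tbase < 2 ^ u"
      using R[of tbase] pvu[of tbase] F[of j] A[of b j] FAu[of b j] a
      by (cases "b = a") (simp_all add: aenv_def)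
  next
    fix p b assume "fldok (aenv a F G i t) p b"
    then have "p < n" "b = 1" by (simp_all add: aenv_def)
    then show "fldv (aenv a F G i t) p b = field w m p b \<and> m (p div w) < 2 ^ w \<and> (r(treg := t, ireg := i)) 0 = w"
      using field1[of m p, OF M] L[of p] \<open>r 0 = w\<close> by (simp add: aenv_def)
  qed (simp add: aenv_def)
qed

lemma runs_reg:
  assumes st: "st x 0 (m, r)" and x: "x < nregs"
    and e: "small (rexp s)" "good u (renv x) (rexp s)" and v: "rval (renv x) s = pv x"
  shows "\<exists>s'. runs w (reg_prog x s) (m, r) (max_ops + rcost s (pv x) + 5) (max_ops + rcost s (pv x) + 5) s' \<and>
     st (Suc x) 0 s'"
proof -
  have M: "models w u (renv x) m r" by (rule models_renv[OF st]) (use x in simp)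
  have d: "u * deg (rexp s) \<le> w" by (rule small_w[OF e(1)])
  note C = compile_correct[OF M e(2) d]
  have o: "ops (compile (rexp s)) \<le> max_ops" using e(1) by (simp add: small_def)
  show ?thesis
  proof (cases s)
    case (Val f)
    then have "runs w (reg_prog x s) (m, r) (ops (compile f) + 1) (ops (compile f) + 1) (m, r(x := pv x))"
      using runs_Assign[of w m r "compile f" "pv x" x] C v by simp
    then have "runs w (reg_prog x s) (m, r) (max_ops + rcost s (pv x) + 5)
        (max_ops + rcost s (pv x) + 5) (m, r(x := pv x))"
      by (rule runs_mono) (use o Val in auto)
    moreover have "st (Suc x) 0 (m, r(x := pv x))" using st by (auto simp: st_def less_Suc_eq)
    ultimately show ?thesis by blast
  next
    case (Flog f)
    have "aeval (renv x) f < 2 ^ w"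
      using C d Flog by (metis rexp.simps(2) less_le_trans one_le_numeral power_increasing)
    then have "runs w (reg_prog x s) (m, r) (ops (compile f) + 10 * pv x + 5) (ops (compile f) + 10 * pv x + 5)
        (m, r(lreg := 0, x := pv x))"
      using runs_flog_prog[of w m r f "aeval (renv x) f" x] C v Flog w_pos x by simp
    then have "runs w (reg_prog x s) (m, r) (max_ops + rcost s (pv x) + 5)
        (max_ops + rcost s (pv x) + 5) (m, r(lreg := 0, x := pv x))"
      by (rule runs_mono) (use o Flog in auto)
    moreover have "st (Suc x) 0 (m, r(lreg := 0, x := pv x))"
      using st x by (auto simp: st_def less_Suc_eq)
    ultimately show ?thesis by blast
  qed
qed

text \<open>\<open>F t j\<close> says that cell \<open>j\<close> is meaningful after
  \<open>t\<close> rounds, and \<open>G t j\<close> is its value then. A meaningful cell is either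
  written in the round or carries its value over. All expressions of a round are evaluated with the
  values from before it, as in a synchronous parallel step.\<close>

definition step_ok ::
  "nat \<Rightarrow> astep \<Rightarrow> nat \<Rightarrow> nat \<Rightarrow> nat \<Rightarrow> (nat \<Rightarrow> nat \<Rightarrow> bool) \<Rightarrow> (nat \<Rightarrow> nat \<Rightarrow> nat) \<Rightarrow> bool" where
  "step_ok a s N0 NB Nk F G \<longleftrightarrow>
     (\<forall>e \<in> {ini_n s, ini_ix s, ini_v s, rounds s, upd_n s, upd_g s, upd_ix s, upd_v s}. small e) \<and>
     N0 \<le> 2 ^ u \<and> NB < 2 ^ u \<and> Nk \<le> 2 ^ u \<and>
     (let E = renv nregs in
        good u E (ini_n s) \<and> aeval E (ini_n s) = N0 \<and>
        good u E (rounds s) \<and> aeval E (rounds s) = NB \<and>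
        good u E (upd_n s) \<and> aeval E (upd_n s) = Nk) \<and>
     (let E = (\<lambda>x. aenv a (\<lambda>_. False) (\<lambda>_. 0) x 0) in
        (\<forall>x < N0. good u (E x) (ini_ix s) \<and> good u (E x) (ini_v s) \<and>
           aeval (E x) (ini_v s) = G 0 (aeval (E x) (ini_ix s))) \<and>
        inj_on (\<lambda>x. aeval (E x) (ini_ix s)) {..<N0} \<and>
        (\<forall>j. F 0 j \<longrightarrow> (\<exists>x < N0. aeval (E x) (ini_ix s) = j))) \<and>
     (\<forall>t < NB. let E = (\<lambda>x. aenv a (F t) (G t) x t) in
        (\<forall>x < Nk. good u (E x) (upd_g s) \<and>
           (aeval (E x) (upd_g s) \<noteq> 0 \<longrightarrow> good u (E x) (upd_ix s) \<and> good u (E x) (upd_v s) \<and>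
              aeval (E x) (upd_v s) = G (Suc t) (aeval (E x) (upd_ix s)))) \<and>
        inj_on (\<lambda>x. aeval (E x) (upd_ix s)) {x. x < Nk \<and> aeval (E x) (upd_g s) \<noteq> 0} \<and>
        (\<forall>j. F (Suc t) j \<longrightarrow>
           (\<exists>x < Nk. aeval (E x) (upd_g s) \<noteq> 0 \<and> aeval (E x) (upd_ix s) = j) \<or>
           F t j \<and> G (Suc t) j = G t j)) \<and>
     (\<forall>t \<le> NB. \<forall>j. F t j \<longrightarrow> G t j < 2 ^ u) \<and>
     (\<forall>j < NA a. F NB j \<and> G NB j = FA a j)"

lemma pow_deg: "small e \<Longrightarrow> aeval E e < 2 ^ (u * deg e) \<Longrightarrow>
    pv tbase + (64 * aeval E e + a) < 2 ^ w \<and> 64 * aeval E e + a < 2 ^ w \<and> 64 * aeval E e < 2 ^ w \<and>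
    a < 2 ^ w \<and> (64::nat) < 2 ^ w" if a: "a < 64"
proof -
  assume s: "small e" and v: "aeval E e < 2 ^ (u * deg e)"
  define q :: nat where "q = 2 ^ (u * (deg e + 1))"
  have "(2::nat) ^ 8 \<le> q" unfolding q_def using u8 deg_pos[of e]
    by (intro power_increasing) (auto simp: algebra_simps)
  then have q8: "256 \<le> q" by simp
  have "pv tbase < 2 ^ u" using pvu by simp
  also have "\<dots> \<le> q" unfolding q_def by (intro power_increasing) auto
  finally have T: "pv tbase < q" .
  have "aeval E e < 2 ^ (u * deg e)" by (rule v)
  also have "\<dots> \<le> q" unfolding q_def by (intro power_increasing) auto
  finally have V: "aeval E e < q" .
  have "pv tbase + (64 * aeval E e + 64) < 128 * q" using T V q8 by linarith
  also have "\<dots> \<le> 2 ^ 8 * q" by simp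
  also have "\<dots> \<le> 2 ^ u * q" using u8 by (intro mult_right_mono power_increasing) auto
  also have "\<dots> = 2 ^ (u * (deg e + 2))" by (simp add: q_def power_add)
  also have "\<dots> \<le> 2 ^ w"
  proof (rule power_increasing)
    have "u * (deg e + 2) \<le> u * max_deg" using s unfolding small_def by (intro mult_le_mono2) simp
    then show "u * (deg e + 2) \<le> w" using uw by (simp add: mult.commute)
  qed simp
  finally show ?thesis using a by linarith
qed

lemma eval_arr_addr:
  assumes M: "models w u E m r" and g: "good u E e" and s: "small e" and a: "a < 64"
    and r: "r tbase = pv tbase"
  shows "eval w m r (arr_addr a (compile e)) = pv tbase + (64 * aeval E e + a)"
proof -
  have C: "eval w m r (compile e) = aeval E e" "aeval E e < 2 ^ (u * deg e)"
    using compile_correct[OF M g small_w[OF s]] by auto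
  note B = pow_deg[OF a s C(2)]
  show ?thesis unfolding arr_addr_def using C(1) B r by (simp add: take_bit_nat_eq_self)
qed

lemma runs_arr:
  assumes st: "st nregs a (m, r)" and a: "a < narrs" and ok: "step_ok a s N0 NB Nk F G"
  shows "\<exists>s'. runs w (arr_prog a s) (m, r) (5 * max_ops * (N0 + (NB + 1) * (Nk + 2) + 2))
     (6 * max_ops * (NB + 4)) s' \<and> st nregs (Suc a) s'"
proof -
  define E0 where "E0 = (\<lambda>x. aenv a (\<lambda>_. False) (\<lambda>_. 0) x 0)"
  define E where "E = (\<lambda>t x. aenv a (F t) (G t) x t)"
  have sm: "small (ini_n s)" "small (ini_ix s)" "small (ini_v s)" "small (rounds s)" "small (upd_n s)"
    "small (upd_g s)" "small (upd_ix s)" "small (upd_v s)"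
    and N: "N0 \<le> 2 ^ u" "NB < 2 ^ u" "Nk \<le> 2 ^ u"
    and sz: "good u (renv nregs) (ini_n s)" "aeval (renv nregs) (ini_n s) = N0"
        "good u (renv nregs) (rounds s)" "aeval (renv nregs) (rounds s) = NB"
        "good u (renv nregs) (upd_n s)" "aeval (renv nregs) (upd_n s) = Nk"
    and i0: "\<And>x. x < N0 \<Longrightarrow> good u (E0 x) (ini_ix s) \<and> good u (E0 x) (ini_v s) \<and>
           aeval (E0 x) (ini_v s) = G 0 (aeval (E0 x) (ini_ix s))"
    and i0inj: "inj_on (\<lambda>x. aeval (E0 x) (ini_ix s)) {..<N0}"
    and i0F: "\<And>j. F 0 j \<Longrightarrow> \<exists>x < N0. aeval (E0 x) (ini_ix s) = j"
    and up: "\<And>t x. t < NB \<Longrightarrow> x < Nk \<Longrightarrow> good u (E t x) (upd_g s) \<and>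
           (aeval (E t x) (upd_g s) \<noteq> 0 \<longrightarrow> good u (E t x) (upd_ix s) \<and> good u (E t x) (upd_v s) \<and>
              aeval (E t x) (upd_v s) = G (Suc t) (aeval (E t x) (upd_ix s)))"
    and upinj: "\<And>t. t < NB \<Longrightarrow>
        inj_on (\<lambda>x. aeval (E t x) (upd_ix s)) {x. x < Nk \<and> aeval (E t x) (upd_g s) \<noteq> 0}"
    and upF: "\<And>t j. t < NB \<Longrightarrow> F (Suc t) j \<Longrightarrow>
           (\<exists>x < Nk. aeval (E t x) (upd_g s) \<noteq> 0 \<and> aeval (E t x) (upd_ix s) = j) \<or>
           F t j \<and> G (Suc t) j = G t j"
    and bd: "\<And>t j. t \<le> NB \<Longrightarrow> F t j \<Longrightarrow> G t j < 2 ^ u"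
    and fin: "\<And>j. j < NA a \<Longrightarrow> F NB j \<and> G NB j = FA a j"
    using ok unfolding step_ok_def Let_def E0_def E_def by auto
  let ?ad = "\<lambda>j. pv tbase + (64 * j + a)"
  have a64: "a < 64" using a by simp
  have lt2: "x < 2 ^ u" if "x < N0" for x using that N by simp
  have lt3: "x < 2 ^ u" if "x < Nk" for x using that N by simp
  have rT: "r' tbase = pv tbase" if "st nregs b (m', r')" for b m' r' using that by (simp add: st_def)
  have c1: "take_bit w (1::nat) = 1" using w_pos by simp
  have st0: "st nregs a (m, r(treg := 0))" using st by (auto simp: st_def)
  have ob: "ops (compile e) \<le> max_ops" if "small e" for e using that by (simp add: small_def)
  have mo: "100000 \<le> max_ops" by (simp add: max_ops_def)

  define P where "P t m' \<longleftrightarrow> st nregs a (m', r) \<and> (\<forall>j. F t j \<longrightarrow> m' (?ad j) = G t j)" for t m'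
  \<comment> \<open>Relative to the base, the addresses of array \<open>a\<close> are congruent to
    \<open>a\<close> modulo 64, and the base is at least \<open>n\<close>. So neither an earlier
    array nor the input is touched.\<close>
  have frame: "st nregs a (m2, r)" if 1: "st nregs a (m1, r)"
    and 2: "\<And>p. (\<And>j. p \<noteq> ?ad j) \<Longrightarrow> m2 p = m1 p" for m1 m2
  proof -
    have "m2 (pv tbase + (64 * i + b)) = m1 (pv tbase + (64 * i + b))" if "b < a" for b i
    proof (rule 2)
      fix j show "pv tbase + (64 * i + b) \<noteq> ?ad j" using that a64 by presburger
    qed
    moreover have "m2 p = m1 p" if "p < n" for p by (rule 2) (use that nT in auto)
    ultimately show ?thesis using 1 by (auto simp: st_def)
  qed
  have modE0: "models w u (E0 x) m (r(treg := 0, ireg := x))" if "x < 2 ^ u" for x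
    unfolding E0_def by (rule models_aenv[OF st]) (use that a in auto)

  let ?r = "r(treg := 0)"
  have size: "eval w m1 r1 (compile e) = aeval (renv nregs) e"
    if "st nregs a (m1, r1)" "good u (renv nregs) e" "small e" for m1 r1 e
    using compile_correct[OF models_renv[OF that(1) order_refl] that(2) small_w[OF that(3)]] by simp
  have addr: "eval w m1 (r(treg := t, ireg := x)) (arr_addr a (compile e)) = ?ad (aeval E e)"
    if "models w u E m1 (r(treg := t, ireg := x))" "good u E e" "small e" for m1 E e t x
    by (rule eval_arr_addr[OF that a64]) (use rT[OF st] in simp)
  have ex: "eval w m1 r1 (compile e) = aeval E e"
    if "models w u E m1 r1" "good u E e" "small e" for m1 r1 E e
    using compile_correct[OF that(1,2) small_w[OF that(3)]] by simp

  have "\<exists>m'. runs w (Par ireg (compile (ini_n s)) (Const 1) (arr_addr a (compile (ini_ix s))) (compile (ini_v s)))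
      (m, ?r) (ops (compile (ini_n s)) + 1 + N0 * (ops (Const 1) + ops (arr_addr a (compile (ini_ix s))) +
          ops (compile (ini_v s)) + 1))
      (ops (compile (ini_n s)) + ops (Const 1) + ops (arr_addr a (compile (ini_ix s))) + ops (compile (ini_v s)) + 2)
      (m', ?r) \<and>
      (\<forall>x < N0. True \<longrightarrow> m' (?ad (aeval (E0 x) (ini_ix s))) = aeval (E0 x) (ini_v s)) \<and>
      (\<forall>p. (\<forall>x < N0. True \<longrightarrow> ?ad (aeval (E0 x) (ini_ix s)) \<noteq> p) \<longrightarrow> m' p = m p)"
  proof (rule runs_Par)
    show "eval w m ?r (compile (ini_n s)) = N0" using size[OF st0 sz(1) sm(1)] sz(2) by simp
    show "inj_on (\<lambda>x. ?ad (aeval (E0 x) (ini_ix s))) {x. x < N0 \<and> True}"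
      using i0inj by (auto simp: inj_on_def)
  next
    fix x assume x: "x < N0"
    note Mx = modE0[OF lt2[OF x]]
    show "(eval w m (?r(ireg := x)) (Const 1) \<noteq> 0) = True" using c1 by simp
    show "eval w m (?r(ireg := x)) (arr_addr a (compile (ini_ix s))) = ?ad (aeval (E0 x) (ini_ix s))"
      using addr[OF Mx] i0[OF x] sm(2) by simp
    show "eval w m (?r(ireg := x)) (compile (ini_v s)) = aeval (E0 x) (ini_v s)"
      using ex[OF Mx] i0[OF x] sm(3) by simp
  qed
  then obtain m1 where m1: "runs w (Par ireg (compile (ini_n s)) (Const 1) (arr_addr a (compile (ini_ix s)))
        (compile (ini_v s)))
      (m, ?r) (ops (compile (ini_n s)) + 1 + N0 * (ops (Const 1) + ops (arr_addr a (compile (ini_ix s))) +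
          ops (compile (ini_v s)) + 1))
      (ops (compile (ini_n s)) + ops (Const 1) + ops (arr_addr a (compile (ini_ix s))) + ops (compile (ini_v s)) + 2)
      (m1, ?r)"
    and m1v: "\<And>x. x < N0 \<Longrightarrow> m1 (?ad (aeval (E0 x) (ini_ix s))) = aeval (E0 x) (ini_v s)"
    and m1f: "\<And>p. (\<And>x. x < N0 \<Longrightarrow> ?ad (aeval (E0 x) (ini_ix s)) \<noteq> p) \<Longrightarrow> m1 p = m p"
    by auto
  have P0: "P 0 m1"
    unfolding P_def
  proof (intro conjI allI impI)
    show "st nregs a (m1, r)" by (rule frame[OF st]) (rule m1f, metis)
    fix j assume "F 0 j"
    then obtain x where "x < N0" "aeval (E0 x) (ini_ix s) = j" using i0F by blast
    then show "m1 (?ad j) = G 0 j" using m1v[of x] i0[of x] by simp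
  qed
  let ?body = "Par ireg (compile (upd_n s)) (compile (upd_g s)) (arr_addr a (compile (upd_ix s)))
      (compile (upd_v s))"
  let ?Wb = "ops (compile (upd_n s)) + 1 + Nk * (ops (compile (upd_g s)) + ops (arr_addr a (compile (upd_ix s))) +
          ops (compile (upd_v s)) + 1)"
  let ?Db = "ops (compile (upd_n s)) + ops (compile (upd_g s)) + ops (arr_addr a (compile (upd_ix s))) +
      ops (compile (upd_v s)) + 2"
  have "\<exists>m'. runs w (for_loop treg (compile (rounds s)) ?body) (m1, ?r)
      ((NB + 1) * (?Wb + ops (compile (rounds s)) + 10)) ((NB + 1) * (?Db + ops (compile (rounds s)) + 10))
      (m', ?r(treg := NB)) \<and> P NB m'"
  proof (rule runs_for_loop)
    show "NB < 2 ^ w" using N(2) u_le_w by (meson less_le_trans one_le_numeral power_increasing)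
    show "P 0 m1" by (rule P0)
  next
    fix j m' assume "P j m'"
    then have "st nregs a (m', ?r(treg := j))" by (auto simp: P_def st_def)
    then show "eval w m' (?r(treg := j)) (compile (rounds s)) = NB"
      using size[OF _ sz(3) sm(4)] sz(4) by simp
  next
    fix t m' assume t: "t < NB" and P: "P t m'"
    then have st': "st nregs a (m', r)" and Pv: "\<And>j. F t j \<Longrightarrow> m' (?ad j) = G t j"
      by (auto simp: P_def)
    have Mx: "models w u (E t x) m' (r(treg := t, ireg := x))" if "x < Nk" for x
      unfolding E_def
      by (rule models_aenv[OF st']) (use Pv bd t lt3 that a N(2) in auto)
    have "\<exists>m''. runs w ?body (m', r(treg := t)) ?Wb ?Db (m'', r(treg := t)) \<and>
      (\<forall>x < Nk. aeval (E t x) (upd_g s) \<noteq> 0 \<longrightarrow> m'' (?ad (aeval (E t x) (upd_ix s))) = aeval (E t x) (upd_v s)) \<and>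
      (\<forall>p. (\<forall>x < Nk. aeval (E t x) (upd_g s) \<noteq> 0 \<longrightarrow> ?ad (aeval (E t x) (upd_ix s)) \<noteq> p) \<longrightarrow> m'' p = m' p)"
    proof (rule runs_Par)
      have "st nregs a (m', r(treg := t))" using st' by (auto simp: st_def)
      then show "eval w m' (r(treg := t)) (compile (upd_n s)) = Nk"
        using size[OF _ sz(5) sm(5)] sz(6) by simp
      show "inj_on (\<lambda>x. ?ad (aeval (E t x) (upd_ix s))) {x. x < Nk \<and> aeval (E t x) (upd_g s) \<noteq> 0}"
        using upinj[OF t] by (auto simp: inj_on_def)
    next
      fix x assume x: "x < Nk"
      show "(eval w m' (r(treg := t, ireg := x)) (compile (upd_g s)) \<noteq> 0) = (aeval (E t x) (upd_g s) \<noteq> 0)"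
        using ex[OF Mx[OF x]] up[OF t x] sm(6) by simp
      assume "aeval (E t x) (upd_g s) \<noteq> 0"
      then have g: "good u (E t x) (upd_ix s)" "good u (E t x) (upd_v s)" using up[OF t x] by auto
      show "eval w m' (r(treg := t, ireg := x)) (arr_addr a (compile (upd_ix s))) = ?ad (aeval (E t x) (upd_ix s))"
        using addr[OF Mx[OF x] g(1) sm(7)] .
      show "eval w m' (r(treg := t, ireg := x)) (compile (upd_v s)) = aeval (E t x) (upd_v s)"
        using ex[OF Mx[OF x] g(2) sm(8)] .
    qed
    then obtain m2 where m2: "runs w ?body (m', r(treg := t)) ?Wb ?Db (m2, r(treg := t))"
      and m2v: "\<And>x. x < Nk \<Longrightarrow> aeval (E t x) (upd_g s) \<noteq> 0 \<Longrightarrow>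
        m2 (?ad (aeval (E t x) (upd_ix s))) = aeval (E t x) (upd_v s)"
      and m2f: "\<And>p. (\<And>x. x < Nk \<Longrightarrow> aeval (E t x) (upd_g s) \<noteq> 0 \<Longrightarrow> ?ad (aeval (E t x) (upd_ix s)) \<noteq> p)
        \<Longrightarrow> m2 p = m' p"
      by auto
    have "P (Suc t) m2"
      unfolding P_def
    proof (intro conjI allI impI)
      show "st nregs a (m2, r)" by (rule frame[OF st']) (rule m2f, metis)
      fix j assume FS: "F (Suc t) j"
      show "m2 (?ad j) = G (Suc t) j"
      proof (cases "\<exists>x < Nk. aeval (E t x) (upd_g s) \<noteq> 0 \<and> aeval (E t x) (upd_ix s) = j")
        case True
        then obtain x where "x < Nk" "aeval (E t x) (upd_g s) \<noteq> 0" "aeval (E t x) (upd_ix s) = j" by blast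
        then show ?thesis using m2v[of x] up[OF t, of x] by simp
      next
        case False
        then have "m2 (?ad j) = m' (?ad j)" by (intro m2f) auto
        moreover have "F t j" "G (Suc t) j = G t j" using upF[OF t FS] False by auto
        ultimately show ?thesis using Pv by simp
      qed
    qed
    with m2 show "\<exists>m''. runs w ?body (m', ?r(treg := t)) ?Wb ?Db (m'', ?r(treg := t)) \<and> P (Suc t) m''"
      by auto
  qed
  then obtain m3 where m3: "runs w (for_loop treg (compile (rounds s)) ?body) (m1, ?r)
      ((NB + 1) * (?Wb + ops (compile (rounds s)) + 10)) ((NB + 1) * (?Db + ops (compile (rounds s)) + 10))
      (m3, ?r(treg := NB))" and P3: "P NB m3" by blast
  note R = runs_Seq[OF runs_Assign_0 runs_Seq[OF m1 m3]]
  note os = ob[OF sm(1)] ob[OF sm(2)] ob[OF sm(3)] ob[OF sm(4)] ob[OF sm(5)] ob[OF sm(6)] ob[OF sm(7)] ob[OF sm(8)]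
  have oa: "ops (arr_addr a e) = ops e + 6" for e by (simp add: arr_addr_def)
  have W1: "N0 * (ops (Const 1) + ops (arr_addr a (compile (ini_ix s))) + ops (compile (ini_v s)) + 1)
      \<le> N0 * (5 * max_ops)"
    using os mo by (intro mult_le_mono2) (simp add: oa)
  have "Nk * (ops (compile (upd_g s)) + ops (arr_addr a (compile (upd_ix s))) + ops (compile (upd_v s)) + 1)
      \<le> Nk * (5 * max_ops)"
    using os mo by (intro mult_le_mono2) (simp add: oa)
  then have "?Wb + ops (compile (rounds s)) + 10 \<le> 5 * max_ops * (Nk + 2)"
    using os mo by (simp add: algebra_simps)
  then have W2: "(NB + 1) * (?Wb + ops (compile (rounds s)) + 10) \<le> (NB + 1) * (5 * max_ops * (Nk + 2))"
    by (rule mult_le_mono2)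
  have D2: "(NB + 1) * (?Db + ops (compile (rounds s)) + 10) \<le> (NB + 1) * (6 * max_ops)"
    using os mo by (intro mult_le_mono2) (simp add: oa)
  have "runs w (arr_prog a s) (m, r) (5 * max_ops * (N0 + (NB + 1) * (Nk + 2) + 2))
     (6 * max_ops * (NB + 4)) (m3, ?r(treg := NB))"
    unfolding arr_prog_def
  proof (rule runs_mono[OF R])
    have "5 * max_ops * (N0 + (NB + 1) * (Nk + 2) + 2)
      = N0 * (5 * max_ops) + (NB + 1) * (5 * max_ops * (Nk + 2)) + 10 * max_ops"
      by (simp add: algebra_simps)
    then show "2 + (ops (compile (ini_n s)) + 1 + N0 * (ops (Const 1) + ops (arr_addr a (compile (ini_ix s))) +
          ops (compile (ini_v s)) + 1) + (NB + 1) * (?Wb + ops (compile (rounds s)) + 10))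
      \<le> 5 * max_ops * (N0 + (NB + 1) * (Nk + 2) + 2)"
      using W1 W2 os mo by linarith
    have "6 * max_ops * (NB + 4) = (NB + 1) * (6 * max_ops) + 18 * max_ops" by (simp add: algebra_simps)
    then show "2 + (ops (compile (ini_n s)) + ops (Const 1) + ops (arr_addr a (compile (ini_ix s))) +
        ops (compile (ini_v s)) + 2 + (NB + 1) * (?Db + ops (compile (rounds s)) + 10))
      \<le> 6 * max_ops * (NB + 4)"
      using D2 os mo oa[of "compile (ini_ix s)"] by (simp only: ops.simps)
  qed
  moreover have "st nregs (Suc a) (m3, ?r(treg := NB))"
    using P3 fin unfolding P_def st_def by (auto simp: less_Suc_eq)
  ultimately show ?thesis by blast
qed

end

section \<open>Packing bits into the words of the block\<close>

text \<open>Register 11 is the length of the two tables in the block, the registers 31 to 44 are the word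
  addresses of its 13 sections and the end of the block; the bits of section \<open>s\<close> are in array \<open>17 + s\<close>.\<close>

definition size_reg :: "nat \<Rightarrow> nat" where
  "size_reg s = [24, 25, 26, 27, 27, 28, 29, 30, 27, 27, 28, 29, 30] ! s"

lemma ops_arr_addr [simp]: "ops (arr_addr a e) = ops e + 6"
  by (simp add: arr_addr_def)

lemma size_reg_less: "s < 13 \<Longrightarrow> size_reg s < 31"
  by (auto simp: size_reg_def less_Suc_eq numeral_eq_Suc)

text \<open>Round \<open>t\<close> inserts bit \<open>t\<close> into all words of the section at
  once. This takes \<open>w\<close> rounds with one processor per word, so the work is linear in the
  number of bits up to \<open>O(w)\<close>. The guard protects the last, partly filled word.\<close>

definition pack_prog :: "nat \<Rightarrow> com" where
  "pack_prog s = (let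
      k = compile (Var (32 + s) -! Var (31 + s));
      ad = compile (Var (31 + s) +! Var ireg);
      pos = Var ireg *! Var 0 +! Var treg
    in Seq (Assign treg (Const 0)) (Seq (Par ireg k (Const 1) ad (Const 0))
      (for_loop treg (Reg 0) (Par ireg k (compile (pos <! Var (size_reg s))) ad
         (Op BitOr (Load ad) (Op ShiftL (compile (Arr (17 + s) pos)) (Reg treg)))))))"

definition header_prog :: com where
  "header_prog = seqs (map (\<lambda>x. Store (compile (Var 1 +! Num x)) (Reg x)) [0..<nregs])"

text \<open>These tables are copied unpacked, one entry per word, so that a query needs a single
  load for \<open>lg\<close> or \<open>floorlog\<close>.\<close>

definition table_prog :: "aexp \<Rightarrow> nat \<Rightarrow> com" where
  "table_prog b a =
     Par ireg (Reg 11) (Const 1) (compile (Var 1 +! Num 64 +! b +! Var ireg)) (compile (Arr a (Var ireg)))"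

definition block_prog :: com where
  "block_prog = Seq header_prog (Seq (Assign treg (Const 0)) (Seq (table_prog (Num 0) 2)
     (Seq (table_prog (Var 11) 1) (Seq (seqs (map pack_prog [0..<13])) (Assign 0 (Reg 1))))))"

text \<open>Register 44 = 31 + 13 is both the end of the block and the base \<open>tbase\<close> of
  the work arrays. Hence writing the block cannot disturb the arrays it is copied from.\<close>

locale block_builder = builder +
  assumes WA_Suc: "\<And>s. s < 13 \<Longrightarrow> pv (32 + s) = pv (31 + s) + pv (size_reg s) div w + 1"
    and WA_0: "pv 31 = n + 64 + 2 * pv 11"
    and NA_sect: "\<And>s. s < 13 \<Longrightarrow> NA (17 + s) = pv (size_reg s)"
    and FA_bit: "\<And>s x. s < 13 \<Longrightarrow> x < NA (17 + s) \<Longrightarrow> FA (17 + s) x \<le> 1"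
    and NA_tab: "NA 1 = pv 11" "NA 2 = pv 11"
begin

section \<open>Writing header, tables and packed sections\<close>

lemma WA_mono: "s \<le> s' \<Longrightarrow> s' \<le> 13 \<Longrightarrow> pv (31 + s) \<le> pv (31 + s')"
proof (induction s' rule: nat_induct_at_least[of s])
  case (Suc k)
  then show ?case using WA_Suc[of k] by simp
qed auto

lemma WA_lower: "s \<le> 13 \<Longrightarrow> n + 64 + 2 * pv 11 \<le> pv (31 + s)"
  using WA_mono[of 0 s] WA_0 by simp

lemma WA_upper: "s \<le> 13 \<Longrightarrow> pv (31 + s) \<le> pv tbase"
  using WA_mono[of s 13] by simp

lemma st_frame:
  assumes "st X Y (m, r)" "\<And>p. p < n \<or> pv tbase \<le> p \<Longrightarrow> m' p = m p"
  shows "st X Y (m', r)"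
  using assms by (simp add: st_def)

definition hdr :: "nat \<Rightarrow> memory \<Rightarrow> bool" where
  "hdr k m \<longleftrightarrow> (\<forall>x < k. m (n + x) = pv x)"

definition tabs :: "bool \<Rightarrow> bool \<Rightarrow> memory \<Rightarrow> bool" where
  "tabs b1 b2 m \<longleftrightarrow> (b1 \<longrightarrow> (\<forall>x < pv 11. m (n + 64 + x) = FA 2 x)) \<and>
     (b2 \<longrightarrow> (\<forall>x < pv 11. m (n + 64 + pv 11 + x) = FA 1 x))"

definition sects :: "nat \<Rightarrow> memory \<Rightarrow> bool" where
  "sects k m \<longleftrightarrow> (\<forall>s < k. \<forall>x < pv (size_reg s).
     mem_bit w m (pv (31 + s) * w + x) \<longleftrightarrow> FA (17 + s) x = 1)"

lemma models_read:
  assumes st: "st nregs narrs (m, r)" and "i < 2 ^ u" "t < 2 ^ u"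
  shows "models w u (aenv narrs (\<lambda>_. False) (\<lambda>_. 0) i t) m (r(treg := t, ireg := i))"
  by (rule models_aenv[OF st]) (use assms in auto)

lemma eval_read:
  assumes st: "st nregs narrs (m, r)" and "i < 2 ^ u" "t < 2 ^ u" and r: "r treg = t"
    and g: "good u (aenv narrs (\<lambda>_. False) (\<lambda>_. 0) i t) e" and s: "small e"
  shows "eval w m (r(ireg := i)) (compile e) = aeval (aenv narrs (\<lambda>_. False) (\<lambda>_. 0) i t) e"
proof -
  have "r(treg := t, ireg := i) = r(ireg := i)" using r by auto
  then show ?thesis
    using compile_correct[OF models_read[OF st assms(2,3)] g small_w[OF s]] by metis
qed

lemma u_pow: "8 \<le> (2::nat) ^ u" "64 < (2::nat) ^ u"
proof -
  have "(2::nat) ^ 8 \<le> 2 ^ u" using u8 by (intro power_increasing) auto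
  then show "8 \<le> (2::nat) ^ u" "64 < (2::nat) ^ u" by auto
qed

lemma mem_bit_sect:
  assumes "x < pv (size_reg s)" "s < 13"
  shows "pv (31 + s) \<le> (pv (31 + s) * w + x) div w" "(pv (31 + s) * w + x) div w < pv (32 + s)"
proof -
  have "(pv (31 + s) * w + x) div w = pv (31 + s) + x div w" using w_pos by simp
  moreover have "x div w \<le> pv (size_reg s) div w" using assms by (simp add: div_le_mono)
  ultimately show "pv (31 + s) \<le> (pv (31 + s) * w + x) div w" "(pv (31 + s) * w + x) div w < pv (32 + s)"
    using WA_Suc[OF assms(2)] by auto
qed

lemma runs_pack:
  assumes st: "st nregs narrs (m, r)" and s: "s < 13" and sc: "sects s m" and h: "hdr nregs m"
    and tb: "tabs True True m"
  shows "\<exists>m' r'. runs w (pack_prog s) (m, r) (200 * (w + 2) * (pv (size_reg s) div w + 3)) (200 * (w + 2)) (m', r')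
    \<and> st nregs narrs (m', r') \<and> sects (Suc s) m' \<and> hdr nregs m' \<and> tabs True True m'"
proof -
  let ?A = "pv (31 + s)" and ?sz = "pv (size_reg s)"
  define N where "N = pv (size_reg s) div w + 1"
  let ?K = "compile (Var (32 + s) -! Var (31 + s))"
  let ?ad = "compile (Var (31 + s) +! Var ireg)"
  let ?pos = "Var ireg *! Var 0 +! Var treg"
  let ?v = "Op BitOr (Load ?ad) (Op ShiftL (compile (Arr (17 + s) ?pos)) (Reg treg))"
  let ?g = "compile (?pos <! Var (size_reg s))"
  let ?r = "r(treg := 0)"
  have sr: "size_reg s < 31" by (rule size_reg_less[OF s])
  have A': "pv (32 + s) = ?A + N" using WA_Suc[OF s] by (simp add: N_def)
  have Nu: "i < 2 ^ u" if "i < N" for i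
  proof -
    have "N \<le> pv (32 + s)" using A' by simp
    also have "\<dots> < 2 ^ u" using pvu[of "32 + s"] s by simp
    finally show ?thesis using that by simp
  qed
  have wu: "w < 2 ^ u" using pvu[of 0] pv0 by simp
  have regs: "r x = pv x" if "x < nregs" for x using st that by (simp add: st_def)
  have stt: "st nregs narrs (m', r(treg := t))" if "st nregs narrs (m', r)" for m' t
    using that by (auto simp: st_def)
  have K: "eval w m' (r(treg := t)) ?K = N" if "st nregs narrs (m', r)" for m' t
  proof -
    have "models w u (renv nregs) m' (r(treg := t))" by (rule models_renv[OF stt[OF that] order_refl])
    moreover have "good u (renv nregs) (Var (32 + s) -! Var (31 + s))" using s by (simp add: renv_def)
    moreover have "small (Var (32 + s) -! Var (31 + s))" by (simp add: small_def max_deg_def max_ops_def)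
    ultimately have "eval w m' (r(treg := t)) ?K = aeval (renv nregs) (Var (32 + s) -! Var (31 + s))"
      using compile_correct small_w by blast
    then show ?thesis using A' by (simp add: renv_def)
  qed
  have ad: "eval w m' (r(treg := t, ireg := i)) ?ad = ?A + i"
    if "st nregs narrs (m', r)" "i < N" "t < 2 ^ u" for m' i t
    using eval_read[OF stt[OF that(1), of t] Nu[OF that(2)] that(3), of "Var (31 + s) +! Var ireg"] s
    by (simp add: small_def max_deg_def max_ops_def aenv_def)
  have gd: "eval w m' (r(treg := t, ireg := i)) ?g = of_bool (i * w + t < ?sz)"
    if "st nregs narrs (m', r)" "i < N" "t < 2 ^ u" for m' i t
    using eval_read[OF stt[OF that(1), of t] Nu[OF that(2)] that(3), of "?pos <! Var (size_reg s)"] s sr pv0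
    by (simp add: small_def max_deg_def max_ops_def aenv_def)
  have vl: "eval w m' (r(treg := t, ireg := i)) (compile (Arr (17 + s) ?pos)) = FA (17 + s) (i * w + t)"
    if "st nregs narrs (m', r)" "i < N" "t < 2 ^ u" "i * w + t < ?sz" for m' i t
    using eval_read[OF stt[OF that(1), of t] Nu[OF that(2)] that(3), of "Arr (17 + s) ?pos"] s sr that(4) pv0 NA_sect[OF s]
    by (simp add: small_def max_deg_def max_ops_def aenv_def)
  have "\<exists>m'. runs w (Par ireg ?K (Const 1) ?ad (Const 0)) (m, ?r)
      (ops ?K + 1 + N * (ops (Const 1) + ops ?ad + ops (Const 0) + 1))
      (ops ?K + ops (Const 1) + ops ?ad + ops (Const 0) + 2) (m', ?r) \<and>
      (\<forall>i < N. True \<longrightarrow> m' (?A + i) = 0) \<and> (\<forall>p. (\<forall>i < N. True \<longrightarrow> ?A + i \<noteq> p) \<longrightarrow> m' p = m p)"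
  proof (rule runs_Par)
    fix i assume "i < N"
    then show "eval w m (?r(ireg := i)) ?ad = ?A + i" using ad[OF st, of i 0] by simp
  qed (use K[OF st] w_pos in \<open>auto simp: inj_on_def\<close>)
  then obtain m1 where m1: "runs w (Par ireg ?K (Const 1) ?ad (Const 0)) (m, ?r)
      (ops ?K + 1 + N * (ops (Const 1) + ops ?ad + ops (Const 0) + 1))
      (ops ?K + ops (Const 1) + ops ?ad + ops (Const 0) + 2) (m1, ?r)"
    and m1v: "\<And>i. i < N \<Longrightarrow> m1 (?A + i) = 0"
    and m1f: "\<And>p. (\<And>i. i < N \<Longrightarrow> ?A + i \<noteq> p) \<Longrightarrow> m1 p = m p" by auto
  define Q where "Q t m' \<longleftrightarrow> (\<forall>p. p < ?A \<or> ?A + N \<le> p \<longrightarrow> m' p = m p) \<and>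
      (\<forall>i < N. \<forall>j. bit (m' (?A + i)) j \<longleftrightarrow> j < t \<and> i * w + j < ?sz \<and> FA (17 + s) (i * w + j) = 1)"
    for t m'
  have Qst: "st nregs narrs (m', r)" if "Q t m'" for t m'
  proof (rule st_frame[OF st])
    fix p assume "p < n \<or> pv tbase \<le> p"
    then have "p < ?A \<or> ?A + N \<le> p"
      using WA_lower[of s] WA_upper[of "Suc s"] s A' by auto
    then show "m' p = m p" using that unfolding Q_def by blast
  qed
  have Q0: "Q 0 m1" using m1v m1f unfolding Q_def by auto
  let ?body = "Par ireg ?K ?g ?ad ?v"
  let ?Wb = "ops ?K + 1 + N * (ops ?g + ops ?ad + ops ?v + 1)"
  let ?Db = "ops ?K + ops ?g + ops ?ad + ops ?v + 2"
  have "\<exists>m'. runs w (for_loop treg (Reg 0) ?body) (m1, ?r)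
      ((w + 1) * (?Wb + ops (Reg 0) + 10)) ((w + 1) * (?Db + ops (Reg 0) + 10)) (m', ?r(treg := w)) \<and> Q w m'"
  proof (rule runs_for_loop)
    show "w < 2 ^ w" by (rule less_exp)
    show "Q 0 m1" by (rule Q0)
    show "eval w m' (?r(treg := j)) (Reg 0) = w" for j m' using regs[of 0] pv0 by simp
  next
    fix t m' assume t: "t < w" and q: "Q t m'"
    note st' = Qst[OF q]
    have tu: "t < 2 ^ u" using t wu by simp
    have FA1: "FA (17 + s) (i * w + t) \<le> 1" if "i * w + t < ?sz" for i
      using FA_bit[OF s] NA_sect[OF s] that by simp
    have "\<exists>m''. runs w ?body (m', r(treg := t)) ?Wb ?Db (m'', r(treg := t)) \<and>
      (\<forall>i < N. i * w + t < ?sz \<longrightarrow> m'' (?A + i) = or (m' (?A + i)) (push_bit t (FA (17 + s) (i * w + t)))) \<and>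
      (\<forall>p. (\<forall>i < N. i * w + t < ?sz \<longrightarrow> ?A + i \<noteq> p) \<longrightarrow> m'' p = m' p)"
    proof (rule runs_Par)
      show "eval w m' (r(treg := t)) ?K = N" by (rule K[OF st'])
      show "inj_on (\<lambda>i. ?A + i) {i. i < N \<and> i * w + t < ?sz}" by (auto simp: inj_on_def)
    next
      fix i assume i: "i < N"
      show "(eval w m' (r(treg := t, ireg := i)) ?g \<noteq> 0) = (i * w + t < ?sz)"
        using gd[OF st' i tu] by simp
      show "eval w m' (r(treg := t, ireg := i)) ?ad = ?A + i" by (rule ad[OF st' i tu])
      assume sz: "i * w + t < ?sz"
      have "push_bit t (FA (17 + s) (i * w + t)) \<le> 2 ^ t"
        using FA1[OF sz] by (simp add: push_bit_eq_mult)
      also have "\<dots> < 2 ^ w" using t by simp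
      finally have "take_bit w (push_bit t (FA (17 + s) (i * w + t))) = push_bit t (FA (17 + s) (i * w + t))"
        by (rule take_bit_nat_eq_self)
      then show "eval w m' (r(treg := t, ireg := i)) ?v
          = or (m' (?A + i)) (push_bit t (FA (17 + s) (i * w + t)))"
        using ad[OF st' i tu] vl[OF st' i tu sz] by (simp only: eval.simps apply_op.simps fun_upd_apply) simp
    qed
    then obtain m2 where m2: "runs w ?body (m', r(treg := t)) ?Wb ?Db (m2, r(treg := t))"
      and m2v: "\<And>i. i < N \<Longrightarrow> i * w + t < ?sz \<Longrightarrow> m2 (?A + i) = or (m' (?A + i)) (push_bit t (FA (17 + s) (i * w + t)))"
      and m2f: "\<And>p. (\<And>i. i < N \<Longrightarrow> i * w + t < ?sz \<Longrightarrow> ?A + i \<noteq> p) \<Longrightarrow> m2 p = m' p" by auto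
    have "Q (Suc t) m2"
      unfolding Q_def
    proof (intro conjI allI impI)
      fix p assume p: "p < ?A \<or> ?A + N \<le> p"
      then have "m2 p = m' p" by (intro m2f) auto
      then show "m2 p = m p" using q p unfolding Q_def by simp
    next
      fix i j assume i: "i < N"
      have qi: "bit (m' (?A + i)) j \<longleftrightarrow> j < t \<and> i * w + j < ?sz \<and> FA (17 + s) (i * w + j) = 1"
        using q i unfolding Q_def by blast
      show "bit (m2 (?A + i)) j \<longleftrightarrow> j < Suc t \<and> i * w + j < ?sz \<and> FA (17 + s) (i * w + j) = 1"
      proof (cases "i * w + t < ?sz")
        case True
        have "FA (17 + s) (i * w + t) = 0 \<or> FA (17 + s) (i * w + t) = 1" using FA1[OF True] by linarith
        moreover have "bit (push_bit t (1::nat)) j \<longleftrightarrow> j = t"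
          by (auto simp: bit_exp_iff)
        ultimately have "bit (push_bit t (FA (17 + s) (i * w + t))) j \<longleftrightarrow> j = t \<and> FA (17 + s) (i * w + t) = 1"
          by auto
        then show ?thesis using m2v[OF i True] qi True by (auto simp: bit_or_iff less_Suc_eq)
      next
        case False
        have "m2 (?A + i) = m' (?A + i)"
          by (rule m2f) (use False in auto)
        then show ?thesis using qi False by (auto simp: less_Suc_eq)
      qed
    qed
    with m2 show "\<exists>m''. runs w ?body (m', ?r(treg := t)) ?Wb ?Db (m'', ?r(treg := t)) \<and> Q (Suc t) m''"
      unfolding fun_upd_upd by blast
  qed
  then obtain m3 where m3: "runs w (for_loop treg (Reg 0) ?body) (m1, ?r)
      ((w + 1) * (?Wb + ops (Reg 0) + 10)) ((w + 1) * (?Db + ops (Reg 0) + 10)) (m3, ?r(treg := w))"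
    and Q3: "Q w m3" by blast
  note R = runs_Seq[OF runs_Assign_0 runs_Seq[OF m1 m3]]
  have oK: "ops ?K = 7" "ops ?ad = 3" "ops ?g = 7" "ops ?v = 19"
    by (simp_all add: arr_addr_def)
  have "N + 2 = pv (size_reg s) div w + 3" by (simp add: N_def)
  moreover have "runs w (pack_prog s) (m, r) (200 * (w + 2) * (N + 2)) (200 * (w + 2)) (m3, ?r(treg := w))"
    unfolding pack_prog_def Let_def
    by (rule runs_mono[OF R]) (simp_all only: oK ops.simps, simp_all add: algebra_simps)
  ultimately have "runs w (pack_prog s) (m, r) (200 * (w + 2) * (pv (size_reg s) div w + 3)) (200 * (w + 2))
    (m3, ?r(treg := w))" by (simp only:)
  moreover have "st nregs narrs (m3, ?r(treg := w))" using stt[OF Qst[OF Q3]] by simp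
  moreover have "m3 p = m p" if "p < ?A" for p using Q3 that unfolding Q_def by blast
  note low3 = this
  have lowA: "n + 64 + 2 * pv 11 \<le> ?A" using WA_lower[of s] s by simp
  have "hdr nregs m3" using h low3 lowA by (simp add: hdr_def)
  moreover have "tabs True True m3" using tb low3 lowA by (simp add: tabs_def)
  moreover have "sects (Suc s) m3"
    unfolding sects_def
  proof (intro allI impI)
    fix s' x assume s': "s' < Suc s" and x: "x < pv (size_reg s')"
    show "mem_bit w m3 (pv (31 + s') * w + x) \<longleftrightarrow> FA (17 + s') x = 1"
    proof (cases "s' = s")
      case True
      have d: "(?A * w + x) div w = ?A + x div w" "(?A * w + x) mod w = x mod w" using w_pos by simp_all
      have "x div w < N" unfolding N_def using x True by (simp add: div_le_mono less_Suc_eq_le)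
      then have "bit (m3 (?A + x div w)) (x mod w) \<longleftrightarrow> x mod w < w \<and> x div w * w + x mod w < ?sz \<and>
          FA (17 + s) (x div w * w + x mod w) = 1"
        using Q3 unfolding Q_def by blast
      then show ?thesis unfolding mem_bit_def True d using x True w_pos by simp
    next
      case False
      then have lt: "s' < s" using s' by simp
      have "(pv (31 + s') * w + x) div w < pv (32 + s')" using mem_bit_sect[OF x] lt s by simp
      also have "pv (32 + s') \<le> ?A" using WA_mono[of "Suc s'" s] lt s by simp
      finally have "m3 ((pv (31 + s') * w + x) div w) = m ((pv (31 + s') * w + x) div w)" by (rule low3)
      then show ?thesis using sc lt x unfolding sects_def mem_bit_def by simp
    qed
  qed
  ultimately show ?thesis by blast
qed

lemma runs_header:
  assumes st: "st nregs narrs (m, r)"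
  shows "\<exists>m'. runs w header_prog (m, r) 300 300 (m', r) \<and> st nregs narrs (m', r) \<and> hdr nregs m'"
proof -
  let ?cs = "map (\<lambda>x. Store (compile (Var 1 +! Num x)) (Reg x)) [0..<nregs]"
  define P where "P k s \<longleftrightarrow> snd s = r \<and> st nregs narrs (fst s, r) \<and> hdr k (fst s)" for k s
  have "\<exists>s'. runs w (seqs ?cs) (m, r) (1 + (\<Sum>j = 0..<0 + length ?cs. 5)) (1 + (\<Sum>j = 0..<0 + length ?cs. 5)) s' \<and>
      P (0 + length ?cs) s'"
  proof (rule runs_seqs)
    show "P 0 (m, r)" using st by (simp add: P_def hdr_def)
  next
    fix j s assume "j < length ?cs" "P (0 + j) s"
    then have j: "j < nregs" and s: "s = (fst s, r)" and S: "st nregs narrs (fst s, r)" and H: "hdr j (fst s)"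
      by (auto simp: P_def)
    have M: "models w u (renv nregs) (fst s) r" by (rule models_renv[OF S order_refl])
    have ju: "j < 2 ^ u" using j u_pow by simp
    have "eval w (fst s) r (compile (Var 1 +! Num j)) = aeval (renv nregs) (Var 1 +! Num j)"
      using compile_correct[OF M _ small_w, of "Var 1 +! Num j"] ju
      by (simp add: small_def max_deg_def max_ops_def renv_def)
    then have "eval w (fst s) r (compile (Var 1 +! Num j)) = n + j" using pv1 by (simp add: renv_def)
    moreover have "eval w (fst s) r (Reg j) = pv j" using S j by (simp add: st_def)
    ultimately have "runs w (Store (compile (Var 1 +! Num j)) (Reg j)) (fst s, r) 5 5 ((fst s)(n + j := pv j), r)"
      by (rule runs_mono[OF runs_Store]) auto
    moreover have "st nregs narrs ((fst s)(n + j := pv j), r)"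
      by (rule st_frame[OF S]) (use j WA_lower[of 13] in auto)
    ultimately show "\<exists>s'. runs w (?cs ! j) s 5 5 s' \<and> P (Suc (0 + j)) s'"
      using s j H by (intro exI[of _ "((fst s)(n + j := pv j), r)"]) (auto simp: P_def hdr_def less_Suc_eq)
  qed
  then obtain s' where "runs w (seqs ?cs) (m, r) (1 + (\<Sum>j = 0..<0 + length ?cs. 5)) (1 + (\<Sum>j = 0..<0 + length ?cs. 5)) s'"
    "P nregs s'" by auto
  moreover from this have "s' = (fst s', r)" by (auto simp: P_def)
  ultimately have R: "runs w (seqs ?cs) (m, r) (1 + (\<Sum>j = 0..<0 + length ?cs. 5)) (1 + (\<Sum>j = 0..<0 + length ?cs. 5))
    (fst s', r)" and P: "P nregs s'" by auto
  have "runs w header_prog (m, r) 300 300 (fst s', r)"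
    unfolding header_prog_def by (rule runs_mono[OF R]) simp_all
  with P show ?thesis by (auto simp: P_def)
qed

lemma runs_table:
  assumes st: "st nregs narrs (m, r)" and t: "r treg = 0" and a: "a < narrs" "NA a = pv 11"
    and b: "good u (renv nregs) b" "aeval (renv nregs) b = off" "b = Num 0 \<or> b = Var 11"
  shows "\<exists>m'. runs w (table_prog b a) (m, r) (30 * (pv 11 + 1)) 40 (m', r) \<and>
    (\<forall>x < pv 11. m' (n + 64 + off + x) = FA a x) \<and>
    (\<forall>p. p < n + 64 + off \<or> n + 64 + off + pv 11 \<le> p \<longrightarrow> m' p = m p)"
proof -
  let ?ad = "compile (Var 1 +! Num 64 +! b +! Var ireg)" and ?v = "compile (Arr a (Var ireg))"
  have iu: "i < 2 ^ u" if "i < pv 11" for i using that pvu[of 11] by simp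
  have "\<exists>m'. runs w (Par ireg (Reg 11) (Const 1) ?ad ?v) (m, r)
      (ops (Reg 11) + 1 + pv 11 * (ops (Const 1) + ops ?ad + ops ?v + 1))
      (ops (Reg 11) + ops (Const 1) + ops ?ad + ops ?v + 2) (m', r) \<and>
      (\<forall>i < pv 11. True \<longrightarrow> m' (n + 64 + off + i) = FA a i) \<and>
      (\<forall>p. (\<forall>i < pv 11. True \<longrightarrow> n + 64 + off + i \<noteq> p) \<longrightarrow> m' p = m p)"
  proof (rule runs_Par)
    fix i assume i: "i < pv 11"
    show "eval w m (r(ireg := i)) ?ad = n + 64 + off + i"
      using eval_read[OF st iu[OF i] _ t, of "Var 1 +! Num 64 +! b +! Var ireg"] b pv1 u_pow
      by (auto simp: small_def max_deg_def max_ops_def aenv_def renv_def)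
    show "eval w m (r(ireg := i)) ?v = FA a i"
      using eval_read[OF st iu[OF i] _ t, of "Arr a (Var ireg)"] a i
      by (simp add: small_def max_deg_def max_ops_def aenv_def)
  qed (use st w_pos in \<open>auto simp: inj_on_def st_def\<close>)
  then obtain m' where m': "runs w (Par ireg (Reg 11) (Const 1) ?ad ?v) (m, r)
      (ops (Reg 11) + 1 + pv 11 * (ops (Const 1) + ops ?ad + ops ?v + 1))
      (ops (Reg 11) + ops (Const 1) + ops ?ad + ops ?v + 2) (m', r)"
    "\<And>i. i < pv 11 \<Longrightarrow> m' (n + 64 + off + i) = FA a i"
    "\<And>p. (\<And>i. i < pv 11 \<Longrightarrow> n + 64 + off + i \<noteq> p) \<Longrightarrow> m' p = m p" by auto
  have "ops ?ad = 7" "ops ?v = 8" using b(3) by auto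
  then have "runs w (table_prog b a) (m, r) (30 * (pv 11 + 1)) 40 (m', r)"
    unfolding table_prog_def by (intro runs_mono[OF m'(1)]) auto
  moreover have "m' p = m p" if "p < n + 64 + off \<or> n + 64 + off + pv 11 \<le> p" for p
    by (rule m'(3)) (use that in auto)
  ultimately show ?thesis using m'(2) by blast
qed

lemma runs_block:
  assumes st: "st nregs narrs (m, r)"
  shows "\<exists>m' r'. runs w block_prog (m, r)
      (500 + 60 * (pv 11 + 1) + (\<Sum>s < 13. 200 * (w + 2) * (pv (size_reg s) div w + 3)))
      (500 + 2600 * (w + 2)) (m', r') \<and> r' 0 = n \<and> (\<forall>p < n. m' p = m0 p) \<and>
      hdr nregs m' \<and> tabs True True m' \<and> sects 13 m'"
proof -
  obtain m1 where m1: "runs w header_prog (m, r) 300 300 (m1, r)" and s1: "st nregs narrs (m1, r)"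
    and h1: "hdr nregs m1" using runs_header[OF st] by blast
  let ?r = "r(treg := 0)"
  have s1': "st nregs narrs (m1, ?r)" using s1 by (auto simp: st_def)
  have low: "n + 64 + 2 * pv 11 \<le> pv tbase" using WA_lower[of 13] by simp
  obtain m2 where m2: "runs w (table_prog (Num 0) 2) (m1, ?r) (30 * (pv 11 + 1)) 40 (m2, ?r)"
    and m2v: "\<And>x. x < pv 11 \<Longrightarrow> m2 (n + 64 + x) = FA 2 x"
    and m2f: "\<And>p. p < n + 64 \<or> n + 64 + pv 11 \<le> p \<Longrightarrow> m2 p = m1 p"
    using runs_table[OF s1', of 2 "Num 0" 0] NA_tab by (auto simp: renv_def)
  have s2: "st nregs narrs (m2, ?r)" by (rule st_frame[OF s1']) (use m2f low in auto)
  obtain m3 where m3: "runs w (table_prog (Var 11) 1) (m2, ?r) (30 * (pv 11 + 1)) 40 (m3, ?r)"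
    and m3v: "\<And>x. x < pv 11 \<Longrightarrow> m3 (n + 64 + pv 11 + x) = FA 1 x"
    and m3f: "\<And>p. p < n + 64 + pv 11 \<or> n + 64 + pv 11 + pv 11 \<le> p \<Longrightarrow> m3 p = m2 p"
    using runs_table[OF s2, of 1 "Var 11" "pv 11"] NA_tab by (auto simp: renv_def)
  have s3: "st nregs narrs (m3, ?r)" by (rule st_frame[OF s2]) (use m3f low in auto)
  have t3: "tabs True True m3" using m3v m3f m2v by (simp add: tabs_def)
  have h3: "hdr nregs m3" using h1 m2f m3f by (simp add: hdr_def)
  define P where "P k s \<longleftrightarrow> st nregs narrs s \<and> sects k (fst s) \<and> hdr nregs (fst s) \<and> tabs True True (fst s)"
    for k s
  let ?cs = "map pack_prog [0..<13]"
  have "\<exists>s'. runs w (seqs ?cs) (m3, ?r)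
      (1 + (\<Sum>j = 0..<0 + length ?cs. 200 * (w + 2) * (pv (size_reg j) div w + 3)))
      (1 + (\<Sum>j = 0..<0 + length ?cs. 200 * (w + 2))) s' \<and> P (0 + length ?cs) s'"
  proof (rule runs_seqs)
    show "P 0 (m3, ?r)" using s3 t3 h3 by (simp add: P_def sects_def)
  next
    fix j and s :: "memory \<times> regs" assume j: "j < length ?cs" and P: "P (0 + j) s"
    obtain m' r' where s: "s = (m', r')" by (cases s)
    show "\<exists>s'. runs w (?cs ! j) s (200 * (w + 2) * (pv (size_reg (0 + j)) div w + 3)) (200 * (w + 2)) s' \<and>
        P (Suc (0 + j)) s'"
      using runs_pack[of m' r' j] j P unfolding s P_def by fastforce
  qed
  then obtain m4 r4 where m4: "runs w (seqs ?cs) (m3, ?r)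
      (1 + (\<Sum>j = 0..<0 + length ?cs. 200 * (w + 2) * (pv (size_reg j) div w + 3)))
      (1 + (\<Sum>j = 0..<0 + length ?cs. 200 * (w + 2))) (m4, r4)" and P4: "P 13 (m4, r4)" by auto
  have "r4 1 = n" using P4 pv1 by (simp add: P_def st_def)
  then have "runs w (Assign 0 (Reg 1)) (m4, r4) (ops (Reg 1) + 1) (ops (Reg 1) + 1) (m4, r4(0 := n))"
    by (intro runs_Assign) simp
  note R = runs_Seq[OF m1 runs_Seq[OF runs_Assign_0 runs_Seq[OF m2 runs_Seq[OF m3 runs_Seq[OF m4 this]]]]]
  have "runs w block_prog (m, r)
      (500 + 60 * (pv 11 + 1) + (\<Sum>s < 13. 200 * (w + 2) * (pv (size_reg s) div w + 3)))
      (500 + 2600 * (w + 2)) (m4, r4(0 := n))"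
    unfolding block_prog_def by (rule runs_mono[OF R]) (auto simp: lessThan_atLeast0)
  then show ?thesis using P4 by (intro exI[of _ m4] exI[of _ "r4(0 := n)"]) (auto simp: P_def st_def)
qed

end

section \<open>Rank, select and the pieces of a sequence\<close>

text \<open>Counting over the first \<open>i\<close> positions, excluding position \<open>i\<close>
  itself, avoids the off-by-one of the inclusive \<open>rank\<close> and makes counts over adjacent
  stretches add up.\<close>

definition occ :: "bool \<Rightarrow> bool list \<Rightarrow> nat \<Rightarrow> nat" where
  "occ c S i = count_list (take i S) c"

lemma occ_card: "occ c S i = card {j. j < i \<and> j < length S \<and> S ! j = c}"
proof -
  have "occ c S i = card {j. j < length (take i S) \<and> c = take i S ! j}"
    by (simp add: occ_def count_list_eq_length_filter length_filter_conv_card)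
  also have "{j. j < length (take i S) \<and> c = take i S ! j} = {j. j < i \<and> j < length S \<and> S ! j = c}" by auto
  finally show ?thesis .
qed

lemma rank_eq_occ: "rank c S i = occ c S (i + 1)"
  by (simp add: rank_def occ_card less_Suc_eq_le)

lemma occ_0 [simp]: "occ c S 0 = 0"
  by (simp add: occ_def)

lemma occ_Suc: "i < length S \<Longrightarrow> occ c S (Suc i) = occ c S i + of_bool (S ! i = c)"
  by (simp add: occ_def take_Suc_conv_app_nth)

lemma occ_ge: "length S \<le> i \<Longrightarrow> occ c S i = count_list S c"
  by (simp add: occ_def)

lemma occ_mono: "i \<le> j \<Longrightarrow> occ c S i \<le> occ c S j"
  by (auto simp: occ_card intro!: card_mono)

lemma occ_le_count: "occ c S i \<le> count_list S c"
  using occ_mono[of i "max i (length S)" c S] occ_ge[of S "max i (length S)" c] by simp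

lemma occ_le: "occ c S i \<le> i"
proof -
  have "occ c S i \<le> card {..<i}" unfolding occ_card by (rule card_mono) auto
  then show ?thesis by simp
qed

lemma occ_diff_le: "a \<le> b \<Longrightarrow> occ c S b - occ c S a \<le> b - a"
proof -
  assume "a \<le> b"
  have "occ c S b \<le> card ({j. j < a \<and> j < length S \<and> S ! j = c} \<union> {a..<b})"
    unfolding occ_card by (rule card_mono) auto
  also have "\<dots> \<le> occ c S a + card {a..<b}" unfolding occ_card by (rule card_Un_le)
  finally show ?thesis by simp
qed

lemma count_le_length': "count_list S c \<le> length S"
  by (rule count_le_length)

lemma occ_False: "i \<le> length S \<Longrightarrow> occ False S i = i - occ True S i"
proof (induction i)
  case (Suc i)
  then show ?case using occ_Suc[of i S] occ_le[of True S i] by (cases "S ! i") auto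
qed simp

text \<open>The list of all occurrences splits at \<open>p\<close>, and exactly
  \<open>occ c S p\<close> of its members come before.\<close>

lemma select_unique:
  assumes "p < length S" "S ! p = c"
  shows "select c S (occ c S p + 1) = p"
proof -
  let ?Q = "\<lambda>q. S ! q = c"
  have "[0..<length S] = [0..<p] @ p # [Suc p..<length S]"
    using assms(1) by (metis le_add1 le_add_same_cancel1 less_imp_le_nat upt_add_eq_append upt_conv_Cons zero_le le_add_diff_inverse)
  then have "filter ?Q [0..<length S] = filter ?Q [0..<p] @ p # filter ?Q [Suc p..<length S]"
    using assms(2) by simp
  moreover have "length (filter ?Q [0..<p]) = occ c S p"
  proof -
    have "length (filter ?Q [0..<p]) = card {i. i < p \<and> S ! i = c}"
      by (auto simp: length_filter_conv_card intro!: arg_cong[where f = card])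
    also have "{i. i < p \<and> S ! i = c} = {j. j < p \<and> j < length S \<and> S ! j = c}" using assms(1) by auto
    finally show ?thesis by (simp add: occ_card)
  qed
  ultimately show ?thesis by (simp add: select_def nth_append)
qed

text \<open>The selected position is an occurrence, so by \<open>select_unique\<close> it also
  stands at index \<open>occ c S\<close> of itself. The list of occurrences is distinct, so this
  index equals \<open>i - 1\<close>.\<close>

lemma
  assumes "1 \<le> i" "i \<le> count_list S c"
  shows select_less: "select c S i < length S" and nth_select: "S ! select c S i = c"
    and occ_select: "occ c S (select c S i) = i - 1"
proof -
  let ?P = "filter (\<lambda>p. S ! p = c) [0..<length S]"
  have len: "length ?P = count_list S c"
  proof -
    have "length ?P = card {i. i < length S \<and> S ! i = c}"
      by (auto simp: length_filter_conv_card intro!: arg_cong[where f = card])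
    also have "\<dots> = occ c S (length S)" by (simp add: occ_card)
    finally show ?thesis by (simp add: occ_ge)
  qed
  have "select c S i \<in> set ?P" unfolding select_def by (rule nth_mem) (use len assms in simp)
  then show p: "select c S i < length S" "S ! select c S i = c" by simp_all
  let ?p = "select c S i"
  have "?P ! (occ c S ?p) = ?P ! (i - 1)"
    using select_unique[OF p] by (simp add: select_def)
  moreover have "occ c S ?p < length ?P"
    using occ_Suc[OF p(1), of c] p(2) occ_le_count[of c S "Suc ?p"] len by simp
  ultimately show "occ c S ?p = i - 1"
    using nth_eq_iff_index_eq[of ?P "occ c S ?p" "i - 1"] len assms by simp
qed

section \<open>Cuts and their relation to prefix counts\<close>

lemma cut_0 [simp]: "cut c S 0 = 0"
  by (simp add: cut_def)

lemma cut_le_length: "cut c S j \<le> length S"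
  using select_less[of j S c] by (auto simp: cut_def)

lemma cut_gt: "count_list S c < j \<Longrightarrow> cut c S j = length S"
  by (auto simp: cut_def)

lemma cut_select: "1 \<le> i \<Longrightarrow> i \<le> count_list S c \<Longrightarrow> cut c S i = select c S i + 1"
  by (simp add: cut_def)

text \<open>A Galois connection between cuts and prefix counts. It yields the monotonicity of cuts
  and, later, the range that owns a given position. The restriction on \<open>y\<close> matters
  because all cuts beyond the last occurrence collapse to \<open>length S\<close>.\<close>

lemma cut_le_iff:
  assumes "y < length S"
  shows "cut c S j \<le> y \<longleftrightarrow> j \<le> occ c S y"
proof -
  consider "j = 0" | "1 \<le> j" "j \<le> count_list S c" | "count_list S c < j" by linarith
  then show ?thesis
  proof cases
    case 2
    note sel = select_less[OF 2] nth_select[OF 2] occ_select[OF 2]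
    have "select c S j < y \<longleftrightarrow> j \<le> occ c S y"
    proof
      assume "select c S j < y"
      then have "occ c S (Suc (select c S j)) \<le> occ c S y" by (intro occ_mono) simp
      then show "j \<le> occ c S y" using occ_Suc[OF sel(1), of c] sel 2 by simp
    next
      assume j: "j \<le> occ c S y"
      show "select c S j < y"
      proof (rule ccontr)
        assume "\<not> select c S j < y"
        then have "occ c S y \<le> occ c S (select c S j)" by (intro occ_mono) simp
        then show False using j sel 2 by simp
      qed
    qed
    then show ?thesis using cut_select[OF 2] by (simp add: Suc_le_eq)
  next
    case 3
    then show ?thesis using cut_gt[OF 3] occ_le_count[of c S y] assms by simp
  qed simp
qed

lemma cut_mono: "i \<le> j \<Longrightarrow> cut c S i \<le> cut c S j"
proof (rule ccontr)
  assume ij: "i \<le> j" and n: "\<not> cut c S i \<le> cut c S j"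
  then have l: "cut c S j < length S" using cut_le_length[of c S i] by simp
  have "j \<le> occ c S (cut c S j)" using cut_le_iff[OF l, of c j] by simp
  then show False using cut_le_iff[OF l, of c i] ij n by simp
qed

lemma occ_cut: "occ c S (cut c S j) = min j (count_list S c)"
proof -
  consider "j = 0" | "1 \<le> j" "j \<le> count_list S c" | "count_list S c < j" by linarith
  then show ?thesis
  proof cases
    case 2
    then show ?thesis using occ_Suc[OF select_less[OF 2], of c] nth_select[OF 2] occ_select[OF 2]
      by (simp add: cut_select)
  qed (simp_all add: cut_gt occ_ge)
qed

lemma cut_less: "i < j \<Longrightarrow> i < count_list S c \<Longrightarrow> cut c S i < cut c S j"
  using occ_cut[of c S i] occ_cut[of c S j] cut_mono[of i j c S] by (cases "cut c S i = cut c S j") auto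

lemma select_eq_cut: "1 \<le> i \<Longrightarrow> i \<le> count_list S c \<Longrightarrow> select c S i = cut c S i - 1"
  by (simp add: cut_select)

text \<open>The part of \<open>S\<close> that contains its occurrences \<open>J + 1, \<dots>, J'\<close> of \<open>c\<close>.\<close>

definition range_of :: "bool \<Rightarrow> bool list \<Rightarrow> nat \<Rightarrow> nat \<Rightarrow> bool list" where
  "range_of c S J J' = drop (cut c S J) (take (cut c S J') S)"

lemma piece_range: "piece c K S k = range_of c S (k * K) ((k + 1) * K)"
  by (simp add: piece_def range_of_def)

lemma length_range: "length (range_of c S J J') = cut c S J' - cut c S J"
  using cut_le_length[of c S J'] by (simp add: range_of_def)

lemma occ_drop_take:
  assumes "a \<le> b" "b \<le> length S"
  shows "occ c (drop a (take b S)) i = occ c S (min (a + i) b) - occ c S a"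
proof -
  have t: "take (min (a + i) b) S = take a S @ take i (drop a (take b S))"
  proof -
    have "take i (drop a (take b S)) = drop a (take (min (a + i) b) S)"
      by (simp add: take_drop min.commute add.commute)
    moreover have "take a S = take a (take (min (a + i) b) S)" using assms by (simp add: min_def)
    ultimately show ?thesis by (metis append_take_drop_id)
  qed
  show ?thesis unfolding occ_def t by simp
qed

context
  fixes c :: bool and S :: "bool list" and J J' :: nat
  assumes JJ: "J \<le> J'" and Jc: "J \<le> count_list S c"
begin

lemma occ_range: "occ c (range_of c S J J') i = occ c S (min (cut c S J + i) (cut c S J')) - J"
  unfolding range_of_def
  using occ_drop_take[OF cut_mono[OF JJ] cut_le_length] Jc by (simp add: occ_cut)

lemma count_range: "count_list (range_of c S J J') c = min J' (count_list S c) - J"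
proof -
  have "count_list (range_of c S J J') c = occ c (range_of c S J J') (length (range_of c S J J'))"
    by (simp add: occ_ge)
  also have "\<dots> = occ c S (cut c S J') - J"
    using occ_range cut_mono[OF JJ, of c S] by (simp add: length_range)
  finally show ?thesis by (simp add: occ_cut)
qed

lemma select_range:
  assumes i: "1 \<le> i" "i \<le> count_list (range_of c S J J') c"
  shows "select c (range_of c S J J') i = select c S (J + i) - cut c S J"
    and "cut c S J \<le> select c S (J + i)"
proof -
  let ?R = "range_of c S J J'" and ?p = "select c S (J + i)" and ?a = "cut c S J"
  have Ji: "1 \<le> J + i" "J + i \<le> count_list S c" "J + i \<le> J'" using i count_range by auto
  note sel = select_less[OF Ji(1,2)] nth_select[OF Ji(1,2)] occ_select[OF Ji(1,2)]
  have a: "?a \<le> ?p" using cut_le_iff[OF sel(1), of c J] sel(3) i by simp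
  have b: "?p < cut c S J'" using cut_mono[OF Ji(3), of c S] cut_select[OF Ji(1,2)] by simp
  have l: "?p - ?a < length ?R" using a b by (simp add: length_range)
  have "?R ! (?p - ?a) = c" using a b sel cut_le_length[of c S J'] by (simp add: range_of_def)
  from select_unique[OF l this] have "select c ?R (occ c ?R (?p - ?a) + 1) = ?p - ?a" .
  moreover have "occ c ?R (?p - ?a) = i - 1"
    using occ_range a b sel(3) i by simp
  ultimately show "select c ?R i = ?p - ?a" using i by simp
  show "?a \<le> ?p" by (rule a)
qed

text \<open>Because of this, whatever is stored relative to a range can be read off the one array of
  cuts of \<open>S\<close>. The cap \<open>J'\<close> also handles an incomplete last range: when
  the occurrences run out, both sides are the end of the range.\<close>

lemma cut_range: "cut c S J + cut c (range_of c S J J') i = cut c S (min (J + i) J')"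
proof -
  have m: "cut c S J \<le> cut c S J'" by (rule cut_mono[OF JJ])
  consider "i = 0" | "1 \<le> i" "i \<le> count_list (range_of c S J J') c"
    | "count_list (range_of c S J J') c < i" by linarith
  then show ?thesis
  proof cases
    case 1 then show ?thesis using JJ by simp
  next
    case 2
    have Ji: "1 \<le> J + i" "J + i \<le> count_list S c" "J + i \<le> J'" using 2 count_range by auto
    show ?thesis using select_range[OF 2] cut_select[OF 2] cut_select[OF Ji(1,2)] Ji by simp
  next
    case 3
    have "cut c S (min (J + i) J') = cut c S J'"
    proof (cases "J' \<le> J + i")
      case False
      then have "count_list S c < J + i" "count_list S c < J'" using 3 count_range by auto
      then show ?thesis using False by (simp add: cut_gt)
    qed (simp add: min_absorb2)
    then show ?thesis using cut_gt[OF 3] m by (simp add: length_range)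
  qed
qed

text \<open>Ranges are closed under taking pieces, so sub-ranges need no theory of their
  own.\<close>

lemma piece_range_of:
  "piece c K2 (range_of c S J J') j =
     range_of c S (min (J + j * K2) J') (min (J + (j + 1) * K2) J')"
proof -
  let ?x = "cut c (range_of c S J J') (j * K2)" and ?y = "cut c (range_of c S J J') ((j + 1) * K2)"
  have y: "cut c S J + ?y \<le> cut c S J'"
    unfolding cut_range by (rule cut_mono) simp
  have "drop ?x (take ?y (range_of c S J J')) = drop (cut c S J + ?x) (take (cut c S J + ?y) S)"
    using y unfolding range_of_def by (simp add: take_drop min_def add.commute)
  then show ?thesis unfolding piece_def cut_range by (simp add: range_of_def)
qed

end

lemma lg_pos [simp]: "Suc 0 \<le> lg x" "0 < lg x" "lg x \<noteq> 0"
  by (auto simp: lg_def)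

section \<open>Directories and tables in terms of prefix and bit counts\<close>

lemma rank_dir1_nth:
  "i < length S div (lg (length S))\<^sup>2 \<Longrightarrow>
     rank_dir1 S ! i = occ True S ((i + 1) * (lg (length S))\<^sup>2)"
  using lg_pos(2)[of "length S"] by (simp add: rank_dir1_def Let_def rank_eq_occ)

lemma length_rank_dir1: "length (rank_dir1 S) = length S div (lg (length S))\<^sup>2"
  by (simp add: rank_dir1_def Let_def)

lemma length_rank_dir2: "length (rank_dir2 S) = length S div lg (length S)"
  by (simp add: rank_dir2_def Let_def)

lemma rank_dir2_nth:
  assumes t: "t < length S div lg (length S)"
  defines "L \<equiv> lg (length S)"
  shows "rank_dir2 S ! t = occ True S ((t + 1) * L) - occ True S (t div L * L\<^sup>2)"
proof -
  have L: "0 < L" by (simp add: L_def lg_def)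
  let ?a = "t div L * L\<^sup>2" and ?i = "(t mod L + 1) * L"
  \<comment> \<open>The offset inside the range and the start of the range recombine to the end of
    block \<open>t\<close> in \<open>S\<close>.\<close>
  have e: "?a + ?i = (t + 1) * L"
  proof -
    have "?a + ?i = (t div L * L + t mod L + 1) * L"
      by (simp only: power2_eq_square add_mult_distrib mult.assoc)
    then show ?thesis by simp
  qed
  have le: "(t + 1) * L \<le> length S"
    using t unfolding L_def[symmetric] by (metis Suc_eq_plus1 Suc_leI div_times_less_eq_dividend le_trans mult_le_mono1)
  have "?i \<le> L\<^sup>2" unfolding power2_eq_square
    by (intro mult_le_mono1) (simp add: Suc_le_eq L)
  then have "take (?i) (take (L\<^sup>2) (drop ?a S)) = take ?i (drop ?a S)" by (simp add: min_def)
  also have "\<dots> = take ?i (drop ?a (take (length S) S))" by simp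
  finally have "occ True (take (L\<^sup>2) (drop ?a S)) ?i = occ True (drop ?a (take (length S) S)) ?i"
    by (simp add: occ_def)
  also have "\<dots> = occ True S (min (?a + ?i) (length S)) - occ True S ?a"
    by (rule occ_drop_take) (use le e in linarith, simp)
  also have "min (?a + ?i) (length S) = (t + 1) * L" using le e by simp
  finally have "occ True (take (L\<^sup>2) (drop ?a S)) ?i = occ True S ((t + 1) * L) - occ True S ?a" .
  moreover have "?i - 1 + 1 = ?i" using L by simp
  ultimately show ?thesis
    using t unfolding rank_dir2_def Let_def L_def[symmetric] by (simp add: rank_eq_occ)
qed

lemma nth_concat_uniform:
  assumes "i < N * l"
  shows "concat (map (\<lambda>x. map (f x) [0..<l]) [0..<N]) ! i = f (i div l) (i mod l)"
  using assms
proof (induction N)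
  case (Suc N)
  have len: "length (concat (map (\<lambda>x. map (f x) [0..<l]) [0..<N])) = N * l"
    by (simp add: length_concat sum_list_triv o_def)
  show ?case
  proof (cases "i < N * l")
    case True
    then show ?thesis using Suc.IH len by (simp add: nth_append)
  next
    case False
    then have "i - N * l < l" "l \<noteq> 0" using Suc.prems by auto
    moreover have "i = (i - N * l) + N * l" using False by simp
    ultimately have "i div l = N" "i mod l = i - N * l"
      by (metis add.commute div_less div_mult_self1 add_0_right)
        (metis \<open>i - N * l < l\<close> \<open>i = i - N * l + N * l\<close> mod_less mod_mult_self1)
    then show ?thesis using False len \<open>i - N * l < l\<close> by (simp add: nth_append)
  qed
qed simp

lemma length_concat_uniform: "length (concat (map (\<lambda>x. map (f x) [0..<l]) [0..<N])) = N * l"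
  by (simp add: length_concat sum_list_triv o_def)

definition popc :: "nat \<Rightarrow> nat \<Rightarrow> nat" where
  "popc k v = (\<Sum>t < k. of_bool (bit v t))"

text \<open>Masking makes one array of counts over a fixed number of bits answer for every shorter
  length.\<close>

lemma popc_take_bit: "j \<le> k \<Longrightarrow> popc k (v mod 2 ^ j) = popc j v"
proof -
  assume "j \<le> k"
  then show "popc k (v mod 2 ^ j) = popc j v"
    unfolding popc_def take_bit_eq_mod[symmetric]
    by (intro sum.mono_neutral_cong_right) (auto simp: bit_take_bit_iff)
qed

lemma popc_le: "popc k v \<le> k"
proof -
  have "popc k v \<le> (\<Sum>t < k. 1)" unfolding popc_def by (intro sum_mono) simp
  then show ?thesis by simp
qed

lemma length_bitstring [simp]: "length (bitstring l x) = l"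
  by (simp add: bitstring_def)

lemma nth_bitstring [simp]: "t < l \<Longrightarrow> bitstring l x ! t \<longleftrightarrow> bit x t"
  by (simp add: bitstring_def)

lemma occ_bitstring: "j \<le> l \<Longrightarrow> occ True (bitstring l x) j = popc j x"
proof (induction j)
  case (Suc j)
  then show ?case by (simp add: occ_Suc popc_def)
qed (simp add: popc_def)

lemma rank_table_nth:
  assumes "i < 2 ^ l * l"
  shows "rank_table l ! i = popc (i mod l + 1) (i div l)"
proof -
  have l: "i mod l < l" using assms by (cases "l = 0") auto
  show ?thesis
    unfolding rank_table_def nth_concat_uniform[OF assms]
    using l by (simp add: rank_eq_occ occ_bitstring)
qed

lemma length_rank_table: "length (rank_table l) = 2 ^ l * l"
  unfolding rank_table_def by (rule length_concat_uniform)

definition sel_entry :: "nat \<Rightarrow> nat \<Rightarrow> nat \<Rightarrow> nat" where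
  "sel_entry l x i = (if i < popc l x then select True (bitstring l x) (i + 1) else 0)"

lemma select_cong_map:
  assumes "length T = length S" "\<And>p. p < length S \<Longrightarrow> (T ! p = d) = (S ! p = c)"
  shows "select d T i = select c S i"
proof -
  have "filter (\<lambda>p. T ! p = d) [0..<length T] = filter (\<lambda>p. S ! p = c) [0..<length S]"
    unfolding assms(1) by (rule filter_cong) (use assms(2) in auto)
  then show ?thesis by (simp add: select_def)
qed

text \<open>Used to reduce selecting zeros to selecting ones.\<close>

lemma bit_complement:
  fixes x :: nat
  assumes "x < 2 ^ l" "t < l"
  shows "bit (2 ^ l - 1 - x) t \<longleftrightarrow> \<not> bit x t"
proof -
  have "int (2 ^ l - 1 - x) = mask l - take_bit l (int x)"
    using assms(1) by (simp add: mask_eq_exp_minus_1 of_nat_diff take_bit_int_eq_self)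
  also have "\<dots> = take_bit l (not (int x))" by (simp add: take_bit_not_eq_mask_diff)
  finally have "bit (int (2 ^ l - 1 - x)) t \<longleftrightarrow> bit (take_bit l (not (int x))) t" by simp
  then show ?thesis using assms(2) by (simp add: bit_take_bit_iff bit_not_iff bit_of_nat_iff)
qed

text \<open>Leading zeros contain no ones and do not move the others, so a single array computed for
  the largest length serves all lengths.\<close>

lemma sel_entry_prefix:
  assumes "x < 2 ^ l" "l \<le> h"
  shows "sel_entry h x i = sel_entry l x i"
proof -
  have "popc h x = popc h (x mod 2 ^ l)" using assms(1) by simp
  also have "\<dots> = popc l x" using assms(2) by (rule popc_take_bit)
  finally have pe: "popc h x = popc l x" .
  show ?thesis
  proof (cases "i < popc l x")
    case True
    have ci: "count_list (bitstring l x) True = popc l x"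
      using occ_bitstring[of l l x] by (simp add: occ_ge)
    have 1: "1 \<le> i + 1" "i + 1 \<le> count_list (bitstring l x) True" using True ci by auto
    let ?p = "select True (bitstring l x) (i + 1)"
    have p: "?p < l" "bit x ?p" "popc ?p x = i"
      using select_less[OF 1] nth_select[OF 1] occ_select[OF 1] occ_bitstring[of ?p l x] by auto
    have "select True (bitstring h x) (occ True (bitstring h x) ?p + 1) = ?p"
      by (rule select_unique) (use p assms(2) in auto)
    moreover have "occ True (bitstring h x) ?p = i"
      using occ_bitstring[of ?p h x] p assms(2) by simp
    ultimately show ?thesis using True pe by (simp add: sel_entry_def)
  qed (simp add: sel_entry_def pe)
qed

text \<open>The zeros of an \<open>l\<close>-bit string are the ones of its complement
  \<open>2 ^ l - 1 - x\<close>. The complement must be taken within \<open>l\<close> bits, since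
  otherwise leading zeros would become spurious ones.\<close>

lemma select_table_nth:
  assumes i: "i < 2 ^ l * l"
  shows "select_table c l ! i =
    sel_entry l (if c then i div l else 2 ^ l - 1 - i div l) (i mod l)"
proof -
  have l: "i mod l < l" using i by (cases "l = 0") auto
  have x: "i div l < 2 ^ l" using i by (simp add: less_mult_imp_div_less)
  let ?x = "i div l" and ?T = "bitstring l (i div l)"
  have e: "select_table c l ! i =
      (if i mod l < count_list ?T c then select c ?T (i mod l + 1) else 0)"
    unfolding select_table_def Let_def nth_concat_uniform[OF i] by simp
  have ct: "count_list (bitstring l y) True = popc l y" for y
    using occ_bitstring[of l l y] by (simp add: occ_ge)
  show ?thesis
  proof (cases c)
    case True
    then show ?thesis using e ct by (simp add: sel_entry_def)
  next
    case False
    let ?y = "2 ^ l - 1 - ?x"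
    have b: "(bitstring l ?y ! p = True) = (?T ! p = False)" if "p < length ?T" for p
      using bit_complement[OF x, of p] that by simp
    have "count_list (bitstring l ?y) True = count_list ?T False"
    proof -
      have "occ True (bitstring l ?y) l = occ False ?T l"
        unfolding occ_card using b by (auto intro!: arg_cong[where f = card])
      then show ?thesis by (simp add: occ_ge)
    qed
    moreover have "select True (bitstring l ?y) (i mod l + 1) = select False ?T (i mod l + 1)"
      by (rule select_cong_map) (use b in auto)
    ultimately show ?thesis using e False ct[of ?y] by (simp add: sel_entry_def)
  qed
qed

lemma length_select_table: "length (select_table c l) = 2 ^ l * l"
  unfolding select_table_def Let_def by (rule length_concat_uniform)

lemma sel_entry_less: "0 < l \<Longrightarrow> sel_entry l x i < l"
proof -
  assume "0 < l"
  have "count_list (bitstring l x) True = popc l x" using occ_bitstring[of l l x] by (simp add: occ_ge)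
  then show ?thesis using select_less[of "i + 1" "bitstring l x" True] \<open>0 < l\<close>
    by (auto simp: sel_entry_def)
qed

section \<open>Logarithms\<close>

lemma less_exp_floorlog: "x < 2 ^ floorlog 2 x"
  using floorlog_bounds[of x 2] by (cases "x = 0") (auto simp: floorlog_def)

lemma floorlog_mono2: "x \<le> y \<Longrightarrow> floorlog 2 x \<le> floorlog 2 y"
  by (rule floorlog_mono)

lemma floorlog_le_if: "x < 2 ^ k \<Longrightarrow> floorlog 2 x \<le> k"
  by (rule floorlog_leI) auto

text \<open>For \<open>x \<ge> 2\<close> the rounded-up logarithm is the bit length of
  \<open>x - 1\<close>. In this form \<open>lg\<close> is computed by the program, which only knows
  how to count bits.\<close>

lemma lg_floorlog: "lg x = max 1 (floorlog 2 (x - 1))"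
proof (cases "x \<le> 1")
  case True
  then have "x = 0 \<or> x = 1" by auto
  then show ?thesis by (auto simp: lg_def floorlog_def log_def)
next
  case False
  let ?f = "floorlog 2 (x - 1)"
  have b: "2 ^ (?f - 1) \<le> x - 1" "x - 1 < 2 ^ ?f" using floorlog_bounds[of "x - 1" 2] False by auto
  have f1: "1 \<le> ?f" using False by (simp add: floorlog_def)
  have "\<lceil>log (real 2) (real x)\<rceil> = int (?f - 1) + 1"
    by (rule ceiling_log_nat_eq_if) (use b f1 False in auto)
  then show ?thesis using f1 by (simp add: lg_def)
qed

lemma le_exp_lg: "x \<le> 2 ^ lg x"
proof -
  have "x - 1 < 2 ^ floorlog 2 (x - 1)" by (rule less_exp_floorlog)
  also have "\<dots> \<le> 2 ^ lg x" unfolding lg_floorlog by (intro power_increasing) auto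
  finally show ?thesis by simp
qed

lemma lg_le: "x \<le> 2 ^ k \<Longrightarrow> 1 \<le> k \<Longrightarrow> lg x \<le> k"
proof -
  assume x: "x \<le> 2 ^ k" and k: "1 \<le> k"
  have "x - 1 < 2 ^ k" using x by (metis diff_less le_less_trans less_le_trans less_numeral_extra(1) neq0_conv zero_less_diff zero_less_numeral zero_less_power diff_is_0_eq' less_imp_diff_less linorder_not_le nat_less_le)
  then show ?thesis unfolding lg_floorlog using floorlog_le_if[of "x - 1" k] k by simp
qed

lemma lg_mono: "x \<le> y \<Longrightarrow> lg x \<le> lg y"
  using lg_le[of x "lg y"] le_exp_lg[of y] by simp

lemma lg_mult: "lg (x * y) \<le> lg x + lg y"
proof (rule lg_le)
  show "x * y \<le> 2 ^ (lg x + lg y)" unfolding power_add by (intro mult_le_mono le_exp_lg)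
  show "1 \<le> lg x + lg y" using lg_pos(1)[of x] by linarith
qed

lemma lg_le_self: "1 \<le> x \<Longrightarrow> lg x \<le> x"
  using lg_le[of x x] less_exp[of x] by simp

lemma floorlog_le_lg: "floorlog 2 x \<le> lg x + 1"
proof -
  have "x < 2 ^ (lg x + 1)" using le_exp_lg[of x] by (simp add: le_less_trans)
  then show ?thesis by (rule floorlog_le_if)
qed

lemma exp_lg_less: "2 \<le> x \<Longrightarrow> 2 ^ (lg x - 1) < x"
proof -
  assume "2 \<le> x"
  then have "2 ^ (floorlog 2 (x - 1) - 1) \<le> x - 1" "1 \<le> floorlog 2 (x - 1)"
    using floorlog_bounds[of "x - 1" 2] by (auto simp: floorlog_def)
  then show ?thesis using \<open>2 \<le> x\<close> unfolding lg_floorlog by (simp add: max_def)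
qed

section \<open>The construction program\<close>

text \<open>
  Registers: 1 \<open>n\<close>, 3 \<open>L = lg n\<close>, 5 \<open>LL = lg L\<close>, 6 \<open>K\<close>, 7 \<open>H\<close> (a bound for the length of the
  sub-ranges that use the look-up table), 8 \<open>h\<close>, 10 the threshold \<open>K\<^sup>2\<close> for long ranges, 11 the
  size of the tables of logarithms, 12 the number of blocks, 13 to 16 lengths of entries, 20 and 21
  the bits for the look-up tables of one length, 22 the size of the arrays of cuts, 23 the bits for
  the second-level directory of one range, 24 to 30 the sizes of the sections.
\<close>

definition rsteps :: "rstep list" where
  "rsteps =
    [Val (Num 0),
     Val (Num 0),
     Flog (Var 1 -! Num 1),
     Val (Var 2 +! (Var 2 =! Num 0)),
     Flog (Var 3 -! Num 1),
     Val (Var 4 +! (Var 4 =! Num 0)),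
     Val (Var 3 *! Var 5),
     Val (Num 16 *! (Var 5 *! Var 5) *! (Var 5 *! Var 5)),
     Val ((Var 3 +! Num 1) div! Num 2),
     Val (Var 8 +! Var 7),
     Val (Var 6 *! Var 6),
     Val (Var 10 +! Var 7 +! Num 1),
     Val (Var 1 div! Var 3 +! Var 5 +! Num 1),
     Flog (Var 1),
     Flog (Var 3 *! Var 3),
     Flog (Var 8),
     Flog (Var 7),
     Val (Pow2 (Var 8)),
     Val (Pow2 (Var 7)),
     Val (Pow2 (Var 9)),
     Val (Var 17 *! Var 8 *! Var 15),
     Val (Var 18 *! Var 7 *! Var 16),
     Val (Num 4 *! Var 1 +! Num 2 *! Var 6 +! Num 4),
     Val (Num 2 *! Var 3 +! Num 5 *! Var 5),
     Val (Var 1 div! (Var 3 *! Var 3) *! Var 13),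
     Val (Var 1 div! Var 3 *! Var 14),
     Val (Var 8 *! Var 20),
     Val ((Var 1 div! Var 6 +! Num 1) *! Var 13),
     Val ((Var 1 div! Var 6 +! Num 1) *! Var 23),
     Val (Num 2 *! (Var 1 div! Var 5)),
     Val (Var 7 *! Var 21),
     Val (Var 1 +! Num 64 +! Num 2 *! Var 11)] @
    map (\<lambda>s. Val (Var (31 + s) +! Var (size_reg s) div! Var 0 +! Num 1)) [0..<13]"

definition gather :: "aexp \<Rightarrow> aexp \<Rightarrow> astep" where
  "gather k e = \<lparr>ini_n = k, ini_ix = Var ireg, ini_v = e, rounds = Num 0, upd_n = Num 0, upd_g = Num 0,
     upd_ix = Num 0, upd_v = Num 0\<rparr>"

definition update :: "aexp \<Rightarrow> aexp \<Rightarrow> aexp \<Rightarrow> aexp \<Rightarrow> aexp \<Rightarrow> aexp \<Rightarrow> aexp \<Rightarrow> astep" where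
  "update k e b k' g ix v = \<lparr>ini_n = k, ini_ix = Var ireg, ini_v = e, rounds = b, upd_n = k', upd_g = g,
     upd_ix = ix, upd_v = v\<rparr>"

abbreviation I_e :: aexp where "I_e \<equiv> Var ireg"
abbreviation t_e :: aexp where "t_e \<equiv> Var treg"

text \<open>Everything that depends on the bit exists twice. The two copies of a work array are
  neighbours; the copies of a section of the block are five sections apart.\<close>

definition cx :: "bool \<Rightarrow> nat" where "cx c = (if c then 0 else 1)"

abbreviation occ_a :: "bool \<Rightarrow> aexp \<Rightarrow> aexp" where "occ_a c \<equiv> Arr (7 + cx c)"
abbreviation cut_a :: "bool \<Rightarrow> aexp \<Rightarrow> aexp" where "cut_a c \<equiv> Arr (9 + cx c)"

text \<open>The sequence is unpacked into one cell per bit and padded with zeros to whole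
  blocks.\<close>

definition bits_a :: astep where
  "bits_a = update (Var 12 *! Var 3) (Num 0) (Num 1) (Var 1) (Num 1) I_e (Fld I_e (Num 1))"

text \<open>The bit length of a number is the number of shift distances that leave it nonzero; round
  \<open>t\<close> tests distance \<open>t\<close> for all arguments at once.\<close>

definition flog_a :: astep where
  "flog_a = update (Var 11) (Num 0) (Var 0) (Var 11) (Num 1) I_e
     (Arr 1 I_e +! (Num 0 <! Bin ShiftR I_e t_e))"

definition lg_a :: astep where
  "lg_a = gather (Var 11) (Arr 1 (I_e -! Num 1) +! (Arr 1 (I_e -! Num 1) =! Num 0))"

text \<open>The length \<open>h + H\<close> is a simple common bound for the \<open>h\<close> bits
  of the rank table and the \<open>H\<close> bits of the select table. Even so
  \<open>2 ^ (h + H)\<close> is \<open>o(n)\<close>, as \<open>h\<close> is about half of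
  \<open>lg n\<close>.\<close>

definition popc_a :: astep where
  "popc_a = update (Var 19) (Num 0) (Var 9) (Var 19) (Num 1) I_e (Arr 3 I_e +! bit_e I_e t_e)"

text \<open>Select inverts the bit count: a set bit at position \<open>p\<close> with
  \<open>i\<close> set bits below it writes \<open>p\<close> into slot \<open>i\<close> of its
  row.\<close>

definition sel_a :: astep where
  "sel_a = update (Var 18 *! Var 7) (Num 0) (Num 1) (Var 18 *! Var 7)
     (bit_e (I_e div! Var 7) (I_e mod! Var 7))
     (I_e div! Var 7 *! Var 7 +! Arr 3 (I_e div! Var 7 mod! Pow2 (I_e mod! Var 7)))
     (I_e mod! Var 7)"

text \<open>Entry \<open>j\<close> belongs to block \<open>j - 1\<close> and entry 0 is 0. With this
  shift the doubling produces counts that exclude the current block.\<close>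

definition count_a :: astep where
  "count_a = update (Var 12 +! Num 1) (Num 0) (Var 3) (Var 12 +! Num 1) (Num 1) I_e
     (Arr 5 I_e +! Arr 0 ((I_e -! Num 1) *! Var 3 +! t_e) *! (Num 0 <! I_e))"

text \<open>Pointer doubling: in round \<open>t\<close> an entry adds the one \<open>2 ^ t\<close>
  places to its left. The guard leaves entries alone that have no such neighbour.\<close>

definition sum_a :: astep where
  "sum_a = update (Var 12 +! Num 1) (Arr 5 I_e) (Var 3 +! Num 2) (Var 12 +! Num 1)
     (Pow2 t_e <! I_e +! Num 1) I_e (Arr 6 I_e +! Arr 6 (I_e -! Pow2 t_e))"

text \<open>The initial store only fills the block boundaries; the rounds then extend all blocks by
  one position at a time.\<close>

definition occ1_a :: astep where
  "occ1_a = \<lparr>ini_n = Var 12, ini_ix = I_e *! Var 3, ini_v = Arr 6 I_e, rounds = Var 3 -! Num 1,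
     upd_n = Var 12, upd_g = Num 1, upd_ix = I_e *! Var 3 +! t_e +! Num 1,
     upd_v = Arr 7 (I_e *! Var 3 +! t_e) +! Arr 0 (I_e *! Var 3 +! t_e)\<rparr>"

definition occ0_a :: astep where
  "occ0_a = gather (Var 12 *! Var 3) (I_e -! Arr 7 I_e)"

text \<open>The default \<open>n\<close> is the value of every cut beyond the last occurrence. A
  position carrying \<open>c\<close> then overwrites the cut with its own number.\<close>

definition cuts_a :: "bool \<Rightarrow> astep" where
  "cuts_a c = update (Var 22) (Var 1 *! (Num 0 <! I_e)) (Num 1) (Var 1)
     (Arr 0 I_e =! Num (of_bool c)) (occ_a c I_e +! Num 1) (I_e +! Num 1)"

text \<open>Lengths of long ranges are replaced by 0, which keeps the later look-ups of
  \<open>lg\<close> and \<open>floorlog\<close> inside their tables.\<close>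

definition mask_e :: "aexp \<Rightarrow> aexp" where
  "mask_e r = r *! (r <! Var 10)"

definition len_a :: "bool \<Rightarrow> astep" where
  "len_a c = gather (Var 1 div! Var 6 +! Num 1)
     (mask_e (cut_a c (I_e *! Var 6 +! Var 6) -! cut_a c (I_e *! Var 6)))"

definition substep_e :: "bool \<Rightarrow> aexp \<Rightarrow> aexp" where
  "substep_e c k = Arr 2 (Arr (11 + cx c) k) *! Var 5"

text \<open>Slot \<open>i\<close> stands for \<open>Var 5\<close> consecutive positions and is
  assigned to the sub-range containing the last of them. The first one would not do: the slot in
  which a sub-range begins may start before it. The result is the number of occurrences that precede
  the sub-range.\<close>

definition sub_a :: "bool \<Rightarrow> astep" where
  "sub_a c = (let j = occ_a c ((I_e +! Num 1) *! Var 5 -! Num 1); s = substep_e c (j div! Var 6)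
     in gather (Var 1 div! Var 5) (j div! Var 6 *! Var 6 +! j mod! Var 6 div! s *! s))"

definition sublen_a :: "bool \<Rightarrow> astep" where
  "sublen_a c = (let q = Arr (13 + cx c) I_e
     in gather (Var 1 div! Var 5)
       (mask_e (cut_a c (min_e (q +! substep_e c (q div! Var 6)) (q div! Var 6 *! Var 6 +! Var 6)) -!
          cut_a c q)))"

section \<open>The bits of the packed sections\<close>

definition dir1_a :: astep where
  "dir1_a = gather (Var 24)
     (bit_e (Arr 7 ((I_e div! Var 13 +! Num 1) *! (Var 3 *! Var 3))) (I_e mod! Var 13))"

definition dir2_a :: astep where
  "dir2_a = gather (Var 25)
     (bit_e (Arr 7 ((I_e div! Var 14 +! Num 1) *! Var 3) -!
         Arr 7 (I_e div! Var 14 div! Var 3 *! (Var 3 *! Var 3)))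
       (I_e mod! Var 14))"

text \<open>Every length gets as much room as the longest table, so one division by
  \<open>Var 20\<close> recovers the length, and the remainder locates the entry.\<close>

definition rtab_a :: astep where
  "rtab_a = (let l = I_e div! Var 20 +! Num 1; y = I_e mod! Var 20; e = y div! Var 15
     in gather (Var 26) (bit_e (Arr 3 (e div! l mod! Pow2 (e mod! l +! Num 1))) (y mod! Var 15)))"

definition seldir_a :: "bool \<Rightarrow> astep" where
  "seldir_a c = gather (Var 27)
     (bit_e (cut_a c ((I_e div! Var 13 +! Num 1) *! Var 6) -! Num 1) (I_e mod! Var 13))"

text \<open>Here a slot stands for \<open>Var 6\<close> positions and holds one answer. Again its
  owner is determined at the last position of the slot, and \<open>q\<close> is the number of
  occurrences before the owning range.\<close>

definition long_a :: "bool \<Rightarrow> astep" where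
  "long_a c = (let z = I_e div! Var 13; q = occ_a c ((z +! Num 1) *! Var 6 -! Num 1) div! Var 6 *! Var 6
     in gather (Var 27)
       (bit_e (cut_a c (q +! (z -! cut_a c q div! Var 6) +! Num 1) -! Num 1) (I_e mod! Var 13)))"

definition subdir_a :: "bool \<Rightarrow> astep" where
  "subdir_a c = (let k = I_e div! Var 23; y = I_e mod! Var 23; b = Arr 1 (Arr (11 + cx c) k)
     in gather (Var 28)
       (bit_e (cut_a c (k *! Var 6 +! min_e ((y div! b +! Num 1) *! substep_e c k) (Var 6)) -! Num 1 -!
           cut_a c (k *! Var 6))
         (y mod! b)))"

text \<open>Two bits are reserved for every \<open>Var 5\<close> positions of \<open>S\<close>,
  which explains the factors 2; bit \<open>I_e\<close> belongs to slot
  \<open>I_e div! Num 2\<close>.\<close>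

definition subans_a :: "bool \<Rightarrow> astep" where
  "subans_a c = (let k = I_e div! Num 2; q = Arr (13 + cx c) k; b = Arr 1 (Arr (15 + cx c) k);
       y = I_e -! Num 2 *! (cut_a c q div! Var 5)
     in gather (Var 29)
       (bit_e (cut_a c (q +! y div! b +! Num 1) -! Num 1 -! cut_a c q) (y mod! b)))"

definition seltab_a :: "bool \<Rightarrow> astep" where
  "seltab_a c = (let l = I_e div! Var 21 +! Num 1; y = I_e mod! Var 21; b = Arr 1 l; e = y div! b;
       v = e div! l mod! Pow2 l
     in gather (Var 30)
       (bit_e (Arr 4 ((if c then v else Pow2 l -! Num 1 -! v) *! Var 7 +! e mod! l)) (y mod! b)))"

definition asteps :: "astep list" where
  "asteps = [bits_a, flog_a, lg_a, popc_a, sel_a, count_a, sum_a, occ1_a, occ0_a,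
     cuts_a True, cuts_a False, len_a True, len_a False, sub_a True, sub_a False,
     sublen_a True, sublen_a False,
     dir1_a, dir2_a, rtab_a,
     seldir_a True, long_a True, subdir_a True, subans_a True, seltab_a True,
     seldir_a False, long_a False, subdir_a False, subans_a False, seltab_a False]"

definition build_prog :: com where
  "build_prog = Seq (seqs (map (\<lambda>x. reg_prog x (rsteps ! x)) [2..<nregs]))
     (Seq (seqs (map (\<lambda>a. arr_prog a (asteps ! a)) [0..<narrs])) block_prog)"

section \<open>The values computed by the construction\<close>

text \<open>The estimates below give powers of \<open>2 ^ L\<close> up to about 1100, the bulk of it
  from \<open>H \<le> 1024 * L\<close>; 8192 is a comfortable power of two above that.\<close>

definition word_factor :: nat where "word_factor = 8192"

locale layout =
  fixes w n :: nat and S :: "bool list" and m0 :: memory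
  assumes wL: "max_deg * (word_factor * lg n) \<le> w"
    and lenS: "length S = n"
    and seqS: "holds_seq w m0 S" and valid0: "valid_mem w m0"
begin

definition u :: nat where "u = w div max_deg"
definition L :: nat where "L = lg n"
definition LL :: nat where "LL = lg L"
definition K :: nat where "K = L * LL"
text \<open>Lengths below \<open>K * K\<close> have logarithms at most \<open>4 * LL\<close>. So a
  sub-range below the threshold \<open>lg r' * lg r * LL ^ 2\<close> is shorter than
  \<open>(4 * LL) * (4 * LL) * LL ^ 2\<close>.\<close>

definition H :: nat where "H = 16 * (LL * LL) * (LL * LL)"
text \<open>Rounded up, so that two look-ups of \<open>h\<close> bits cover \<open>L\<close>
  bits.\<close>

definition h :: nat where "h = (L + 1) div 2"
text \<open>Exceeds all arguments for which logarithms are looked up: lengths of short ranges are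
  below \<open>K * K\<close>, and those of table strings are at most \<open>H\<close>.\<close>

definition M :: nat where "M = K * K + H + 1"
text \<open>The additional \<open>LL\<close> blocks amount to \<open>K\<close> positions: the last
  slot of \<open>K\<close> positions may stick out beyond \<open>n\<close>, and prefix counts are
  read at its end.\<close>

definition nb :: nat where "nb = n div L + LL + 1"
definition fn :: nat where "fn = floorlog 2 n"
definition f2 :: nat where "f2 = floorlog 2 (L * L)"
definition fh :: nat where "fh = floorlog 2 h"
definition fH :: nat where "fH = floorlog 2 H"
definition RA :: nat where "RA = 2 ^ h * h * fh"
definition SA :: nat where "SA = 2 ^ H * H * fH"
text \<open>Slots without an owner are filled as well. Their contents are arbitrary, but the cut
  indices they compute must exist; \<open>X\<close> exceeds all of them.\<close>

definition X :: nat where "X = 4 * n + 2 * K + 4"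
definition A2 :: nat where "A2 = 2 * L + 5 * LL"

definition sizes :: "nat list" where
  "sizes = [n div (L * L) * fn, n div L * f2, h * RA, (n div K + 1) * fn, (n div K + 1) * A2,
     2 * (n div LL), H * SA]"

fun WA :: "nat \<Rightarrow> nat" where
  "WA 0 = n + 64 + 2 * M"
| "WA (Suc s) = WA s + sizes ! (size_reg s - 24) div w + 1"

definition pv :: "nat \<Rightarrow> nat" where
  "pv x = (if x < 31 then
     [w, n, floorlog 2 (n - 1), L, floorlog 2 (L - 1), LL, K, H, h, h + H, K * K, M, nb, fn, f2, fh, fH,
      2 ^ h, 2 ^ H, 2 ^ (h + H), RA, SA, X, A2, n div (L * L) * fn, n div L * f2, h * RA,
      (n div K + 1) * fn, (n div K + 1) * A2, 2 * (n div LL), H * SA] ! x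
     else WA (x - 31))"

lemma pv_simps [simp]:
  "pv 0 = w" "pv (Suc 0) = n" "pv 1 = n" "pv 2 = floorlog 2 (n - 1)" "pv 3 = L" "pv 4 = floorlog 2 (L - 1)"
  "pv 5 = LL" "pv 6 = K" "pv 7 = H" "pv 8 = h" "pv 9 = h + H" "pv 10 = K * K" "pv 11 = M" "pv 12 = nb"
  "pv 13 = fn" "pv 14 = f2" "pv 15 = fh" "pv 16 = fH" "pv 17 = 2 ^ h" "pv 18 = 2 ^ H"
  "pv 19 = 2 ^ (h + H)" "pv 20 = RA" "pv 21 = SA" "pv 22 = X" "pv 23 = A2"
  "pv 24 = n div (L * L) * fn" "pv 25 = n div L * f2" "pv 26 = h * RA" "pv 27 = (n div K + 1) * fn"
  "pv 28 = (n div K + 1) * A2" "pv 29 = 2 * (n div LL)" "pv 30 = H * SA" "pv 31 = n + 64 + 2 * M"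
  by (simp_all add: pv_def)

lemma pv_WA: "pv (31 + s) = WA s"
  by (simp add: pv_def)

lemma all_less_13: "(\<And>s. s \<in> {0, 1, 2, 3, 4, 5, 6, 7, 8, 9, 10, 11, 12} \<Longrightarrow> P s) \<Longrightarrow> s < 13 \<Longrightarrow> P (s::nat)"
  by (auto simp: less_Suc_eq numeral_eq_Suc)

lemma pv_size: "s < 13 \<Longrightarrow> sizes ! (size_reg s - 24) = pv (size_reg s)"
  by (rule all_less_13[of "\<lambda>s. sizes ! (size_reg s - 24) = pv (size_reg s)"])
    (auto simp: size_reg_def sizes_def)

lemma WA_Suc': "s < 13 \<Longrightarrow> pv (32 + s) = pv (31 + s) + pv (size_reg s) div w + 1"
  using pv_WA[of "Suc s"] pv_WA[of s] pv_size[of s] by simp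

section \<open>Size estimates\<close>

lemma L_pos [simp]: "0 < L" "0 < LL" "0 < K" "0 < H" "0 < h"
  by (simp_all add: L_def LL_def K_def H_def h_def)

lemma L_eq: "L = (if floorlog 2 (n - 1) = 0 then 1 else floorlog 2 (n - 1))"
  unfolding L_def lg_floorlog by auto

lemma LL_eq: "LL = (if floorlog 2 (L - 1) = 0 then 1 else floorlog 2 (L - 1))"
  unfolding LL_def lg_floorlog by auto

lemma u_ge: "word_factor * L \<le> u"
  unfolding u_def L_def using wL by (simp add: less_eq_div_iff_mult_less_eq max_deg_def mult.commute)

lemma u_large: "8192 \<le> u"
  using u_ge L_pos(1) by (cases L) (auto simp: word_factor_def)

lemma w_ge: "max_deg * u \<le> w"
  unfolding u_def by simp

lemma LL_le: "LL \<le> L"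
  unfolding LL_def by (rule lg_le_self) (simp add: Suc_leI)

text \<open>From \<open>k = 5\<close> on, the left side grows by a factor of at most
  \<open>(7 / 6) ^ 4 < 2\<close> per step, so induction works there and the smaller cases are
  computed. The quotient peaks near 40 at \<open>k = 5\<close>; 64 is the next power of two.\<close>

lemma four_bound: "(k + 1) ^ 4 \<le> 64 * 2 ^ k" for k :: nat
proof -
  have "(k + 6) ^ 4 \<le> 64 * 2 ^ (k + 5)" for k :: nat
  proof (induction k)
    case (Suc k)
    have "(Suc k + 6) ^ 4 \<le> 2 * (k + 6) ^ 4"
      by (simp add: power4_eq_xxxx algebra_simps)
    also have "\<dots> \<le> 2 * (64 * 2 ^ (k + 5))" using Suc by (intro mult_le_mono2)
    also have "\<dots> = 64 * 2 ^ (Suc k + 5)" by (simp add: power_add)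
    finally show ?case .
  qed simp
  note large = this
  have "k = 0 \<or> k = 1 \<or> k = 2 \<or> k = 3 \<or> k = 4 \<or> (\<exists>j. k = j + 5)" by presburger
  then show ?thesis using large by (elim disjE exE) (simp_all add: add.commute power4_eq_xxxx)
qed

lemma LL4: "LL ^ 4 \<le> 64 * L"
proof (cases "L \<le> 1")
  case True
  then have "L = 1" using L_pos(1) by linarith
  then show ?thesis by (simp add: LL_def lg_def)
next
  case False
  then have "2 ^ (LL - 1) < L" unfolding LL_def by (intro exp_lg_less) simp
  moreover have "LL ^ 4 \<le> 64 * 2 ^ (LL - 1)" using four_bound[of "LL - 1"] by simp
  ultimately show ?thesis by linarith
qed

lemma H_le: "H \<le> 1024 * L"
  using LL4 by (simp add: H_def power4_eq_xxxx mult.assoc)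

lemma n_le: "n \<le> 2 ^ L"
  unfolding L_def by (rule le_exp_lg)

text \<open>A calculus of polynomial growth: as \<open>n \<le> 2 ^ L\<close>, the index plays the
  role of a degree. Products add degrees, and sums take the larger one plus 1.\<close>

definition bnd :: "nat \<Rightarrow> nat \<Rightarrow> bool" where
  "bnd k x \<longleftrightarrow> x \<le> 2 ^ (k * L)"

lemma bnd_le: "bnd k x \<Longrightarrow> y \<le> x \<Longrightarrow> bnd k y"
  unfolding bnd_def by simp

lemma bnd_mono: "bnd k x \<Longrightarrow> k \<le> k' \<Longrightarrow> bnd k' x"
  unfolding bnd_def by (meson le_trans mult_le_mono1 one_le_numeral power_increasing)

lemma bnd_add: "bnd a x \<Longrightarrow> bnd b y \<Longrightarrow> bnd (max a b + 1) (x + y)"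
proof -
  assume "bnd a x" "bnd b y"
  then have "x \<le> 2 ^ (max a b * L)" "y \<le> 2 ^ (max a b * L)"
    using bnd_mono[of a x "max a b"] bnd_mono[of b y "max a b"] by (auto simp: bnd_def)
  then have "x + y \<le> 2 ^ (max a b * L + 1)" by simp
  also have "\<dots> \<le> 2 ^ ((max a b + 1) * L)" using L_pos(1) by (intro power_increasing) (simp_all add: Suc_leI)
  finally show ?thesis by (simp add: bnd_def)
qed

lemma bnd_mult: "bnd a x \<Longrightarrow> bnd b y \<Longrightarrow> bnd (a + b) (x * y)"
  unfolding bnd_def by (simp add: add_mult_distrib power_add mult_le_mono)

lemma bnd_num: "x \<le> 2 ^ k \<Longrightarrow> bnd k x"
proof -
  assume "x \<le> 2 ^ k"
  also have "(2::nat) ^ k \<le> 2 ^ (k * L)"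
    using L_pos(1) by (intro power_increasing) (simp_all add: Suc_leI)
  finally show ?thesis by (simp add: bnd_def)
qed

lemma bnd_pow: "x \<le> k * L \<Longrightarrow> bnd k (2 ^ x)"
  unfolding bnd_def by (intro power_increasing) auto

lemma bnd_lin: "x \<le> k * L \<Longrightarrow> bnd k x"
  unfolding bnd_def using less_exp[of "k * L"] by linarith

lemma bnd_u: "bnd k x \<Longrightarrow> k < 8192 \<Longrightarrow> x < 2 ^ u"
proof -
  assume b: "bnd k x" and k: "k < 8192"
  have "k * L < word_factor * L" using k L_pos(1) by (simp add: word_factor_def)
  also have "\<dots> \<le> u" by (rule u_ge)
  finally have "(2::nat) ^ (k * L) < 2 ^ u" by simp
  with b show ?thesis unfolding bnd_def by (rule le_less_trans)
qed

lemma h_le: "h \<le> L"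
  unfolding h_def using L_pos(1) by linarith

lemma bnd_basic: "bnd 1 n" "bnd 1 L" "bnd 1 LL" "bnd 2 K" "bnd 10 H" "bnd 1 h" "bnd 1 (2 ^ h)"
  "bnd 1024 (2 ^ H)" "bnd 1025 (2 ^ (h + H))" "bnd 12 M" "bnd 3 nb" "bnd 1 fn" "bnd 2 f2" "bnd 1 fh" "bnd 10 fH"
  "bnd 3 RA" "bnd 1044 SA" "bnd 6 X" "bnd 6 A2"
proof -
  show n: "bnd 1 n" using n_le by (simp add: bnd_def)
  show L: "bnd 1 L" by (rule bnd_lin) simp
  show LL: "bnd 1 LL" by (rule bnd_lin) (use LL_le in simp)
  show K: "bnd 2 K" unfolding K_def using bnd_mult[OF L LL] by (simp add: numeral_2_eq_2)
  show H: "bnd 10 H"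
    unfolding H_def
    by (rule bnd_mono[OF bnd_mult[OF bnd_mult[OF bnd_num[of 16 4] bnd_mult[OF LL LL]] bnd_mult[OF LL LL]]]) auto
  show h: "bnd 1 h" by (rule bnd_lin) (use h_le in simp)
  show h2: "bnd 1 (2 ^ h)" by (rule bnd_pow) (use h_le in simp)
  show H2: "bnd 1024 (2 ^ H)" by (rule bnd_pow) (rule H_le)
  show "bnd 1025 (2 ^ (h + H))" by (rule bnd_pow) (use h_le H_le in simp)
  show "bnd 12 M"
    unfolding M_def using bnd_add[OF bnd_add[OF bnd_mult[OF K K] H] bnd_num[of 1 0]] by simp
  show "bnd 3 nb"
    unfolding nb_def
    by (rule bnd_mono[OF bnd_add[OF bnd_add[OF bnd_le[OF n div_le_dividend] LL] bnd_num[of 1 0]]]) auto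
  show "bnd 1 fn" unfolding fn_def by (rule bnd_le[OF n floorlog_le])
  show "bnd 2 f2" unfolding f2_def by (rule bnd_le[OF _ floorlog_le]) (use bnd_mult[OF L L] in \<open>simp add: numeral_2_eq_2\<close>)
  show fh: "bnd 1 fh" unfolding fh_def by (rule bnd_le[OF h floorlog_le])
  show fH: "bnd 10 fH" unfolding fH_def by (rule bnd_le[OF H floorlog_le])
  show "bnd 3 RA" unfolding RA_def using bnd_mult[OF bnd_mult[OF h2 h] fh] by (simp add: numeral_eq_Suc)
  show "bnd 1044 SA" unfolding SA_def using bnd_mult[OF bnd_mult[OF H2 H] fH] by simp
  show "bnd 6 X"
    unfolding X_def
    by (rule bnd_mono[OF bnd_add[OF bnd_add[OF bnd_mult[OF bnd_num[of 4 2] n] bnd_mult[OF bnd_num[of 2 1] K]]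
            bnd_num[of 4 2]]]) auto
  show "bnd 6 A2"
    unfolding A2_def
    by (rule bnd_mono[OF bnd_add[OF bnd_mult[OF bnd_num[of 2 1] L] bnd_mult[OF bnd_num[of 5 3] LL]]]) auto
qed

lemma size_bnd: "bnd 1054 (n div (L * L) * fn)" "bnd 1054 (n div L * f2)" "bnd 1054 (h * RA)"
  "bnd 1054 ((n div K + 1) * fn)" "bnd 1054 ((n div K + 1) * A2)" "bnd 1054 (2 * (n div LL))" "bnd 1054 (H * SA)"
proof -
  have d: "bnd 1 (n div k)" for k by (rule bnd_le[OF bnd_basic(1) div_le_dividend])
  have d1: "bnd 2 (n div k + 1)" for k by (rule bnd_mono[OF bnd_add[OF d bnd_num[of 1 0]]]) auto
  note m = bnd_mono[OF bnd_mult]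
  show "bnd 1054 (n div (L * L) * fn)" by (rule m[OF d bnd_basic(12)]) simp
  show "bnd 1054 (n div L * f2)" by (rule m[OF d bnd_basic(13)]) simp
  show "bnd 1054 (h * RA)" by (rule m[OF bnd_basic(6,16)]) simp
  show "bnd 1054 ((n div K + 1) * fn)" by (rule m[OF d1 bnd_basic(12)]) simp
  show "bnd 1054 ((n div K + 1) * A2)" by (rule m[OF d1 bnd_basic(19)]) simp
  show "bnd 1054 (2 * (n div LL))" by (rule m[OF bnd_num[of 2 1] d]) simp_all
  show "bnd 1054 (H * SA)" by (rule m[OF bnd_basic(5,17)]) simp
qed

lemma bnd_size: "s < 13 \<Longrightarrow> bnd 1054 (pv (size_reg s))"
  by (rule all_less_13[of "\<lambda>s. bnd 1054 (pv (size_reg s))"]) (use size_bnd in \<open>auto simp: size_reg_def\<close>)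

lemma bnd_WA: "s \<le> 13 \<Longrightarrow> bnd (1060 + 2 * s) (WA s)"
proof (induction s)
  case 0
  have "bnd 1060 (n + 64 + 2 * M)"
    by (rule bnd_mono[OF bnd_add[OF bnd_add[OF bnd_basic(1) bnd_num[of 64 6]]
          bnd_mult[OF bnd_num[of 2 1] bnd_basic(10)]]]) auto
  then show ?case by simp
next
  case (Suc s)
  have "bnd 1054 (pv (size_reg s) div w)" by (rule bnd_le[OF bnd_size div_le_dividend]) (use Suc in simp)
  then have "bnd (1060 + 2 * Suc s) (WA s + pv (size_reg s) div w + 1)"
    using Suc by (intro bnd_mono[OF bnd_add[OF bnd_add[OF Suc.IH] bnd_num[of 1 0]]]) auto
  then show ?case using pv_size[of s] Suc.prems by simp
qed

text \<open>Register 0 holds \<open>w\<close>, so \<open>w\<close> itself has to be a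
  \<open>u\<close>-bit value although \<open>u\<close> is only a small fraction of it.\<close>

lemma w_less: "w < 2 ^ u"
proof -
  have "w < max_deg * (u + 1)"
    unfolding u_def using dividend_less_times_div[of max_deg w] by (simp add: max_deg_def)
  also have "\<dots> \<le> 2 ^ u"
  proof -
    have e: "4096 * (j + 8192 + 1) \<le> 2 ^ (j + 8192)" for j :: nat
    proof (induction j)
      case 0
      have "(4096::nat) * 8193 \<le> 2 ^ 26" by simp
      also have "\<dots> \<le> 2 ^ 8192" by (intro power_increasing) auto
      finally show ?case by simp
    next
      case (Suc j)
      have "4096 * (Suc j + 8192 + 1) \<le> 2 * (4096 * (j + 8192 + 1))" by simp
      also have "\<dots> \<le> 2 * 2 ^ (j + 8192)" using Suc by (intro mult_le_mono2)
      also have "\<dots> = 2 ^ (Suc j + 8192)" by (simp only: add_Suc power_Suc)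
      finally show ?case .
    qed
    have "u = (u - 8192) + 8192" using u_large by simp
    then show ?thesis using e[of "u - 8192"] by (simp add: max_deg_def)
  qed
  finally show ?thesis .
qed

lemma pv_less: "x < nregs \<Longrightarrow> pv x < 2 ^ u"
proof -
  assume x: "x < nregs"
  consider "x = 0 \<or> x = 1" | "x \<in> set [2..<31]" | s where "s \<le> 13" "x = 31 + s"
  proof (cases "x < 31")
    case True
    then have "(x = 0 \<or> x = 1) \<or> x \<in> set [2..<31]"
      unfolding set_upt atLeastLessThan_iff by linarith
    then show ?thesis using that by blast
  next
    case False
    then show ?thesis using that(3)[of "x - 31"] x by simp
  qed
  then show ?thesis
  proof cases
    case 2
    have fl: "bnd 1 (floorlog 2 (n - 1))" "bnd 1 (floorlog 2 (L - 1))"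
      by (rule bnd_le[OF bnd_le[OF bnd_basic(1) diff_le_self] floorlog_le]
          bnd_le[OF bnd_le[OF bnd_basic(2) diff_le_self] floorlog_le])+
    have KK: "bnd 4 (K * K)" using bnd_mult[OF bnd_basic(4,4)] by simp
    have hH: "bnd 11 (h + H)" using bnd_add[OF bnd_basic(6,5)] by simp
    have "list_all (\<lambda>x. bnd 1054 (pv x)) [2..<31]"
      using fl[THEN bnd_mono, of 1054] KK[THEN bnd_mono, of 1054] hH[THEN bnd_mono, of 1054]
        bnd_basic[THEN bnd_mono, of 1054] size_bnd by simp
    then have "bnd 1054 (pv x)" using 2 by (simp only: list_all_iff)
    then show ?thesis by (rule bnd_u) simp
  next
    case (3 s)
    then show ?thesis using bnd_u[OF bnd_WA[of s]] pv_WA[of s] by simp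
  qed (use w_less bnd_u[OF bnd_basic(1)] in auto)
qed

section \<open>Closed forms of the array contents\<close>

definition bt :: "nat \<Rightarrow> nat" where "bt i = of_bool (i < n \<and> S ! i)"
text \<open>For zeros this counts the padding beyond \<open>n\<close> too, so it agrees with
  \<open>occ\<close> only up to \<open>n\<close>. The slots that have an owner are looked up at
  positions below \<open>n\<close>.\<close>

definition occf :: "bool \<Rightarrow> nat \<Rightarrow> nat" where
  "occf c j = (if c then occ True S j else j - occ True S j)"
definition lenf :: "bool \<Rightarrow> nat \<Rightarrow> nat" where
  "lenf c k = (let r = cut c S (k * K + K) - cut c S (k * K) in r * of_bool (r < K * K))"
definition stepf :: "bool \<Rightarrow> nat \<Rightarrow> nat" where
  "stepf c k = lg (lenf c k) * LL"
definition subf :: "bool \<Rightarrow> nat \<Rightarrow> nat" where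
  "subf c i = (let j = occf c ((i + 1) * LL - 1); s = stepf c (j div K) in j div K * K + j mod K div s * s)"
definition sublenf :: "bool \<Rightarrow> nat \<Rightarrow> nat" where
  "sublenf c i = (let q = subf c i;
     r = cut c S (min (q + stepf c (q div K)) (q div K * K + K)) - cut c S q in r * of_bool (r < K * K))"
definition dir1f :: "nat \<Rightarrow> bool" where
  "dir1f x = bit (occ True S ((x div fn + 1) * (L * L))) (x mod fn)"
definition dir2f :: "nat \<Rightarrow> bool" where
  "dir2f x = bit (occ True S ((x div f2 + 1) * L) - occ True S (x div f2 div L * (L * L))) (x mod f2)"
definition rtabf :: "nat \<Rightarrow> bool" where
  "rtabf x = (let l = x div RA + 1; y = x mod RA; e = y div fh
     in bit (popc (h + H) (e div l mod 2 ^ (e mod l + 1))) (y mod fh))"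
definition seldirf :: "bool \<Rightarrow> nat \<Rightarrow> bool" where
  "seldirf c x = bit (cut c S ((x div fn + 1) * K) - 1) (x mod fn)"
definition longf :: "bool \<Rightarrow> nat \<Rightarrow> bool" where
  "longf c x = (let z = x div fn; q = occf c ((z + 1) * K - 1) div K * K
     in bit (cut c S (q + (z - cut c S q div K) + 1) - 1) (x mod fn))"
definition subdirf :: "bool \<Rightarrow> nat \<Rightarrow> bool" where
  "subdirf c x = (let k = x div A2; y = x mod A2; b = floorlog 2 (lenf c k)
     in bit (cut c S (k * K + min ((y div b + 1) * stepf c k) K) - 1 - cut c S (k * K)) (y mod b))"
definition subansf :: "bool \<Rightarrow> nat \<Rightarrow> bool" where
  "subansf c x = (let k = x div 2; q = subf c k; b = floorlog 2 (sublenf c k);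
       y = x - 2 * (cut c S q div LL)
     in bit (cut c S (q + y div b + 1) - 1 - cut c S q) (y mod b))"
definition sel_list :: "nat \<Rightarrow> nat" where
  "sel_list j = sel_entry H (j div H) (j mod H)"
definition seltabf :: "bool \<Rightarrow> nat \<Rightarrow> bool" where
  "seltabf c x = (let l = x div SA + 1; y = x mod SA; b = floorlog 2 l; e = y div b; v = e div l mod 2 ^ l
     in bit (sel_list ((if c then v else 2 ^ l - 1 - v) * H + e mod l)) (y mod b))"

definition FA :: "nat \<Rightarrow> nat \<Rightarrow> nat" where
  "FA a = [bt, floorlog 2, lg, popc (h + H), sel_list,
     \<lambda>j. occ True S (j * L) - occ True S ((j - 1) * L), \<lambda>j. occ True S (j * L),
     occf True, occf False, cut True S, cut False S, lenf True, lenf False, subf True, subf False,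
     sublenf True, sublenf False, of_bool \<circ> dir1f, of_bool \<circ> dir2f, of_bool \<circ> rtabf,
     of_bool \<circ> seldirf True, of_bool \<circ> longf True, of_bool \<circ> subdirf True, of_bool \<circ> subansf True,
     of_bool \<circ> seltabf True,
     of_bool \<circ> seldirf False, of_bool \<circ> longf False, of_bool \<circ> subdirf False, of_bool \<circ> subansf False,
     of_bool \<circ> seltabf False] ! a"

definition NA :: "nat \<Rightarrow> nat" where
  "NA a = [nb * L, M, M, 2 ^ (h + H), 2 ^ H * H, nb + 1, nb + 1, nb * L, nb * L, X, X,
     n div K + 1, n div K + 1, n div LL, n div LL, n div LL, n div LL,
     n div (L * L) * fn, n div L * f2, h * RA,
     (n div K + 1) * fn, (n div K + 1) * fn, (n div K + 1) * A2, 2 * (n div LL), H * SA,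
     (n div K + 1) * fn, (n div K + 1) * fn, (n div K + 1) * A2, 2 * (n div LL), H * SA] ! a"

lemma FA_simps [simp]:
  "FA 0 = bt" "FA (Suc 0) = floorlog 2" "FA 1 = floorlog 2" "FA 2 = lg" "FA 3 = popc (h + H)" "FA 4 = sel_list"
  "FA 5 = (\<lambda>j. occ True S (j * L) - occ True S ((j - 1) * L))" "FA 6 = (\<lambda>j. occ True S (j * L))"
  "FA 7 = occf True" "FA 8 = occf False" "FA 9 = cut True S" "FA 10 = cut False S"
  "FA 11 = lenf True" "FA 12 = lenf False" "FA 13 = subf True" "FA 14 = subf False"
  "FA 15 = sublenf True" "FA 16 = sublenf False"
  "FA 17 = of_bool \<circ> dir1f" "FA 18 = of_bool \<circ> dir2f" "FA 19 = of_bool \<circ> rtabf"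
  "FA 20 = of_bool \<circ> seldirf True" "FA 21 = of_bool \<circ> longf True" "FA 22 = of_bool \<circ> subdirf True"
  "FA 23 = of_bool \<circ> subansf True" "FA 24 = of_bool \<circ> seltabf True"
  "FA 25 = of_bool \<circ> seldirf False" "FA 26 = of_bool \<circ> longf False" "FA 27 = of_bool \<circ> subdirf False"
  "FA 28 = of_bool \<circ> subansf False" "FA 29 = of_bool \<circ> seltabf False"
  by (simp_all add: FA_def)

lemma NA_simps [simp]:
  "NA 0 = nb * L" "NA (Suc 0) = M" "NA 1 = M" "NA 2 = M" "NA 3 = 2 ^ (h + H)" "NA 4 = 2 ^ H * H"
  "NA 5 = nb + 1" "NA 6 = nb + 1" "NA 7 = nb * L" "NA 8 = nb * L" "NA 9 = X" "NA 10 = X"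
  "NA 11 = n div K + 1" "NA 12 = n div K + 1" "NA 13 = n div LL" "NA 14 = n div LL" "NA 15 = n div LL"
  "NA 16 = n div LL"
  "NA 17 = n div (L * L) * fn" "NA 18 = n div L * f2" "NA 19 = h * RA"
  "NA 20 = (n div K + 1) * fn" "NA 21 = (n div K + 1) * fn" "NA 22 = (n div K + 1) * A2"
  "NA 23 = 2 * (n div LL)" "NA 24 = H * SA"
  "NA 25 = (n div K + 1) * fn" "NA 26 = (n div K + 1) * fn" "NA 27 = (n div K + 1) * A2"
  "NA 28 = 2 * (n div LL)" "NA 29 = H * SA"
  by (simp_all add: NA_def)

lemma nbL: "n + K < nb * L"
proof -
  have "n < n div L * L + L" using dividend_less_div_times[of L n] by simp
  then show ?thesis by (simp add: nb_def K_def algebra_simps)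
qed

lemma occf_le: "occf c j \<le> j"
  using occ_le[of True S j] by (simp add: occf_def)

lemma lenf_less: "lenf c k < M"
  by (auto simp: lenf_def Let_def M_def)

lemma sublenf_less: "sublenf c k < M"
  by (auto simp: sublenf_def Let_def M_def)

lemma cut_le_n: "cut c S j \<le> n"
  using cut_le_length[of c S j] lenS by simp

lemma lenf_le: "lenf c k \<le> n"
  using cut_le_n[of c "k * K + K"] by (auto simp: lenf_def Let_def)

lemma sublenf_le: "sublenf c k \<le> n"
  unfolding sublenf_def Let_def
  using le_trans[OF diff_le_self cut_le_n] by (auto simp: of_bool_def)

lemma subf_le: "subf c i \<le> occf c ((i + 1) * LL - 1)"
proof -
  let ?j = "occf c ((i + 1) * LL - 1)"
  have "?j div K * K + ?j mod K div s * s \<le> ?j div K * K + ?j mod K" for s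
    by (intro add_left_mono) (simp add: div_times_less_eq_dividend)
  then show ?thesis by (simp add: subf_def Let_def)
qed

lemma subf_less: "i < n div LL \<Longrightarrow> subf c i < n"
proof -
  assume "i < n div LL"
  then have "(i + 1) * LL \<le> n"
    by (metis Suc_eq_plus1 Suc_leI div_times_less_eq_dividend le_trans mult_le_mono1)
  then show ?thesis using subf_le[of c i] occf_le[of c "(i + 1) * LL - 1"] L_pos(2)
    by (cases "LL") auto
qed

lemma FA_less:
  assumes a: "a < narrs" and i: "i < NA a"
  shows "FA a i < 2 ^ u"
proof -
  have nu: "n < 2 ^ u" using pv_less[of 1] by simp
  have Mu: "M < 2 ^ u" using pv_less[of 11] by simp
  have hHu: "h + H < 2 ^ u" using pv_less[of 9] by simp
  have Hu: "H < 2 ^ u" using pv_less[of 7] by simp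
  have oc: "occ True S j \<le> n" for j using occ_le_count[of True S j] count_le_length'[of S True] lenS by simp
  have oc': "occ True S j - k < 2 ^ u" "occ True S j < 2 ^ u" for j k using oc[of j] nu by auto
  have of: "occf c j < 2 ^ u" if "j < nb * L" for c j
  proof -
    have "bnd 4 (nb * L)" by (rule bnd_mono[OF bnd_mult[OF bnd_basic(11,2)]]) simp
    then have "nb * L < 2 ^ u" by (rule bnd_u) simp
    then show ?thesis using occf_le[of c j] that by simp
  qed
  have lgu: "lg j < 2 ^ u" if "j < M" for j
  proof (cases "j = 0")
    case True
    then have "lg j = 1" by (simp add: lg_floorlog floorlog_def)
    then show ?thesis using u_large one_less_power[of "2::nat" u] by simp
  next
    case False
    then have "lg j \<le> j" by (intro lg_le_self) simp
    then show ?thesis using that Mu by linarith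
  qed
  have b1: "of_bool P < (2::nat) ^ u" for P
    using u_large one_less_power[of "2::nat" u] by (cases P) simp_all
  have s: "subf c i < 2 ^ u" if "i < n div LL" for c i using subf_less[OF that] nu by (rule less_trans)
  have c: "cut c S j < 2 ^ u" "lenf c j < 2 ^ u" "sublenf c j < 2 ^ u" for c j
    using cut_le_n[of c j] lenf_le[of c j] sublenf_le[of c j] nu by auto
  have p: "popc (h + H) j < 2 ^ u" "floorlog 2 k < 2 ^ u" if "k < M" for j k
    using popc_le[of "h + H" j] hHu floorlog_le[of k] that Mu by auto
  have se: "sel_list j < 2 ^ u" for j using sel_entry_less[OF L_pos(4)] Hu by (auto simp: sel_list_def intro: less_trans)
  have pp: "popc (h + H) j < 2 ^ u" for j using popc_le[of "h + H" j] hHu by simp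
  have "list_all (\<lambda>a. \<forall>i < NA a. FA a i < 2 ^ u) [2..<narrs]"
    using b1 oc' of lgu s c p pp se by simp
  then have "\<forall>a \<in> set [2..<narrs]. \<forall>i < NA a. FA a i < 2 ^ u" by (simp only: list_all_iff)
  moreover have "(a = 0 \<or> a = 1) \<or> a \<in> set [2..<narrs]"
    unfolding set_upt atLeastLessThan_iff using a by linarith
  moreover have "FA a i < 2 ^ u" if "a = 0 \<or> a = 1" using that b1 p i by (auto simp: bt_def)
  ultimately show ?thesis using i by blast
qed

sublocale bb: block_builder w u n pv NA FA m0
proof
  show "8 \<le> u" using u_large by simp
  show "max_deg * u \<le> w" by (rule w_ge)
  show "m0 p < 2 ^ w" for p using valid0 by (simp add: valid_mem_def)
  have "WA 0 \<le> WA s" for s by (induction s) auto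
  from this[of 13] show "n \<le> pv tbase" using pv_WA[of 13] by simp
  show "NA (17 + s) = pv (size_reg s)" if "s < 13" for s
    by (rule all_less_13[OF _ that]) (auto simp: size_reg_def)
  show "FA (17 + s) x \<le> 1" if "s < 13" "x < NA (17 + s)" for s x
  proof -
    have "\<forall>x. FA (17 + s) x \<le> 1" by (rule all_less_13[OF _ that(1)]) auto
    then show ?thesis by blast
  qed
qed (use pv_less FA_less WA_Suc' in auto)

end

context layout
begin

section \<open>Each step reproduces its closed form\<close>

lemma L_nonzero [simp]: "L \<noteq> 0" "LL \<noteq> 0" "K \<noteq> 0" "H \<noteq> 0" "h \<noteq> 0"
  using L_pos by (metis less_not_refl)+

lemma u_bounds: "h < u" "H < u" "h + H < u" "L + 2 < u" "2 < (2::nat) ^ u" "1 < (2::nat) ^ u" "0 < u"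
proof -
  have "8192 * L \<le> u" using u_ge by (simp add: word_factor_def)
  then show "h < u" "H < u" "h + H < u" "L + 2 < u" "0 < u" using h_le H_le L_pos(1) by linarith+
  have "(2::nat) ^ 1 < 2 ^ u" using u_large by (intro power_strict_increasing) auto
  then show "2 < (2::nat) ^ u" by simp
  then show "1 < (2::nat) ^ u" by linarith
qed

lemma num_less: "k < 4096 \<Longrightarrow> k < (2::nat) ^ u"
proof -
  assume "k < 4096"
  also have "(4096::nat) = 2 ^ 12" by simp
  also have "\<dots> \<le> 2 ^ u" using u_large by (intro power_increasing) auto
  finally show ?thesis .
qed

lemma num_less' [simp]: "0 < (2::nat) ^ u" "Suc 0 < (2::nat) ^ u" "2 < (2::nat) ^ u" "4 < (2::nat) ^ u"
  "5 < (2::nat) ^ u" "16 < (2::nat) ^ u" "64 < (2::nat) ^ u"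
  using num_less by auto

lemma L_sum: "floorlog 2 (n - Suc 0) + of_bool (floorlog 2 (n - Suc 0) = 0) = L"
  "floorlog 2 (L - Suc 0) + of_bool (floorlog 2 (L - Suc 0) = 0) = LL"
  using L_eq LL_eq by auto

lemma rstep_ok:
  assumes "2 \<le> x" "x < nregs"
  shows "small (rexp (rsteps ! x)) \<and> good u (bb.renv x) (rexp (rsteps ! x)) \<and> rval (bb.renv x) (rsteps ! x) = pv x"
proof (cases "x < 32")
  case True
  have "list_all (\<lambda>x. small (rexp (rsteps ! x)) \<and> good u (bb.renv x) (rexp (rsteps ! x)) \<and>
      rval (bb.renv x) (rsteps ! x) = pv x) [2..<32]"
    using u_bounds L_sum
    by (simp add: rsteps_def bb.renv_def small_def max_deg_def max_ops_def K_def H_def h_def M_def nb_def fn_def f2_def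
        fh_def fH_def RA_def SA_def X_def A2_def)
  moreover have "x \<in> set [2..<32]" unfolding set_upt atLeastLessThan_iff using assms True by simp
  ultimately show ?thesis by (simp only: list_all_iff)
next
  case False
  define s where "s = x - 32"
  have s: "x = 32 + s" "s < 13" using False assms by (auto simp: s_def)
  have "rsteps ! x = Val (Var (31 + s) +! Var (size_reg s) div! Var 0 +! Num 1)"
    unfolding s(1) using s(2) by (simp add: rsteps_def nth_append)
  moreover have "size_reg s < 31" by (rule size_reg_less[OF s(2)])
  ultimately show ?thesis
    using WA_Suc'[OF s(2)] unfolding s(1)
    by (simp add: bb.renv_def small_def max_deg_def max_ops_def)
qed

lemma NA_le: "a < narrs \<Longrightarrow> NA a \<le> 2 ^ u"
proof -
  assume a: "a < narrs"
  have d: "bnd 1 (n div k)" for k by (rule bnd_le[OF bnd_basic(1) div_le_dividend])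
  have d1: "bnd 2 (n div k + 1)" for k by (rule bnd_mono[OF bnd_add[OF d bnd_num[of 1 0]]]) auto
  have nbL: "bnd 4 (nb * L)" by (rule bnd_mono[OF bnd_mult[OF bnd_basic(11,2)]]) simp
  have nb1: "bnd 4 (nb + 1)" by (rule bnd_mono[OF bnd_add[OF bnd_basic(11) bnd_num[of 1 0]]]) auto
  have HH: "bnd 1034 (2 ^ H * H)" by (rule bnd_mono[OF bnd_mult[OF bnd_basic(8,5)]]) simp
  have "list_all (\<lambda>a. bnd 1054 (NA a)) [2..<narrs]"
    using d[THEN bnd_mono, of 1054] d1[THEN bnd_mono, of 1054] nbL[THEN bnd_mono, of 1054]
      nb1[THEN bnd_mono, of 1054] HH[THEN bnd_mono, of 1054] bnd_basic[THEN bnd_mono, of 1054] size_bnd by simp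
  then have "\<forall>a \<in> set [2..<narrs]. bnd 1054 (NA a)" by (simp only: list_all_iff)
  moreover have "(a = 0 \<or> a = 1) \<or> a \<in> set [2..<narrs]"
    unfolding set_upt atLeastLessThan_iff using a by linarith
  moreover have "bnd 1054 (NA a)" if "a = 0 \<or> a = 1"
    using that nbL[THEN bnd_mono, of 1054] bnd_basic(10)[THEN bnd_mono, of 1054] by auto
  ultimately have "bnd 1054 (NA a)" by blast
  then show ?thesis using bnd_u[of 1054 "NA a"] by simp
qed

lemmas small_simps = small_def max_deg_def max_ops_def

lemma small_0: "small (Num k)" "small (Var x)"
  by (simp_all add: small_simps)

lemma gather_ok:
  assumes a: "a < narrs" and sm: "small k" "small e"
    and k: "good u (bb.renv nregs) k" "aeval (bb.renv nregs) k = NA a"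
    and e: "\<And>x. x < NA a \<Longrightarrow> good u (bb.aenv a (\<lambda>_. False) (\<lambda>_. 0) x 0) e \<and>
      aeval (bb.aenv a (\<lambda>_. False) (\<lambda>_. 0) x 0) e = FA a x"
  shows "\<exists>F G. bb.step_ok a (gather k e) (NA a) 0 0 F G"
  unfolding bb.step_ok_def Let_def gather_def
  by (rule exI[of _ "\<lambda>_ j. j < NA a"], rule exI[of _ "\<lambda>_ j. FA a j"])
    (use assms small_0 NA_le[OF a] FA_less[OF a] in \<open>auto simp: bb.aenv_def bb.renv_def inj_on_def\<close>)

text \<open>The common case of \<open>step_ok\<close>: the initial store already fills the whole
  array, so all cells are meaningful throughout and only their values evolve.\<close>

lemma update_ok:
  fixes G :: "nat \<Rightarrow> nat \<Rightarrow> nat"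
  assumes a: "a < narrs" and sm: "small k" "small e" "small b" "small k'" "small g" "small ix" "small v"
    and k: "good u (bb.renv nregs) k" "aeval (bb.renv nregs) k = NA a"
    and b: "good u (bb.renv nregs) b" "aeval (bb.renv nregs) b = NB" "NB < 2 ^ u"
    and k': "good u (bb.renv nregs) k'" "aeval (bb.renv nregs) k' = Nk" "Nk \<le> 2 ^ u"
    and e: "\<And>x. x < NA a \<Longrightarrow> good u (bb.aenv a (\<lambda>_. False) (\<lambda>_. 0) x 0) e \<and>
      aeval (bb.aenv a (\<lambda>_. False) (\<lambda>_. 0) x 0) e = G 0 x"
    and g: "\<And>t x. t < NB \<Longrightarrow> x < Nk \<Longrightarrow> good u (bb.aenv a (\<lambda>j. j < NA a) (G t) x t) g \<and>
      aeval (bb.aenv a (\<lambda>j. j < NA a) (G t) x t) g = of_bool (gd t x)"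
    and v: "\<And>t x. t < NB \<Longrightarrow> x < Nk \<Longrightarrow> gd t x \<Longrightarrow>
      good u (bb.aenv a (\<lambda>j. j < NA a) (G t) x t) ix \<and> good u (bb.aenv a (\<lambda>j. j < NA a) (G t) x t) v \<and>
      aeval (bb.aenv a (\<lambda>j. j < NA a) (G t) x t) ix = ad t x \<and>
      aeval (bb.aenv a (\<lambda>j. j < NA a) (G t) x t) v = G (Suc t) (ad t x)"
    and inj: "\<And>t. t < NB \<Longrightarrow> inj_on (ad t) {x. x < Nk \<and> gd t x}"
    and step: "\<And>t j. t < NB \<Longrightarrow> j < NA a \<Longrightarrow> (\<exists>x < Nk. gd t x \<and> ad t x = j) \<or> G (Suc t) j = G t j"
    and bd: "\<And>t j. t \<le> NB \<Longrightarrow> j < NA a \<Longrightarrow> G t j < 2 ^ u"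
    and fin: "\<And>j. j < NA a \<Longrightarrow> G NB j = FA a j"
  shows "\<exists>F G. bb.step_ok a (update k e b k' g ix v) (NA a) NB Nk F G"
proof (intro exI)
  let ?E = "\<lambda>t x. bb.aenv a (\<lambda>j. j < NA a) (G t) x t"
  have I: "inj_on (\<lambda>x. aeval (?E t x) ix) {x. x < Nk \<and> aeval (?E t x) g \<noteq> 0}" if t: "t < NB" for t
  proof (rule inj_onI)
    fix x y assume xy: "x \<in> {x. x < Nk \<and> aeval (?E t x) g \<noteq> 0}" "y \<in> {x. x < Nk \<and> aeval (?E t x) g \<noteq> 0}"
      and eq: "aeval (?E t x) ix = aeval (?E t y) ix"
    then have "x < Nk \<and> gd t x" "y < Nk \<and> gd t y" using g[OF t] by auto
    moreover from this have "ad t x = ad t y" using eq v[OF t, of x] v[OF t, of y] by auto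
    ultimately show "x = y" using inj[OF t] by (auto dest: inj_onD)
  qed
  have St: "(\<exists>x < Nk. aeval (?E t x) g \<noteq> 0 \<and> aeval (?E t x) ix = j) \<or> j < NA a \<and> G (Suc t) j = G t j"
    if t: "t < NB" and j: "j < NA a" for t j
  proof -
    from step[OF t j] show ?thesis
    proof
      assume "\<exists>x < Nk. gd t x \<and> ad t x = j"
      then obtain x where x: "x < Nk" "gd t x" "ad t x = j" by blast
      then have "aeval (?E t x) g \<noteq> 0 \<and> aeval (?E t x) ix = j" using g[OF t x(1)] v[OF t x(1,2)] by simp
      then show ?thesis using x(1) by blast
    qed (use j in simp)
  qed
  have V: "good u (?E t x) g \<and> (aeval (?E t x) g \<noteq> 0 \<longrightarrow> good u (?E t x) ix \<and> good u (?E t x) v \<and>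
      aeval (?E t x) v = G (Suc t) (aeval (?E t x) ix))" if "t < NB" "x < Nk" for t x
    using g[OF that] v[OF that] by auto
  have I0: "aeval (bb.aenv a (\<lambda>_. False) (\<lambda>_. 0) x 0) (Var ireg) = x"
    "good u (bb.aenv a (\<lambda>_. False) (\<lambda>_. 0) x 0) (Var ireg)"
    "regok (bb.aenv a (\<lambda>_. False) (\<lambda>_. 0) x 0) ireg" for x
    by (simp_all add: bb.aenv_def)
  show "bb.step_ok a (update k e b k' g ix v) (NA a) NB Nk (\<lambda>_ j. j < NA a) G"
    unfolding bb.step_ok_def Let_def update_def astep.simps I0
    using sm small_0 k b k' e V I St bd fin NA_le[OF a] by (auto simp: inj_on_def I0)
qed

lemma occ_bt: "occ True S (Suc i) = occ True S i + bt i"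
  using occ_Suc[of i S True] occ_ge[of S i True] occ_ge[of S "Suc i" True] lenS
  by (cases "i < n") (auto simp: bt_def)

lemma FA_c: "FA (7 + cx c) = occf c" "FA (9 + cx c) = cut c S" "FA (11 + cx c) = lenf c"
  "FA (13 + cx c) = subf c" "FA (15 + cx c) = sublenf c"
  by (cases c; simp add: cx_def)+

lemma lt_div_le: "e < n div d \<Longrightarrow> (e + 1) * d \<le> n" for e d :: nat
  by (metis Suc_eq_plus1 Suc_leI div_times_less_eq_dividend le_trans mult_le_mono1)

lemma lt_div_le': "e < n div d + 1 \<Longrightarrow> (e + 1) * d \<le> n + d" for e d :: nat
proof -
  assume "e < n div d + 1"
  then have "e * d \<le> n div d * d" by (intro mult_le_mono1) simp
  then have "e * d \<le> n" using div_times_less_eq_dividend[of n d] by (rule le_trans)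
  then show ?thesis by simp
qed

lemma bits_ok: "\<exists>F G. bb.step_ok 0 bits_a (nb * L) 1 n F G"
proof -
  define G :: "nat \<Rightarrow> nat \<Rightarrow> nat" where "G = (\<lambda>t j. if t = 0 then 0 else bt j)"
  have f: "field w m0 i (Suc 0) = bt i" if "i < n" for i
    using that seqS lenS unfolding holds_seq_def field_def bt_def by simp
  have nu: "n < 2 ^ u" using pv_less[of 1] by simp
  have "\<exists>F G. bb.step_ok 0 (update (Var 12 *! Var 3) (Num 0) (Num 1) (Var 1) (Num 1) I_e (Fld I_e (Num 1)))
      (NA 0) 1 n F G"
  proof (rule update_ok[where G = G and gd = "\<lambda>_ _. True" and ad = "\<lambda>_ x. x"])
    fix t j show "(\<exists>x < n. True \<and> x = j) \<or> G (Suc t) j = G t j"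
      by (cases "j < n") (auto simp: G_def bt_def)
  qed (use f u_bounds nu in \<open>auto simp: small_simps bb.renv_def bb.aenv_def G_def bt_def\<close>)
  then show ?thesis unfolding bits_a_def by simp
qed

text \<open>A shift by \<open>s\<close> leaves something exactly if \<open>2 ^ s \<le> x\<close>,
  that is, if \<open>s\<close> is below the bit length.\<close>

lemma flog_sum: "x < 2 ^ k \<Longrightarrow> (\<Sum>s < k. of_bool (0 < x div 2 ^ s)) = floorlog 2 x" for x :: nat
proof -
  assume x: "x < 2 ^ k"
  have s: "0 < x div 2 ^ s \<longleftrightarrow> s < floorlog 2 x" for s
  proof -
    have "0 < x div 2 ^ s \<longleftrightarrow> 2 ^ s \<le> x" by (simp add: div_greater_zero_iff)
    also have "\<dots> \<longleftrightarrow> s < floorlog 2 x"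
    proof
      assume "2 ^ s \<le> x"
      then have "(2::nat) ^ s < 2 ^ floorlog 2 x" using less_exp_floorlog[of x] by linarith
      then show "s < floorlog 2 x" by simp
    next
      assume sl: "s < floorlog 2 x"
      then have "0 < x" by (cases "x = 0") (simp_all add: floorlog_def)
      then have "2 ^ (floorlog 2 x - 1) \<le> x" using floorlog_bounds[of x 2] by simp
      moreover have "(2::nat) ^ s \<le> 2 ^ (floorlog 2 x - 1)" using sl by (intro power_increasing) auto
      ultimately show "2 ^ s \<le> x" by linarith
    qed
    finally show ?thesis .
  qed
  have "floorlog 2 x \<le> k" using x by (rule floorlog_le_if)
  then have "{..<k} \<inter> {s. s < floorlog 2 x} = {..<floorlog 2 x}" by auto
  then show ?thesis unfolding s by (simp add: of_bool_def sum.If_cases)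
qed

lemma flog_ok: "\<exists>F G. bb.step_ok 1 flog_a M w M F G"
proof -
  define G :: "nat \<Rightarrow> nat \<Rightarrow> nat" where "G = (\<lambda>t j. \<Sum>s < t. of_bool (0 < j div 2 ^ s))"
  have Mw: "M < 2 ^ w" and Mu: "M < 2 ^ u"
    using pv_less[of 11] bb.u_le_w by (auto intro: less_le_trans)
  have G0: "G 0 j = 0" for j by (simp add: G_def)
  have GS: "G (Suc t) j = G t j + of_bool (0 < j div 2 ^ t)" for t j
    unfolding G_def by (rule sum.lessThan_Suc)
  have fin: "G w j = floorlog 2 j" if "j < M" for j using flog_sum[of j w] that Mw by (simp add: G_def)
  have bd: "G t j < 2 ^ u" if "t \<le> w" "j < M" for t j
  proof -
    have "G t j \<le> G w j" unfolding G_def using that by (intro sum_mono2) auto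
    also have "\<dots> \<le> j" using fin[OF that(2)] floorlog_le[of j] by simp
    finally show ?thesis using that Mu by simp
  qed
  have "\<exists>F G. bb.step_ok 1 (update (Var 11) (Num 0) (Var 0) (Var 11) (Num 1) I_e
     (Arr 1 I_e +! (Num 0 <! Bin ShiftR I_e t_e))) (NA 1) w M F G"
    by (rule update_ok[where G = G and gd = "\<lambda>_ _. True" and ad = "\<lambda>_ x. x"])
      (use fin bd u_bounds Mu w_less G0 GS in \<open>auto simp: small_simps bb.renv_def bb.aenv_def\<close>)
  then show ?thesis unfolding flog_a_def by simp
qed

lemma lg_sum: "lg x = floorlog 2 (x - 1) + of_bool (floorlog 2 (x - 1) = 0)"
  unfolding lg_floorlog by auto

lemma lg_ok: "\<exists>F G. bb.step_ok 2 lg_a (NA 2) 0 0 F G"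
  unfolding lg_a_def
  by (rule gather_ok) (use lg_sum in \<open>auto simp: small_simps bb.renv_def bb.aenv_def\<close>)

lemma popc_ok: "\<exists>F G. bb.step_ok 3 popc_a (2 ^ (h + H)) (h + H) (2 ^ (h + H)) F G"
proof -
  have hH: "h + H < 2 ^ u" using pv_less[of 9] by simp
  have bd: "popc t j < 2 ^ u" if "t \<le> h + H" for t j using popc_le[of t j] that hH by simp
  have "\<exists>F G. bb.step_ok 3 (update (Var 19) (Num 0) (Var 9) (Var 19) (Num 1) I_e (Arr 3 I_e +! bit_e I_e t_e))
      (NA 3) (h + H) (2 ^ (h + H)) F G"
    by (rule update_ok[where G = popc and gd = "\<lambda>_ _. True" and ad = "\<lambda>_ x. x"])
      (use bd hH NA_le[of 3] u_bounds in \<open>auto simp: small_simps bb.renv_def bb.aenv_def popc_def simp del: sum_of_bool_eq\<close>)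
  then show ?thesis unfolding popc_a_def by simp
qed

lemma popc_strict: "s < s' \<Longrightarrow> bit v s \<Longrightarrow> popc s v < popc s' v"
proof -
  assume s: "s < s'" "bit v s"
  have "popc s v < popc (Suc s) v" using s by (simp add: popc_def)
  also have "\<dots> \<le> popc s' v" unfolding popc_def using s by (intro sum_mono2) auto
  finally show ?thesis .
qed

lemma sel_ok: "\<exists>F G. bb.step_ok 4 sel_a (2 ^ H * H) 1 (2 ^ H * H) F G"
proof -
  define G :: "nat \<Rightarrow> nat \<Rightarrow> nat" where "G = (\<lambda>t j. if t = 0 then 0 else sel_list j)"
  define ad where "ad = (\<lambda>x. x div H * H + popc (x mod H) (x div H))"
  define gd where "gd = (\<lambda>x. bit (x div H) (x mod H))"
  have mH: "x mod H < H" for x using L_pos(4) by simp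
  have pe: "popc (h + H) (x div H mod 2 ^ (x mod H)) = popc (x mod H) (x div H)" for x
    by (rule popc_take_bit) (use mH[of x] in linarith)
  have pl: "x div H mod 2 ^ (x mod H) < 2 ^ (h + H)" for x
  proof -
    have "x div H mod 2 ^ (x mod H) < 2 ^ (x mod H)" by simp
    also have "\<dots> \<le> 2 ^ (h + H)" using less_imp_le[OF mH[of x]] by (intro power_increasing trans_le_add2) auto
    finally show ?thesis .
  qed
  have pH: "popc (x mod H) (x div H) < H" for x using popc_le[of "x mod H" "x div H"] mH[of x] by linarith
  have ad_dm: "ad x div H = x div H" "ad x mod H = popc (x mod H) (x div H)" for x
    using pH[of x] by (simp_all add: ad_def)
  have sl: "sel_list (ad x) = x mod H" if "gd x" for x
  proof -
    have l: "x mod H < length (bitstring H (x div H))" using mH by simp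
    moreover have b: "bitstring H (x div H) ! (x mod H) = True" using that mH by (simp add: gd_def)
    ultimately have "select True (bitstring H (x div H)) (occ True (bitstring H (x div H)) (x mod H) + 1) = x mod H"
      by (rule select_unique)
    moreover have "occ True (bitstring H (x div H)) (x mod H) = popc (x mod H) (x div H)"
      by (rule occ_bitstring) (use mH[of x] in linarith)
    moreover have "popc (x mod H) (x div H) < popc H (x div H)"
      using popc_strict[OF mH[of x]] that by (simp add: gd_def)
    ultimately show ?thesis unfolding sel_list_def ad_dm by (simp add: sel_entry_def)
  qed
  \<comment> \<open>A slot determines its writer: the row is preserved, and the value stored in the
    slot is the bit position.\<close>
  have inj: "inj_on ad {x. x < 2 ^ H * H \<and> gd x}"
  proof (rule inj_onI)
    fix x y assume xy: "x \<in> {x. x < 2 ^ H * H \<and> gd x}" "y \<in> {x. x < 2 ^ H * H \<and> gd x}" and eq: "ad x = ad y"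
    have "x div H = y div H" using ad_dm(1)[of x] ad_dm(1)[of y] eq by simp
    moreover have "x mod H = y mod H" using sl[of x] sl[of y] xy eq by simp
    ultimately show "x = y" by (metis div_mult_mod_eq)
  qed
  \<comment> \<open>A slot claimed by no bit lies beyond the set bits of its row, where the initial
    0 is the required padding.\<close>
  have cover: "(\<exists>x < 2 ^ H * H. gd x \<and> ad x = j) \<or> sel_list j = 0" if j: "j < 2 ^ H * H" for j
  proof (cases "j mod H < popc H (j div H)")
    case True
    let ?B = "bitstring H (j div H)" and ?p = "select True (bitstring H (j div H)) (j mod H + 1)"
    have "count_list ?B True = popc H (j div H)" using occ_bitstring[of H H "j div H"] by (simp add: occ_ge)
    then have 1: "1 \<le> j mod H + 1" "j mod H + 1 \<le> count_list ?B True" using True by auto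
    have p: "?p < H" "bit (j div H) ?p" "popc ?p (j div H) = j mod H"
      using select_less[OF 1] nth_select[OF 1] occ_select[OF 1] occ_bitstring[of ?p H "j div H"] by auto
    define x where "x = j div H * H + ?p"
    have x: "x div H = j div H" "x mod H = ?p" using p(1) by (simp_all add: x_def)
    have "x < 2 ^ H * H"
    proof -
      have "j div H < 2 ^ H" using j by (simp add: less_mult_imp_div_less)
      then have "(j div H + 1) * H \<le> 2 ^ H * H" by (intro mult_le_mono1) simp
      then show ?thesis using p(1) by (simp add: x_def)
    qed
    moreover have "gd x" using p(2) x by (simp add: gd_def)
    moreover have "ad x = j" unfolding ad_def x using p(3) by simp
    ultimately show ?thesis by blast
  qed (simp add: sel_list_def sel_entry_def)
  have Hu: "H < 2 ^ u" using pv_less[of 7] by simp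
  have sb: "sel_list j < 2 ^ u" for j using sel_entry_less[OF L_pos(4)] Hu by (auto simp: sel_list_def intro: less_trans)
  have mu: "x mod H < u" for x using mH[of x] u_bounds(2) by linarith
  have "\<exists>F G. bb.step_ok 4 (update (Var 18 *! Var 7) (Num 0) (Num 1) (Var 18 *! Var 7)
     (bit_e (I_e div! Var 7) (I_e mod! Var 7))
     (I_e div! Var 7 *! Var 7 +! Arr 3 (I_e div! Var 7 mod! Pow2 (I_e mod! Var 7)))
     (I_e mod! Var 7)) (NA 4) 1 (2 ^ H * H) F G"
  proof (rule update_ok[where G = G and gd = "\<lambda>_. gd" and ad = "\<lambda>_. ad"])
    fix t j :: nat assume "t < 1" "j < NA 4"
    then show "(\<exists>x < 2 ^ H * H. gd x \<and> ad x = j) \<or> G (Suc t) j = G t j"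
      using cover[of j] by (simp add: G_def)
  next
    fix t show "inj_on ad {x. x < 2 ^ H * H \<and> gd x}" by (rule inj)
  qed (use u_bounds mu pe pl sl sb NA_le[of 4] in \<open>auto simp: small_simps bb.renv_def bb.aenv_def G_def gd_def ad_def\<close>)
  then show ?thesis unfolding sel_a_def by simp
qed

lemma occ_u: "occ True S j - k < 2 ^ u" "occ True S j < 2 ^ u"
proof -
  have "occ True S j \<le> n" using occ_le_count[of True S j] count_le_length'[of S True] lenS by simp
  then show "occ True S j < 2 ^ u" using pv_less[of 1] by simp
  then show "occ True S j - k < 2 ^ u" by simp
qed

lemma nb_pos: "0 < nb" by (simp add: nb_def)

lemma count_ok: "\<exists>F G. bb.step_ok 5 count_a (nb + 1) L (nb + 1) F G"
proof -
  define G :: "nat \<Rightarrow> nat \<Rightarrow> nat" where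
    "G = (\<lambda>t j. if j = 0 then 0 else occ True S ((j - 1) * L + t) - occ True S ((j - 1) * L))"
  have bd: "G t j < 2 ^ u" for t j by (simp add: G_def occ_u)
  have ix: "(x - 1) * L + t < nb * L" if "x < nb + 1" "t < L" for x t
  proof -
    have "(x - 1 + 1) * L \<le> nb * L" by (rule mult_le_mono1) (use that nb_pos in simp)
    then show ?thesis using that by simp
  qed
  have GS: "G (Suc t) x = G t x + bt ((x - 1) * L + t) * of_bool (0 < x)" for t x
  proof (cases "x = 0")
    case False
    have "occ True S ((x - 1) * L) \<le> occ True S ((x - 1) * L + t)" by (rule occ_mono) simp
    then show ?thesis using False occ_bt[of "(x - 1) * L + t"] by (simp add: G_def)
  qed (simp add: G_def)
  have fin: "G L j = occ True S (j * L) - occ True S ((j - 1) * L)" for j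
    by (cases j) (auto simp: G_def add.commute)
  have Lu: "L < 2 ^ u" using pv_less[of 3] by simp
  have "\<exists>F G. bb.step_ok 5 (update (Var 12 +! Num 1) (Num 0) (Var 3) (Var 12 +! Num 1) (Num 1) I_e
     (Arr 5 I_e +! Arr 0 ((I_e -! Num 1) *! Var 3 +! t_e) *! (Num 0 <! I_e))) (NA 5) L (nb + 1) F G"
  proof (rule update_ok[where G = G and gd = "\<lambda>_ _. True" and ad = "\<lambda>_ x. x"])
    fix t x assume tx: "t < L" "x < nb + 1"
    then show "good u (bb.aenv 5 (\<lambda>j. j < NA 5) (G t) x t) I_e \<and>
      good u (bb.aenv 5 (\<lambda>j. j < NA 5) (G t) x t) (Arr 5 I_e +! Arr 0 ((I_e -! Num 1) *! Var 3 +! t_e) *! (Num 0 <! I_e)) \<and>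
      aeval (bb.aenv 5 (\<lambda>j. j < NA 5) (G t) x t) I_e = x \<and>
      aeval (bb.aenv 5 (\<lambda>j. j < NA 5) (G t) x t)
        (Arr 5 I_e +! Arr 0 ((I_e -! Num 1) *! Var 3 +! t_e) *! (Num 0 <! I_e)) = G (Suc t) x"
      using ix[OF tx(2,1)] GS[of t x] by (simp add: bb.aenv_def)
  qed (use fin bd Lu NA_le[of 5] in \<open>auto simp: small_simps bb.renv_def bb.aenv_def G_def\<close>)
  then show ?thesis unfolding count_a_def by simp
qed

lemma sum_ok: "\<exists>F G. bb.step_ok 6 sum_a (nb + 1) (L + 2) (nb + 1) F G"
proof -
  \<comment> \<open>After \<open>t\<close> rounds, entry \<open>j\<close> covers the
    \<open>2 ^ t\<close> blocks before it; truncated subtraction stops the window at the start of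
    the sequence.\<close>
  define G :: "nat \<Rightarrow> nat \<Rightarrow> nat" where
    "G = (\<lambda>t j. occ True S (j * L) - occ True S ((j - 2 ^ t) * L))"
  have bd: "G t j < 2 ^ u" for t j by (simp add: G_def occ_u)
  have GS: "G (Suc t) x = G t x + G t (x - 2 ^ t)" for t x
  proof -
    have "occ True S ((x - 2 ^ t) * L) \<le> occ True S (x * L)"
      "occ True S ((x - 2 ^ t - 2 ^ t) * L) \<le> occ True S ((x - 2 ^ t) * L)"
      by (intro occ_mono mult_le_mono1 diff_le_self)+
    moreover have "x - 2 ^ Suc t = x - 2 ^ t - 2 ^ t" by simp
    ultimately show ?thesis unfolding G_def by simp
  qed
  have fin: "G (L + 2) j = occ True S (j * L)" if "j < nb + 1" for j
  proof -
    \<comment> \<open>The extra blocks may push \<open>nb\<close> beyond \<open>2 ^ L\<close>, hence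
      two rounds more than \<open>L\<close>.\<close>
    have "nb \<le> n + L + 1" using LL_le div_le_dividend[of n L] unfolding nb_def by linarith
    also have "\<dots> \<le> 2 ^ L + 2 ^ L" using n_le less_exp[of L] by linarith
    also have "\<dots> \<le> 2 ^ (L + 2)" by simp
    finally have "j \<le> 2 ^ (L + 2)" using that by simp
    then show ?thesis by (simp add: G_def)
  qed
  have Lu: "L + 2 < 2 ^ u" using u_bounds(4) less_exp[of u] by linarith
  have "\<exists>F G. bb.step_ok 6 (update (Var 12 +! Num 1) (Arr 5 I_e) (Var 3 +! Num 2) (Var 12 +! Num 1)
     (Pow2 t_e <! I_e +! Num 1) I_e (Arr 6 I_e +! Arr 6 (I_e -! Pow2 t_e))) (NA 6) (L + 2) (nb + 1) F G"
  proof (rule update_ok[where G = G and gd = "\<lambda>t x. 2 ^ t \<le> x" and ad = "\<lambda>_ x. x"])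
    fix t j assume "t < L + 2" "j < NA 6"
    then show "(\<exists>x < nb + 1. 2 ^ t \<le> x \<and> x = j) \<or> G (Suc t) j = G t j"
      by (cases "2 ^ t \<le> j") (auto simp: G_def)
  next
    fix t x assume tx: "t < L + 2" "x < nb + 1"
    then have t: "t < u" using u_bounds(4) by simp
    show "good u (bb.aenv 6 (\<lambda>j. j < NA 6) (G t) x t) (Pow2 t_e <! I_e +! Num 1) \<and>
        aeval (bb.aenv 6 (\<lambda>j. j < NA 6) (G t) x t) (Pow2 t_e <! I_e +! Num 1) = of_bool (2 ^ t \<le> x)"
      using t by (simp add: bb.aenv_def less_Suc_eq_le)
    show "good u (bb.aenv 6 (\<lambda>j. j < NA 6) (G t) x t) I_e \<and>
      good u (bb.aenv 6 (\<lambda>j. j < NA 6) (G t) x t) (Arr 6 I_e +! Arr 6 (I_e -! Pow2 t_e)) \<and>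
      aeval (bb.aenv 6 (\<lambda>j. j < NA 6) (G t) x t) I_e = x \<and>
      aeval (bb.aenv 6 (\<lambda>j. j < NA 6) (G t) x t) (Arr 6 I_e +! Arr 6 (I_e -! Pow2 t_e)) = G (Suc t) x"
      using t tx GS[of t x] by (simp add: bb.aenv_def)
  next
    fix j assume "j < NA 6"
    then show "G (L + 2) j = FA 6 j" using fin[of j] by simp
  next
    fix x assume "x < NA 6"
    then show "good u (bb.aenv 6 (\<lambda>_. False) (\<lambda>_. 0) x 0) (Arr 5 I_e) \<and>
        aeval (bb.aenv 6 (\<lambda>_. False) (\<lambda>_. 0) x 0) (Arr 5 I_e) = G 0 x"
      by (simp add: bb.aenv_def G_def)
  next
    show "small (Pow2 t_e <! I_e +! Num 1)" "small (Arr 6 I_e +! Arr 6 (I_e -! Pow2 t_e))"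
      by (simp_all add: small_simps)
  qed (use bd Lu NA_le[of 6] in \<open>auto simp: small_simps bb.renv_def\<close>)
  then show ?thesis unfolding sum_a_def by simp
qed

text \<open>All blocks advance in lockstep, so after \<open>t\<close> rounds the meaningful cells
  are those with offset at most \<open>t\<close>. The set of cells grows while the values are final
  from the start; this is why \<open>step_ok\<close> is used directly.\<close>

lemma occ1_ok: "\<exists>F G. bb.step_ok 7 occ1_a nb (L - 1) nb F G"
proof (intro exI)
  let ?F = "\<lambda>t j. j < nb * L \<and> j mod L \<le> t" and ?G = "\<lambda>t. occ True S"
  have ix: "x * L + t < nb * L" "(x * L + t) mod L = t" if "x < nb" "t < L" for x t
  proof -
    have "(x + 1) * L \<le> nb * L" by (rule mult_le_mono1) (use that in simp)
    then show "x * L + t < nb * L" using that by simp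
    show "(x * L + t) mod L = t" using that by simp
  qed
  have nu: "nb \<le> 2 ^ u" "L - 1 < 2 ^ u" using pv_less[of 12] pv_less[of 3] by auto
  have inj: "inj_on (\<lambda>x. x * L + k) A" for A k using L_pos(1) by (auto simp: inj_on_def)
  have inj0: "inj_on (\<lambda>x. x * L) A" for A using L_pos(1) by (auto simp: inj_on_def)
  have dm: "j div L < nb" "j div L * L + j mod L = j" if "j < nb * L" for j
    using that by (simp_all add: less_mult_imp_div_less)
  have sm: "small (Var 12)" "small (I_e *! Var 3)" "small (Arr 6 I_e)" "small (Var 3 -! Num 1)" "small (Num 1)"
    "small (I_e *! Var 3 +! t_e +! Num 1)" "small (Arr 7 (I_e *! Var 3 +! t_e) +! Arr 0 (I_e *! Var 3 +! t_e))"
    by (simp_all add: small_simps)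
  have lp: "t < L" "Suc t < L" if "t < L - 1" for t using that by auto
  have ml: "j mod L \<le> L - Suc 0" for j using mod_less_divisor[OF L_pos(1), of j] by linarith
  show "bb.step_ok 7 occ1_a nb (L - 1) nb ?F ?G"
    unfolding bb.step_ok_def Let_def occ1_a_def astep.simps
  proof (intro conjI allI impI)
    fix j assume "j < nb * L \<and> j mod L \<le> 0"
    then have "j < nb * L" "j mod L = 0" by auto
    then show "\<exists>x<nb. aeval (bb.aenv 7 (\<lambda>_. False) (\<lambda>_. 0) x 0) (I_e *! Var 3) = j"
      using dm[of j] by (intro exI[of _ "j div L"]) (simp add: bb.aenv_def)
  next
    fix t j assume t: "t < L - 1" and j: "j < nb * L \<and> j mod L \<le> Suc t"
    show "(\<exists>x<nb. aeval (bb.aenv 7 (?F t) (?G t) x t) (Num 1) \<noteq> 0 \<and>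
        aeval (bb.aenv 7 (?F t) (?G t) x t) (I_e *! Var 3 +! t_e +! Num 1) = j) \<or>
      (j < nb * L \<and> j mod L \<le> t) \<and> occ True S j = occ True S j"
    proof (cases "j mod L = Suc t")
      case True
      then show ?thesis using dm[of j] j by (intro disjI1 exI[of _ "j div L"]) (simp add: bb.aenv_def)
    qed (use j in auto)
  qed (use sm nu inj inj0 ix lp occ_u L_pos(1) occ_bt ml in \<open>auto simp: bb.aenv_def bb.renv_def inj_on_def occf_def\<close>)
qed

lemma occ0_ok: "\<exists>F G. bb.step_ok 8 occ0_a (NA 8) 0 0 F G"
  unfolding occ0_a_def
  by (rule gather_ok) (auto simp: small_simps bb.renv_def bb.aenv_def occf_def)

lemma occf_eq: "x \<le> n \<Longrightarrow> occf c x = occ c S x"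
  using occ_False[of x S] lenS by (cases c) (simp_all add: occf_def)

lemma cuts_ok: "\<exists>F G. bb.step_ok (9 + cx c) (cuts_a c) X 1 n F G"
proof -
  define G :: "nat \<Rightarrow> nat \<Rightarrow> nat" where
    "G = (\<lambda>t j. if t = 0 then (if j = 0 then 0 else n) else cut c S j)"
  have nu: "n < 2 ^ u" "X \<le> 2 ^ u" using pv_less[of 1] pv_less[of 22] by simp_all
  have NX: "NA (9 + cx c) = X" by (simp add: cx_def)
  have a: "9 + cx c < narrs" by (simp add: cx_def)
  have bd: "G t j < 2 ^ u" for t j using nu cut_le_n[of c j] by (auto simp: G_def)
  \<comment> \<open>The occurrence at \<open>x\<close> is number \<open>occf c x + 1\<close>, and
    the cut behind it is \<open>x + 1\<close>. Since the value reveals \<open>x\<close>, this also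
    gives the injectivity of the scatter.\<close>
  have ct: "cut c S (Suc (occf c x)) = Suc x" if "x < n" "S ! x = c" for x
  proof -
    have x: "x < length S" using that lenS by simp
    have "occ c S (Suc x) = occ c S x + 1" using occ_Suc[OF x, of c] that by simp
    then have "occ c S x + 1 \<le> count_list S c" using occ_le_count[of c S "Suc x"] by simp
    then have "cut c S (occ c S x + 1) = x + 1"
      using cut_select[of "occ c S x + 1" S c] select_unique[OF x that(2)] by simp
    then show ?thesis using occf_eq[of x c] that by simp
  qed
  have gd: "(bt x = of_bool c) = (S ! x = c)" if "x < n" for x
    using that by (cases c) (auto simp: bt_def)
  have ix: "x < nb * L" if "x < n" for x using that nbL by simp
  have "\<exists>F G. bb.step_ok (9 + cx c) (update (Var 22) (Var 1 *! (Num 0 <! I_e)) (Num 1) (Var 1)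
     (Arr 0 I_e =! Num (of_bool c)) (occ_a c I_e +! Num 1) (I_e +! Num 1)) (NA (9 + cx c)) 1 n F G"
  proof (rule update_ok[where G = G and gd = "\<lambda>_ x. S ! x = c" and ad = "\<lambda>_ x. occf c x + 1"])
    fix t x assume tx: "t < (1::nat)" "x < n"
    show "good u (bb.aenv (9 + cx c) (\<lambda>j. j < NA (9 + cx c)) (G t) x t) (Arr 0 I_e =! Num (of_bool c)) \<and>
      aeval (bb.aenv (9 + cx c) (\<lambda>j. j < NA (9 + cx c)) (G t) x t) (Arr 0 I_e =! Num (of_bool c)) =
      of_bool (S ! x = c)"
      using gd[OF tx(2)] ix[OF tx(2)] by (auto simp: bb.aenv_def)
    assume Sx: "S ! x = c"
    show "good u (bb.aenv (9 + cx c) (\<lambda>j. j < NA (9 + cx c)) (G t) x t) (occ_a c I_e +! Num 1) \<and>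
       good u (bb.aenv (9 + cx c) (\<lambda>j. j < NA (9 + cx c)) (G t) x t) (I_e +! Num 1) \<and>
       aeval (bb.aenv (9 + cx c) (\<lambda>j. j < NA (9 + cx c)) (G t) x t) (occ_a c I_e +! Num 1) = occf c x + 1 \<and>
       aeval (bb.aenv (9 + cx c) (\<lambda>j. j < NA (9 + cx c)) (G t) x t) (I_e +! Num 1) = G (Suc t) (occf c x + 1)"
      using ct[OF tx(2) Sx] ix[OF tx(2)] by (cases c) (simp_all add: bb.aenv_def cx_def G_def)
  next
    fix t show "inj_on (\<lambda>x. occf c x + 1) {x. x < n \<and> S ! x = c}"
    proof (rule inj_onI)
      fix x y assume "x \<in> {x. x < n \<and> S ! x = c}" "y \<in> {x. x < n \<and> S ! x = c}"
        and eq: "occf c x + 1 = occf c y + 1"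
      then have xy: "x < n" "S ! x = c" "y < n" "S ! y = c" by blast+
      have "Suc x = Suc y" using ct[OF xy(1,2)] ct[OF xy(3,4)] eq by (metis Suc_eq_plus1)
      then show "x = y" by (rule Suc_inject)
    qed
  next
    fix t j assume t: "t < (1::nat)"
    consider "j = 0" | "1 \<le> j" "j \<le> count_list S c" | "count_list S c < j" by linarith
    then show "(\<exists>x < n. S ! x = c \<and> occf c x + 1 = j) \<or> G (Suc t) j = G t j"
    proof cases
      case 2
      have sl: "select c S j < n" "S ! select c S j = c" "occ c S (select c S j) = j - 1"
        using select_less[OF 2] nth_select[OF 2] occ_select[OF 2] lenS by auto
      then show ?thesis using occf_eq[of "select c S j" c] 2
        by (intro disjI1 exI[of _ "select c S j"]) simp
    next
      case 3
      then show ?thesis using t lenS by (simp add: G_def cut_gt)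
    qed (use t in \<open>simp add: G_def\<close>)
  next
    fix j show "G 1 j = FA (9 + cx c) j" by (simp add: G_def FA_c)
  qed (use nu bd NX a u_bounds num_less' in \<open>auto simp: small_simps bb.renv_def bb.aenv_def G_def of_bool_def\<close>)
  then show ?thesis unfolding cuts_a_def NX .
qed

lemma len_ok: "\<exists>F G. bb.step_ok (11 + cx c) (len_a c) (NA (11 + cx c)) 0 0 F G"
  unfolding len_a_def mask_e_def
proof (rule gather_ok)
  fix x assume "x < NA (11 + cx c)"
  then have "x < n div K + 1" by (cases c) (simp_all add: cx_def)
  from lt_div_le'[OF this] have ix: "x * K + K < X" "x * K < X" by (simp_all add: X_def)
  then show "good u (bb.aenv (11 + cx c) (\<lambda>_. False) (\<lambda>_. 0) x 0)
      ((cut_a c (I_e *! Var 6 +! Var 6) -! cut_a c (I_e *! Var 6)) *!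
        ((cut_a c (I_e *! Var 6 +! Var 6) -! cut_a c (I_e *! Var 6)) <! Var 10)) \<and>
    aeval (bb.aenv (11 + cx c) (\<lambda>_. False) (\<lambda>_. 0) x 0)
      ((cut_a c (I_e *! Var 6 +! Var 6) -! cut_a c (I_e *! Var 6)) *!
        ((cut_a c (I_e *! Var 6 +! Var 6) -! cut_a c (I_e *! Var 6)) <! Var 10)) = FA (11 + cx c) x"
    by (cases c) (simp_all add: bb.aenv_def cx_def lenf_def Let_def)
qed (auto simp: small_simps bb.renv_def cx_def)

end

context layout
begin

abbreviation genv :: "nat \<Rightarrow> nat \<Rightarrow> env" where
  "genv a x \<equiv> bb.aenv a (\<lambda>_. False) (\<lambda>_. 0) x 0"

lemma gather_ok':
  assumes "s = gather (ini_n s) (ini_v s)" and "a < narrs" and "small (ini_n s)" "small (ini_v s)"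
    and "good u (bb.renv nregs) (ini_n s)" "aeval (bb.renv nregs) (ini_n s) = NA a"
    and "\<And>x. x < NA a \<Longrightarrow> good u (genv a x) (ini_v s) \<and> aeval (genv a x) (ini_v s) = FA a x"
  shows "\<exists>F G. bb.step_ok a s (NA a) 0 0 F G"
  by (subst assms(1), rule gather_ok) (use assms(2-) in auto)

lemmas gs = gather_def bb.aenv_def bb.renv_def cx_def small_simps

section \<open>Arrays derived from the cuts: all reads stay in range\<close>

lemma NA_c: "NA (11 + cx c) = n div K + 1" "NA (13 + cx c) = n div LL" "NA (15 + cx c) = n div LL"
  "NA (20 + 5 * cx c) = (n div K + 1) * fn" "NA (21 + 5 * cx c) = (n div K + 1) * fn"
  "NA (22 + 5 * cx c) = (n div K + 1) * A2" "NA (23 + 5 * cx c) = 2 * (n div LL)" "NA (24 + 5 * cx c) = H * SA"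
  by (cases c; simp add: cx_def)+

lemma sub_pos:
  assumes "x < n div LL"
  shows "(x + 1) * LL - 1 < n" "occf c ((x + 1) * LL - 1) < n" "subf c x div K < n div K + 1"
    "occf c ((x + 1) * LL - 1) div K < n div K + 1"
proof -
  show 1: "(x + 1) * LL - 1 < n" using lt_div_le[OF assms] L_pos(2) by (cases LL) auto
  then show "occf c ((x + 1) * LL - 1) < n" using occf_le[of c "(x + 1) * LL - 1"] by simp
  then show "occf c ((x + 1) * LL - 1) div K < n div K + 1" by (simp add: div_le_mono less_Suc_eq_le)
  show "subf c x div K < n div K + 1" using subf_less[OF assms, of c] by (simp add: div_le_mono less_Suc_eq_le)
qed

lemma sub_ok: "\<exists>F G. bb.step_ok (13 + cx c) (sub_a c) (NA (13 + cx c)) 0 0 F G"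
proof (rule gather_ok')
  fix x assume "x < NA (13 + cx c)"
  then have x: "x < n div LL" by (simp add: NA_c)
  have i: "(x + 1) * LL - 1 < nb * L" using sub_pos(1)[OF x] nbL by linarith
  show "good u (genv (13 + cx c) x) (ini_v (sub_a c)) \<and> aeval (genv (13 + cx c) x) (ini_v (sub_a c)) = FA (13 + cx c) x"
    using i sub_pos(4)[OF x, of c] lenf_less[of c]
    by (cases c) (simp_all add: sub_a_def substep_e_def Let_def gs subf_def stepf_def)
qed (cases c; simp add: sub_a_def substep_e_def Let_def gs)+

lemma sublen_ok: "\<exists>F G. bb.step_ok (15 + cx c) (sublen_a c) (NA (15 + cx c)) 0 0 F G"
proof (rule gather_ok')
  fix x assume "x < NA (15 + cx c)"
  then have x: "x < n div LL" by (simp add: NA_c)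
  let ?q = "subf c x"
  have q: "?q < X" using subf_less[OF x, of c] by (simp add: X_def)
  have "?q div K * K + K < X" using div_times_less_eq_dividend[of ?q K] subf_less[OF x, of c]
    unfolding X_def by linarith
  then have m: "min (?q + stepf c (?q div K)) (?q div K * K + K) < X" by simp
  show "good u (genv (15 + cx c) x) (ini_v (sublen_a c)) \<and>
      aeval (genv (15 + cx c) x) (ini_v (sublen_a c)) = FA (15 + cx c) x"
    using x q m sub_pos(3)[OF x, of c] lenf_less[of c]
    by (cases c) (simp_all add: sublen_a_def mask_e_def substep_e_def Let_def gs sublenf_def stepf_def)
qed (cases c; simp add: sublen_a_def mask_e_def substep_e_def Let_def gs)+

lemma dir1_ok: "\<exists>F G. bb.step_ok 17 dir1_a (NA 17) 0 0 F G"
proof (rule gather_ok')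
  fix x assume "x < NA 17"
  then have "x div fn < n div (L * L)" by (simp add: less_mult_imp_div_less)
  from lt_div_le[OF this] have "(x div fn + 1) * (L * L) < nb * L" using nbL by linarith
  then show "good u (genv 17 x) (ini_v dir1_a) \<and> aeval (genv 17 x) (ini_v dir1_a) = FA 17 x"
    by (simp add: dir1_a_def gs dir1f_def occf_def)
qed (simp_all add: dir1_a_def gs)

lemma dir2_ok: "\<exists>F G. bb.step_ok 18 dir2_a (NA 18) 0 0 F G"
proof (rule gather_ok')
  fix x assume "x < NA 18"
  then have e: "x div f2 < n div L" by (simp add: less_mult_imp_div_less)
  from lt_div_le[OF this] have i: "(x div f2 + 1) * L < nb * L" using nbL by linarith
  have "x div f2 div L * (L * L) = x div f2 div L * L * L" by (simp only: mult.assoc)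
  also have "\<dots> \<le> x div f2 * L" by (intro mult_le_mono1 div_times_less_eq_dividend)
  also have "\<dots> \<le> (x div f2 + 1) * L" by (intro mult_le_mono1) simp
  also note i
  finally have "x div f2 div L * (L * L) < nb * L" .
  with i show "good u (genv 18 x) (ini_v dir2_a) \<and> aeval (genv 18 x) (ini_v dir2_a) = FA 18 x"
    by (simp add: dir2_a_def gs dir2f_def occf_def)
qed (simp_all add: dir2_a_def gs)

lemma rtab_ok: "\<exists>F G. bb.step_ok 19 rtab_a (NA 19) 0 0 F G"
proof (rule gather_ok')
  fix x assume "x < NA 19"
  then have l: "x div RA + 1 \<le> h" by (simp add: less_mult_imp_div_less Suc_leI)
  define l where "l = x div RA + 1"
  define e where "e = x mod RA div fh"
  have el: "e mod l + 1 \<le> h" using l mod_less_divisor[of l e] unfolding l_def by linarith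
  have p: "e mod l + 1 < u" using el u_bounds(1) by linarith
  have "e div l mod 2 ^ (e mod l + 1) < 2 ^ (e mod l + 1)" by simp
  also have "\<dots> \<le> 2 ^ (h + H)" using el by (intro power_increasing) auto
  finally have i: "e div l mod 2 ^ (e mod l + 1) < 2 ^ (h + H)" .
  show "good u (genv 19 x) (ini_v rtab_a) \<and> aeval (genv 19 x) (ini_v rtab_a) = FA 19 x"
    using p i unfolding l_def e_def by (simp add: rtab_a_def gs rtabf_def Let_def)
qed (simp_all add: rtab_a_def gs Let_def)

lemma seldir_ok: "\<exists>F G. bb.step_ok (20 + 5 * cx c) (seldir_a c) (NA (20 + 5 * cx c)) 0 0 F G"
proof (rule gather_ok')
  fix x assume "x < NA (20 + 5 * cx c)"
  then have "x div fn < n div K + 1" unfolding NA_c by (rule less_mult_imp_div_less)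
  from lt_div_le'[OF this] have "(x div fn + 1) * K < X" by (simp add: X_def)
  then show "good u (genv (20 + 5 * cx c) x) (ini_v (seldir_a c)) \<and>
      aeval (genv (20 + 5 * cx c) x) (ini_v (seldir_a c)) = FA (20 + 5 * cx c) x"
    by (cases c) (simp_all add: seldir_a_def gs seldirf_def)
qed (cases c; simp add: seldir_a_def gs)+

lemma long_ok: "\<exists>F G. bb.step_ok (21 + 5 * cx c) (long_a c) (NA (21 + 5 * cx c)) 0 0 F G"
proof (rule gather_ok')
  fix x assume "x < NA (21 + 5 * cx c)"
  then have z: "x div fn < n div K + 1" unfolding NA_c by (rule less_mult_imp_div_less)
  define z where "z = x div fn"
  have zK: "(z + 1) * K - 1 < n + K" using lt_div_le'[OF z] L_pos(3) unfolding z_def by linarith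
  define q where "q = occf c ((z + 1) * K - 1) div K * K"
  have "q \<le> occf c ((z + 1) * K - 1)" unfolding q_def by (rule div_times_less_eq_dividend)
  then have q: "q < n + K" using occf_le[of c "(z + 1) * K - 1"] zK by linarith
  have zn: "z \<le> n" using z div_le_dividend[of n K] unfolding z_def by linarith
  have i: "(z + 1) * K - 1 < nb * L" "q < X" "q + (z - cut c S q div K) + 1 < X"
    using zK nbL q zn by (auto simp: X_def)
  show "good u (genv (21 + 5 * cx c) x) (ini_v (long_a c)) \<and>
      aeval (genv (21 + 5 * cx c) x) (ini_v (long_a c)) = FA (21 + 5 * cx c) x"
    using i unfolding z_def q_def by (cases c) (simp_all add: long_a_def gs Let_def longf_def)
qed (cases c; simp add: long_a_def gs Let_def)+

lemma subdir_ok: "\<exists>F G. bb.step_ok (22 + 5 * cx c) (subdir_a c) (NA (22 + 5 * cx c)) 0 0 F G"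
proof (rule gather_ok')
  fix x assume "x < NA (22 + 5 * cx c)"
  then have k: "x div A2 < n div K + 1" unfolding NA_c by (rule less_mult_imp_div_less)
  define k where "k = x div A2"
  have kK: "k * K + K \<le> n + K" using lt_div_le'[OF k] unfolding k_def by simp
  then have i: "k * K < X" "\<And>y. k * K + min y K < X" by (auto simp: X_def min_def)
  show "good u (genv (22 + 5 * cx c) x) (ini_v (subdir_a c)) \<and>
      aeval (genv (22 + 5 * cx c) x) (ini_v (subdir_a c)) = FA (22 + 5 * cx c) x"
    using i k lenf_less[of c] unfolding k_def
    by (cases c) (simp_all add: subdir_a_def substep_e_def gs Let_def subdirf_def stepf_def)
qed (cases c; simp add: subdir_a_def substep_e_def gs Let_def)+

lemma subans_ok: "\<exists>F G. bb.step_ok (23 + 5 * cx c) (subans_a c) (NA (23 + 5 * cx c)) 0 0 F G"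
proof (rule gather_ok')
  fix x assume "x < NA (23 + 5 * cx c)"
  then have x: "x < 2 * (n div LL)" by (simp only: NA_c)
  then have k: "x div 2 < n div LL" by simp
  have xn: "x \<le> 2 * n" using x div_le_dividend[of n LL] by linarith
  have q: "subf c (x div 2) < n" by (rule subf_less[OF k])
  have d: "(x - y) div b \<le> 2 * n" for y b using div_le_dividend[of "x - y" b] xn by linarith
  have i: "subf c (x div 2) < X" using q unfolding X_def by linarith
  have i2: "subf c (x div 2) + (x - y) div b + 1 < X" for y b
    using d[of y b] q unfolding X_def by linarith
  show "good u (genv (23 + 5 * cx c) x) (ini_v (subans_a c)) \<and>
      aeval (genv (23 + 5 * cx c) x) (ini_v (subans_a c)) = FA (23 + 5 * cx c) x"
    using i i2 k sublenf_less[of c]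
    by (cases c) (simp_all add: subans_a_def gs Let_def subansf_def)
qed (cases c; simp add: subans_a_def gs Let_def)+

lemma seltab_ok: "\<exists>F G. bb.step_ok (24 + 5 * cx c) (seltab_a c) (NA (24 + 5 * cx c)) 0 0 F G"
proof (rule gather_ok')
  fix x assume "x < NA (24 + 5 * cx c)"
  then have "x < H * SA" by (simp only: NA_c)
  then have lH: "x div SA + 1 \<le> H" by (simp add: less_mult_imp_div_less Suc_leI)
  define l where "l = x div SA + 1"
  have l: "l \<le> H" "0 < l" using lH by (simp_all add: l_def)
  have lM: "l < M" using l by (simp add: M_def)
  have lu: "l < u" using l u_bounds(2) by simp
  have p: "(2::nat) ^ l \<le> 2 ^ H" using l by (intro power_increasing) auto
  have i: "(if c then e div l mod 2 ^ l else 2 ^ l - 1 - e div l mod 2 ^ l) * H + e mod l < 2 ^ H * H" for e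
  proof -
    let ?v = "if c then e div l mod 2 ^ l else 2 ^ l - 1 - e div l mod 2 ^ l"
    obtain k where k: "e div l mod 2 ^ l = k" "k < 2 ^ l" using mod_less_divisor[of "2 ^ l"] by simp
    have "?v + 1 \<le> 2 ^ l" using k(2) unfolding k(1) by (cases c) auto
    then have "(?v + 1) * H \<le> 2 ^ H * H" using p by (intro mult_le_mono1) linarith
    moreover have "e mod l < H" using l mod_less_divisor[of l e] by linarith
    ultimately show ?thesis by simp
  qed
  show "good u (genv (24 + 5 * cx c) x) (ini_v (seltab_a c)) \<and>
      aeval (genv (24 + 5 * cx c) x) (ini_v (seltab_a c)) = FA (24 + 5 * cx c) x"
    using i lM lu unfolding l_def
    by (cases c) (simp_all add: seltab_a_def gs Let_def seltabf_def)
qed (cases c; simp add: seltab_a_def gs Let_def)+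

text \<open>The processors of the initial store; \<open>NBf\<close> and \<open>Nkf\<close> are the
  number of rounds and the processors per round. Array 7 is the exception because its initial store
  covers block boundaries only.\<close>

definition N0f :: "nat \<Rightarrow> nat" where "N0f a = (if a = 7 then nb else NA a)"
definition NBf :: "nat \<Rightarrow> nat" where
  "NBf a = (if a < 11 then [1, w, 0, h + H, 1, L, L + 2, L - 1, 0, 1, 1] ! a else 0)"
definition Nkf :: "nat \<Rightarrow> nat" where
  "Nkf a = (if a < 11 then [n, M, 0, 2 ^ (h + H), 2 ^ H * H, nb + 1, nb + 1, nb, 0, n, n] ! a else 0)"

lemma arrays_ok:
  assumes "a < narrs"
  shows "\<exists>F G. bb.step_ok a (asteps ! a) (N0f a) (NBf a) (Nkf a) F G"
proof -
  note c = cuts_ok len_ok sub_ok sublen_ok seldir_ok long_ok subdir_ok subans_ok seltab_ok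
  note cT = c[of True, unfolded cx_def, simplified]
  note cF = c[of False, unfolded cx_def, simplified]
  have "list_all (\<lambda>a. \<exists>F G. bb.step_ok a (asteps ! a) (N0f a) (NBf a) (Nkf a) F G) [2..<narrs]"
    using lg_ok popc_ok sel_ok count_ok sum_ok occ1_ok occ0_ok cT cF dir1_ok dir2_ok rtab_ok
    by (simp add: asteps_def N0f_def NBf_def Nkf_def)
  then have "\<forall>a \<in> set [2..<narrs]. \<exists>F G. bb.step_ok a (asteps ! a) (N0f a) (NBf a) (Nkf a) F G"
    by (simp only: list_all_iff)
  moreover have "(a = 0 \<or> a = 1) \<or> a \<in> set [2..<narrs]"
    unfolding set_upt atLeastLessThan_iff using assms by linarith
  moreover have "\<exists>F G. bb.step_ok 0 (asteps ! 0) (N0f 0) (NBf 0) (Nkf 0) F G"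
    using bits_ok by (simp add: asteps_def N0f_def NBf_def Nkf_def)
  moreover have "\<exists>F G. bb.step_ok 1 (asteps ! 1) (N0f 1) (NBf 1) (Nkf 1) F G"
    using flog_ok by (simp add: asteps_def N0f_def NBf_def Nkf_def)
  ultimately show ?thesis by blast
qed

definition reg_cost :: nat where
  "reg_cost = 1 + (\<Sum>x = 2..<nregs. max_ops + rcost (rsteps ! x) (pv x) + 5)"
definition arr_work :: nat where
  "arr_work = 1 + (\<Sum>a = 0..<narrs. 5 * max_ops * (N0f a + (NBf a + 1) * (Nkf a + 2) + 2))"
definition arr_depth :: nat where
  "arr_depth = 1 + (\<Sum>a = 0..<narrs. 6 * max_ops * (NBf a + 4))"

lemma runs_build:
  "\<exists>m' r'. runs w build_prog (m0, init_regs [w, n])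
     (reg_cost + (arr_work + (500 + 60 * (M + 1) + (\<Sum>s < 13. 200 * (w + 2) * (pv (size_reg s) div w + 3)))))
     (reg_cost + (arr_depth + (500 + 2600 * (w + 2)))) (m', r') \<and> r' 0 = n \<and> (\<forall>p < n. m' p = m0 p) \<and>
     bb.hdr nregs m' \<and> bb.tabs True True m' \<and> bb.sects 13 m'"
proof -
  let ?rs = "map (\<lambda>x. reg_prog x (rsteps ! x)) [2..<nregs]"
  let ?as = "map (\<lambda>a. arr_prog a (asteps ! a)) [0..<narrs]"
  have l: "2 + length ?rs = nregs" "0 + length ?as = narrs" by simp_all
  have "\<exists>s. runs w (seqs ?rs) (m0, init_regs [w, n])
      (1 + (\<Sum>x = 2..<2 + length ?rs. max_ops + rcost (rsteps ! x) (pv x) + 5))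
      (1 + (\<Sum>x = 2..<2 + length ?rs. max_ops + rcost (rsteps ! x) (pv x) + 5)) s \<and> bb.st (2 + length ?rs) 0 s"
  proof (rule runs_seqs)
    show "bb.st 2 0 (m0, init_regs [w, n])"
      by (auto simp: bb.st_def init_regs_def numeral_2_eq_2 less_Suc_eq)
  next
    fix j and s :: "memory \<times> regs" assume j: "j < length ?rs" and st: "bb.st (2 + j) 0 s"
    obtain m r where s: "s = (m, r)" by (cases s)
    have jl: "j < length [2..<nregs]" using j by (simp only: length_map)
    then have x: "2 \<le> 2 + j" "2 + j < nregs" unfolding length_upt by linarith+
    have e: "?rs ! j = reg_prog (2 + j) (rsteps ! (2 + j))"
      by (simp only: nth_map[OF jl] nth_upt[OF x(2)])
    note ok = rstep_ok[OF x]
    show "\<exists>s'. runs w (?rs ! j) s (max_ops + rcost (rsteps ! (2 + j)) (pv (2 + j)) + 5)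
        (max_ops + rcost (rsteps ! (2 + j)) (pv (2 + j)) + 5) s' \<and> bb.st (Suc (2 + j)) 0 s'"
      unfolding s e
      by (rule bb.runs_reg[OF st[unfolded s] x(2)]) (use ok in blast)+
  qed
  then obtain s1 where s1: "runs w (seqs ?rs) (m0, init_regs [w, n]) reg_cost reg_cost s1"
    "bb.st nregs 0 s1" unfolding l reg_cost_def by blast
  obtain m1 r1 where p1: "s1 = (m1, r1)" by (cases s1)
  note 1 = s1[unfolded p1]
  have "\<exists>s. runs w (seqs ?as) (m1, r1)
      (1 + (\<Sum>a = 0..<0 + length ?as. 5 * max_ops * (N0f a + (NBf a + 1) * (Nkf a + 2) + 2)))
      (1 + (\<Sum>a = 0..<0 + length ?as. 6 * max_ops * (NBf a + 4))) s \<and> bb.st nregs (0 + length ?as) s"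
  proof (rule runs_seqs)
    show "bb.st nregs 0 (m1, r1)" by (rule 1)
  next
    fix j and s :: "memory \<times> regs" assume j: "j < length ?as" and st: "bb.st nregs (0 + j) s"
    obtain m r where s: "s = (m, r)" by (cases s)
    have jl: "j < length [0..<narrs]" using j by (simp only: length_map)
    then have a: "0 + j < narrs" "j < narrs" unfolding length_upt by linarith+
    have e: "?as ! j = arr_prog j (asteps ! j)"
      by (simp only: nth_map[OF jl] nth_upt[OF a(1)] add_0)
    from arrays_ok[OF a(2)] obtain F G where "bb.step_ok j (asteps ! j) (N0f j) (NBf j) (Nkf j) F G" by blast
    from bb.runs_arr[OF st[unfolded s add_0] a(2) this]
    show "\<exists>s'. runs w (?as ! j) s (5 * max_ops * (N0f (0 + j) + (NBf (0 + j) + 1) * (Nkf (0 + j) + 2) + 2))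
        (6 * max_ops * (NBf (0 + j) + 4)) s' \<and> bb.st nregs (Suc (0 + j)) s'"
      unfolding s e add_0 .
  qed
  then obtain s2 where s2: "runs w (seqs ?as) (m1, r1) arr_work arr_depth s2"
    "bb.st nregs narrs s2" unfolding l arr_work_def arr_depth_def by blast
  obtain m2 r2 where p2: "s2 = (m2, r2)" by (cases s2)
  note 2 = s2[unfolded p2]
  from bb.runs_block[OF 2(2)] obtain m3 r3 where 3: "runs w block_prog (m2, r2)
      (500 + 60 * (pv 11 + 1) + (\<Sum>s < 13. 200 * (w + 2) * (pv (size_reg s) div w + 3)))
      (500 + 2600 * (w + 2)) (m3, r3)" "r3 0 = n" "\<forall>p < n. m3 p = m0 p"
      "bb.hdr nregs m3" "bb.tabs True True m3" "bb.sects 13 m3" by blast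
  from runs_Seq[OF 1(1) runs_Seq[OF 2(1) 3(1)]] show ?thesis
    using 3(2-) unfolding build_prog_def pv_simps by blast
qed

end

section \<open>The contents of the block\<close>

lemma field_eqI:
  assumes "\<And>j. j < b \<Longrightarrow> mem_bit w m (p + j) \<longleftrightarrow> bit v j" and "v < 2 ^ b"
  shows "field w m p b = v"
proof (rule bit_eqI)
  fix j
  have "\<not> bit v j" if "b \<le> j"
    using assms(2) that by (metis bit_take_bit_iff leD take_bit_nat_eq_self)
  then show "bit (field w m p b) j \<longleftrightarrow> bit v j"
    using assms(1)[of j] by (cases "j < b") (auto simp: bit_field)
qed

lemma div_mod_slot: "j < b \<Longrightarrow> (i * b + j) div b = i \<and> (i * b + j) mod b = j" for i j b :: nat
  by simp

lemma stores_Nil: "stores w m base len b []"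
  unfolding stores_def by (intro exI[of _ "base * w"]) simp

lemma select_table_entry:
  assumes "x < 2 ^ l" "i < l"
  shows "select_table c l ! (x * l + i) =
    (if i < count_list (bitstring l x) c then select c (bitstring l x) (i + 1) else 0)"
proof -
  have "(x + 1) * l \<le> 2 ^ l * l" using assms by (intro mult_le_mono1) simp
  then have "x * l + i < 2 ^ l * l" using assms by simp
  then show ?thesis
    using assms(2) unfolding select_table_def Let_def by (subst nth_concat_uniform) auto
qed

context layout
begin

definition blk :: "memory \<Rightarrow> bool" where
  "blk m \<longleftrightarrow> bb.hdr nregs m \<and> bb.tabs True True m \<and> bb.sects 13 m"

definition len :: nat where "len = WA 13 - n"

lemma WA_bounds: "s \<le> 13 \<Longrightarrow> n \<le> WA s" "s \<le> 13 \<Longrightarrow> WA s \<le> WA 13" "n + 64 + 2 * M \<le> WA 13"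
  using bb.WA_lower[of s] bb.WA_mono[of s 13] bb.WA_lower[of 13] pv_WA[of s] pv_WA[of 13] by auto

lemma n_len: "n + len = WA 13"
  using WA_bounds(3) by (simp add: len_def)

text \<open>Every word that \<open>blk\<close> inspects lies between \<open>n\<close> and
  \<open>n + len\<close>. This is what makes the queries work in any memory that agrees with the
  built one on the block.\<close>

lemma blk_agree:
  assumes "blk m" and eq: "\<And>p. n \<le> p \<Longrightarrow> p < n + len \<Longrightarrow> m2 p = m p"
  shows "blk m2"
proof -
  have "m2 ((pv (31 + s) * w + x) div w) = m ((pv (31 + s) * w + x) div w)"
    if "s < 13" "x < pv (size_reg s)" for s x
  proof (rule eq)
    note b = bb.mem_bit_sect[OF that(2,1)]
    show "n \<le> (pv (31 + s) * w + x) div w" using b(1) WA_bounds(1)[of s] that pv_WA[of s] by simp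
    show "(pv (31 + s) * w + x) div w < n + len"
      using b(2) WA_bounds(2)[of "Suc s"] that pv_WA[of "Suc s"] unfolding n_len by simp
  qed
  then show ?thesis
    using assms(1) eq WA_bounds(3) n_len
    unfolding blk_def bb.hdr_def bb.tabs_def bb.sects_def mem_bit_def by simp
qed

lemma sect_bit: "blk m \<Longrightarrow> s < 13 \<Longrightarrow> x < pv (size_reg s) \<Longrightarrow>
    mem_bit w m (WA s * w + x) \<longleftrightarrow> FA (17 + s) x = 1"
  unfolding blk_def bb.sects_def using pv_WA[of s] by auto

lemma sect_field:
  assumes "blk m" "s < 13" "p + b \<le> pv (size_reg s)" "v < 2 ^ b"
    and "\<And>j. j < b \<Longrightarrow> FA (17 + s) (p + j) = 1 \<longleftrightarrow> bit v j"
  shows "field w m (WA s * w + p) b = v"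
  by (rule field_eqI) (use assms sect_bit[OF assms(1,2), of "p + _"] in \<open>auto simp: add.assoc\<close>)

lemma sect_stores:
  assumes "s < 13" "p + length xs * b \<le> pv (size_reg s)"
    and "\<And>i. i < length xs \<Longrightarrow> field w m (WA s * w + (p + i * b)) b = xs ! i"
  shows "stores w m n len b xs"
  unfolding stores_def
proof (intro exI conjI)
  show "n * w \<le> WA s * w + p" using WA_bounds(1)[of s] assms(1) by (simp add: trans_le_add1)
  have "pv (size_reg s) \<le> (pv (size_reg s) div w + 1) * w"
    using dividend_less_div_times[of w "pv (size_reg s)"] bb.w_pos by simp
  then have "WA s * w + (p + length xs * b) \<le> WA s * w + (pv (size_reg s) div w + 1) * w"
    using assms(2) by linarith
  also have "\<dots> = WA (Suc s) * w"
    using WA_Suc'[OF assms(1)] pv_WA[of s] pv_WA[of "Suc s"] by (simp add: algebra_simps)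
  also have "\<dots> \<le> (n + len) * w"
    unfolding n_len using WA_bounds(2)[of "Suc s"] assms(1) by (intro mult_le_mono1) simp
  finally show "WA s * w + p + length xs * b \<le> (n + len) * w" by simp
  show "\<forall>i < length xs. field w m (WA s * w + p + i * b) b = xs ! i"
    using assms(3) by (simp add: add.assoc)
qed

lemma hdr_word: "blk m \<Longrightarrow> x < nregs \<Longrightarrow> m (n + x) = pv x"
  by (simp add: blk_def bb.hdr_def)

lemma tab_word: "blk m \<Longrightarrow> x < M \<Longrightarrow> m (n + 64 + x) = lg x"
  "blk m \<Longrightarrow> x < M \<Longrightarrow> m (n + 64 + M + x) = floorlog 2 x"
  by (simp_all add: blk_def bb.tabs_def)

section \<open>Reading back the entries of each section\<close>

lemma slot_le: "i < N \<Longrightarrow> i * b + b \<le> N * b" for i N b :: nat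
  using mult_le_mono1[of "i + 1" N b] by simp

lemma fn_fits: "x \<le> n \<Longrightarrow> x < 2 ^ fn"
  unfolding fn_def using less_exp_floorlog[of n] by linarith

lemma dir1_entry:
  assumes "blk m" "i < n div (L * L)"
  shows "field w m (WA 0 * w + i * fn) fn = occ True S ((i + 1) * (L * L))"
proof (rule sect_field[OF assms(1)])
  show "i * fn + fn \<le> pv (size_reg 0)" using slot_le[OF assms(2)] by (simp add: size_reg_def)
  have "occ True S ((i + 1) * (L * L)) \<le> n"
    using occ_le_count[of True S] count_le_length'[of S True] lenS le_trans by metis
  then show "occ True S ((i + 1) * (L * L)) < 2 ^ fn" by (rule fn_fits)
  fix j assume "j < fn"
  from div_mod_slot[OF this, of i]
  show "FA (17 + 0) (i * fn + j) = 1 \<longleftrightarrow> bit (occ True S ((i + 1) * (L * L))) j"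
    by (simp add: dir1f_def)
qed simp

lemma dir2_entry:
  assumes "blk m" "i < n div L"
  shows "field w m (WA 1 * w + i * f2) f2 = occ True S ((i + 1) * L) - occ True S (i div L * (L * L))"
proof (rule sect_field[OF assms(1)])
  show "i * f2 + f2 \<le> pv (size_reg 1)" using slot_le[OF assms(2)] by (simp add: size_reg_def)
  have e: "(i + 1) * L = i div L * (L * L) + (i mod L + 1) * L"
  proof -
    have "i div L * (L * L) + (i mod L + 1) * L = (i div L * L + i mod L + 1) * L"
      by (simp only: add_mult_distrib mult.assoc)
    then show ?thesis by simp
  qed
  have "i mod L + 1 \<le> L" using mod_less_divisor[OF L_pos(1), of i] by linarith
  then have "(i mod L + 1) * L \<le> L * L" by (rule mult_le_mono1)
  moreover have "occ True S ((i + 1) * L) - occ True S (i div L * (L * L)) \<le> (i + 1) * L - i div L * (L * L)"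
    by (rule occ_diff_le) (use e in linarith)
  ultimately have "occ True S ((i + 1) * L) - occ True S (i div L * (L * L)) \<le> L * L" using e by linarith
  then show "occ True S ((i + 1) * L) - occ True S (i div L * (L * L)) < 2 ^ f2"
    unfolding f2_def using less_exp_floorlog[of "L * L"] by linarith
  fix j assume "j < f2"
  from div_mod_slot[OF this, of i]
  show "FA (17 + 1) (i * f2 + j) = 1 \<longleftrightarrow> bit (occ True S ((i + 1) * L) - occ True S (i div L * (L * L))) j"
    by (simp add: dir2f_def)
qed simp

lemma table_slot:
  assumes "l \<le> B" "j < 2 ^ l * l" "b \<le> B'" "k < b"
  shows "j * b + k < 2 ^ B * B * (B' :: nat)"
proof -
  have "j * b + k < 2 ^ l * l * b" using slot_le[OF assms(2), of b] assms(4) by simp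
  also have "\<dots> \<le> 2 ^ B * B * B'"
    using assms(1,3) by (intro mult_le_mono power_increasing) auto
  finally show ?thesis .
qed

lemma rtab_entry:
  assumes "blk m" "1 \<le> l" "l \<le> h" "j < 2 ^ l * l"
  shows "field w m (WA 2 * w + ((l - 1) * RA + j * fh)) fh = popc (j mod l + 1) (j div l)"
proof (rule sect_field[OF assms(1)])
  have y: "j * fh + k < RA" if "k < fh" for k
    unfolding RA_def by (rule table_slot[OF assms(3,4) _ that]) simp
  have "j * fh + fh \<le> RA"
    unfolding RA_def using slot_le[OF assms(4), of fh] assms(3)
    by (meson le_trans mult_le_mono order_refl power_increasing one_le_numeral)
  moreover have "(l - 1) * RA + RA \<le> h * RA" using slot_le[of "l - 1" h RA] assms(2,3) by simp
  ultimately show "(l - 1) * RA + j * fh + fh \<le> pv (size_reg 2)" by (simp add: size_reg_def)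
  have jl: "j mod l + 1 \<le> l" using assms(2) mod_less_divisor[of l j] by linarith
  then have "popc (j mod l + 1) (j div l) \<le> h" using popc_le[of "j mod l + 1" "j div l"] assms(3) by linarith
  then show "popc (j mod l + 1) (j div l) < 2 ^ fh"
    unfolding fh_def using less_exp_floorlog[of h] by linarith
  fix k assume k: "k < fh"
  have a: "((l - 1) * RA + (j * fh + k)) div RA = l - 1" "((l - 1) * RA + (j * fh + k)) mod RA = j * fh + k"
    using div_mod_slot[OF y[OF k], of "l - 1"] by auto
  have l1: "l - 1 + 1 = l" using assms(2) by simp
  have p: "popc (h + H) (j div l mod 2 ^ (j mod l + 1)) = popc (j mod l + 1) (j div l)"
    by (rule popc_take_bit) (use jl assms(3) in linarith)
  have "rtabf ((l - 1) * RA + (j * fh + k)) \<longleftrightarrow> bit (popc (j mod l + 1) (j div l)) k"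
    unfolding rtabf_def Let_def a l1 using div_mod_slot[OF k, of j] p by simp
  then show "FA (17 + 2) ((l - 1) * RA + j * fh + k) = 1 \<longleftrightarrow> bit (popc (j mod l + 1) (j div l)) k"
    by (simp add: add.assoc)
qed simp

lemma size_c: "pv (size_reg (3 + 5 * cx c)) = (n div K + 1) * fn" "pv (size_reg (4 + 5 * cx c)) = (n div K + 1) * fn"
  "pv (size_reg (5 + 5 * cx c)) = (n div K + 1) * A2" "pv (size_reg (6 + 5 * cx c)) = 2 * (n div LL)"
  "pv (size_reg (7 + 5 * cx c)) = H * SA"
  by (cases c; simp add: cx_def size_reg_def)+

lemma FA_section: "FA (17 + (3 + 5 * cx c)) = of_bool \<circ> seldirf c" "FA (17 + (4 + 5 * cx c)) = of_bool \<circ> longf c"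
  "FA (17 + (5 + 5 * cx c)) = of_bool \<circ> subdirf c" "FA (17 + (6 + 5 * cx c)) = of_bool \<circ> subansf c"
  "FA (17 + (7 + 5 * cx c)) = of_bool \<circ> seltabf c"
  by (cases c; simp add: cx_def)+

lemma cx_le: "cx c \<le> 1" by (simp add: cx_def)

lemma sect_field':
  assumes "blk m" "s < 13" "p + b \<le> pv (size_reg s)" "v < 2 ^ b" "FA (17 + s) = of_bool \<circ> f"
    and "\<And>j. j < b \<Longrightarrow> f (p + j) \<longleftrightarrow> bit v j"
  shows "field w m (WA s * w + p) b = v"
  by (rule sect_field[OF assms(1-4)]) (simp add: assms(5,6))

lemma count_le_n: "count_list S c \<le> n"
  using count_le_length'[of S c] lenS by simp

text \<open>The section continues beyond the last directory entry. For missing occurrences it holds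
  \<open>n - 1\<close>, so a query finds the end of an incomplete last range in the same way as any
  other end.\<close>

lemma seldir_entry:
  assumes "blk m" "e \<le> n div K"
  shows "field w m (WA (3 + 5 * cx c) * w + e * fn) fn = cut c S ((e + 1) * K) - 1"
proof (rule sect_field'[OF assms(1) _ _ _ FA_section(1)])
  show "3 + 5 * cx c < 13" using cx_le[of c] by simp
  show "e * fn + fn \<le> pv (size_reg (3 + 5 * cx c))"
    unfolding size_c by (rule slot_le) (use assms(2) in simp)
  show "cut c S ((e + 1) * K) - 1 < 2 ^ fn"
    by (rule fn_fits) (use cut_le_n[of c "(e + 1) * K"] in simp)
  fix j assume "j < fn"
  from div_mod_slot[OF this, of e]
  show "seldirf c (e * fn + j) \<longleftrightarrow> bit (cut c S ((e + 1) * K) - 1) j"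
    by (simp add: seldirf_def)
qed

text \<open>The instance of \<open>cut_le_iff\<close> that finds owners: the occurrences before a
  position inside a range determine the number of the range.\<close>

lemma occ_between:
  assumes "y < n" "cut c S J \<le> y" "y < cut c S J'"
  shows "J \<le> occf c y" "occf c y < J'"
  using cut_le_iff[of y S c J] cut_le_iff[of y S c J'] occf_eq[of y c] assms lenS by auto

text \<open>A range of at least \<open>K * K\<close> positions contains the last positions of
  \<open>K\<close> consecutive slots, the first of them being slot \<open>?s div K\<close>. So each
  answer has a slot owned by this range, and different ranges cannot collide.\<close>

lemma long_entry:
  assumes "blk m" and a: "a < K" and r: "cut c S (k * K) + K * K \<le> cut c S (k * K + K)"
  shows "field w m (WA (4 + 5 * cx c) * w + (cut c S (k * K) div K + a) * fn) fn = cut c S (k * K + a + 1) - 1"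
proof (rule sect_field'[OF assms(1) _ _ _ FA_section(2)])
  let ?s = "cut c S (k * K)"
  define z where "z = ?s div K + a"
  have "(z + 1) * K \<le> (?s div K + K) * K" using a by (intro mult_le_mono1) (simp add: z_def)
  also have "\<dots> \<le> ?s + K * K" using div_times_less_eq_dividend[of ?s K] by (simp add: algebra_simps)
  finally have z1: "(z + 1) * K \<le> cut c S (k * K + K)" using r by linarith
  have "?s < (?s div K + 1) * K" using dividend_less_div_times[of K ?s] by simp
  also have "\<dots> \<le> (z + 1) * K" by (intro mult_le_mono1) (simp add: z_def)
  finally have z2: "?s < (z + 1) * K" .
  have y: "(z + 1) * K - 1 < cut c S (k * K + K)" "?s \<le> (z + 1) * K - 1" using z1 z2 by linarith+
  then have yn: "(z + 1) * K - 1 < n" using cut_le_n[of c "k * K + K"] by linarith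
  \<comment> \<open>At least \<open>k * K\<close> and fewer than \<open>(k + 1) * K\<close>
    occurrences precede the end of slot \<open>z\<close>, so the division recovers
    \<open>k\<close>.\<close>
  have "occf c ((z + 1) * K - 1) div K = k"
    using occ_between[OF yn y(2,1)] by (intro div_nat_eqI) (simp_all add: mult.commute)
  note own = this
  have zn: "z < n div K + 1"
  proof -
    have "z * K \<le> n" using yn by simp
    then have "z \<le> n div K" using L_pos(3) by (simp add: less_eq_div_iff_mult_less_eq)
    then show ?thesis by simp
  qed
  show "4 + 5 * cx c < 13" using cx_le[of c] by simp
  show "(?s div K + a) * fn + fn \<le> pv (size_reg (4 + 5 * cx c))"
    unfolding size_c z_def[symmetric] by (rule slot_le[OF zn])
  show "cut c S (k * K + a + 1) - 1 < 2 ^ fn"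
    by (rule fn_fits) (use cut_le_n[of c "k * K + a + 1"] in simp)
  fix j assume j: "j < fn"
  have d: "(z * fn + j) div fn = z" "(z * fn + j) mod fn = j" using div_mod_slot[OF j, of z] by auto
  have "longf c (z * fn + j) \<longleftrightarrow> bit (cut c S (k * K + a + 1) - 1) j"
    unfolding longf_def Let_def d own by (simp add: z_def)
  then show "longf c ((?s div K + a) * fn + j) \<longleftrightarrow> bit (cut c S (k * K + a + 1) - 1) j"
    unfolding z_def .
qed

lemma lg_LL: "lg LL \<le> LL"
  by (rule lg_le_self) (simp add: Suc_leI)

lemma lg_short: "r < K * K \<Longrightarrow> lg r \<le> 4 * LL"
proof -
  assume "r < K * K"
  then have "lg r \<le> lg (K * K)" by (intro lg_mono) simp
  also have "\<dots> \<le> lg K + lg K" by (rule lg_mult)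
  also have "lg K \<le> lg L + lg LL" unfolding K_def by (rule lg_mult)
  finally show ?thesis using lg_LL LL_def by linarith
qed

lemma lenf_eq:
  "cut c S (k * K + K) - cut c S (k * K) < K * K \<Longrightarrow> lenf c k = cut c S (k * K + K) - cut c S (k * K)"
  by (simp add: lenf_def Let_def)

text \<open>The factor \<open>LL\<close> cancels in \<open>K div K2\<close>, leaving
  \<open>L div lg r\<close> entries of at most \<open>2 * lg r\<close> bits, together at most
  \<open>2 * L\<close>. The remaining \<open>5 * LL\<close> pays for one further entry, the end of
  the last sub-range.\<close>

lemma subdir_room:
  assumes r: "r < K * K" and i: "i \<le> K div (lg r * LL)"
  shows "i * floorlog 2 r + floorlog 2 r \<le> A2"
proof -
  have K2: "K div (lg r * LL) = L div lg r" unfolding K_def by simp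
  have b1: "floorlog 2 r \<le> 2 * lg r" "floorlog 2 r \<le> 5 * LL"
    using floorlog_le_lg[of r] lg_pos(1)[of r] lg_short[OF r] L_pos(2) by linarith+
  have "i * floorlog 2 r \<le> L div lg r * (2 * lg r)" using i b1(1) unfolding K2 by (intro mult_le_mono)
  also have "\<dots> = 2 * (L div lg r * lg r)" by simp
  also have "\<dots> \<le> 2 * L" by (intro mult_le_mono2 div_times_less_eq_dividend)
  finally show ?thesis unfolding A2_def using b1(2) by linarith
qed

text \<open>The threshold for storing answers directly is exactly what is needed:
  \<open>lg r * LL\<close> answers of at most \<open>2 * lg r'\<close> bits fit if two bits are
  granted per \<open>LL\<close> positions of the sub-range.\<close>

lemma subans_room:
  assumes "lg r' * lg r * (LL * LL) \<le> r'"
  shows "lg r * LL * floorlog 2 r' \<le> 2 * (r' div LL)"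
proof -
  have b1: "floorlog 2 r' \<le> 2 * lg r'" using floorlog_le_lg[of r'] lg_pos(1)[of r'] by linarith
  then have "lg r * LL * floorlog 2 r' \<le> lg r * LL * (2 * lg r')" by (intro mult_le_mono2)
  also have "\<dots> = 2 * (lg r' * lg r * LL)" by simp
  also have "\<dots> \<le> 2 * (r' div LL)"
  proof -
    have "lg r' * lg r * LL * LL \<le> r'" using assms by (simp only: mult.assoc)
    then have "lg r' * lg r * LL \<le> r' div LL" using L_pos(2) by (simp only: less_eq_div_iff_mult_less_eq)
    then show ?thesis by simp
  qed
  finally show ?thesis .
qed

lemma div_add_le: "s div d + r div d \<le> (s + r) div d" for s r d :: nat
proof (cases "d = 0")
  case False
  have "(s div d + r div d) * d \<le> s + r"
    using div_times_less_eq_dividend[of s d] div_times_less_eq_dividend[of r d]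
    unfolding add_mult_distrib by linarith
  then show ?thesis using False by (simp add: less_eq_div_iff_mult_less_eq)
qed simp

lemma subdir_entry:
  fixes c k
  defines "r \<equiv> cut c S (k * K + K) - cut c S (k * K)"
  defines "K2 \<equiv> lg r * LL" and "b \<equiv> floorlog 2 r"
  assumes "blk m" and k: "k * K < count_list S c" and r: "r < K * K" and i: "i \<le> K div K2"
  shows "field w m (WA (5 + 5 * cx c) * w + (k * A2 + i * b)) b =
     cut c S (k * K + min ((i + 1) * K2) K) - 1 - cut c S (k * K)"
proof (rule sect_field'[OF assms(4) _ _ _ FA_section(3)])
  have lf: "lenf c k = r" using lenf_eq r by (simp add: r_def)
  have ib: "i * b + b \<le> A2" unfolding b_def by (rule subdir_room[OF r]) (use i in \<open>simp add: K2_def\<close>)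
  have kn: "k < n div K + 1"
  proof -
    have "k * K \<le> n" using k count_le_n[of c] by linarith
    then have "k \<le> n div K" using L_pos(3) by (simp add: less_eq_div_iff_mult_less_eq)
    then show ?thesis by simp
  qed
  show "5 + 5 * cx c < 13" using cx_le[of c] by simp
  show "k * A2 + i * b + b \<le> pv (size_reg (5 + 5 * cx c))"
    unfolding size_c using slot_le[OF kn, of A2] ib by linarith
  have "cut c S (k * K + min ((i + 1) * K2) K) \<le> cut c S (k * K + K)" by (intro cut_mono) simp
  then have "cut c S (k * K + min ((i + 1) * K2) K) - 1 - cut c S (k * K) \<le> r"
    unfolding r_def by linarith
  then show "cut c S (k * K + min ((i + 1) * K2) K) - 1 - cut c S (k * K) < 2 ^ b"
    using less_exp_floorlog[of r] unfolding b_def by linarith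
  fix j assume j: "j < b"
  have "i * b + j < A2" using ib j by linarith
  note d = div_mod_slot[OF this, of k]
  show "subdirf c (k * A2 + i * b + j) \<longleftrightarrow>
      bit (cut c S (k * K + min ((i + 1) * K2) K) - 1 - cut c S (k * K)) j"
    using d div_mod_slot[OF j, of i] unfolding subdirf_def Let_def stepf_def add.assoc
    by (simp add: lf b_def[symmetric] K2_def[symmetric])
qed

text \<open>Only slots lying before the last slot boundary of the sub-range are used. By
  \<open>subans_room\<close> they suffice, and each of them is owned by this very sub-range, so the
  closed form decodes it correctly.\<close>

lemma subans_entry:
  fixes c k j
  defines "r \<equiv> cut c S (k * K + K) - cut c S (k * K)"
  defines "K2 \<equiv> lg r * LL"
  defines "q \<equiv> k * K + j * K2"
  defines "r' \<equiv> cut c S (min (q + K2) (k * K + K)) - cut c S q"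
  defines "b \<equiv> floorlog 2 r'"
  assumes "blk m" and r: "r < K * K" and jK: "j * K2 < K"
    and r': "lg r' * lg r * (LL * LL) \<le> r'" and a: "a < K2"
    and fit: "q + a + 1 \<le> min (q + K2) (k * K + K)"
  shows "field w m (WA (6 + 5 * cx c) * w + (2 * (cut c S q div LL) + a * b)) b =
     cut c S (q + a + 1) - 1 - cut c S q \<and> cut c S (q + a + 1) - 1 - cut c S q < 2 ^ b"
proof -
  let ?s = "cut c S q" and ?e = "cut c S (min (q + K2) (k * K + K))"
  have se: "?s \<le> ?e" by (rule cut_mono) (use jK in \<open>simp add: q_def\<close>)
  have lf: "lenf c k = r" using lenf_eq r by (simp add: r_def)
  have rr: "r' \<le> r"
  proof -
    have "?e \<le> cut c S (k * K + K)" by (rule cut_mono) simp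
    moreover have "cut c S (k * K) \<le> ?s" by (rule cut_mono) (simp add: q_def)
    ultimately show ?thesis unfolding r_def r'_def by linarith
  qed
  have cap: "a * b + o' < 2 * (r' div LL)" if "o' < b" for o'
  proof -
    have "a * b + o' < K2 * b" using slot_le[OF a, of b] that by linarith
    also have "\<dots> \<le> 2 * (r' div LL)" unfolding K2_def b_def by (rule subans_room[OF r'])
    finally show ?thesis .
  qed
  have dv: "?s div LL + r' div LL \<le> ?e div LL"
  proof -
    have "(?s div LL + r' div LL) * LL \<le> ?s + r'"
      using div_times_less_eq_dividend[of ?s LL] div_times_less_eq_dividend[of r' LL]
      unfolding add_mult_distrib by linarith
    then have "(?s div LL + r' div LL) * LL \<le> ?e" using se unfolding r'_def by linarith
    then show ?thesis using L_pos(2) by (simp only: less_eq_div_iff_mult_less_eq)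
  qed
  \<comment> \<open>The last position of slot \<open>v\<close> lies in the sub-range. The
    occurrences before it first give the range \<open>k\<close> and then, modulo \<open>K\<close>,
    the sub-range \<open>j\<close>.\<close>
  have own: "subf c v = q" "sublenf c v = r'" "v < n div LL"
    if v: "?s div LL \<le> v" "v < ?e div LL" for v
  proof -
    have en: "?e div LL \<le> n div LL" by (intro div_le_mono cut_le_n)
    then show "v < n div LL" using v by linarith
    have "?s < (?s div LL + 1) * LL" using dividend_less_div_times[of LL ?s] by simp
    also have "\<dots> \<le> (v + 1) * LL" using v by (intro mult_le_mono1) simp
    finally have y1: "?s \<le> (v + 1) * LL - 1" by linarith
    have "(v + 1) * LL \<le> ?e div LL * LL" using v by (intro mult_le_mono1) simp
    also have "\<dots> \<le> ?e" by (rule div_times_less_eq_dividend)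
    finally have y2: "(v + 1) * LL - 1 < ?e" using y1 L_pos(2) by (cases "(v + 1) * LL") auto
    have yn: "(v + 1) * LL - 1 < n" using y2 cut_le_n[of c "min (q + K2) (k * K + K)"] by linarith
    define j0 where "j0 = occf c ((v + 1) * LL - 1)"
    have j0: "q \<le> j0" "j0 < q + K2" "j0 < k * K + K"
      using occ_between[OF yn y1 y2] by (simp_all add: j0_def)
    have jk: "j0 div K = k"
      by (rule div_nat_eqI) (use j0 in \<open>simp_all add: q_def mult.commute\<close>)
    have km: "k * K + j0 mod K = j0" using div_mult_mod_eq[of j0 K] jk by simp
    have jm: "j0 mod K div K2 = j"
    proof (rule div_nat_eqI)
      show "K2 * j \<le> j0 mod K" using km j0(1) mult.commute[of K2 j] unfolding q_def by linarith
      show "j0 mod K < K2 * Suc j"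
        using km j0(2) mult.commute[of K2 j] unfolding q_def mult_Suc_right by linarith
    qed
    show sf: "subf c v = q"
      unfolding subf_def Let_def j0_def[symmetric] jk stepf_def lf K2_def[symmetric] jm
      by (simp add: q_def)
    have qk: "q div K = k"
      by (rule div_nat_eqI) (use jK in \<open>simp_all add: q_def mult.commute\<close>)
    show "sublenf c v = r'"
      unfolding sublenf_def Let_def sf qk stepf_def lf K2_def[symmetric] r'_def[symmetric]
      using rr r by simp
  qed
  \<comment> \<open>The start is rounded down to a slot boundary and the capacity is
    \<open>2 * (r' div LL)\<close> bits, so every bit falls into an owned slot.\<close>
  have bitpos: "?s div LL \<le> (2 * (?s div LL) + (a * b + o')) div 2"
    "(2 * (?s div LL) + (a * b + o')) div 2 < ?e div LL" if "o' < b" for o'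
    using cap[OF that] dv by linarith+
  have small: "cut c S (q + a + 1) - 1 - ?s < 2 ^ b"
  proof -
    have "cut c S (q + a + 1) \<le> ?e" by (rule cut_mono[OF fit])
    then have "cut c S (q + a + 1) - 1 - ?s \<le> r'" unfolding r'_def by linarith
    then show ?thesis using less_exp_floorlog[of r'] unfolding b_def by linarith
  qed
  have "field w m (WA (6 + 5 * cx c) * w + (2 * (?s div LL) + a * b)) b = cut c S (q + a + 1) - 1 - ?s"
  proof (rule sect_field'[OF assms(6) _ _ small FA_section(4)])
    show "6 + 5 * cx c < 13" using cx_le[of c] by simp
    have "a * b + b \<le> 2 * (r' div LL)"
      using cap[of "b - 1"] by (cases b) auto
    then show "2 * (?s div LL) + a * b + b \<le> pv (size_reg (6 + 5 * cx c))"
      unfolding size_c using dv div_le_mono[OF cut_le_n[of c "min (q + K2) (k * K + K)"], of LL] by linarith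
    fix o' assume o: "o' < b"
    note ow = own[OF bitpos[OF o]]
    have x: "2 * (?s div LL) + (a * b + o') - 2 * (?s div LL) = a * b + o'" by simp
    show "subansf c (2 * (?s div LL) + a * b + o') \<longleftrightarrow> bit (cut c S (q + a + 1) - 1 - ?s) o'"
      unfolding subansf_def Let_def add.assoc[of _ "a * b" o'] ow x b_def[symmetric]
      using div_mod_slot[OF o, of a] by (simp add: add.assoc)
  qed
  with small show ?thesis by blast
qed

lemma seltab_entry:
  assumes "blk m" "1 \<le> l" "l \<le> H" "j < 2 ^ l * l"
  shows "field w m (WA (7 + 5 * cx c) * w + ((l - 1) * SA + j * floorlog 2 l)) (floorlog 2 l) = select_table c l ! j"
proof (rule sect_field'[OF assms(1) _ _ _ FA_section(5)])
  let ?b = "floorlog 2 l"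
  have bH: "?b \<le> fH" unfolding fH_def using assms(3) by (rule floorlog_mono2)
  have y: "j * ?b + k < SA" if "k < ?b" for k
    unfolding SA_def by (rule table_slot[OF assms(3,4) bH that])
  show "7 + 5 * cx c < 13" using cx_le[of c] by simp
  have b0: "0 < ?b" using less_exp_floorlog[of l] assms(2) by (cases ?b) auto
  have "j * ?b + ?b \<le> SA" using y[of "?b - 1"] b0 by simp
  moreover have "(l - 1) * SA + SA \<le> H * SA" using slot_le[of "l - 1" H SA] assms(2,3) by simp
  ultimately show "(l - 1) * SA + j * ?b + ?b \<le> pv (size_reg (7 + 5 * cx c))" unfolding size_c by linarith
  have x: "j div l < 2 ^ l" using assms(4) by (simp add: less_mult_imp_div_less)
  have st: "select_table c l ! j = sel_entry l (if c then j div l else 2 ^ l - 1 - j div l) (j mod l)"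
    by (rule select_table_nth[OF assms(4)])
  have "select_table c l ! j < l" unfolding st using assms(2) by (intro sel_entry_less) simp
  then show "select_table c l ! j < 2 ^ ?b" using less_exp_floorlog[of l] by linarith
  fix k assume k: "k < ?b"
  have a: "((l - 1) * SA + (j * ?b + k)) div SA = l - 1" "((l - 1) * SA + (j * ?b + k)) mod SA = j * ?b + k"
    using div_mod_slot[OF y[OF k], of "l - 1"] by auto
  have l1: "l - 1 + 1 = l" using assms(2) by simp
  let ?v = "if c then j div l else 2 ^ l - 1 - j div l"
  have v: "?v < 2 ^ l" using x by (cases c) auto
  have jm: "j mod l < H" using assms(2,3) mod_less_divisor[of l j] by linarith
  have "sel_list (?v * H + j mod l) = sel_entry H ?v (j mod l)"
    unfolding sel_list_def using div_mod_slot[OF jm, of ?v] by simp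
  also have "\<dots> = select_table c l ! j" unfolding st by (rule sel_entry_prefix[OF v assms(3)])
  finally have sl: "sel_list (?v * H + j mod l) = select_table c l ! j" .
  have xm: "j div l mod 2 ^ l = j div l" using x by simp
  have d: "(j * ?b + k) div ?b = j" "(j * ?b + k) mod ?b = k" using div_mod_slot[OF k, of j] by auto
  show "seltabf c ((l - 1) * SA + j * ?b + k) \<longleftrightarrow> bit (select_table c l ! j) k"
    unfolding seltabf_def Let_def add.assoc[of _ "j * ?b" k] a l1 d xm sl ..
qed

section \<open>The block contains both structures\<close>

lemma jacobson_blk:
  assumes b: "blk m"
  shows "jacobson w m n len S"
proof -
  have LL2: "L\<^sup>2 = L * L" by (simp add: power2_eq_square)
  have 1: "stores w m n len fn (rank_dir1 S)"
    by (rule sect_stores[of 0 0])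
      (use dir1_entry[OF b] in \<open>auto simp: size_reg_def length_rank_dir1 rank_dir1_nth lenS LL2 L_def[symmetric]\<close>)
  have 2: "stores w m n len f2 (rank_dir2 S)"
    by (rule sect_stores[of 1 0])
      (use dir2_entry[OF b] in \<open>auto simp: size_reg_def length_rank_dir2 rank_dir2_nth lenS LL2 L_def[symmetric]\<close>)
  have 3: "stores w m n len fh (rank_table l)" if l: "l \<le> h" for l
  proof (cases "l = 0")
    case True
    then show ?thesis using stores_Nil length_rank_table[of 0] by simp
  next
    case False
    have "2 ^ l * l * fh \<le> RA" unfolding RA_def using l by (intro mult_le_mono power_increasing) auto
    moreover have "(l - 1) * RA + RA \<le> h * RA" using slot_le[of "l - 1" h RA] l False by simp
    ultimately have "(l - 1) * RA + length (rank_table l) * fh \<le> pv (size_reg 2)"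
      by (simp add: size_reg_def length_rank_table)
    then show ?thesis
      by (rule sect_stores[rotated])
        (use rtab_entry[OF b _ l] False in \<open>auto simp: length_rank_table rank_table_nth\<close>)
  qed
  show ?thesis
    unfolding jacobson_def Let_def lenS L_def[symmetric] h_def[symmetric] LL2
    using 1 2 3 by (simp add: fn_def f2_def fh_def)
qed

lemma lt_div_mult_le: "i < a div d \<Longrightarrow> (i + 1) * d \<le> a" for i a d :: nat
  using mult_le_mono1[of "i + 1" "a div d" d] div_times_less_eq_dividend[of a d] by linarith

lemma long_stores:
  fixes c k
  defines "R \<equiv> range_of c S (k * K) (k * K + K)"
  assumes b: "blk m" and k: "k * K < count_list S c" and r: "K * K \<le> length R"
  shows "stores w m n len fn (map (\<lambda>a. cut c S (k * K) + a) (select_answers c R))"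
proof -
  let ?s = "cut c S (k * K)"
  have JJ: "k * K \<le> k * K + K" and Jc: "k * K \<le> count_list S c" using k by simp_all
  have lR: "length R = cut c S (k * K + K) - ?s" by (simp add: R_def length_range)
  have r': "?s + K * K \<le> cut c S (k * K + K)"
    using r L_pos(3) unfolding lR by (cases "cut c S (k * K + K) - ?s") auto
  have cR: "count_list R c = min (k * K + K) (count_list S c) - k * K"
    unfolding R_def by (rule count_range[OF JJ Jc])
  have "(?s div K + K) * K \<le> n"
    using r' cut_le_n[of c "k * K + K"] div_times_less_eq_dividend[of ?s K] unfolding add_mult_distrib by linarith
  then have sl: "?s div K + K \<le> n div K" using L_pos(3) by (simp add: less_eq_div_iff_mult_less_eq)
  have "?s div K + count_list R c \<le> n div K + 1" using sl cR by linarith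
  then have "(?s div K + count_list R c) * fn \<le> (n div K + 1) * fn" by (rule mult_le_mono1)
  then have sz: "?s div K * fn + length (map (\<lambda>a. ?s + a) (select_answers c R)) * fn \<le> pv (size_reg (4 + 5 * cx c))"
    unfolding size_c by (simp add: select_answers_def add_mult_distrib)
  show ?thesis
  proof (rule sect_stores[OF _ sz])
    show "4 + 5 * cx c < 13" using cx_le[of c] by simp
    fix i assume "i < length (map (\<lambda>a. ?s + a) (select_answers c R))"
    then have i: "i < count_list R c" by (simp add: select_answers_def)
    have iK: "i < K" using i cR by linarith
    have ic: "1 \<le> i + 1" "i + 1 \<le> count_list (range_of c S (k * K) (k * K + K)) c" using i by (simp_all add: R_def)
    have "select c R (i + 1) + ?s = select c S (k * K + (i + 1))"
      using select_range[OF JJ Jc ic] by (simp add: R_def)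
    also have "\<dots> = cut c S (k * K + i + 1) - 1"
      using select_eq_cut[of "k * K + (i + 1)" S c] i cR by simp
    finally have v: "map (\<lambda>a. ?s + a) (select_answers c R) ! i = cut c S (k * K + i + 1) - 1"
      using i by (simp add: select_answers_def add.commute)
    show "field w m (WA (4 + 5 * cx c) * w + (?s div K * fn + i * fn)) fn
        = map (\<lambda>a. ?s + a) (select_answers c R) ! i"
      unfolding v using long_entry[OF b iK r'] by (simp only: add_mult_distrib)
  qed
qed

lemma subdir_stores:
  fixes c k
  defines "R \<equiv> range_of c S (k * K) (k * K + K)"
  defines "r \<equiv> length R"
  assumes b: "blk m" and k: "k * K < count_list S c" and r: "r < K * K"
  shows "stores w m n len (floorlog 2 r) (select_dir c (lg r * LL) R)"
proof -
  let ?s = "cut c S (k * K)" and ?K2 = "lg r * LL"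
  have JJ: "k * K \<le> k * K + K" and Jc: "k * K \<le> count_list S c" using k by simp_all
  have lR: "r = cut c S (k * K + K) - ?s" by (simp add: r_def R_def length_range)
  have cR: "count_list R c = min (k * K + K) (count_list S c) - k * K"
    unfolding R_def by (rule count_range[OF JJ Jc])
  have cK: "count_list R c div ?K2 \<le> K div ?K2" by (rule div_le_mono) (use cR in linarith)
  have "k * K \<le> n" using k count_le_n[of c] by linarith
  then have kn: "k < n div K + 1" using L_pos(3) by (simp add: less_Suc_eq_le less_eq_div_iff_mult_less_eq)
  have "count_list R c div ?K2 * floorlog 2 r + floorlog 2 r \<le> A2" by (rule subdir_room[OF r cK])
  then have sz: "k * A2 + length (select_dir c ?K2 R) * floorlog 2 r \<le> pv (size_reg (5 + 5 * cx c))"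
    unfolding size_c select_dir_def length_map length_upt diff_zero using slot_le[OF kn, of A2] by linarith
  show ?thesis
  proof (rule sect_stores[OF _ sz])
    show "5 + 5 * cx c < 13" using cx_le[of c] by simp
    fix i assume "i < length (select_dir c ?K2 R)"
    then have i: "i < count_list R c div ?K2" by (simp add: select_dir_def)
    then have i2: "(i + 1) * ?K2 \<le> count_list R c" by (rule lt_div_mult_le)
    have mn: "min ((i + 1) * ?K2) K = (i + 1) * ?K2" using i2 cR by linarith
    have ic: "1 \<le> (i + 1) * ?K2" "(i + 1) * ?K2 \<le> count_list (range_of c S (k * K) (k * K + K)) c"
      using i2 by (simp_all add: R_def Suc_leI)
    have "select c R ((i + 1) * ?K2) = select c S (k * K + (i + 1) * ?K2) - ?s"
      using select_range(1)[OF JJ Jc ic] by (simp add: R_def)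
    also have "\<dots> = cut c S (k * K + (i + 1) * ?K2) - 1 - ?s"
      using select_eq_cut[of "k * K + (i + 1) * ?K2" S c] ic(1) i2 cR by simp
    finally have v: "select_dir c ?K2 R ! i = cut c S (k * K + min ((i + 1) * ?K2) K) - 1 - ?s"
      unfolding mn using i by (simp add: select_dir_def)
    show "field w m (WA (5 + 5 * cx c) * w + (k * A2 + i * floorlog 2 r)) (floorlog 2 r) = select_dir c ?K2 R ! i"
      unfolding v
      using subdir_entry[OF b k, of i] r i cK unfolding lR[symmetric] by simp
  qed
qed

lemma short_bound:
  assumes "r < K * K" "r' \<le> r" "r' < lg r' * lg r * (LL * LL)"
  shows "r' < H"
proof -
  have "lg r \<le> 4 * LL" "lg r' \<le> 4 * LL" using lg_short[of r] lg_short[of r'] assms by simp_all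
  then have "lg r' * lg r * (LL * LL) \<le> (4 * LL) * (4 * LL) * (LL * LL)" by (intro mult_le_mono) auto
  also have "\<dots> = H" by (simp add: H_def)
  finally show ?thesis using assms(3) by linarith
qed

lemma subrange_blk:
  fixes c k j
  defines "R \<equiv> range_of c S (k * K) (k * K + K)"
  defines "r \<equiv> length R"
  assumes b: "blk m" and k: "k * K < count_list S c" and r: "r < K * K" and j: "j * (lg r * LL) < count_list R c"
  shows "clark_subrange w m n len c LL r (piece c (lg r * LL) R j)"
proof -
  let ?s = "cut c S (k * K)"
  define K2 where "K2 = lg r * LL"
  define q where "q = k * K + j * K2"
  define T where "T = piece c K2 R j"
  have JJ: "k * K \<le> k * K + K" and Jc: "k * K \<le> count_list S c" using k by simp_all
  have lR: "r = cut c S (k * K + K) - ?s" by (simp add: r_def R_def length_range)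
  have cR: "count_list R c = min (k * K + K) (count_list S c) - k * K"
    unfolding R_def by (rule count_range[OF JJ Jc])
  have jK: "j * K2 < K" "q < count_list S c" using j cR unfolding K2_def q_def by linarith+
  have T: "T = range_of c S q (min (q + K2) (k * K + K))"
    unfolding T_def R_def piece_range_of[OF JJ Jc]
    using jK(1) by (simp add: q_def min_absorb1 add_mult_distrib algebra_simps)
  let ?Q = "min (q + K2) (k * K + K)"
  have qQ: "q \<le> ?Q" using jK(1) by (simp add: q_def)
  have qc: "q \<le> count_list S c" using jK(2) by simp
  define r' where "r' = length T"
  have lT: "r' = cut c S ?Q - cut c S q" unfolding r'_def T by (rule length_range)
  have cT: "count_list T c = min ?Q (count_list S c) - q" unfolding T by (rule count_range[OF qQ qc])
  have rr: "r' \<le> r"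
  proof -
    have "cut c S ?Q \<le> cut c S (k * K + K)" by (rule cut_mono) simp
    moreover have "?s \<le> cut c S q" by (rule cut_mono) (simp add: q_def)
    ultimately show ?thesis unfolding lT lR by linarith
  qed
  have "stores w m n len (floorlog 2 r') (select_answers c T)" if long: "lg r' * lg r * (LL * LL) \<le> r'"
  proof -
    have "count_list T c \<le> K2" using cT by linarith
    then have "count_list T c * floorlog 2 r' \<le> K2 * floorlog 2 r'" by (rule mult_le_mono1)
    also have "\<dots> \<le> 2 * (r' div LL)" unfolding K2_def by (rule subans_room[OF long])
    finally have "count_list T c * floorlog 2 r' \<le> 2 * (r' div LL)" .
    moreover have "cut c S q div LL + r' div LL \<le> n div LL"
    proof -
      have "cut c S q + r' \<le> n" using lT cut_mono[OF qQ, of c S] cut_le_n[of c ?Q] by linarith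
      then have "(cut c S q + r') div LL \<le> n div LL" by (rule div_le_mono)
      then show ?thesis using div_add_le[of "cut c S q" LL r'] by linarith
    qed
    ultimately have sz: "2 * (cut c S q div LL) + length (select_answers c T) * floorlog 2 r' \<le> pv (size_reg (6 + 5 * cx c))"
      unfolding size_c by (simp add: select_answers_def)
    show ?thesis
    proof (rule sect_stores[OF _ sz])
      show "6 + 5 * cx c < 13" using cx_le[of c] by simp
      fix a assume "a < length (select_answers c T)"
      then have a: "a < count_list T c" by (simp add: select_answers_def)
      have aK: "a < K2" "q + a + 1 \<le> ?Q" "q + a + 1 \<le> count_list S c" using a cT by linarith+
      have ac: "1 \<le> a + 1" "a + 1 \<le> count_list (range_of c S q ?Q) c" using a unfolding T by simp_all
      have "select c T (a + 1) = select c S (q + (a + 1)) - cut c S q"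
        unfolding T by (rule select_range(1)[OF qQ qc ac])
      also have "\<dots> = cut c S (q + a + 1) - 1 - cut c S q"
        using select_eq_cut[of "q + (a + 1)" S c] aK(3) by simp
      finally have v: "select_answers c T ! a = cut c S (q + a + 1) - 1 - cut c S q"
        using a by (simp add: select_answers_def)
      show "field w m (WA (6 + 5 * cx c) * w + (2 * (cut c S q div LL) + a * floorlog 2 r')) (floorlog 2 r')
          = select_answers c T ! a"
        unfolding v
        using subans_entry[OF b, of c k j a] r jK(1) long aK(1,2)
        unfolding lR[symmetric] K2_def[symmetric] q_def[symmetric] lT[symmetric] by blast
    qed
  qed
  moreover have "stores w m n len (floorlog 2 l) (select_table c l)"
    if short: "r' < lg r' * lg r * (LL * LL)" and l: "l \<le> r'" for l
  proof (cases "l = 0")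
    case True
    then show ?thesis using stores_Nil length_select_table[of c 0] by simp
  next
    case False
    have lH: "l \<le> H" using short_bound[OF r rr short] l by linarith
    have "2 ^ l * l * floorlog 2 l \<le> SA"
      unfolding SA_def fH_def using lH by (intro mult_le_mono power_increasing floorlog_mono2) auto
    moreover have "(l - 1) * SA + SA \<le> H * SA" using slot_le[of "l - 1" H SA] lH False by simp
    ultimately have sz: "(l - 1) * SA + length (select_table c l) * floorlog 2 l \<le> pv (size_reg (7 + 5 * cx c))"
      unfolding size_c length_select_table by linarith
    show ?thesis
      by (rule sect_stores[OF _ sz])
        (use seltab_entry[OF b _ lH] False cx_le[of c] in \<open>auto simp: length_select_table\<close>)
  qed
  ultimately show ?thesis
    unfolding clark_subrange_def Let_def K2_def[symmetric] T_def[symmetric] r'_def[symmetric]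
    by (simp add: power2_eq_square not_le)
qed

lemma clark_blk:
  assumes b: "blk m"
  shows "clark w m n len c S"
proof -
  have LK: "L\<^sup>2 * LL\<^sup>2 = K * K" by (simp add: K_def power2_eq_square)
  have 1: "stores w m n len fn (select_dir c K S)"
  proof (rule sect_stores[of "3 + 5 * cx c" 0])
    show "3 + 5 * cx c < 13" using cx_le[of c] by simp
    have "count_list S c div K \<le> n div K" by (rule div_le_mono[OF count_le_n])
    then have "count_list S c div K * fn \<le> (n div K + 1) * fn" by (intro mult_le_mono1) simp
    then show "0 + length (select_dir c K S) * fn \<le> pv (size_reg (3 + 5 * cx c))"
      unfolding size_c by (simp add: select_dir_def)
    fix i assume "i < length (select_dir c K S)"
    then have i: "i < count_list S c div K" by (simp add: select_dir_def)
    then have iK: "(i + 1) * K \<le> count_list S c" by (rule lt_div_mult_le)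
    have "i \<le> n div K" using i div_le_mono[OF count_le_n[of c], of K] by linarith
    moreover have "1 \<le> (i + 1) * K" using L_pos(3) by (simp add: Suc_leI)
    ultimately show "field w m (WA (3 + 5 * cx c) * w + (0 + i * fn)) fn = select_dir c K S ! i"
      using seldir_entry[OF b, of i c] select_eq_cut[OF _ iK] i by (simp add: select_dir_def)
  qed
  have P: "piece c K S k = range_of c S (k * K) (k * K + K)" for k
    unfolding piece_range by (simp add: add.commute)
  have 2: "if K * K \<le> length (range_of c S (k * K) (k * K + K))
     then stores w m n len fn (map (\<lambda>a. cut c S (k * K) + a) (select_answers c (range_of c S (k * K) (k * K + K))))
     else stores w m n len (floorlog 2 (length (range_of c S (k * K) (k * K + K))))
            (select_dir c (lg (length (range_of c S (k * K) (k * K + K))) * LL) (range_of c S (k * K) (k * K + K))) \<and>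
       (\<forall>j. j * (lg (length (range_of c S (k * K) (k * K + K))) * LL) < count_list (range_of c S (k * K) (k * K + K)) c \<longrightarrow>
          clark_subrange w m n len c LL (length (range_of c S (k * K) (k * K + K)))
            (piece c (lg (length (range_of c S (k * K) (k * K + K))) * LL) (range_of c S (k * K) (k * K + K)) j))"
    if k: "k * K < count_list S c" for k
  proof (cases "K * K \<le> length (range_of c S (k * K) (k * K + K))")
    case True
    then show ?thesis using long_stores[OF b k True] by (simp only: if_True)
  next
    case False
    then have r: "length (range_of c S (k * K) (k * K + K)) < K * K" by simp
    show ?thesis using subdir_stores[OF b k r] subrange_blk[OF b k r] False by (simp only: if_False) blast
  qed
  show ?thesis
    unfolding clark_def Let_def lenS L_def[symmetric] LL_def[symmetric] K_def[symmetric] LK P fn_def[symmetric]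
    using 1 2 by blast
qed

end

section \<open>Queries\<close>

text \<open>Register \<open>x\<close> of the construction is word \<open>x\<close> of the block, whose address is in register 1.\<close>

abbreviation hd_e :: "nat \<Rightarrow> aexp" where "hd_e x \<equiv> Wrd (Var 1 +! Num x)"
abbreviation lg_e :: "aexp \<Rightarrow> aexp" where "lg_e e \<equiv> Wrd (Var 1 +! Num 64 +! e)"
abbreviation flog_e :: "aexp \<Rightarrow> aexp" where "flog_e e \<equiv> Wrd (Var 1 +! Num 64 +! hd_e 11 +! e)"
abbreviation sect_e :: "nat \<Rightarrow> aexp \<Rightarrow> aexp \<Rightarrow> aexp" where
  "sect_e s p b \<equiv> Fld (hd_e (31 + s) *! Var 0 +! p) b"

definition assigns :: "nat \<Rightarrow> aexp list \<Rightarrow> com" where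
  "assigns x0 es = seqs (map (\<lambda>k. Assign (x0 + k) (compile (es ! k))) [0..<length es])"

text \<open>The last column of the rank table for length \<open>h\<close>: the rank at the final bit
  of the string \<open>v\<close> is its number of ones.\<close>

definition ones_e :: "aexp \<Rightarrow> aexp" where
  "ones_e v = sect_e 2 ((hd_e 8 -! Num 1) *! hd_e 20 +! (v *! hd_e 8 +! (hd_e 8 -! Num 1)) *! hd_e 15) (hd_e 15)"

text \<open>With \<open>p = i + 1\<close> in register 4, the count is the sum of a first-level entry
  (8), a second-level entry (9) and the ones in two halves (11, 12) of the remaining
  \<open>p mod L\<close> bits (10). Directory entry 0 already covers one full block, so indices are
  lowered by 1 and a comparison suppresses the entry when no block precedes.\<close>

definition rank_es :: "aexp list" where
  "rank_es = [Var 3 +! Num 1,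
     hd_e 3,
     Var 4 div! (Var 5 *! Var 5),
     Var 4 div! Var 5,
     sect_e 0 ((Var 6 -! Num 1) *! hd_e 13) (hd_e 13) *! (Num 0 <! Var 6),
     sect_e 1 ((Var 7 -! Num 1) *! hd_e 14) (hd_e 14) *! (Num 0 <! Var 7 mod! Var 5),
     Fld (Var 7 *! Var 5) (Var 4 mod! Var 5),
     ones_e (Var 10 mod! hd_e 17),
     ones_e (Var 10 div! hd_e 17),
     Var 8 +! Var 9 +! Var 11 +! Var 12]"

text \<open>Zeros are the positions that are not ones; the two products replace a branch on
  \<open>c\<close>.\<close>

definition rank_query :: com where
  "rank_query = Seq (assigns 4 rank_es)
     (Assign 0 (compile (Var 2 *! Var 13 +! (Num 1 -! Var 2) *! (Var 4 -! Var 13))))"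

text \<open>Occurrences are counted from 0 here. Registers 5 to 8 hold the number, start, end and
  length of the range. Adding 1 turns the stored position of an occurrence into the cut behind
  it.\<close>

definition sel_es :: "bool \<Rightarrow> aexp list" where
  "sel_es c = [Var 3 -! Num 1,
     Var 4 div! hd_e 6,
     (Num 0 <! Var 5) *! (sect_e (3 + 5 * cx c) ((Var 5 -! Num 1) *! hd_e 13) (hd_e 13) +! Num 1),
     sect_e (3 + 5 * cx c) (Var 5 *! hd_e 13) (hd_e 13) +! Num 1,
     Var 7 -! Var 6]"

definition sel_long :: "bool \<Rightarrow> com" where
  "sel_long c = Assign 0 (compile
     (sect_e (4 + 5 * cx c) ((Var 6 div! hd_e 6 +! Var 4 mod! hd_e 6) *! hd_e 13) (hd_e 13)))"

text \<open>Registers 9 to 11 hold the logarithm, entry length and step of the range; 12 to 15 the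
  number, start, end and length of the sub-range; 16 and 17 its logarithm and entry length; 18 the
  index within it; 19 the threshold.\<close>

definition sub_es :: "bool \<Rightarrow> aexp list" where
  "sub_es c = [lg_e (Var 8),
     flog_e (Var 8),
     Var 9 *! hd_e 5,
     Var 4 mod! hd_e 6 div! Var 11,
     Var 6 +! (Num 0 <! Var 12) *!
       (sect_e (5 + 5 * cx c) (Var 5 *! hd_e 23 +! (Var 12 -! Num 1) *! Var 10) (Var 10) +! Num 1),
     Var 6 +! (sect_e (5 + 5 * cx c) (Var 5 *! hd_e 23 +! Var 12 *! Var 10) (Var 10) +! Num 1),
     Var 14 -! Var 13,
     lg_e (Var 15),
     flog_e (Var 15),
     Var 4 mod! hd_e 6 mod! Var 11,
     Var 16 *! Var 9 *! (hd_e 5 *! hd_e 5)]"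

definition sel_sub :: "bool \<Rightarrow> com" where
  "sel_sub c = Seq (assigns 9 (sub_es c))
     (Cond (compile (Var 15 <! Var 19))
       (Seq (assigns 20 [Fld (Var 13) (Var 15)])
         (Assign 0 (compile (sect_e (7 + 5 * cx c)
            ((Var 15 -! Num 1) *! hd_e 21 +! (Var 20 *! Var 15 +! Var 18) *! Var 17) (Var 17) +! Var 13))))
       (Assign 0 (compile (sect_e (6 + 5 * cx c)
            (Num 2 *! (Var 13 div! hd_e 5) +! Var 18 *! Var 17) (Var 17) +! Var 13))))"

definition sel_prog :: "bool \<Rightarrow> com" where
  "sel_prog c = Seq (assigns 4 (sel_es c))
     (Cond (compile (Var 8 <! hd_e 10)) (sel_sub c) (sel_long c))"

definition select_query :: com where
  "select_query = Cond (Reg 2) (sel_prog True) (sel_prog False)"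

context layout
begin

text \<open>Memory may contain full \<open>w\<close>-bit words, but only words of \<open>u\<close>
  bits may enter arithmetic. Header and logarithm tables meet this; everything else is read as a
  field.\<close>

definition qenv :: "memory \<Rightarrow> (nat \<Rightarrow> nat) \<Rightarrow> nat \<Rightarrow> env" where
  "qenv m qv y = \<lparr>regv = qv, regok = (\<lambda>x. x < y), arrv = (\<lambda>_ _. 0), arrok = (\<lambda>_ _. False),
     wrdv = m, wrdok = (\<lambda>p. m p < 2 ^ u), fldv = field w m, fldok = (\<lambda>_ _. True)\<rparr>"

lemma models_qenv:
  assumes "valid_mem w m" "qv 0 = w" "0 < y" "\<And>x. x < y \<Longrightarrow> r x = qv x \<and> qv x < 2 ^ u"
  shows "models w u (qenv m qv y) m r"
  by (rule modelsI) (use assms bb.u8 in \<open>auto simp: qenv_def valid_mem_def\<close>)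

lemma runs_assigns:
  assumes m: "valid_mem w m" "qv 0 = w" "0 < x0"
    and r: "\<And>x. x < x0 \<Longrightarrow> r x = qv x"
    and u: "\<And>x. x < x0 + length es \<Longrightarrow> qv x < 2 ^ u"
    and ok: "\<And>k. k < length es \<Longrightarrow> small (es ! k) \<and> good u (qenv m qv (x0 + k)) (es ! k) \<and>
        aeval (qenv m qv (x0 + k)) (es ! k) = qv (x0 + k)"
  shows "\<exists>r'. runs w (assigns x0 es) (m, r) (1 + length es * (max_ops + 1)) (1 + length es * (max_ops + 1)) (m, r')
     \<and> (\<forall>x < x0 + length es. r' x = qv x)"
proof -
  define P where "P k s \<longleftrightarrow> fst s = m \<and> (\<forall>x < x0 + k. snd s x = qv x)" for k and s :: "memory \<times> regs"
  let ?cs = "map (\<lambda>k. Assign (x0 + k) (compile (es ! k))) [0..<length es]"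
  have "\<exists>s'. runs w (seqs ?cs) (m, r) (1 + (\<Sum>k = 0..<0 + length ?cs. max_ops + 1))
      (1 + (\<Sum>k = 0..<0 + length ?cs. max_ops + 1)) s' \<and> P (0 + length ?cs) s'"
  proof (rule runs_seqs)
    show "P 0 (m, r)" using r by (simp add: P_def)
  next
    fix k and s :: "memory \<times> regs" assume "k < length ?cs" and P: "P (0 + k) s"
    then have k: "k < length es" by simp
    obtain r1 where s: "s = (m, r1)" using P by (cases s) (auto simp: P_def)
    have r1: "r1 x = qv x" if "x < x0 + k" for x using P that by (auto simp: P_def s)
    have M: "models w u (qenv m qv (x0 + k)) m r1"
      by (rule models_qenv) (use m r1 u k in auto)
    note o = ok[OF k]
    have "eval w m r1 (compile (es ! k)) = qv (x0 + k)"
      using compile_correct[OF M _ bb.small_w] o by simp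
    from runs_Assign[OF this, of "x0 + k"]
    have "runs w (Assign (x0 + k) (compile (es ! k))) (m, r1) (max_ops + 1) (max_ops + 1) (m, r1(x0 + k := qv (x0 + k)))"
      by (rule runs_mono) (use o in \<open>auto simp: small_def\<close>)
    moreover have "P (Suc (0 + k)) (m, r1(x0 + k := qv (x0 + k)))"
      using r1 by (auto simp: P_def less_Suc_eq)
    ultimately show "\<exists>s'. runs w (?cs ! k) s (max_ops + 1) (max_ops + 1) s' \<and> P (Suc (0 + k)) s'"
      using k unfolding s by auto
  qed
  then obtain s' where s': "runs w (seqs ?cs) (m, r) (1 + (\<Sum>k = 0..<0 + length ?cs. max_ops + 1))
      (1 + (\<Sum>k = 0..<0 + length ?cs. max_ops + 1)) s'" "P (0 + length ?cs) s'" by blast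
  then obtain r' where p: "s' = (m, r')" by (cases s') (auto simp: P_def)
  have "runs w (assigns x0 es) (m, r) (1 + length es * (max_ops + 1)) (1 + length es * (max_ops + 1)) (m, r')"
    unfolding assigns_def by (rule runs_mono[OF s'(1)[unfolded p]]) auto
  then show ?thesis using s'(2) by (auto simp: P_def p)
qed

lemma runs_result:
  assumes m: "valid_mem w m" "qv 0 = w" "0 < y"
    and r: "\<And>x. x < y \<Longrightarrow> r x = qv x" and u: "\<And>x. x < y \<Longrightarrow> qv x < 2 ^ u"
    and e: "small e" "good u (qenv m qv y) e" "aeval (qenv m qv y) e = v"
  shows "\<exists>r'. runs w (Assign 0 (compile e)) (m, r) (max_ops + 1) (max_ops + 1) (m, r') \<and> r' 0 = v"
proof -
  have M: "models w u (qenv m qv y) m r" by (rule models_qenv) (use m r u in auto)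
  have "eval w m r (compile e) = v" using compile_correct[OF M e(2) bb.small_w[OF e(1)]] e(3) by simp
  from runs_Assign[OF this, of 0] have "runs w (Assign 0 (compile e)) (m, r) (max_ops + 1) (max_ops + 1) (m, r(0 := v))"
    by (rule runs_mono) (use e(1) in \<open>auto simp: small_def\<close>)
  then show ?thesis by (intro exI[of _ "r(0 := v)"]) simp
qed

lemma eval_cond:
  assumes m: "valid_mem w m" "qv 0 = w" "0 < y"
    and r: "\<And>x. x < y \<Longrightarrow> r x = qv x" and u: "\<And>x. x < y \<Longrightarrow> qv x < 2 ^ u"
    and e: "small e" "good u (qenv m qv y) e"
  shows "eval w m r (compile e) = aeval (qenv m qv y) e"
proof -
  have M: "models w u (qenv m qv y) m r" by (rule models_qenv) (use m r u in auto)
  show ?thesis using compile_correct[OF M e(2) bb.small_w[OF e(1)]] by simp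
qed

lemma field_u: "b < u \<Longrightarrow> field w m p b < 2 ^ u"
  using field_less[of w m p b] by (meson less_imp_le_nat less_le_trans one_le_numeral power_increasing)

lemma len_bounds: "fn < u" "f2 < u" "fh < u" "fH < u"
proof -
  have L: "8192 * L \<le> u" using u_ge by (simp add: word_factor_def)
  have "n < 2 ^ (L + 1)" using n_le by (simp add: le_less_trans)
  then have "fn \<le> L + 1" unfolding fn_def by (rule floorlog_le_if)
  then show "fn < u" using L L_pos(1) by linarith
  have "L * L < 2 ^ L * 2 ^ L" using less_exp[of L] by (intro mult_strict_mono) auto
  then have "f2 \<le> L + L" unfolding f2_def by (intro floorlog_le_if) (simp add: power_add)
  then show "f2 < u" using L L_pos(1) by linarith
  show "fh < u" using floorlog_le[of h] h_le L L_pos(1) unfolding fh_def by linarith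
  show "fH < u" using floorlog_le[of H] u_bounds(2) unfolding fH_def by linarith
qed

section \<open>Rank queries\<close>

lemma seq_bit:
  assumes "holds_seq w m S" "i < n"
  shows "mem_bit w m i = S ! i"
  using assms lenS by (simp add: holds_seq_def)

lemma occ_add: "a + t \<le> n \<Longrightarrow> occ True S (a + t) = occ True S a + (\<Sum>j < t. of_bool (S ! (a + j)))"
proof (induction t)
  case (Suc t)
  then show ?case using occ_Suc[of "a + t" S True] lenS by simp
qed simp

lemma popc_add: "popc (a + b) v = popc a v + popc b (v div 2 ^ a)"
proof (induction b)
  case (Suc b)
  then show ?case by (simp add: popc_def flip: drop_bit_eq_div) (simp add: bit_drop_bit_eq add.assoc)
qed (simp add: popc_def)

text \<open>The surplus \<open>d\<close> allows counting over two halves of \<open>h\<close> bits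
  although the field may be shorter: the bits above it are zero.\<close>

lemma popc_field:
  assumes "holds_seq w m S" "a + t \<le> n"
  shows "popc (t + d) (field w m a t) = occ True S (a + t) - occ True S a"
proof -
  have "popc (t + d) (field w m a t) = popc (t + d) (field w m a t mod 2 ^ t)"
    using field_less[of w m a t] by simp
  also have "\<dots> = popc t (field w m a t)" by (rule popc_take_bit) simp
  also have "\<dots> = (\<Sum>j < t. of_bool (S ! (a + j)))"
    unfolding popc_def using seq_bit[OF assms(1)] assms(2) by (intro sum.cong) (auto simp: bit_field)
  finally show ?thesis using occ_add[OF assms(2)] by simp
qed

lemma rank_query_correct:
  assumes b: "blk m" and v: "valid_mem w m" and hs: "holds_seq w m S" and i: "i < n"
  shows "\<exists>r. runs w rank_query (m, init_regs [w, n, of_bool c, i]) (20 * (max_ops + 1)) (20 * (max_ops + 1)) (m, r) \<and>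
     r 0 = rank c S i"
proof -
  define p where "p = i + 1"
  define A where "A = p div (L * L)"
  define B where "B = p div L"
  define x where "x = field w m (B * L) (p mod L)"
  have pn: "p \<le> n" using i by (simp add: p_def)
  have nu: "n < 2 ^ u" using pv_less[of 1] by simp
  let ?d1 = "field w m (WA 0 * w + (A - 1) * fn) fn * of_bool (0 < A)"
  let ?d2 = "field w m (WA 1 * w + (B - 1) * f2) f2 * of_bool (0 < B mod L)"
  have AB: "A = B div L" unfolding A_def B_def by (simp add: div_mult2_eq)
  have d1: "?d1 = occ True S (A * (L * L))"
  proof (cases "A = 0")
    case False
    have "A \<le> n div (L * L)" unfolding A_def using pn by (rule div_le_mono)
    then have "A - 1 < n div (L * L)" using False by linarith
    from dir1_entry[OF b this] show ?thesis using False by simp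
  qed simp
  have BL: "A * (L * L) + B mod L * L = B * L"
  proof -
    have "A * (L * L) + B mod L * L = (B div L * L + B mod L) * L"
      unfolding AB by (simp only: add_mult_distrib mult.assoc)
    then show ?thesis by simp
  qed
  \<comment> \<open>If \<open>B\<close> is a multiple of \<open>L\<close>, the prefix ends at a
    first-level mark and nothing is to be added; entry \<open>B - 1\<close> would still belong to
    the preceding range.\<close>
  have d2: "?d2 = occ True S (B * L) - occ True S (A * (L * L))"
  proof (cases "B mod L = 0")
    case True
    have "A * (L * L) = B * L" using BL unfolding True by (simp only: mult_0 add_0_right)
    then show ?thesis using True by (simp only:) simp
  next
    case False
    have B0: "0 < B" using False by (cases B) auto
    have "B \<le> n div L" unfolding B_def using pn by (rule div_le_mono)
    then have "B - 1 < n div L" using B0 by linarith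
    note e = dir2_entry[OF b this]
    have "(B - 1) div L = A"
    proof (rule div_nat_eqI)
      have bl: "L * A + B mod L = B" unfolding AB by simp
      show "L * A \<le> B - 1" using bl False by linarith
      show "B - 1 < L * Suc A" using bl mod_less_divisor[OF L_pos(1), of B] unfolding mult_Suc_right by linarith
    qed
    then show ?thesis using e False B0 by simp
  qed
  have pm: "p mod L < L" using L_pos(1) by simp
  have Bp: "B * L + p mod L = p" unfolding B_def by simp
  \<comment> \<open>Fewer than \<open>L\<close> bits are left after the directories, so two look-ups
    of \<open>h\<close> bits suffice.\<close>
  have hh: "L \<le> h + h" unfolding h_def by linarith
  define d where "d = h + h - p mod L"
  have hd: "h + h = p mod L + d" using pm hh unfolding d_def by linarith
  have x: "popc (h + h) x = occ True S p - occ True S (B * L)"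
    unfolding hd x_def using popc_field[OF hs, of "B * L" "p mod L" d] Bp pn by simp
  have x2: "popc (h + h) x = popc h (x mod 2 ^ h) + popc h (x div 2 ^ h)"
    unfolding popc_add by (simp add: popc_take_bit)
  have one: "field w m (WA 2 * w + ((h - 1) * RA + (y * h + (h - 1)) * fh)) fh = popc h y" if y: "y < 2 ^ h" for y
  proof -
    have hl: "h - 1 < h" using L_pos(5) by simp
    have j: "y * h + (h - 1) < 2 ^ h * h" using slot_le[OF y, of h] hl by linarith
    have "(y * h + (h - 1)) div h = y" "(y * h + (h - 1)) mod h = h - 1" using div_mod_slot[OF hl] by auto
    then show ?thesis using rtab_entry[OF b _ order_refl j] L_pos(5) by (simp add: Suc_leI)
  qed
  have xl: "x < 2 ^ (p mod L)" unfolding x_def by (rule field_less)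
  also have "\<dots> \<le> 2 ^ (h + h)" using hd by (intro power_increasing) auto
  finally have "x < 2 ^ h * 2 ^ h" by (simp add: power_add)
  then have xh: "x div 2 ^ h < 2 ^ h" by (rule less_mult_imp_div_less)
  have xm: "x mod 2 ^ h < 2 ^ h" by simp
  have Lu: "L < u" using u_bounds(4) by simp
  have xu: "x < 2 ^ u" unfolding x_def by (rule field_u) (use pm Lu in linarith)
  have ou: "occ True S y \<le> n" for y
    using occ_le_count[of True S y] count_le_n[of True] by linarith
  have hu: "h < 2 ^ u" using pv_less[of 8] by simp
  have pu: "popc h y < 2 ^ u" for y using popc_le[of h y] hu by linarith
  have mono: "occ True S (A * (L * L)) \<le> occ True S (B * L)" "occ True S (B * L) \<le> occ True S p"
    by (rule occ_mono, use BL in linarith, rule occ_mono, use Bp in linarith)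
  define tot where "tot = occ True S p"
  have sum: "occ True S (A * (L * L)) + (occ True S (B * L) - occ True S (A * (L * L))) +
      popc h (x mod 2 ^ h) + popc h (x div 2 ^ h) = tot"
    using x x2 mono unfolding tot_def by linarith
  define qs where "qs = [w, n, of_bool c, i, p, L, A, B, occ True S (A * (L * L)),
    occ True S (B * L) - occ True S (A * (L * L)), x, popc h (x mod 2 ^ h), popc h (x div 2 ^ h), tot]"
  let ?qv = "\<lambda>k. qs ! k"
  have Su: "\<forall>y \<in> set qs. y < 2 ^ u"
    unfolding qs_def using w_less nu i pn ou xu pu Lu
      le_less_trans[OF div_le_dividend[of p L]] le_less_trans[OF div_le_dividend[of p "L * L"]]
      pv_less[of 3] num_less'(2)
    by (auto simp: A_def B_def tot_def of_bool_def intro: le_less_trans le_less_trans[OF diff_le_self])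
  have lq: "length qs = 14" by (simp add: qs_def)
  have Qu: "?qv k < 2 ^ u" if "k < 14" for k using Su that lq by (metis nth_mem)
  note hw = hdr_word[OF b]
  have H1: "m (n + 3) = L" "m (n + 13) = fn" "m (n + 14) = f2" "m (n + 8) = h" "m (n + 20) = RA" "m (n + 15) = fh"
    "m (n + 17) = 2 ^ h" "m (n + 31) = WA 0" "m (n + 32) = WA 1" "m (n + 33) = WA 2"
    using hw[of 3] hw[of 13] hw[of 14] hw[of 8] hw[of 20] hw[of 15] hw[of 17] hw[of 31] hw[of 32] hw[of 33]
      pv_WA[of 0] pv_WA[of 1] pv_WA[of 2] by (simp_all del: WA.simps)
  have H2: "L < 2 ^ u" "fn < 2 ^ u" "f2 < 2 ^ u" "h < 2 ^ u" "RA < 2 ^ u" "fh < 2 ^ u" "2 ^ h < (2::nat) ^ u"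
    "WA 0 < 2 ^ u" "WA 1 < 2 ^ u" "WA 2 < 2 ^ u"
    using pv_less[of 3] pv_less[of 13] pv_less[of 14] pv_less[of 8] pv_less[of 20] pv_less[of 15] pv_less[of 17]
      pv_less[of 31] pv_less[of 32] pv_less[of 33] pv_WA[of 0] pv_WA[of 1] pv_WA[of 2] by (simp_all del: WA.simps)
  have plu: "p mod L < u" using pm Lu by linarith
  have W1: "WA (Suc 0) < 2 ^ u" using H2(9) by (simp del: WA.simps)
  have facts: "Suc i = p" "p div (L * L) = A" "p div L = B" "field w m (B * L) (p mod L) = x"
    by (simp_all add: p_def A_def B_def x_def)
  have d1a: "field w m (WA 0 * w + (A - Suc 0) * fn) fn = occ True S (A * (L * L))" if "0 < A"
    using d1 that by (simp del: WA.simps)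
  have d2a: "field w m (WA (Suc 0) * w + (B - Suc 0) * f2) f2 = occ True S (B * L) - occ True S (A * (L * L))"
    if "0 < B mod L"
    using d2 that by (simp del: WA.simps)
  have d2b: "occ True S (B * L) \<le> occ True S (A * (L * L))" if "B mod L = 0"
    using d2 that by simp
  have one': "field w m (WA 2 * w + ((h - Suc 0) * RA + (y * h + (h - Suc 0)) * fh)) fh = popc h y" if "y < 2 ^ h" for y
    using one[OF that] by simp
  have ok: "small (rank_es ! k) \<and> good u (qenv m ?qv (4 + k)) (rank_es ! k) \<and>
      aeval (qenv m ?qv (4 + k)) (rank_es ! k) = ?qv (4 + k)" if "k < 10" for k
  proof -
    have "k = 0 \<or> k = 1 \<or> k = 2 \<or> k = 3 \<or> k = 4 \<or> k = 5 \<or> k = 6 \<or> k = 7 \<or> k = 8 \<or> k = 9" using that by presburger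
    then show ?thesis
      by (elim disjE)
        (simp_all add: rank_es_def qs_def qenv_def small_simps num_less ones_e_def H1
          H2 len_bounds plu facts d1a d2a d2b one' xm xh sum W1 del: WA.simps)
  qed
  have "\<exists>r'. runs w (assigns 4 rank_es) (m, init_regs [w, n, of_bool c, i])
      (1 + length rank_es * (max_ops + 1)) (1 + length rank_es * (max_ops + 1)) (m, r') \<and>
      (\<forall>x < 4 + length rank_es. r' x = ?qv x)"
  proof (rule runs_assigns[OF v])
    show "?qv 0 = w" by (simp add: qs_def)
    show "init_regs [w, n, of_bool c, i] x = ?qv x" if "x < 4" for x
      using that by (auto simp: init_regs_def qs_def less_Suc_eq numeral_eq_Suc)
    show "?qv x < 2 ^ u" if "x < 4 + length rank_es" for x
      by (rule Qu) (use that in \<open>simp add: rank_es_def\<close>)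
    show "small (rank_es ! k) \<and> good u (qenv m ?qv (4 + k)) (rank_es ! k) \<and>
        aeval (qenv m ?qv (4 + k)) (rank_es ! k) = ?qv (4 + k)" if "k < length rank_es" for k
      by (rule ok) (use that in \<open>simp add: rank_es_def\<close>)
  qed simp
  then obtain r1 where r1: "runs w (assigns 4 rank_es) (m, init_regs [w, n, of_bool c, i])
      (1 + length rank_es * (max_ops + 1)) (1 + length rank_es * (max_ops + 1)) (m, r1)"
    and r1v: "\<And>x. x < 14 \<Longrightarrow> r1 x = ?qv x" by (auto simp: rank_es_def)
  have res: "rank c S i = of_bool c * tot + (1 - of_bool c) * (p - tot)"
    unfolding rank_eq_occ tot_def p_def[symmetric] using occ_False[of p S] pn lenS by (cases c) simp_all
  have "\<exists>r'. runs w (Assign 0 (compile (Var 2 *! Var 13 +! (Num 1 -! Var 2) *! (Var 4 -! Var 13)))) (m, r1)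
      (max_ops + 1) (max_ops + 1) (m, r') \<and> r' 0 = rank c S i"
    by (rule runs_result[where qv = "(!) qs" and y = 14, OF v _ _ r1v Qu]) (auto simp: qs_def qenv_def small_simps res)
  then obtain r2 where r2: "runs w (Assign 0 (compile (Var 2 *! Var 13 +! (Num 1 -! Var 2) *! (Var 4 -! Var 13))))
      (m, r1) (max_ops + 1) (max_ops + 1) (m, r2)" "r2 0 = rank c S i" by blast
  have "runs w rank_query (m, init_regs [w, n, of_bool c, i]) (20 * (max_ops + 1)) (20 * (max_ops + 1)) (m, r2)"
    unfolding rank_query_def by (rule runs_mono[OF runs_Seq[OF r1 r2(1)]]) (simp_all add: rank_es_def)
  then show ?thesis using r2(2) by blast
qed

section \<open>Select queries\<close>

lemma bitstring_field:
  assumes hs: "holds_seq w m S"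
  shows "bitstring (cut c S J' - cut c S J) (field w m (cut c S J) (cut c S J' - cut c S J)) = range_of c S J J'"
proof (rule nth_equalityI)
  show "length (bitstring (cut c S J' - cut c S J) (field w m (cut c S J) (cut c S J' - cut c S J))) = length (range_of c S J J')"
    by (simp add: length_range)
  fix t assume "t < length (bitstring (cut c S J' - cut c S J) (field w m (cut c S J) (cut c S J' - cut c S J)))"
  then have t: "t < cut c S J' - cut c S J" by simp
  then have tn: "cut c S J + t < n" using cut_le_n[of c J'] by linarith
  show "bitstring (cut c S J' - cut c S J) (field w m (cut c S J) (cut c S J' - cut c S J)) ! t = range_of c S J J' ! t"
    using t seq_bit[OF hs tn] cut_le_n[of c J'] lenS by (simp add: bit_field range_of_def)
qed

lemma select_query_correct:
  assumes b: "blk m" and v: "valid_mem w m" and hs: "holds_seq w m S"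
    and i: "1 \<le> i" "i \<le> count_list S c"
  shows "\<exists>r. runs w select_query (m, init_regs [w, n, of_bool c, i]) (40 * (max_ops + 1)) (40 * (max_ops + 1)) (m, r) \<and>
     r 0 = select c S i"
proof -
  define j where "j = i - 1"
  define k where "k = j div K"
  define s where "s = cut c S (k * K)"
  define e where "e = cut c S (k * K + K)"
  define r where "r = e - s"
  have jc: "j < count_list S c" "i = j + 1" using i by (simp_all add: j_def)
  have kj: "k * K \<le> j" "j < k * K + K" "k * K + j mod K = j"
    using dividend_less_div_times[OF L_pos(3), of j] by (simp_all add: k_def)
  have kc: "k * K < count_list S c" using kj jc by linarith
  have kn: "k \<le> n div K"
  proof -
    have "k * K \<le> n" using kc count_le_n[of c] by linarith
    then show ?thesis using L_pos(3) by (simp add: less_eq_div_iff_mult_less_eq)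
  qed
  \<comment> \<open>There is an occurrence, so cuts of positive index are positive. Adding 1 to a
    stored entry therefore undoes a genuine subtraction and not a truncated one.\<close>
  have c0: "0 < cut c S y" if "0 < y" for y
    using cut_less[OF that, of S c] jc by simp
  have res: "select c S i = cut c S (j + 1) - 1" using select_eq_cut[OF i] jc(2) by simp
  have nu: "n < 2 ^ u" using pv_less[of 1] by simp
  have cu: "cut c S y < 2 ^ u" "cut c S y - y' < 2 ^ u" for y y' using cut_le_n[of c y] nu by auto
  have cn: "i < 2 ^ u" "j < 2 ^ u" "k < 2 ^ u"
    using i(2) count_le_n[of c] nu jc(2) div_le_dividend[of j K] unfolding k_def by linarith+
  have d6: "(if 0 < k then field w m (WA (3 + 5 * cx c) * w + (k - 1) * fn) fn + 1 else 0) = s"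
  proof (cases "k = 0")
    case False
    then show ?thesis using seldir_entry[OF b, of "k - 1" c] kn c0[of "k * K"] L_pos(3) by (simp add: s_def)
  qed (simp add: s_def)
  \<comment> \<open>For the last range this reads an entry behind the directory proper, which is
    filled with \<open>n - 1\<close>.\<close>
  have d7: "field w m (WA (3 + 5 * cx c) * w + k * fn) fn + 1 = e"
    using seldir_entry[OF b kn, of c] c0[of "k * K + K"] L_pos(3) by (simp add: e_def add.commute)
  define qs where "qs = [w, n, of_bool c, i, j, k, s, e, r]"
  have lq: "length qs = 9" by (simp add: qs_def)
  have "\<forall>y \<in> set qs. y < 2 ^ u"
    unfolding qs_def using w_less nu cn cu num_less'(2) by (auto simp: s_def e_def r_def of_bool_def)
  then have Qu: "qs ! y < 2 ^ u" if "y < 9" for y using that lq by (metis nth_mem)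
  note hw = hdr_word[OF b]
  have H1: "m (n + 6) = K" "m (n + 13) = fn" "m (n + 10) = K * K" "m (n + 5) = LL" "m (n + 11) = M" "m (n + 23) = A2"
    "m (n + 21) = SA"
    using hw[of 6] hw[of 13] hw[of 10] hw[of 5] hw[of 11] hw[of 23] hw[of 21] by simp_all
  have H2: "K < 2 ^ u" "fn < 2 ^ u" "K * K < 2 ^ u" "LL < 2 ^ u" "M < 2 ^ u" "A2 < 2 ^ u" "SA < 2 ^ u"
    using pv_less[of 6] pv_less[of 13] pv_less[of 10] pv_less[of 5] pv_less[of 11] pv_less[of 23] pv_less[of 21] by simp_all
  have WAw: "m (n + (31 + y)) = WA y" "WA y < 2 ^ u" if "y < 13" for y
    using hw[of "31 + y"] pv_less[of "31 + y"] pv_WA[of y] that by simp_all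
  have H3: "m (n + (34 + 5 * cx c)) = WA (3 + 5 * cx c)" "m (n + (35 + 5 * cx c)) = WA (4 + 5 * cx c)"
    "m (n + (36 + 5 * cx c)) = WA (5 + 5 * cx c)" "m (n + (37 + 5 * cx c)) = WA (6 + 5 * cx c)"
    "m (n + (38 + 5 * cx c)) = WA (7 + 5 * cx c)"
    using WAw(1)[of "3 + 5 * cx c"] WAw(1)[of "4 + 5 * cx c"] WAw(1)[of "5 + 5 * cx c"]
      WAw(1)[of "6 + 5 * cx c"] WAw(1)[of "7 + 5 * cx c"] cx_le[of c] by (simp_all add: add.assoc[symmetric])
  have H4: "WA (3 + 5 * cx c) < 2 ^ u" "WA (4 + 5 * cx c) < 2 ^ u" "WA (5 + 5 * cx c) < 2 ^ u"
    "WA (6 + 5 * cx c) < 2 ^ u" "WA (7 + 5 * cx c) < 2 ^ u"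
    using cx_le[of c] by (auto intro!: WAw(2))
  have cxu: "34 + 5 * cx c < 2 ^ u" "35 + 5 * cx c < 2 ^ u" "36 + 5 * cx c < 2 ^ u" "37 + 5 * cx c < 2 ^ u"
    "38 + 5 * cx c < 2 ^ u"
    using cx_le[of c] by (auto intro!: num_less)
  have ok: "small (sel_es c ! y) \<and> good u (qenv m ((!) qs) (4 + y)) (sel_es c ! y) \<and>
      aeval (qenv m ((!) qs) (4 + y)) (sel_es c ! y) = qs ! (4 + y)" if "y < 5" for y
  proof -
    have "y = 0 \<or> y = 1 \<or> y = 2 \<or> y = 3 \<or> y = 4" using that by presburger
    then show ?thesis
      by (elim disjE)
        (simp_all add: sel_es_def qs_def qenv_def small_simps num_less H1 H2 H3 H4 cxu len_bounds,
         use d6 d7 in \<open>auto simp: j_def k_def r_def\<close>)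
  qed
  have "\<exists>r'. runs w (assigns 4 (sel_es c)) (m, init_regs [w, n, of_bool c, i])
      (1 + length (sel_es c) * (max_ops + 1)) (1 + length (sel_es c) * (max_ops + 1)) (m, r') \<and>
      (\<forall>x < 4 + length (sel_es c). r' x = qs ! x)"
  proof (rule runs_assigns[OF v])
    show "qs ! 0 = w" by (simp add: qs_def)
    show "init_regs [w, n, of_bool c, i] x = qs ! x" if "x < 4" for x
      using that by (auto simp: init_regs_def qs_def less_Suc_eq numeral_eq_Suc)
    show "qs ! x < 2 ^ u" if "x < 4 + length (sel_es c)" for x
      by (rule Qu) (use that in \<open>simp add: sel_es_def\<close>)
    show "small (sel_es c ! y) \<and> good u (qenv m ((!) qs) (4 + y)) (sel_es c ! y) \<and>
        aeval (qenv m ((!) qs) (4 + y)) (sel_es c ! y) = qs ! (4 + y)" if "y < length (sel_es c)" for y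
      by (rule ok) (use that in \<open>simp add: sel_es_def\<close>)
  qed simp
  then obtain r1 where r1: "runs w (assigns 4 (sel_es c)) (m, init_regs [w, n, of_bool c, i])
      (1 + length (sel_es c) * (max_ops + 1)) (1 + length (sel_es c) * (max_ops + 1)) (m, r1)"
    and r1v: "\<And>x. x < 9 \<Longrightarrow> r1 x = qs ! x" by (auto simp: sel_es_def)
  have cond1: "eval w m r1 (compile (Var 8 <! hd_e 10)) = of_bool (r < K * K)"
    using eval_cond[where qv = "(!) qs" and y = 9, OF v _ _ r1v Qu, where e = "Var 8 <! hd_e 10"]
    by (simp add: qs_def qenv_def small_simps num_less H1 H2)
  have "\<exists>r'. runs w (if eval w m r1 (compile (Var 8 <! hd_e 10)) \<noteq> 0 then sel_sub c else sel_long c) (m, r1)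
     (25 * (max_ops + 1)) (25 * (max_ops + 1)) (m, r') \<and> r' 0 = select c S i"
  proof (cases "r < K * K")
    case False
    have rr: "s + K * K \<le> e" using False L_pos(3) unfolding r_def by (cases "e - s") auto
    have "field w m (WA (4 + 5 * cx c) * w + (s div K + j mod K) * fn) fn = cut c S (k * K + j mod K + 1) - 1"
      using long_entry[OF b, of "j mod K" c k] rr L_pos(3) unfolding s_def e_def by simp
    then have en: "field w m (WA (4 + 5 * cx c) * w + (s div K + j mod K) * fn) fn = select c S i"
      unfolding kj(3) res .
    have "\<exists>r'. runs w (sel_long c) (m, r1) (max_ops + 1) (max_ops + 1) (m, r') \<and> r' 0 = select c S i"
      unfolding sel_long_def
      by (rule runs_result[where qv = "(!) qs" and y = 9, OF v _ _ r1v Qu])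
        (use en in \<open>simp_all add: qs_def qenv_def small_simps num_less H1 H2 H3 H4 cxu len_bounds\<close>)
    then obtain r2 where r2: "runs w (sel_long c) (m, r1) (max_ops + 1) (max_ops + 1) (m, r2)" "r2 0 = select c S i"
      by blast
    have "runs w (sel_long c) (m, r1) (25 * (max_ops + 1)) (25 * (max_ops + 1)) (m, r2)"
      by (rule runs_mono[OF r2(1)]) auto
    then show ?thesis using cond1 False r2(2) by auto
  next
    case True
    define K2 where "K2 = lg r * LL"
    define bl where "bl = floorlog 2 r"
    define kk where "kk = j mod K div K2"
    define q where "q = k * K + kk * K2"
    define Q where "Q = min (q + K2) (k * K + K)"
    define s' where "s' = cut c S q"
    define e' where "e' = cut c S Q"
    define r' where "r' = e' - s'"
    define bl' where "bl' = floorlog 2 r'"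
    define idx where "idx = j mod K mod K2"
    define thr where "thr = lg r' * lg r * (LL * LL)"
    have K2p: "0 < K2" by (simp add: K2_def)
    have jm: "kk * K2 + idx = j mod K" "idx < K2"
      unfolding kk_def idx_def using K2p by simp_all
    have jK: "j mod K < K" using L_pos(3) by simp
    have kkK: "kk * K2 < K" using jm jK by linarith
    have qj: "q + idx = j" using jm kj(3) unfolding q_def by linarith
    have qc: "q < count_list S c" using qj jc by linarith
    have jQ: "j + 1 \<le> Q" using qj jm(2) kj(2) unfolding Q_def by linarith
    have qQ: "q \<le> Q" using jQ qj by linarith
    have kkd: "kk \<le> K div K2" unfolding kk_def using jK by (intro div_le_mono) simp
    have s_lt: "s < cut c S y" if "k * K < y" for y unfolding s_def by (rule cut_less[OF that kc])
    have rr: "r' \<le> r"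
    proof -
      have "e' \<le> e" unfolding e'_def e_def by (rule cut_mono) (simp add: Q_def)
      moreover have "s \<le> s'" unfolding s_def s'_def by (rule cut_mono) (simp add: q_def)
      ultimately show ?thesis unfolding r_def r'_def by linarith
    qed
    have entry: "field w m (WA (5 + 5 * cx c) * w + (k * A2 + y * bl)) bl = cut c S (k * K + min ((y + 1) * K2) K) - 1 - s"
      if "y \<le> K div K2" for y
      using subdir_entry[OF b kc, of y] True that unfolding bl_def K2_def s_def e_def r_def by simp
    have d13: "s + (if 0 < kk then field w m (WA (5 + 5 * cx c) * w + (k * A2 + (kk - 1) * bl)) bl + 1 else 0) = s'"
    proof (cases "kk = 0")
      case False
      have "min ((kk - 1 + 1) * K2) K = kk * K2" using kkK False by simp
      then have "field w m (WA (5 + 5 * cx c) * w + (k * A2 + (kk - 1) * bl)) bl = s' - 1 - s"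
        using entry[of "kk - 1"] kkd False unfolding s'_def q_def by simp
      moreover have "s < s'" unfolding s'_def by (rule s_lt) (use False K2p in \<open>simp add: q_def\<close>)
      ultimately show ?thesis using False by simp
    qed (simp add: s_def s'_def q_def)
    \<comment> \<open>The end of the last sub-range comes from the additional second-level entry,
      whose index is capped at the end of the range.\<close>
    have d14: "s + (field w m (WA (5 + 5 * cx c) * w + (k * A2 + kk * bl)) bl + 1) = e'"
    proof -
      have "k * K + min ((kk + 1) * K2) K = Q" unfolding Q_def q_def by simp
      then have "field w m (WA (5 + 5 * cx c) * w + (k * A2 + kk * bl)) bl = e' - 1 - s"
        using entry[OF kkd] unfolding e'_def by simp
      moreover have "s < e'" unfolding e'_def by (rule s_lt) (use jQ kj(1) in linarith)
      ultimately show ?thesis by simp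
    qed
    have lr: "lg r \<le> 4 * LL" "lg r' \<le> 4 * LL" using lg_short[OF True] lg_short[of r'] rr True by simp_all
    have H4LL: "4 * LL + 1 < u" "4 * LL * LL \<le> H" "4 * LL \<le> H"
    proof -
      have "8192 * L \<le> u" using u_ge by (simp add: word_factor_def)
      then show "4 * LL + 1 < u" using LL_le L_pos(1) by linarith
      have 1: "1 \<le> LL * LL" "1 \<le> LL" using L_pos(2) by (simp_all add: Suc_leI)
      have "4 * (LL * LL) * 1 \<le> 16 * (LL * LL) * (LL * LL)" by (intro mult_le_mono 1) simp_all
      then show h2: "4 * LL * LL \<le> H" unfolding H_def by simp
      have "4 * LL * 1 \<le> 4 * LL * LL" by (intro mult_le_mono2 1)
      then show "4 * LL \<le> H" using h2 by linarith
    qed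
    have thrH: "thr \<le> H"
    proof -
      have "thr \<le> (4 * LL) * (4 * LL) * (LL * LL)" unfolding thr_def using lr by (intro mult_le_mono) auto
      then show ?thesis by (simp add: H_def)
    qed
    have K2H: "K2 \<le> H"
    proof -
      have "K2 \<le> 4 * LL * LL" unfolding K2_def using lr(1) by (intro mult_le_mono1)
      then show ?thesis using H4LL by linarith
    qed
    have Hu: "H < 2 ^ u" using pv_less[of 7] by simp
    have blu: "bl < u" "bl' < u"
      using floorlog_le_lg[of r] floorlog_le_lg[of r'] lr H4LL unfolding bl_def bl'_def by linarith+
    have uu: "y < 2 ^ u" if "y < u" for y using that less_exp[of u] by linarith
    define ts where "ts = [w, n, of_bool c, i, j, k, s, e, r, lg r, bl, K2, kk, s', e', r', lg r', bl', idx, thr]"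
    have lt: "length ts = 20" by (simp add: ts_def)
    have "kk < 2 ^ u" "idx < 2 ^ u"
      using jm(1,2) jK H2(1) K2H Hu div_le_dividend[of "j mod K" K2] unfolding kk_def[symmetric] by linarith+
    moreover have "lg r < 2 ^ u" "lg r' < 2 ^ u" using lr H4LL uu[of "lg r"] uu[of "lg r'"] by auto
    ultimately have tu: "\<forall>y \<in> set ts. y < 2 ^ u"
      unfolding ts_def using w_less nu cn cu num_less'(2) uu[OF blu(1)] uu[OF blu(2)] le_less_trans[OF K2H Hu]
        le_less_trans[OF thrH Hu]
      by (auto simp: s_def e_def r_def s'_def e'_def r'_def of_bool_def)
    then have Tu: "ts ! y < 2 ^ u" if "y < 20" for y using that lt by (metis nth_mem)
    have rM: "r < M" "r' < M" using True rr by (simp_all add: M_def)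
    have tw: "m (n + 64 + r) = lg r" "m (n + 64 + M + r) = bl" "m (n + 64 + r') = lg r'" "m (n + 64 + M + r') = bl'"
      using tab_word[OF b rM(1)] tab_word[OF b rM(2)] by (simp_all add: bl_def bl'_def)
    have tlu: "lg r < 2 ^ u" "bl < 2 ^ u" "lg r' < 2 ^ u" "bl' < 2 ^ u"
      using Tu[of 9] Tu[of 10] Tu[of 16] Tu[of 17] by (simp_all add: ts_def)
    have tok: "small (sub_es c ! y) \<and> good u (qenv m ((!) ts) (9 + y)) (sub_es c ! y) \<and>
        aeval (qenv m ((!) ts) (9 + y)) (sub_es c ! y) = ts ! (9 + y)" if "y < 11" for y
    proof -
      have "y = 0 \<or> y = 1 \<or> y = 2 \<or> y = 3 \<or> y = 4 \<or> y = 5 \<or> y = 6 \<or> y = 7 \<or> y = 8 \<or> y = 9 \<or> y = 10"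
        using that by presburger
      then show ?thesis
        by (elim disjE)
          (simp_all add: sub_es_def ts_def qenv_def small_simps num_less H1 H2 H3 H4 cxu len_bounds tw tlu blu,
           use d13 d14 in \<open>auto simp: K2_def kk_def idx_def thr_def r'_def\<close>)
    qed
    have r1t: "r1 x = ts ! x" if "x < 9" for x
      using r1v[OF that] that by (auto simp: qs_def ts_def less_Suc_eq numeral_eq_Suc)
    have "\<exists>r''. runs w (assigns 9 (sub_es c)) (m, r1)
        (1 + length (sub_es c) * (max_ops + 1)) (1 + length (sub_es c) * (max_ops + 1)) (m, r'') \<and>
        (\<forall>x < 9 + length (sub_es c). r'' x = ts ! x)"
    proof (rule runs_assigns[OF v])
      show "ts ! 0 = w" by (simp add: ts_def)
      show "ts ! x < 2 ^ u" if "x < 9 + length (sub_es c)" for x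
        by (rule Tu) (use that in \<open>simp add: sub_es_def\<close>)
      show "small (sub_es c ! y) \<and> good u (qenv m ((!) ts) (9 + y)) (sub_es c ! y) \<and>
          aeval (qenv m ((!) ts) (9 + y)) (sub_es c ! y) = ts ! (9 + y)" if "y < length (sub_es c)" for y
        by (rule tok) (use that in \<open>simp add: sub_es_def\<close>)
    qed (use r1t in auto)
    then obtain r2 where r2: "runs w (assigns 9 (sub_es c)) (m, r1)
        (1 + length (sub_es c) * (max_ops + 1)) (1 + length (sub_es c) * (max_ops + 1)) (m, r2)"
      and r2v: "\<And>x. x < 20 \<Longrightarrow> r2 x = ts ! x" by (auto simp: sub_es_def)
    have cond2: "eval w m r2 (compile (Var 15 <! Var 19)) = of_bool (r' < thr)"
      using eval_cond[where qv = "(!) ts" and y = 20, OF v _ _ r2v Tu, where e = "Var 15 <! Var 19"]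
      by (simp add: ts_def qenv_def small_simps)
    let ?tab = "Seq (assigns 20 [Fld (Var 13) (Var 15)])
         (Assign 0 (compile (sect_e (7 + 5 * cx c)
            ((Var 15 -! Num 1) *! hd_e 21 +! (Var 20 *! Var 15 +! Var 18) *! Var 17) (Var 17) +! Var 13)))"
    let ?ans = "Assign 0 (compile (sect_e (6 + 5 * cx c)
            (Num 2 *! (Var 13 div! hd_e 5) +! Var 18 *! Var 17) (Var 17) +! Var 13))"
    have s'j: "s' \<le> cut c S (j + 1) - 1"
      using cut_less[of q "j + 1" S c] qj qc unfolding s'_def by linarith
    have "\<exists>r''. runs w (if eval w m r2 (compile (Var 15 <! Var 19)) \<noteq> 0 then ?tab else ?ans) (m, r2)
       (1 + (max_ops + 1) + (max_ops + 1)) (1 + (max_ops + 1) + (max_ops + 1)) (m, r'') \<and> r'' 0 = select c S i"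
    proof (cases "r' < thr")
      case False
      then have "thr \<le> r'" by simp
      have "field w m (WA (6 + 5 * cx c) * w + (2 * (s' div LL) + idx * bl')) bl' = cut c S (q + idx + 1) - 1 - s'"
      proof -
        have rq: "cut c S (k * K + K) - cut c S (k * K) = r" "cut c S Q - cut c S q = r'"
          by (simp_all add: r_def s_def e_def r'_def s'_def e'_def)
        note E = subans_entry[OF b, of c k kk idx,
            unfolded rq K2_def[symmetric] q_def[symmetric] Q_def[symmetric], unfolded rq bl'_def[symmetric] s'_def[symmetric]]
        show ?thesis
          using E[OF True kkK \<open>thr \<le> r'\<close>[unfolded thr_def] jm(2)] jQ qj by simp
      qed
      then have en: "field w m (WA (6 + 5 * cx c) * w + (2 * (s' div LL) + idx * bl')) bl' + s' = select c S i"
        using s'j unfolding qj res by simp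
      have "\<exists>r''. runs w ?ans (m, r2) (max_ops + 1) (max_ops + 1) (m, r'') \<and> r'' 0 = select c S i"
        by (rule runs_result[where qv = "(!) ts" and y = 20, OF v _ _ r2v Tu])
          (use en in \<open>simp_all add: ts_def qenv_def small_simps num_less H1 H2 H3 H4 cxu blu\<close>)
      then obtain r3 where r3: "runs w ?ans (m, r2) (max_ops + 1) (max_ops + 1) (m, r3)" "r3 0 = select c S i" by blast
      have "runs w ?ans (m, r2) (1 + (max_ops + 1) + (max_ops + 1)) (1 + (max_ops + 1) + (max_ops + 1)) (m, r3)"
        by (rule runs_mono[OF r3(1)]) auto
      then show ?thesis using cond2 False r3(2) by auto
    next
      case short: True
      \<comment> \<open>Being shorter than \<open>H\<close>, hence than \<open>u\<close>, the
        sub-range can be fetched from the sequence as a single field.\<close>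
      have r'H: "r' < H" using short thrH by linarith
      have r'u: "r' < u" using r'H u_bounds(2) by linarith
      define x where "x = field w m s' r'"
      have xl: "x < 2 ^ r'" unfolding x_def by (rule field_less)
      have xu: "x < 2 ^ u" unfolding x_def by (rule field_u[OF r'u])
      let ?T = "range_of c S q Q"
      \<comment> \<open>The fetched word is the bit string of the sub-range itself and thus the row
        number in the select table.\<close>
      have T: "bitstring r' x = ?T" unfolding x_def r'_def s'_def e'_def by (rule bitstring_field[OF hs])
      have cT: "count_list ?T c = min Q (count_list S c) - q" by (rule count_range[OF qQ]) (use qc in simp)
      have ic: "1 \<le> idx + 1" "idx + 1 \<le> count_list ?T c" using cT jQ qj jc by linarith+
      have il: "idx < r'" using ic(2) count_le_length'[of ?T c] unfolding length_range r'_def s'_def e'_def by linarith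
      have r'1: "1 \<le> r'" using il by linarith
      have xj: "x * r' + idx < 2 ^ r' * r'" using slot_le[OF xl, of r'] il by linarith
      have "field w m (WA (7 + 5 * cx c) * w + ((r' - 1) * SA + (x * r' + idx) * bl')) bl' = select_table c r' ! (x * r' + idx)"
        unfolding bl'_def by (rule seltab_entry[OF b r'1 _ xj]) (use r'H in simp)
      also have "\<dots> = select c ?T (idx + 1)"
        unfolding select_table_entry[OF xl il] T using ic by simp
      also have "\<dots> = select c S (q + (idx + 1)) - s'"
        unfolding s'_def by (rule select_range(1)[OF qQ _ ic]) (use qc in simp)
      finally have f: "field w m (WA (7 + 5 * cx c) * w + ((r' - 1) * SA + (x * r' + idx) * bl')) bl' = select c S (q + (idx + 1)) - s'" .
      have "q + (idx + 1) = i" using qj jc by simp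
      then have en: "field w m (WA (7 + 5 * cx c) * w + ((r' - 1) * SA + (x * r' + idx) * bl')) bl' + s' = select c S i"
        using f s'j res by simp
      define xs where "xs = ts @ [x]"
      have xs: "xs ! y = ts ! y" if "y < 20" for y using that lt by (simp add: xs_def nth_append)
      have x20: "xs ! 20 = x" using lt by (simp add: xs_def nth_append)
      have Xu: "xs ! y < 2 ^ u" if "y < 21" for y
        using that Tu[of y] xs[of y] x20 xu by (cases "y = 20") auto
      have "\<exists>r''. runs w (assigns 20 [Fld (Var 13) (Var 15)]) (m, r2)
          (1 + length [Fld (Var 13) (Var 15)] * (max_ops + 1)) (1 + length [Fld (Var 13) (Var 15)] * (max_ops + 1)) (m, r'') \<and>
          (\<forall>y < 20 + length [Fld (Var 13) (Var 15)]. r'' y = xs ! y)"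
        by (rule runs_assigns[OF v])
          (use r2v xs Xu x20 r'u in \<open>auto simp: ts_def qenv_def small_simps x_def\<close>)
      then obtain r3 where r3: "runs w (assigns 20 [Fld (Var 13) (Var 15)]) (m, r2)
          (1 + length [Fld (Var 13) (Var 15)] * (max_ops + 1)) (1 + length [Fld (Var 13) (Var 15)] * (max_ops + 1)) (m, r3)"
        and r3v: "\<And>y. y < 21 \<Longrightarrow> r3 y = xs ! y" by auto
      have "\<exists>r''. runs w (Assign 0 (compile (sect_e (7 + 5 * cx c)
            ((Var 15 -! Num 1) *! hd_e 21 +! (Var 20 *! Var 15 +! Var 18) *! Var 17) (Var 17) +! Var 13)))
            (m, r3) (max_ops + 1) (max_ops + 1) (m, r'') \<and> r'' 0 = select c S i"
        by (rule runs_result[where qv = "(!) xs" and y = 21, OF v _ _ r3v Xu])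
          (use en in \<open>simp_all add: xs x20 ts_def qenv_def small_simps num_less H1 H2 H3 H4 cxu blu\<close>)
      then obtain r4 where r4: "runs w (Assign 0 (compile (sect_e (7 + 5 * cx c)
            ((Var 15 -! Num 1) *! hd_e 21 +! (Var 20 *! Var 15 +! Var 18) *! Var 17) (Var 17) +! Var 13)))
            (m, r3) (max_ops + 1) (max_ops + 1) (m, r4)" "r4 0 = select c S i" by blast
      have "runs w ?tab (m, r2) (1 + (max_ops + 1) + (max_ops + 1)) (1 + (max_ops + 1) + (max_ops + 1)) (m, r4)"
        by (rule runs_mono[OF runs_Seq[OF r3 r4(1)]]) auto
      then show ?thesis using cond2 short r4(2) by auto
    qed
    then obtain r5 where r5: "runs w (if eval w m r2 (compile (Var 15 <! Var 19)) \<noteq> 0 then ?tab else ?ans) (m, r2)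
       (1 + (max_ops + 1) + (max_ops + 1)) (1 + (max_ops + 1) + (max_ops + 1)) (m, r5)" "r5 0 = select c S i" by blast
    from runs_Seq[OF r2 runs_Cond[OF r5(1)]]
    have "runs w (sel_sub c) (m, r1) (25 * (max_ops + 1)) (25 * (max_ops + 1)) (m, r5)"
      unfolding sel_sub_def by (rule runs_mono) (simp_all add: sub_es_def max_ops_def)
    then show ?thesis using cond1 True r5(2) by auto
  qed
  then obtain r6 where r6: "runs w (if eval w m r1 (compile (Var 8 <! hd_e 10)) \<noteq> 0 then sel_sub c else sel_long c) (m, r1)
     (25 * (max_ops + 1)) (25 * (max_ops + 1)) (m, r6)" "r6 0 = select c S i" by blast
  from runs_Seq[OF r1 runs_Cond[OF r6(1)]]
  have "runs w (sel_prog c) (m, init_regs [w, n, of_bool c, i]) (35 * (max_ops + 1)) (35 * (max_ops + 1)) (m, r6)"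
    unfolding sel_prog_def by (rule runs_mono) (simp_all add: sel_es_def max_ops_def)
  then have "runs w (if eval w m (init_regs [w, n, of_bool c, i]) (Reg 2) \<noteq> 0 then sel_prog True else sel_prog False)
      (m, init_regs [w, n, of_bool c, i]) (35 * (max_ops + 1)) (35 * (max_ops + 1)) (m, r6)"
    by (cases c) (simp_all add: init_regs_def)
  from runs_Cond[OF this]
  have "runs w select_query (m, init_regs [w, n, of_bool c, i]) (40 * (max_ops + 1)) (40 * (max_ops + 1)) (m, r6)"
    unfolding select_query_def by (rule runs_mono) (simp_all add: max_ops_def)
  then show ?thesis using r6(2) by blast
qed

end

section \<open>Costs\<close>

text \<open>The lower-order terms, with \<open>x\<close>, \<open>y\<close> and \<open>z\<close>
  bounding \<open>lg n\<close>, its logarithm and \<open>h + H\<close>. The first term is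
  polylogarithmic. In the second, \<open>z\<close> is half of \<open>log 2 n\<close> plus a power of
  log log \<open>n\<close>, so the tables cost sqrt(n) times a factor that grows more slowly than
  any power of \<open>n\<close>.\<close>

definition rest :: "real \<Rightarrow> real \<Rightarrow> real" where
  "rest C n = (let x = log 2 n; y = log 2 (x + 1) + 1; z = x / 2 + 1 + 16 * y ^ 4
     in 100 * (C * x * (((x + 1) * y) ^ 2 + 16 * y ^ 4 + 3)) + 4 * (2 powr z * (z + 2) ^ 3) + 40 * ((x + 1) * y))"

lemma rest_smallo: "rest C \<in> o(\<lambda>n. n)"
  unfolding rest_def Let_def by real_asymp

lemma loglog_smallo: "(\<lambda>n. n / log 2 (log 2 n)) \<in> o(\<lambda>n::real. n)"
  by real_asymp

context layout
begin

definition total :: nat where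
  "total = n div (L * L) * fn + n div L * f2 + h * RA +
     2 * (2 * ((n div K + 1) * fn) + (n div K + 1) * A2 + 2 * (n div LL) + H * SA)"

definition space :: nat where "space = total + 100 * (w * (M + 2))"

text \<open>A bound depending on \<open>w\<close> and \<open>n\<close> alone; its constants are
  chosen for easy estimates.\<close>

definition work :: nat where
  "work = 5 * max_ops * (1000000 * (n + K + total + w * (M + 2) + 2 ^ (h + H) * (h + H + 2)))"

definition depth :: nat where "depth = 10000000 * (max_ops * w)"

lemma sum_13: "(\<Sum>s < 13. f s) = f 0 + f 1 + f 2 + f 3 + f 4 + f 5 + f 6 + f 7 + f 8 + f 9 + f 10 + f 11 + f (12::nat)"
  for f :: "nat \<Rightarrow> nat"
  by (simp add: lessThan_nat_numeral lessThan_Suc eval_nat_numeral)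

lemma sum_sizes: "(\<Sum>s < 13. pv (size_reg s)) = total"
  unfolding sum_13 by (simp add: size_reg_def total_def)

lemma WA_sum: "s \<le> 13 \<Longrightarrow> WA s = n + 64 + 2 * M + (\<Sum>i < s. pv (size_reg i) div w + 1)"
  by (induction s) (use pv_size in auto)

text \<open>Rounding to whole words wastes at most one word per section; these, the header and the
  unpacked tables are absorbed by the term \<open>w * (M + 2)\<close>.\<close>

lemma len_le: "len * w \<le> space"
proof -
  have "len = 64 + 2 * M + (\<Sum>i < 13. pv (size_reg i) div w + 1)"
    using WA_sum[of 13] n_len by simp
  then have "len * w = (64 + 2 * M) * w + (\<Sum>i < 13. (pv (size_reg i) div w + 1) * w)"
    by (simp only: add_mult_distrib sum_distrib_right)
  also have "(\<Sum>i < 13. (pv (size_reg i) div w + 1) * w) \<le> (\<Sum>i < 13. pv (size_reg i) + w)"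
    by (intro sum_mono) (simp add: add_mult_distrib)
  also have "\<dots> = total + 13 * w" by (simp add: sum.distrib sum_sizes)
  finally show ?thesis by (simp add: space_def algebra_simps)
qed

lemma L_le_w: "L \<le> w" "1 \<le> w"
proof -
  have "8192 * L \<le> u" using u_ge by (simp add: word_factor_def)
  then show "L \<le> w" using bb.u_le_w by linarith
  then show "1 \<le> w" using L_pos(1) by linarith
qed

section \<open>Work and depth of the construction\<close>

lemma rcost_le:
  assumes "x \<in> {2..<nregs}"
  shows "rcost (rsteps ! x) (pv x) \<le> 10240 * L"
proof -
  have e: "n < 2 ^ (L + 1)" using n_le by (simp add: le_less_trans)
  have 1: "fn \<le> L + 1" unfolding fn_def using e by (rule floorlog_le_if)
  have 2: "floorlog 2 (n - 1) \<le> L + 1" using floorlog_mono2[of "n - 1" n] 1 unfolding fn_def by simp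
  have 3: "floorlog 2 (L - 1) \<le> L" using floorlog_le[of "L - 1"] by linarith
  have "L * L < 2 ^ L * 2 ^ L" using less_exp[of L] by (intro mult_strict_mono) auto
  then have 4: "f2 \<le> L + L" unfolding f2_def by (intro floorlog_le_if) (simp add: power_add)
  have 5: "fh \<le> L" "fH \<le> 1024 * L" using floorlog_le[of h] h_le floorlog_le[of H] H_le
    unfolding fh_def fH_def by linarith+
  have L1: "1 \<le> L" using L_pos(1) by linarith
  show ?thesis
  proof (cases "x < 32")
    case True
    have "list_all (\<lambda>x. rcost (rsteps ! x) (pv x) \<le> 10240 * L) [2..<32]"
      using 1 2 3 4 5 L1 by (simp add: rsteps_def)
    then have "\<forall>x \<in> set [2..<32]. rcost (rsteps ! x) (pv x) \<le> 10240 * L" by (simp only: list_all_iff)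
    moreover have "x \<in> set [2..<32]" unfolding set_upt using True assms by simp
    ultimately show ?thesis by blast
  next
    case False
    then obtain s where s: "x = 32 + s" using le_Suc_ex[of 32 x] by auto
    then have s: "x = 32 + s" "s < 13" using assms by auto
    have "rsteps ! x = Val (Var (31 + s) +! Var (size_reg s) div! Var 0 +! Num 1)"
      unfolding s(1) using s(2) by (simp add: rsteps_def nth_append)
    then show ?thesis by simp
  qed
qed

lemma reg_cost_le: "reg_cost \<le> 100 * (max_ops * w)"
proof -
  have "reg_cost \<le> 1 + (\<Sum>x = 2..<nregs. max_ops + 10240 * L + 5)"
    unfolding reg_cost_def by (intro add_left_mono sum_mono) (use rcost_le in auto)
  also have "\<dots> = 1 + 43 * (max_ops + 10240 * L + 5)" by simp
  also have "\<dots> \<le> 100 * (max_ops * w)"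
    using L_le_w unfolding max_ops_def by simp
  finally show ?thesis .
qed

lemma sum_30: "(\<Sum>a = 0..<30. f a) = f 0 + f 1 + f 2 + f 3 + f 4 + f 5 + f 6 + f 7 + f 8 + f 9 + f 10 + f 11 + f 12
   + f 13 + f 14 + f 15 + f 16 + f 17 + f 18 + f 19 + f 20 + f 21 + f 22 + f 23 + f 24 + f 25 + f 26 + f 27 + f 28 + f (29::nat)"
  for f :: "nat \<Rightarrow> nat"
  by (simp add: eval_nat_numeral)

text \<open>The longest loops take \<open>w\<close> rounds (bit lengths, packing),
  \<open>h + H\<close> rounds (bit counts) or about \<open>L\<close> rounds (prefix sums), each of
  which is \<open>O(w)\<close>.\<close>

lemma depth_le: "reg_cost + (arr_depth + (500 + 2600 * (w + 2))) \<le> depth"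
proof -
  have hH: "h + H \<le> 1025 * w" using h_le H_le L_le_w(1) by linarith
  have "arr_depth = 1 + 6 * max_ops * (\<Sum>a = 0..<narrs. NBf a + 4)"
    unfolding arr_depth_def by (simp add: sum_distrib_left)
  also have "(\<Sum>a = 0..<narrs. NBf a + 4) = w + (h + H) + L + (L + 2) + (L - 1) + 4 + 120"
    unfolding sum_30 by (simp add: NBf_def)
  also have "\<dots> \<le> 2000 * w" using hH L_le_w by linarith
  finally have "arr_depth \<le> 1 + 6 * max_ops * (2000 * w)" by simp
  then show ?thesis using reg_cost_le L_le_w(2) unfolding depth_def max_ops_def by simp
qed

text \<open>Loops of non-constant length only run over short arrays: about \<open>n / L\<close>
  blocks for \<open>O(L)\<close> rounds, \<open>M\<close> logarithms for \<open>w\<close> rounds,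
  \<open>2 ^ (h + H)\<close> strings for \<open>h + H\<close> rounds. All other arrays take a
  constant number of rounds.\<close>

lemma work_le:
  "reg_cost + (arr_work + (500 + 60 * (M + 1) + (\<Sum>s < 13. 200 * (w + 2) * (pv (size_reg s) div w + 3)))) \<le> work"
proof -
  \<comment> \<open>A common upper bound, so that every contribution below is a constant multiple of
    one quantity.\<close>
  define Y where "Y = n + K + total + w * (M + 2) + 2 ^ (h + H) * (h + H + 2)"
  have w1: "1 \<le> w" by (rule L_le_w)
  have wM: "w * (M + 2) = w * M + 2 * w" by simp
  have Mw: "M \<le> w * M" using w1 by (cases w) auto
  have LK: "L \<le> K" unfolding K_def using L_pos(2) by (cases LL) auto
  have base: "n \<le> Y" "K \<le> Y" "total \<le> Y" "w * M \<le> Y" "w \<le> Y" "M \<le> Y" "L \<le> Y" "1 \<le> Y"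
    using wM Mw w1 LK unfolding Y_def by linarith+
  have E: "2 ^ (h + H) * (h + H + 2) = (h + H + 1) * 2 ^ (h + H) + 2 ^ (h + H)" by (simp add: algebra_simps)
  have p: "(h + H + 1) * 2 ^ (h + H) \<le> Y" "2 ^ (h + H) \<le> Y" "h + H \<le> Y"
  proof -
    show 1: "(h + H + 1) * 2 ^ (h + H) \<le> Y" "2 ^ (h + H) \<le> Y" using E unfolding Y_def by linarith+
    have "h + H < 2 ^ (h + H)" by (rule less_exp)
    then show "h + H \<le> Y" using 1(2) by linarith
  qed
  have HH: "2 ^ H * H \<le> Y"
  proof -
    have "2 ^ H * H \<le> 2 ^ (h + H) * (h + H + 1)" by (intro mult_le_mono power_increasing) auto
    then show ?thesis using p(1) by (simp add: mult.commute)
  qed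
  have nbL: "nb * L \<le> 3 * Y"
  proof -
    have "nb * L = n div L * L + K + L" by (simp add: nb_def K_def algebra_simps)
    then show ?thesis using div_times_less_eq_dividend[of n L] base by linarith
  qed
  have nb: "nb \<le> 3 * Y" using nbL L_pos(1) by (cases L) auto
  have nb3: "(L + 3) * (nb + 3) \<le> 30 * Y"
  proof -
    have "L + 3 \<le> 4 * L" using L_pos(1) by linarith
    then have "(L + 3) * (nb + 3) \<le> 4 * L * (nb + 3)" by (rule mult_le_mono1)
    also have "\<dots> = 4 * (nb * L) + 12 * L" by (simp add: algebra_simps)
    also have "\<dots> \<le> 30 * Y" using nbL base by linarith
    finally show ?thesis .
  qed
  have nb1: "(L + 1) * (nb + 3) \<le> 30 * Y" "L * (nb + 2) \<le> 30 * Y"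
    using le_trans[OF mult_le_mono nb3, of "L + 1" "nb + 3"] le_trans[OF mult_le_mono nb3, of L "nb + 2"] by auto
  have X: "X \<le> 10 * Y" using base unfolding X_def by linarith
  have nd: "n div y \<le> Y" for y using div_le_dividend[of n y] base(1) by linarith
  have t: "n div (L * L) * fn \<le> Y" "n div L * f2 \<le> Y" "h * RA \<le> Y" "(n div K + 1) * fn \<le> Y"
    "(n div K + 1) * A2 \<le> Y" "2 * (n div LL) \<le> Y" "H * SA \<le> Y"
  proof -
    have g: "a1 \<le> Y \<and> a2 \<le> Y \<and> a3 \<le> Y \<and> a4 \<le> Y \<and> a5 \<le> Y \<and> a6 \<le> Y \<and> a7 \<le> Y"
      if "a1 + a2 + a3 + 2 * (2 * a4 + a5 + a6 + a7) \<le> Y" for a1 a2 a3 a4 a5 a6 a7 :: nat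
      using that by (intro conjI; simp only: distrib_left; linarith)
    from g[OF base(3)[unfolded total_def]]
    show "n div (L * L) * fn \<le> Y" "n div L * f2 \<le> Y" "h * RA \<le> Y" "(n div K + 1) * fn \<le> Y"
      "(n div K + 1) * A2 \<le> Y" "2 * (n div LL) \<le> Y" "H * SA \<le> Y" by blast+
  qed
  have wM2: "(w + 1) * (M + 2) \<le> 10 * Y"
  proof -
    have "(w + 1) * (M + 2) = w * M + 2 * w + M + 2" by (simp add: algebra_simps)
    then show ?thesis using base by linarith
  qed
  have pp: "(h + H + 1) * (2 ^ (h + H) + 2) \<le> 10 * Y"
  proof -
    have "(h + H + 1) * (2 ^ (h + H) + 2) = (h + H + 1) * 2 ^ (h + H) + 2 * (h + H + 1)" by (simp add: algebra_simps)
    also have "\<dots> \<le> Y + 9 * Y" by (rule add_mono[OF p(1)]) (use p(3) base(8) in simp)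
    finally show ?thesis by simp
  qed
  have A: "(\<Sum>a = 0..<narrs. N0f a + (NBf a + 1) * (Nkf a + 2) + 2) \<le> 1200 * Y"
  proof -
    let ?f = "\<lambda>a. N0f a + (NBf a + 1) * (Nkf a + 2) + 2"
    have v: "N0f 0 + (NBf 0 + 1) * (Nkf 0 + 2) + 2 = nb * L + 2 * (n + 2) + 2"
      "N0f 1 + (NBf 1 + 1) * (Nkf 1 + 2) + 2 = M + (w + 1) * (M + 2) + 2"
      "N0f 2 + (NBf 2 + 1) * (Nkf 2 + 2) + 2 = M + 4"
      "N0f 3 + (NBf 3 + 1) * (Nkf 3 + 2) + 2 = 2 ^ (h + H) + (h + H + 1) * (2 ^ (h + H) + 2) + 2"
      "N0f 4 + (NBf 4 + 1) * (Nkf 4 + 2) + 2 = 2 ^ H * H + 2 * (2 ^ H * H + 2) + 2"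
      "N0f 5 + (NBf 5 + 1) * (Nkf 5 + 2) + 2 = nb + 1 + (L + 1) * (nb + 3) + 2"
      "N0f 6 + (NBf 6 + 1) * (Nkf 6 + 2) + 2 = nb + 1 + (L + 3) * (nb + 3) + 2"
      "N0f 7 + (NBf 7 + 1) * (Nkf 7 + 2) + 2 = nb + L * (nb + 2) + 2"
      "N0f 8 + (NBf 8 + 1) * (Nkf 8 + 2) + 2 = nb * L + 4"
      "N0f 9 + (NBf 9 + 1) * (Nkf 9 + 2) + 2 = X + 2 * (n + 2) + 2"
      "N0f 10 + (NBf 10 + 1) * (Nkf 10 + 2) + 2 = X + 2 * (n + 2) + 2"
      using L_pos(1) by (simp_all add: N0f_def NBf_def Nkf_def algebra_simps)
    have v2: "N0f a + (NBf a + 1) * (Nkf a + 2) + 2 = NA a + 4" if "11 \<le> a" for a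
      using that by (simp add: N0f_def NBf_def Nkf_def)
    have V: "?f 0 \<le> 40 * Y" "?f 1 \<le> 40 * Y" "?f 2 \<le> 40 * Y" "?f 3 \<le> 40 * Y" "?f 4 \<le> 40 * Y" "?f 5 \<le> 40 * Y"
      "?f 6 \<le> 40 * Y" "?f 7 \<le> 40 * Y" "?f 8 \<le> 40 * Y" "?f 9 \<le> 40 * Y" "?f 10 \<le> 40 * Y"
      unfolding v distrib_left_numeral using nbL wM2 pp p(2) HH nb1 nb3 nb X base by linarith+
    have NA: "NA 11 \<le> 2 * Y" "NA 12 \<le> 2 * Y" "NA 13 \<le> 2 * Y" "NA 14 \<le> 2 * Y" "NA 15 \<le> 2 * Y"
      "NA 16 \<le> 2 * Y" "NA 17 \<le> 2 * Y" "NA 18 \<le> 2 * Y" "NA 19 \<le> 2 * Y" "NA 20 \<le> 2 * Y" "NA 21 \<le> 2 * Y"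
      "NA 22 \<le> 2 * Y" "NA 23 \<le> 2 * Y" "NA 24 \<le> 2 * Y" "NA 25 \<le> 2 * Y" "NA 26 \<le> 2 * Y" "NA 27 \<le> 2 * Y"
      "NA 28 \<le> 2 * Y" "NA 29 \<le> 2 * Y"
      using nd[of K] nd[of LL] t[THEN le_trans, of "2 * Y"] base(8) unfolding NA_simps by linarith+
    have "?f a \<le> 40 * Y" if "a < 30" for a
    proof (cases "a < 11")
      case True
      then have "a = 0 \<or> a = 1 \<or> a = 2 \<or> a = 3 \<or> a = 4 \<or> a = 5 \<or> a = 6 \<or> a = 7 \<or> a = 8 \<or> a = 9 \<or> a = 10"
        by presburger
      then show ?thesis by (elim disjE) (simp_all only: V)
    next
      case False
      have "list_all (\<lambda>a. NA a \<le> 2 * Y) [11..<30]"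
        by (use NA in \<open>simp del: NA_simps\<close>)
      then have "\<forall>a \<in> set [11..<30]. NA a \<le> 2 * Y" by (simp only: list_all_iff)
      moreover have "a \<in> set [11..<30]" unfolding set_upt using that False by simp
      ultimately have "NA a \<le> 2 * Y" by blast
      then show ?thesis using v2[of a] False base(8) by linarith
    qed
    then have "(\<Sum>a = 0..<30. ?f a) \<le> (\<Sum>a = 0..<(30::nat). 40 * Y)" by (intro sum_mono) simp
    then show ?thesis by simp
  qed
  have "arr_work = 1 + 5 * max_ops * (\<Sum>a = 0..<narrs. N0f a + (NBf a + 1) * (Nkf a + 2) + 2)"
    unfolding arr_work_def by (simp add: sum_distrib_left)
  then have 1: "arr_work \<le> 1 + 5 * max_ops * (1200 * Y)" using mult_le_mono2[OF A, of "5 * max_ops"] by linarith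
  \<comment> \<open>Packing uses \<open>w\<close> rounds on about \<open>1 / w\<close> times as many
    words as there are bits, so it is linear in the size of the section plus
    \<open>O(w)\<close>.\<close>
  have 2: "(\<Sum>s < 13. 200 * (w + 2) * (pv (size_reg s) div w + 3)) \<le> 200 * (3 * total + 13 * (9 * w))"
  proof -
    have "200 * (w + 2) * (pv (size_reg s) div w + 3) \<le> 200 * (3 * pv (size_reg s) + 9 * w)" for s
    proof -
      have "(w + 2) * (pv (size_reg s) div w + 3) \<le> 3 * w * (pv (size_reg s) div w + 3)"
        using w1 by (intro mult_le_mono1) linarith
      also have "\<dots> = 3 * (pv (size_reg s) div w * w) + 9 * w" by (simp add: algebra_simps)
      also have "\<dots> \<le> 3 * pv (size_reg s) + 9 * w"
        by (intro add_mono mult_le_mono2 div_times_less_eq_dividend order_refl)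
      finally show ?thesis by (simp only: mult.assoc mult_le_mono2)
    qed
    then have "(\<Sum>s < 13. 200 * (w + 2) * (pv (size_reg s) div w + 3)) \<le> (\<Sum>s < 13. 200 * (3 * pv (size_reg s) + 9 * w))"
      by (rule sum_mono)
    also have "\<dots> = 200 * (3 * total + 13 * (9 * w))"
      by (simp only: sum_distrib_left[symmetric] sum.distrib sum_sizes) simp
    finally show ?thesis .
  qed
  have 3: "reg_cost \<le> 100 * (max_ops * Y)" using reg_cost_le base(5) mult_le_mono2[OF base(5), of max_ops] by linarith
  have "reg_cost + (arr_work + (500 + 60 * (M + 1) + (\<Sum>s < 13. 200 * (w + 2) * (pv (size_reg s) div w + 3))))
      \<le> 100 * (max_ops * Y) + 6000 * (max_ops * Y) + 100000 * Y"
  proof -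
    have "arr_work \<le> 1 + 6000 * (max_ops * Y)" using 1 by (simp only: mult.commute mult.left_commute mult.assoc)
    moreover have "200 * (3 * total + 13 * (9 * w)) = 600 * total + 23400 * w" by simp
    ultimately show ?thesis unfolding distrib_left_numeral[of _ M] using 2 3 base by linarith
  qed
  also have "\<dots> \<le> 5 * max_ops * (1000000 * Y)" by (simp add: max_ops_def)
  finally show ?thesis unfolding work_def Y_def .
qed

text \<open>Everything except the tables is \<open>O(n / LL)\<close> up to multiples of
  \<open>K\<close>. The largest coefficient, 192, comes from the second rank directory: it has
  \<open>n / L\<close> entries of at most \<open>3 * LL\<close> bits, and
  \<open>LL * LL \<le> 64 * L\<close>.\<close>

lemma total_real: "real total \<le> 250 * (real n / real LL) + 40 * real K + 3 * (2 ^ (h + H) * (real (h + H) + 2) ^ 3)"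
proof -
  have d: "real (n div y) \<le> real n / real y" for y by (rule of_nat_div_le_of_nat)
  have L1: "1 \<le> real L" "1 \<le> real LL" using L_pos(1,2) by linarith+
  have LLL: "real LL \<le> real L" using LL_le by simp
  have e: "n < 2 ^ (L + 1)" using n_le by (simp add: le_less_trans)
  have fn: "real fn \<le> 2 * real L"
  proof -
    have "fn \<le> L + 1" unfolding fn_def using e by (rule floorlog_le_if)
    then show ?thesis using L1 by linarith
  qed
  have f2: "real f2 \<le> 3 * real LL"
  proof -
    have "f2 \<le> lg (L * L) + 1" unfolding f2_def by (rule floorlog_le_lg)
    moreover have "lg (L * L) \<le> LL + LL" using lg_mult[of L L] by (simp add: LL_def)
    ultimately show ?thesis using L1 by linarith
  qed
  have LL3: "real LL * real LL \<le> 64 * real L"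
  proof -
    have "LL * LL * 1 \<le> LL * LL * (LL * LL)" using L_pos(2) by (intro mult_le_mono2) (simp add: Suc_leI)
    moreover have "LL ^ 4 = LL * LL * (LL * LL)" by (simp add: power4_eq_xxxx mult.assoc)
    ultimately have "LL * LL \<le> 64 * L" using LL4 by linarith
    then show ?thesis by (metis of_nat_le_iff of_nat_mult of_nat_numeral)
  qed
  have 1: "real (n div (L * L) * fn) \<le> 2 * (real n / real LL)"
  proof -
    have "real (n div (L * L) * fn) \<le> real n / real (L * L) * (2 * real L)"
      unfolding of_nat_mult[of "n div (L * L)"] using d[of "L * L"] fn by (intro mult_mono) auto
    also have "\<dots> = 2 * (real n / real L)" using L1 by (simp add: field_simps)
    also have "\<dots> \<le> 2 * (real n / real LL)" using LLL L1 by (intro mult_left_mono divide_left_mono) auto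
    finally show ?thesis .
  qed
  have 2: "real (n div L * f2) \<le> 192 * (real n / real LL)"
  proof -
    have "real (n div L * f2) \<le> real n / real L * (3 * real LL)"
      unfolding of_nat_mult using d[of L] f2 by (intro mult_mono) auto
    also have "\<dots> = 3 * real n * (real LL / real L)" by simp
    also have "real LL / real L \<le> 64 / real LL" using LL3 L1 by (simp add: field_simps)
    finally show ?thesis by (simp add: mult_left_mono)
  qed
  have dK: "real (n div K + 1) \<le> real n / (real L * real LL) + 1" using d[of K] by (simp add: K_def)
  have LK: "real L \<le> real K" unfolding K_def of_nat_mult using L1 by simp
  have 3: "real ((n div K + 1) * fn) \<le> 2 * (real n / real LL) + 2 * real K"
  proof -
    have "real ((n div K + 1) * fn) \<le> (real n / (real L * real LL) + 1) * (2 * real L)"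
      unfolding of_nat_mult[of "n div K + 1"] using dK fn by (intro mult_mono) auto
    also have "\<dots> = 2 * (real n / real LL) + 2 * real L" using L1 by (simp add: field_simps)
    finally show ?thesis using LK by linarith
  qed
  have 4: "real ((n div K + 1) * A2) \<le> 7 * (real n / real LL) + 7 * real K"
  proof -
    have A2: "real A2 \<le> 7 * real L" unfolding A2_def using LL_le by simp
    have "real ((n div K + 1) * A2) \<le> (real n / (real L * real LL) + 1) * (7 * real L)"
      unfolding of_nat_mult[of "n div K + 1"] using dK A2 by (intro mult_mono) auto
    also have "\<dots> = 7 * (real n / real LL) + 7 * real L" using L1 by (simp add: field_simps)
    finally show ?thesis using LK by linarith
  qed
  have 5: "real (n div LL) \<le> real n / real LL" by (rule d)
  have T: "h * RA \<le> 2 ^ (h + H) * (h + H + 2) ^ 3" "H * SA \<le> 2 ^ (h + H) * (h + H + 2) ^ 3"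
  proof -
    have "h * RA = 2 ^ h * (h * h * fh)" by (simp add: RA_def)
    also have "\<dots> \<le> 2 ^ (h + H) * ((h + H + 2) * (h + H + 2) * (h + H + 2))"
      using floorlog_le[of h] by (intro mult_le_mono power_increasing) (auto simp: fh_def)
    finally show "h * RA \<le> 2 ^ (h + H) * (h + H + 2) ^ 3" by (simp add: power3_eq_cube)
    have "H * SA = 2 ^ H * (H * H * fH)" by (simp add: SA_def)
    also have "\<dots> \<le> 2 ^ (h + H) * ((h + H + 2) * (h + H + 2) * (h + H + 2))"
      using floorlog_le[of H] by (intro mult_le_mono power_increasing) (auto simp: fH_def)
    finally show "H * SA \<le> 2 ^ (h + H) * (h + H + 2) ^ 3" by (simp add: power3_eq_cube)
  qed
  have T': "real (h * RA) \<le> 2 ^ (h + H) * (real (h + H) + 2) ^ 3" "real (H * SA) \<le> 2 ^ (h + H) * (real (h + H) + 2) ^ 3"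
    using T[THEN of_nat_mono[where 'a = real]] by (simp_all add: ac_simps)
  have "real total = real (n div (L * L) * fn) + real (n div L * f2) + real (h * RA) +
     (4 * real ((n div K + 1) * fn) + 2 * real ((n div K + 1) * A2) + 4 * real (n div LL) + 2 * real (H * SA))"
    unfolding total_def by simp
  also have "\<dots> \<le> 250 * (real n / real LL) + 40 * real K + 3 * (2 ^ (h + H) * (real (h + H) + 2) ^ 3)"
  proof -
    have "0 \<le> real n / real LL" "0 \<le> real K" by simp_all
    then show ?thesis using 1 2 3 4 5 T' by linarith
  qed
  finally show ?thesis .
qed

lemma lg_real:
  assumes "2 \<le> (k::nat)"
  shows "log 2 (real k) \<le> real (lg k)" "real (lg k) \<le> log 2 (real k) + 1"
proof -
  have "log 2 2 \<le> log 2 (real k)" using assms by (subst log_le_cancel_iff) auto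
  then have k1: "1 \<le> log 2 (real k)" by simp
  then have "lg k = nat \<lceil>log 2 (real k)\<rceil>" unfolding lg_def by (simp add: max_def) linarith
  then have "real (lg k) = of_int \<lceil>log 2 (real k)\<rceil>" using k1 by simp
  then show "log 2 (real k) \<le> real (lg k)" "real (lg k) \<le> log 2 (real k) + 1" by linarith+
qed

text \<open>From \<open>n = 4\<close> on, log log \<open>n\<close> is at least 1, so the division by
  it is harmless and the rounded logarithms exceed the real ones by at most a constant.\<close>

lemma real_bounds:
  assumes n4: "4 \<le> n" and wC: "real w \<le> C * log 2 (real n)" and C: "0 \<le> C"
  shows "real space \<le> 250 * (real n / log 2 (log 2 (real n))) + rest C (real n)"
    and "real (n + K + total + w * (M + 2) + 2 ^ (h + H) * (h + H + 2)) \<le>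
      real n + 250 * (real n / log 2 (log 2 (real n))) + 2 * rest C (real n)"
proof -
  define x where "x = log 2 (real n)"
  define y where "y = log 2 (x + 1) + 1"
  define z where "z = x / 2 + 1 + 16 * y ^ 4"
  have "log 2 4 \<le> x" unfolding x_def using n4 by (subst log_le_cancel_iff) auto
  moreover have "log 2 (4::real) = 2" using log_pow_cancel[of 2 2] by simp
  ultimately have x2: "2 \<le> x" by simp
  have L: "x \<le> real L" "real L \<le> x + 1" using lg_real[of n] n4 unfolding L_def x_def by auto
  have L2: "2 \<le> L" using L(1) x2 by linarith
  have lx: "log 2 x \<le> log 2 (real L)" "log 2 (real L) \<le> log 2 (x + 1)" "1 \<le> log 2 x"
  proof -
    show "log 2 x \<le> log 2 (real L)" "log 2 (real L) \<le> log 2 (x + 1)"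
      using L x2 by (subst log_le_cancel_iff; simp)+
    have "log 2 2 \<le> log 2 x" using x2 by (subst log_le_cancel_iff) auto
    then show "1 \<le> log 2 x" by simp
  qed
  have LL: "log 2 x \<le> real LL" "real LL \<le> y"
    using lg_real[OF L2] lx unfolding LL_def y_def by linarith+
  have y1: "1 \<le> y" using LL(2) L_pos(2) by linarith
  have K: "real K \<le> (x + 1) * y" unfolding K_def of_nat_mult using L LL x2 by (intro mult_mono) auto
  have K0: "0 \<le> (x + 1) * y" using x2 y1 by simp
  have H: "real H \<le> 16 * y ^ 4"
  proof -
    have "real H = 16 * real LL ^ 4" by (simp add: H_def power4_eq_xxxx)
    also have "\<dots> \<le> 16 * y ^ 4" using LL(2) by (intro mult_left_mono power_mono) auto
    finally show ?thesis .
  qed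
  have h: "real h \<le> x / 2 + 1"
  proof -
    have "2 * h \<le> L + 1" unfolding h_def by linarith
    then have "2 * real h \<le> real L + 1" by linarith
    then show ?thesis using L(2) by linarith
  qed
  have hH: "real (h + H) \<le> z" using h H unfolding z_def by simp
  have z0: "0 \<le> z" using hH by (meson of_nat_0_le_iff order_trans)
  have P: "(2::real) ^ (h + H) \<le> 2 powr z"
  proof -
    have "(2::real) ^ (h + H) = 2 powr real (h + H)" by (rule powr_realpow[symmetric]) simp
    also have "\<dots> \<le> 2 powr z" using hH by (intro powr_mono) auto
    finally show ?thesis .
  qed
  have P3: "2 ^ (h + H) * (real (h + H) + 2) ^ 3 \<le> 2 powr z * (z + 2) ^ 3"
    using P hH by (intro mult_mono power_mono) auto
  have P1: "2 ^ (h + H) * (real (h + H) + 2) \<le> 2 powr z * (z + 2) ^ 3"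
  proof -
    have "2 ^ (h + H) * (real (h + H) + 2) \<le> 2 ^ (h + H) * (real (h + H) + 2) ^ 3"
      using power_increasing[of 1 3 "real (h + H) + 2"] by (intro mult_left_mono) auto
    then show ?thesis using P3 by linarith
  qed
  have M: "real (M + 2) \<le> ((x + 1) * y) ^ 2 + 16 * y ^ 4 + 3"
  proof -
    have "real K * real K \<le> ((x + 1) * y) * ((x + 1) * y)" using K K0 by (intro mult_mono) auto
    then show ?thesis using H unfolding M_def power2_eq_square by simp
  qed
  have wM: "real (w * (M + 2)) \<le> C * x * (((x + 1) * y) ^ 2 + 16 * y ^ 4 + 3)"
    unfolding of_nat_mult using wC M C x2 unfolding x_def[symmetric] by (intro mult_mono) auto
  have nLL: "real n / real LL \<le> real n / log 2 x" using LL lx by (intro divide_left_mono) auto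
  have r: "rest C (real n) = 100 * (C * x * (((x + 1) * y) ^ 2 + 16 * y ^ 4 + 3)) + 4 * (2 powr z * (z + 2) ^ 3) +
      40 * ((x + 1) * y)"
    unfolding rest_def Let_def x_def[symmetric] y_def[symmetric] z_def[symmetric] ..
  have p0: "0 \<le> 2 powr z * (z + 2) ^ 3" using z0 by simp
  have c0: "0 \<le> C * x * (((x + 1) * y) ^ 2 + 16 * y ^ 4 + 3)"
    using wM by (meson of_nat_0_le_iff order_trans)
  have sp: "real space = real total + 100 * real (w * (M + 2))" by (simp add: space_def)
  show "real space \<le> 250 * (real n / log 2 (log 2 (real n))) + rest C (real n)"
    unfolding sp r x_def[symmetric] using total_real nLL K P3 wM p0 by linarith
  have "real (n + K + total + w * (M + 2) + 2 ^ (h + H) * (h + H + 2)) =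
      real n + real K + real total + real (w * (M + 2)) + 2 ^ (h + H) * (real (h + H) + 2)"
    by (simp add: algebra_simps)
  moreover have "n' + k + t + m + q \<le> n' + 250 * ng + 2 * (100 * c + 4 * p + 40 * kk)"
    if "t \<le> 250 * nl + 40 * k + 3 * q3" "nl \<le> ng" "k \<le> kk" "0 \<le> kk" "q3 \<le> p" "q \<le> p"
      "m \<le> c" "0 \<le> p" "0 \<le> c" for n' k t m q ng c p kk nl q3 :: real
    using that by (simp only: distrib_left)
  from this[OF total_real nLL K K0 P3 P1 wM p0 c0]
  have "real n + real K + real total + real (w * (M + 2)) + 2 ^ (h + H) * (real (h + H) + 2) \<le>
      real n + 250 * (real n / log 2 x) + 2 * rest C (real n)" unfolding r .
  ultimately show "real (n + K + total + w * (M + 2) + 2 ^ (h + H) * (h + H + 2)) \<le>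
      real n + 250 * (real n / log 2 (log 2 (real n))) + 2 * rest C (real n)"
    unfolding x_def by (simp only:)
qed

lemma holds_seq_low: "(\<And>p. p < n \<Longrightarrow> m p = m0 p) \<Longrightarrow> holds_seq w m S"
  using seqS lenS le_less_trans[OF div_le_dividend] by (auto simp: holds_seq_def mem_bit_def)

lemma block_end: "n + len \<le> 2 ^ w"
proof -
  have "n + len < 2 ^ u" unfolding n_len using pv_less[of 44] pv_WA[of 13] by simp
  also have "\<dots> \<le> 2 ^ w" using bb.u_le_w by (intro power_increasing) auto
  finally show ?thesis by simp
qed

lemma build_correct:
  "\<exists>W' D' m' r' base len'.
     exec w build_prog (m0, init_regs [w, n]) W' D' (m', r') \<and> W' \<le> work \<and> D' \<le> depth \<and>
     holds_seq w m' S \<and> r' 0 = base \<and> base + len' \<le> 2 ^ w \<and> len' * w \<le> space \<and>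
     jacobson w m' base len' S \<and> clark w m' base len' True S \<and> clark w m' base len' False S \<and>
     (\<forall>m2. valid_mem w m2 \<and> holds_seq w m2 S \<and> (\<forall>p. base \<le> p \<and> p < base + len' \<longrightarrow> m2 p = m' p) \<longrightarrow>
        (\<forall>c i. i < n \<longrightarrow> answers w rank_query m2 base (40 * (max_ops + 1)) (\<lambda>c. rank c S) c i) \<and>
        (\<forall>c i. 1 \<le> i \<and> i \<le> count_list S c \<longrightarrow>
           answers w select_query m2 base (40 * (max_ops + 1)) (\<lambda>c. select c S) c i))"
proof -
  from runs_build obtain m' r' where R: "runs w build_prog (m0, init_regs [w, n])
     (reg_cost + (arr_work + (500 + 60 * (M + 1) + (\<Sum>s < 13. 200 * (w + 2) * (pv (size_reg s) div w + 3)))))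
     (reg_cost + (arr_depth + (500 + 2600 * (w + 2)))) (m', r')"
    and r0: "r' 0 = n" and lowm: "\<forall>p < n. m' p = m0 p"
    and b: "bb.hdr nregs m'" "bb.tabs True True m'" "bb.sects 13 m'" by blast
  from runs_mono[OF R work_le depth_le] obtain W' D' where
    E: "exec w build_prog (m0, init_regs [w, n]) W' D' (m', r')" "W' \<le> work" "D' \<le> depth"
    unfolding runs_def by blast
  have blk: "blk m'" using b by (simp add: blk_def)
  have q: "(\<forall>c i. i < n \<longrightarrow> answers w rank_query m2 n (40 * (max_ops + 1)) (\<lambda>c. rank c S) c i) \<and>
      (\<forall>c i. 1 \<le> i \<and> i \<le> count_list S c \<longrightarrow>
         answers w select_query m2 n (40 * (max_ops + 1)) (\<lambda>c. select c S) c i)"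
    if m2: "valid_mem w m2" "holds_seq w m2 S" "\<forall>p. n \<le> p \<and> p < n + len \<longrightarrow> m2 p = m' p" for m2
  proof -
    have blk2: "blk m2" by (rule blk_agree[OF blk]) (use m2(3) in blast)
    have 1: "answers w rank_query m2 n (40 * (max_ops + 1)) (\<lambda>c. rank c S) c i" if i: "i < n" for c i
    proof -
      from rank_query_correct[OF blk2 m2(1,2) i] obtain r W D where
        "exec w rank_query (m2, init_regs [w, n, of_bool c, i]) W D (m2, r)" "W \<le> 20 * (max_ops + 1)" "r 0 = rank c S i"
        unfolding runs_def by blast
      then show ?thesis unfolding answers_def
        by (intro exI[of _ W] exI[of _ D] exI[of _ r]) (auto elim: le_trans)
    qed
    have 2: "answers w select_query m2 n (40 * (max_ops + 1)) (\<lambda>c. select c S) c i"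
      if i: "1 \<le> i" "i \<le> count_list S c" for c i
      using select_query_correct[OF blk2 m2(1,2) i] unfolding runs_def answers_def by blast
    show ?thesis using 1 2 by blast
  qed
  have hs: "holds_seq w m' S" by (rule holds_seq_low) (use lowm in blast)
  show ?thesis
    by (intro exI[of _ W'] exI[of _ D'] exI[of _ m'] exI[of _ r'] exI[of _ n] exI[of _ len] conjI)
      (use E hs r0 block_end len_le jacobson_blk[OF blk] clark_blk[OF blk] q in blast)+
qed

end

theorem mainTheorem5:
  "\<exists>(c0 :: nat) build rank_query select_query. \<forall>w :: nat \<Rightarrow> nat.
     (\<lambda>n. real (w n)) \<in> \<Theta>(\<lambda>n. log 2 (real n)) \<and> (\<forall>n. w n \<ge> c0 * lg n) \<longrightarrow>
     (\<exists>(W :: nat \<Rightarrow> nat) (D :: nat \<Rightarrow> nat) (Z :: nat \<Rightarrow> nat) (Q :: nat).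
        (\<lambda>n. real (W n)) \<in> O(\<lambda>n. real n) \<and>
        (\<lambda>n. real (D n)) \<in> O(\<lambda>n. log 2 (real n)) \<and>
        (\<lambda>n. real (Z n)) \<in> o(\<lambda>n. real n) \<and>
        (\<forall>n S m. length S = n \<and> valid_mem (w n) m \<and> holds_seq (w n) m S \<longrightarrow>
           (\<exists>W' D' m' r' base len.
              exec (w n) build (m, init_regs [w n, n]) W' D' (m', r') \<and> W' \<le> W n \<and> D' \<le> D n \<and>
              holds_seq (w n) m' S \<and>
              r' 0 = base \<and> base + len \<le> 2 ^ w n \<and> len * w n \<le> Z n \<and>
              jacobson (w n) m' base len S \<and>
              clark (w n) m' base len True S \<and> clark (w n) m' base len False S \<and>
              (\<forall>m2. valid_mem (w n) m2 \<and> holds_seq (w n) m2 S \<and>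
                    (\<forall>p. base \<le> p \<and> p < base + len \<longrightarrow> m2 p = m' p) \<longrightarrow>
                 (\<forall>c i. i < n \<longrightarrow>
                    answers (w n) rank_query m2 base Q (\<lambda>c. rank c S) c i) \<and>
                 (\<forall>c i. 1 \<le> i \<and> i \<le> count_list S c \<longrightarrow>
                    answers (w n) select_query m2 base Q (\<lambda>c. select c S) c i)))))"
proof (rule exI[of _ "max_deg * word_factor"], rule exI[of _ build_prog], rule exI[of _ rank_query],
    rule exI[of _ select_query], intro allI impI)
  fix w :: "nat \<Rightarrow> nat"
  assume w: "(\<lambda>n. real (w n)) \<in> \<Theta>(\<lambda>n. log 2 (real n)) \<and> (\<forall>n. w n \<ge> max_deg * word_factor * lg n)"
  then have ge: "max_deg * (word_factor * lg n) \<le> w n" for n by (simp add: mult.assoc)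
  have lay: "layout (w n) n S m" if "length S = n" "valid_mem (w n) m" "holds_seq (w n) m S" for n S m
    by unfold_locales (use ge that in auto)
  \<comment> \<open>The cost bounds depend on \<open>w\<close> and \<open>n\<close> only, so their
    growth may be derived from any one input; the all-zero sequence in an all-zero memory satisfies
    the assumptions for every \<open>n\<close>.\<close>
  have lay0: "layout (w n) n (replicate n False) (\<lambda>_. 0)" for n
    by (rule lay) (auto simp: valid_mem_def holds_seq_def mem_bit_def)
  have wO: "(\<lambda>n. real (w n)) \<in> O(\<lambda>n. log 2 (real n))" using w by (simp add: bigthetaD1)
  then obtain C where C: "0 < C" "eventually (\<lambda>n. norm (real (w n)) \<le> C * norm (log 2 (real n))) at_top"
    by (elim landau_o.bigE) auto
  define g where "g = (\<lambda>n::real. n / log 2 (log 2 n))"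
  have wC: "eventually (\<lambda>n. 4 \<le> n \<and> real (w n) \<le> C * log 2 (real n)) at_top"
    using C(2) eventually_ge_at_top[of 4] by eventually_elim auto
  have small: "(\<lambda>n::nat. g (real n)) \<in> o(\<lambda>n. real n)" "(\<lambda>n::nat. rest C (real n)) \<in> o(\<lambda>n. real n)"
    using landau_o.small.compose[OF loglog_smallo filterlim_real_sequentially]
      landau_o.small.compose[OF rest_smallo[of C] filterlim_real_sequentially] by (simp_all add: g_def)
  have Zo: "(\<lambda>n. real (layout.space (w n) n)) \<in> o(\<lambda>n. real n)"
  proof -
    have "(\<lambda>n. real (layout.space (w n) n)) \<in> O(\<lambda>n. 250 * g (real n) + rest C (real n))"
    proof (rule bigoI[of _ 1])
      show "eventually (\<lambda>n. norm (real (layout.space (w n) n)) \<le> 1 * norm (250 * g (real n) + rest C (real n))) at_top"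
        using wC
      proof eventually_elim
        case (elim n)
        then show ?case using layout.real_bounds(1)[OF lay0[of n], of C] C(1) unfolding g_def by simp
      qed
    qed
    moreover have "(\<lambda>n. 250 * g (real n) + rest C (real n)) \<in> o(\<lambda>n. real n)"
      by (intro sum_in_smallo) (use small in simp_all)
    ultimately show ?thesis by (rule landau_o.big_small_trans)
  qed
  have WO: "(\<lambda>n. real (layout.work (w n) n)) \<in> O(\<lambda>n. real n)"
  proof -
    let ?c = "5 * real max_ops * 1000000"
    have "(\<lambda>n. real (layout.work (w n) n)) \<in> O(\<lambda>n. real n + 250 * g (real n) + 2 * rest C (real n))"
    proof (rule bigoI[of _ ?c])
      show "eventually (\<lambda>n. norm (real (layout.work (w n) n)) \<le>
          ?c * norm (real n + 250 * g (real n) + 2 * rest C (real n))) at_top"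
        using wC
      proof eventually_elim
        case (elim n)
        note B = layout.real_bounds(2)[OF lay0[of n], of C]
        have "real (layout.work (w n) n) \<le> ?c * (real n + 250 * g (real n) + 2 * rest C (real n))"
        proof -
          let ?i = "n + layout.K n + layout.total n + w n * (layout.M n + 2) +
            2 ^ (layout.h n + layout.H n) * (layout.h n + layout.H n + 2)"
          have eq: "real (layout.work (w n) n) = ?c * real ?i"
            unfolding layout.work_def[OF lay0] by (simp only: of_nat_mult of_nat_numeral mult.assoc)
          have le: "real ?i \<le> real n + 250 * g (real n) + 2 * rest C (real n)"
            unfolding g_def using B elim C(1) by (simp only: less_imp_le)
          show ?thesis unfolding eq by (rule mult_left_mono[OF le]) simp
        qed
        also have "\<dots> \<le> ?c * norm (real n + 250 * g (real n) + 2 * rest C (real n))"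
          by (intro mult_left_mono) auto
        finally show ?case by simp
      qed
    qed
    moreover have "(\<lambda>n. real n + 250 * g (real n) + 2 * rest C (real n)) \<in> O(\<lambda>n. real n)"
      by (intro sum_in_bigo) (use small[THEN landau_o.small_imp_big] in simp_all)
    ultimately show ?thesis by (rule landau_o.big_trans)
  qed
  have DO: "(\<lambda>n. real (layout.depth (w n))) \<in> O(\<lambda>n. log 2 (real n))"
  proof -
    have "layout.depth (w n) = 10000000 * (max_ops * w n)" for n
      by (rule layout.depth_def[OF lay0])
    then show ?thesis using wO by (simp add: max_ops_def)
  qed
  show "\<exists>W D Z Q. (\<lambda>n. real (W n)) \<in> O(\<lambda>n. real n) \<and>
        (\<lambda>n. real (D n)) \<in> O(\<lambda>n. log 2 (real n)) \<and>
        (\<lambda>n. real (Z n)) \<in> o(\<lambda>n. real n) \<and>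
        (\<forall>n S m. length S = n \<and> valid_mem (w n) m \<and> holds_seq (w n) m S \<longrightarrow>
           (\<exists>W' D' m' r' base len.
              exec (w n) build_prog (m, init_regs [w n, n]) W' D' (m', r') \<and> W' \<le> W n \<and> D' \<le> D n \<and>
              holds_seq (w n) m' S \<and>
              r' 0 = base \<and> base + len \<le> 2 ^ w n \<and> len * w n \<le> Z n \<and>
              jacobson (w n) m' base len S \<and>
              clark (w n) m' base len True S \<and> clark (w n) m' base len False S \<and>
              (\<forall>m2. valid_mem (w n) m2 \<and> holds_seq (w n) m2 S \<and>
                    (\<forall>p. base \<le> p \<and> p < base + len \<longrightarrow> m2 p = m' p) \<longrightarrow>
                 (\<forall>c i. i < n \<longrightarrow>
                    answers (w n) rank_query m2 base Q (\<lambda>c. rank c S) c i) \<and>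
                 (\<forall>c i. 1 \<le> i \<and> i \<le> count_list S c \<longrightarrow>
                    answers (w n) select_query m2 base Q (\<lambda>c. select c S) c i))))"
  proof (rule exI[of _ "\<lambda>n. layout.work (w n) n"], rule exI[of _ "\<lambda>n. layout.depth (w n)"],
      rule exI[of _ "\<lambda>n. layout.space (w n) n"], rule exI[of _ "40 * (max_ops + 1)"], intro conjI WO DO Zo allI impI)
    fix n S m assume a: "length S = n \<and> valid_mem (w n) m \<and> holds_seq (w n) m S"
    then have "layout (w n) n S m" by (intro lay) auto
    from layout.build_correct[OF this] show "\<exists>W' D' m' r' base len.
              exec (w n) build_prog (m, init_regs [w n, n]) W' D' (m', r') \<and>
              W' \<le> layout.work (w n) n \<and> D' \<le> layout.depth (w n) \<and>
              holds_seq (w n) m' S \<and>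
              r' 0 = base \<and> base + len \<le> 2 ^ w n \<and> len * w n \<le> layout.space (w n) n \<and>
              jacobson (w n) m' base len S \<and>
              clark (w n) m' base len True S \<and> clark (w n) m' base len False S \<and>
              (\<forall>m2. valid_mem (w n) m2 \<and> holds_seq (w n) m2 S \<and>
                    (\<forall>p. base \<le> p \<and> p < base + len \<longrightarrow> m2 p = m' p) \<longrightarrow>
                 (\<forall>c i. i < n \<longrightarrow>
                    answers (w n) rank_query m2 base (40 * (max_ops + 1)) (\<lambda>c. rank c S) c i) \<and>
                 (\<forall>c i. 1 \<le> i \<and> i \<le> count_list S c \<longrightarrow>
                    answers (w n) select_query m2 base (40 * (max_ops + 1)) (\<lambda>c. select c S) c i))" .
  qed
qed

end
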